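(* Assume $h/\varepsilon_h\to\infty$ as $h\to0$. There is $C>0$ independent of $h$ such that for every $h$ there exists a linear extension operator $\mathbf u\mapsto\tilde{\mathbf u}:H^1(\Omega^{\varepsilon_h}_1;\mathbb{R}^3)\to H^1(\Omega;\mathbb{R}^3)$ with $\tilde{\mathbf u}=\mathbf u$ on $\Omega_1^{\varepsilon_h}$ and $$\|\operatorname{sym}\nabla_h\tilde{\mathbf u}\|_{L^2(\Omega;\mathbb{R}^{3\times3})}\le C\|\operatorname{sym}\nabla_h\mathbf u\|_{L^2(\Omega_1^{\varepsilon_h};\mathbb{R}^{3\times3})}.$$
   Context: $\omega\subset\mathbb{R}^2$ bounded Lipschitz domain, $I=(-1/2,1/2)$, $\Omega=\omega\times I$, $x=(\hat x,x_3)$. $Y=[0,1)^2$, $Y_0\subset Y$ open with Lipschitz boundary and closure in the interior of $Y$; $\Omega_0^\varepsilon=\bigcup_{z\in\mathbb{Z}^2:\varepsilon(Y+z)\subset\omega}\varepsilon(Y_0+z)\times I$, $\Omega_1^\varepsilon=\Omega\setminus\Omega_0^\varepsilon$; $\varepsilon_h\to 0$. $\nabla_h\mathbf u=(\nabla_{\hat x}\mathbf u\,|\,h^{-1}\partial_{x_3}\mathbf u)$, $\operatorname{sym}\mathbf M=(\mathbf M+\mathbf M^\top)/2$.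
   Formalization: The set Y minus the closure of Y_0 is additionally assumed connected; otherwise (e.g. Y_0 an annulus) a displacement that is constant on an enclosed piece and zero elsewhere has zero symmetrised gradient but no admissible extension. *)

theory Defs
  imports "HOL-Analysis.Analysis"
begin

definition lipschitz_boundary :: "(real^2) set \<Rightarrow> bool" where
  "lipschitz_boundary U \<longleftrightarrow>
     (\<forall>p\<in>frontier U. \<exists>(R::real^2\<Rightarrow>real^2) \<delta> L (g::real\<Rightarrow>real).
        orthogonal_transformation R \<and> \<delta> > 0 \<and> L-lipschitz_on UNIV g \<and>
        (\<forall>x. \<bar>R (x - p) $ 1\<bar> < \<delta> \<and> \<bar>R (x - p) $ 2\<bar> < \<delta> \<longrightarrow>
              (x \<in> U \<longleftrightarrow> R (x - p) $ 2 < g (R (x - p) $ 1))))"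

definition lipschitz_domain :: "(real^2) set \<Rightarrow> bool" where
  "lipschitz_domain U \<longleftrightarrow> open U \<and> connected U \<and> U \<noteq> {} \<and> lipschitz_boundary U"

definition Ycell :: "(real^2) set" where
  "Ycell = {y. \<forall>i. 0 \<le> y $ i \<and> y $ i < 1}"

definition hat :: "real^3 \<Rightarrow> real^2" where
  "hat x = vector [x $ 1, x $ 2]"

definition Iint :: "real set" where
  "Iint = {-1/2<..<1/2}"

definition Omega :: "(real^2) set \<Rightarrow> (real^3) set" where
  "Omega \<omega> = {x. hat x \<in> \<omega> \<and> x $ 3 \<in> Iint}"

definition Omega0 :: "(real^2) set \<Rightarrow> (real^2) set \<Rightarrow> real \<Rightarrow> (real^3) set" where
  "Omega0 \<omega> Y0 \<epsilon> = {x. x $ 3 \<in> Iint \<and>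
     (\<exists>z::real^2. z $ 1 \<in> \<int> \<and> z $ 2 \<in> \<int> \<and>
        (\<lambda>y. \<epsilon> *\<^sub>R (y + z)) ` Ycell \<subseteq> \<omega> \<and>
        hat x \<in> (\<lambda>y. \<epsilon> *\<^sub>R (y + z)) ` Y0)}"

definition Omega1 :: "(real^2) set \<Rightarrow> (real^2) set \<Rightarrow> real \<Rightarrow> (real^3) set" where
  "Omega1 \<omega> Y0 \<epsilon> = Omega \<omega> - Omega0 \<omega> Y0 \<epsilon>"

definition Dp :: "(real^'n \<Rightarrow> real) \<Rightarrow> 'n \<Rightarrow> real^'n \<Rightarrow> real" where
  "Dp f i x = deriv (\<lambda>t. f (x + t *\<^sub>R axis i 1)) 0"

definition smooth_fun :: "(real^'n \<Rightarrow> real) \<Rightarrow> bool" where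
  "smooth_fun f \<longleftrightarrow> (\<forall>is x. (foldr (\<lambda>i g. Dp g i) is f) differentiable (at x))"

definition test_fun :: "(real^'n) set \<Rightarrow> (real^'n \<Rightarrow> real) \<Rightarrow> bool" where
  "test_fun U \<phi> \<longleftrightarrow> smooth_fun \<phi> \<and>
     (\<exists>K. compact K \<and> K \<subseteq> U \<and> (\<forall>x. x \<notin> K \<longrightarrow> \<phi> x = 0))"

definition L2_on :: "(real^'n) set \<Rightarrow> (real^'n \<Rightarrow> real) \<Rightarrow> bool" where
  "L2_on U f \<longleftrightarrow> set_borel_measurable lebesgue U f \<and>
                 set_integrable lebesgue U (\<lambda>x. (f x)\<^sup>2)"

definition weak_partial ::
  "(real^'n) set \<Rightarrow> (real^'n \<Rightarrow> real) \<Rightarrow> 'n \<Rightarrow> (real^'n \<Rightarrow> real) \<Rightarrow> bool" where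
  "weak_partial U f i g \<longleftrightarrow>
     (\<forall>\<phi>. test_fun U \<phi> \<longrightarrow>
        (LINT x:U|lebesgue. f x * Dp \<phi> i x) = - (LINT x:U|lebesgue. g x * \<phi> x))"

definition H1 :: "(real^'n) set \<Rightarrow> (real^'n \<Rightarrow> real) \<Rightarrow> bool" where
  "H1 U f \<longleftrightarrow> L2_on U f \<and> (\<forall>i. \<exists>g. L2_on U g \<and> weak_partial U f i g)"

definition H1v :: "(real^3) set \<Rightarrow> (real^3 \<Rightarrow> real^3) \<Rightarrow> bool" where
  "H1v U u \<longleftrightarrow> (\<forall>k. H1 U (\<lambda>x. u x $ k))"

text \<open>Weak gradient (row k = component u_k, column j = derivative in x_j); unique a.e.\<close>
definition wgrad :: "(real^3) set \<Rightarrow> (real^3 \<Rightarrow> real^3) \<Rightarrow> real^3 \<Rightarrow> real^3^3" where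
  "wgrad U u x = (\<chi> k j. (SOME g. L2_on U g \<and> weak_partial U (\<lambda>y. u y $ k) j g) x)"

definition grad_h :: "real \<Rightarrow> (real^3) set \<Rightarrow> (real^3 \<Rightarrow> real^3) \<Rightarrow> real^3 \<Rightarrow> real^3^3" where
  "grad_h h U u x = (\<chi> k j. (if j = 3 then 1 / h else 1) * wgrad U u x $ k $ j)"

definition symm :: "real^3^3 \<Rightarrow> real^3^3" where
  "symm M = (1/2) *\<^sub>R (M + transpose M)"

text \<open>L^2 norm of a matrix field (the norm on real^3^3 is the Frobenius norm).\<close>
definition L2norm :: "(real^3) set \<Rightarrow> (real^3 \<Rightarrow> real^3^3) \<Rightarrow> real" where
  "L2norm U F = sqrt (LINT x:U|lebesgue. (norm (F x))\<^sup>2)"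

end

theory Submission
  imports Defs
begin

text \<open>Idea. A displacement \<open>u\<close> of the perforated cell (stretched to height \<open>T = h / \<epsilon>\<close>) is
  averaged over the ball of centre \<open>p\<close> and radius \<open>l\<close> into the rigid motion \<open>Fr u\<close>, whose derivatives in
  \<open>p\<close> and \<open>l\<close> involve the symmetrised gradient only. Near a boundary point of the hole, \<open>p\<close> is \<open>x\<close> pushed
  out of the hole by a multiple of a regularised distance, tilted vertically towards the mid-plane so that
  no ball leaves the layer; \<open>x\<close> is then mapped to the value at \<open>x\<close> of that rigid motion. This replaces
  reflection and keeps the symmetrised gradient under control without Korn's inequality. Inside the hole
  these local extensions are glued to a rigid motion taken over a fixed column; chains of balls, which exist
  since the cell without the hole is connected, bound the differences uniformly in \<open>T\<close>. The \<open>L\<^sup>2\<close> bounds of ball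
  averages come from a Schur test. Finally the cell extensions are rescaled and glued.\<close>

text \<open>The substitution x = \<epsilon>(y + z) in the plane and x_3 = (\<epsilon>/h) y_3 turns
  the scaled gradient into 1/\<epsilon> times the ordinary one; this is the reason for the stretched
  cell. The divergence of h/\<epsilon> enters as a lower bound T >= c0 > 0, from which the tilt and
  the largest admissible radius are computed. The obstacle is that the rotation of a displacement
  may vary strongly along a tall column, so that no single rigid motion fits it: every rigid motion
  used at x is taken over a ball at about the height of x. The gradient of such a field is a skew
  matrix, which symmetrisation removes, plus averages of the symmetrised gradient. The price is paid
  at the boundary of the hole, where the radius tends to 0 and the average degenerates to the value
  of u: weak differentiability across it is obtained from positive radii by a passage to the limit.
  The spaces of the statement rest on Lebesgue measurable functions and on weak derivatives picked
  by a choice operator; Borel representatives and uniqueness of weak derivatives link them to the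
  construction.\<close>

abbreviation (input) scR :: "real => 'a::real_vector => 'a" (infixr "*R" 75) where "r *R x == r *\<^sub>R x"
abbreviation (input) lb_integral :: "('a::euclidean_space => 'b::{banach, second_countable_topology}) => 'b" (binder "LB " 10) where "lb_integral f == integral\<^sup>L lborel f"
abbreviation (input) lb_nn_integral :: "('a::euclidean_space => ennreal) => ennreal" (binder "NB " 10) where "lb_nn_integral f == integral\<^sup>N lborel f"
abbreviation (input) bmb :: "('a::topological_space => 'b::topological_space) set" where "bmb == borel_measurable borel"
abbreviation (input) intb :: "('a::euclidean_space => 'b::{banach, second_countable_topology}) => bool" where "intb f == integrable lborel f"

section \<open>Functions of class C1\<close>

lemma borel_measurable_vec_component[measurable (raw)]:
 fixes f :: "'a => real^'n"
 assumes "f \<in> borel_measurable M" shows "(%x. f x $ i) \<in> borel_measurable M"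
 by (rule measurable_compose[OF assms borel_measurable_continuous_onI]) (intro continuous_intros)

text \<open>The gradient is a second argument, so that the closure rules below also compute it. Test
  functions are taken of this class rather than smooth, because the tests that arise later are
  products with cut-offs and scaled kernels having only finitely many derivatives.\<close>

definition C1 :: "(real^'n => real) => (real^'n => real^'n) => bool" where
 "C1 f f' \<longleftrightarrow> (\<forall>x. (f has_derivative (%h. f' x \<bullet> h)) (at x)) & continuous_on UNIV f'"

lemma C1_D: "C1 f f' ==> (f has_derivative (%h. f' x \<bullet> h)) (at x)"
 by (simp add: C1_def)

lemma C1_cont: "C1 f f' ==> continuous_on UNIV f"
 unfolding C1_def by (meson continuous_at_imp_continuous_on has_derivative_continuous)

lemma C1_cont': "C1 f f' ==> continuous_on UNIV f'"
 by (simp add: C1_def)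

lemma C1_contI: "C1 f f' ==> continuous_on UNIV (%x. f' x $ i)"
 by (auto simp: C1_def intro!: continuous_intros)

lemma C1_const: "C1 (%x. c) (%x. 0)"
 by (simp add: C1_def)

lemma C1_coord: "C1 (%x. x $ i) (%x. axis i 1)"
 using bounded_linear.has_derivative[OF bounded_linear_vec_nth has_derivative_ident]
 by (auto simp: C1_def inner_axis')

lemma C1_add: "C1 f f' ==> C1 g g' ==> C1 (%x. f x + g x) (%x. f' x + g' x)"
 unfolding C1_def by (auto simp: inner_add_left intro!: derivative_eq_intros continuous_intros)

lemma C1_mult: "C1 f f' ==> C1 g g' ==> C1 (%x. f x * g x) (%x. f x *R g' x + g x *R f' x)"
 by (frule C1_cont, frule C1_cont[of g])
  (auto simp: C1_def inner_add_left algebra_simps intro!: derivative_eq_intros continuous_intros)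

lemma C1_cmult: "C1 f f' ==> C1 (%x. c * f x) (%x. c *R f' x)"
 using C1_mult[OF C1_const, of f f' c] by simp

lemma C1_diff: "C1 f f' ==> C1 g g' ==> C1 (%x. f x - g x) (%x. f' x - g' x)"
 using C1_add[OF _ C1_cmult, of f f' g g' "-1"] by simp

lemma C1_sum: "(!!k. k \<in> S ==> C1 (f k) (f' k)) ==> C1 (%x. \<Sum>k\<in>S. f k x) (%x. \<Sum>k\<in>S. f' k x)"
 by (induction S rule: infinite_finite_induct) (auto intro: C1_const C1_add)

lemma C1_comp:
 assumes m: "!!t. (m has_real_derivative m' t) (at t)" "continuous_on UNIV m'" and f: "C1 f f'"
 shows "C1 (%x. m (f x)) (%x. m' (f x) *R f' x)"
proof -
 have "((%x. m (f x)) has_derivative (%h. (f' x \<bullet> h) * m' (f x))) (at x)" for x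
  by (rule DERIV_compose_FDERIV[OF m(1) C1_D[OF f]])
 moreover have "continuous_on UNIV (%x. m' (f x))"
  using continuous_on_compose2[OF m(2) C1_cont[OF f]] by auto
 ultimately show ?thesis using f by (auto simp: C1_def mult.commute intro!: continuous_intros)
qed

lemma C1_partial:
 assumes "C1 f f'"
 shows "((%t. f (x + t *R axis i 1)) has_real_derivative f' (x + t *R axis i 1) $ i) (at t)"
proof -
 have "((%t. x + t *R axis i 1) has_derivative (%h. h *R axis i 1)) (at t)"
  by (auto intro!: derivative_eq_intros)
 from has_derivative_compose[OF this C1_D[OF assms]] show ?thesis
  by (simp add: has_field_derivative_def inner_axis mult.commute[of _ "f' _ $ i"])
qed

lemma C1_Dp: "C1 f f' ==> Dp f i x = f' x $ i"
 unfolding Dp_def using C1_partial[of f f' x i 0] by (simp add: DERIV_imp_deriv)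

lemma C1_borel: "C1 f f' ==> f \<in> bmb" "C1 f f' ==> f' \<in> bmb"
 by (auto intro!: borel_measurable_continuous_onI simp: C1_cont C1_cont')

lemma C1_zero_outside:
 assumes "C1 f f'" "closed K" "!!x. x ~: K ==> f x = 0" "x ~: K"
 shows "f' x = 0"
proof -
 have "(f has_derivative (%h. f' x \<bullet> h)) (at x)" using assms by (simp add: C1_D)
 moreover have "((%x. 0) has_derivative (%h. 0)) (at x)" by simp
 hence "(f has_derivative (%h. 0)) (at x)"
  by (rule has_derivative_transform_within_open[of _ _ _ "UNIV" "- K"]) (use assms in auto)
 ultimately have "(%h. f' x \<bullet> h) = (%h. 0)" by (rule has_derivative_unique)
 hence "f' x \<bullet> f' x = 0" by meson
 thus ?thesis by simp
qed

text \<open>Meant for points where two formulas meet, such as the edge of a truncated power, of the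
  flat function \<open>expk\<close> or of the regularised distance: a quadratic bound there replaces
  a computation of one-sided derivatives.\<close>

lemma has_derivative_quadratic:
 fixes f :: "'a::real_normed_vector => 'b::real_normed_vector"
 assumes "!!y. norm (f y - f x) <= C * (norm (y - x))\<^sup>2"
 shows "(f has_derivative (%h. 0)) (at x)"
proof -
 have "((%y. norm (f y - f x - 0) / norm (y - x)) \<longlongrightarrow> 0) (at x)"
 proof (rule tendsto_sandwich[where f = "%_. 0" and h = "%y. C * norm (y - x)"])
  have "norm (f y - f x) / norm (y - x) <= C * norm (y - x)" if "y ~= x" for y
   using assms[of y] that by (simp add: divide_le_eq power2_eq_square mult.assoc)
  thus "\<forall>\<^sub>F y in at x. norm (f y - f x - 0) / norm (y - x) <= C * norm (y - x)"
   by (auto simp: eventually_at intro!: exI[of _ 1])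
  have "((%y. C * norm (y - x)) \<longlongrightarrow> C * norm (x - x)) (at x)"
   by (intro tendsto_intros)
  thus "((%y. C * norm (y - x)) \<longlongrightarrow> 0) (at x)" by simp
 qed auto
 thus ?thesis by (simp add: has_derivative_iff_norm)
qed

text \<open>The mean value inequality bounds the difference quotients of \<open>J\<close> by
  \<open>B\<close>, so that dominated convergence applies along every sequence tending to
  \<open>x0\<close>. The factor \<open>v\<close> is merely integrable; all smoothness sits in
  \<open>J\<close>, which is how averages of Sobolev functions get differentiated.\<close>

lemma has_derivative_under_integral:
 fixes J :: "'a::euclidean_space => 'b => real"
 assumes v: "integrable M v" and d: "0 < d"
  and der: "!!x y. x \<in> ball x0 d ==> y \<in> space M ==> ((%x. J x y) has_derivative (%h. J' x y \<bullet> h)) (at x)"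
  and B: "!!x y. x \<in> ball x0 d ==> y \<in> space M ==> norm (J' x y) <= B"
  and B0: "!!y. y \<in> space M ==> \<bar>J x0 y\<bar> <= B0"
  and meas[measurable]: "!!x. x \<in> ball x0 d ==> J x \<in> borel_measurable M" and meas'[measurable]: "J' x0 \<in> borel_measurable M"
 shows "((%x. \<integral>y. J x y * v y \<partial>M) has_derivative (%h. (\<integral>y. v y *R J' x0 y \<partial>M) \<bullet> h)) (at x0)"
proof (cases "space M = {}")
 case True
 hence "!!f :: 'b => real. (\<integral>y. f y \<partial>M) = 0" "!!f :: 'b => 'a. (\<integral>y. f y \<partial>M) = 0"
  by (auto intro!: integral_eq_zero_AE AE_I2)
 thus ?thesis by simp
next
 case False
 have x0: "x0 \<in> ball x0 d" using d by simp
 have Bp: "0 <= B" using B[OF x0] False norm_ge_zero by (meson all_not_in_conv order_trans)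
 have [measurable]: "v \<in> borel_measurable M" using v by auto
 have lip: "\<bar>J x y - J x0 y\<bar> <= B * norm (x - x0)" if "x \<in> ball x0 d" "y \<in> space M" for x y
 proof -
  have "norm (J x y - J x0 y) <= B * norm (x - x0)"
  proof (rule differentiable_bound[OF convex_ball])
   fix z assume z: "z \<in> ball x0 d"
   show "((%x. J x y) has_derivative (%h. J' z y \<bullet> h)) (at z within ball x0 d)"
   using der[OF z that(2)] by (rule has_derivative_at_withinI)
   show "onorm (%h. J' z y \<bullet> h) <= B"
   by (rule onorm_bound[OF Bp]) (metis B Cauchy_Schwarz_ineq2 mult_right_mono norm_ge_zero order_trans real_norm_def that(2) z)
  qed (use that x0 in auto)
  thus ?thesis by simp
 qed
 have intJ: "integrable M (%y. J x y * v y)" if x: "x \<in> ball x0 d" for x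
 proof (rule Bochner_Integration.integrable_bound[where f = "%y. (B0 + B * d) * v y"])
  show "integrable M (%y. (B0 + B * d) * v y)" using v by simp
  show "(%y. J x y * v y) \<in> borel_measurable M" using x by measurable
  show "AE y in M. norm (J x y * v y) <= norm ((B0 + B * d) * v y)"
  proof (rule AE_I2)
   fix y assume y: "y \<in> space M"
   have "\<bar>J x y\<bar> <= B0 + B * norm (x - x0)" using lip[OF x y] B0[OF y] by linarith
   also have "... <= B0 + B * d" using x Bp by (auto simp: dist_norm norm_minus_commute intro!: mult_left_mono)
   finally show "norm (J x y * v y) <= norm ((B0 + B * d) * v y)"
   by (simp add: abs_mult mult_right_mono)
  qed
 qed
 have intJ': "integrable M (%y. v y *R J' x0 y)"
 proof (rule Bochner_Integration.integrable_bound[where f = "%y. B * v y"])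
  show "integrable M (%y. B * v y)" using v by simp
  show "AE y in M. norm (v y *R J' x0 y) <= norm (B * v y)"
  proof (rule AE_I2)
   fix y assume "y \<in> space M"
   from mult_right_mono[OF B[OF x0 this], of "\<bar>v y\<bar>"] show "norm (v y *R J' x0 y) <= norm (B * v y)"
   using Bp by (simp add: abs_mult mult.commute)
  qed
 qed simp
 let ?I = "%x. \<integral>y. J x y * v y \<partial>M" and ?D = "\<integral>y. v y *R J' x0 y \<partial>M"
 have "((%x. norm (?I x - ?I x0 - ?D \<bullet> (x - x0)) / norm (x - x0)) \<longlongrightarrow> 0) (at x0)"
  unfolding tendsto_at_iff_sequentially
 proof (intro allI impI)
  fix X assume Xn: "\<forall>i. X i \<in> UNIV - {x0}" and X: "X \<longlonglongrightarrow> x0"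
  \<comment> \<open>Normalised remainder of the linearisation, set to 0 while \<open>X n\<close> is
    outside the ball, so that the bound 2 B holds for every index.\<close>
  define w where "w n y = (if X n \<in> ball x0 d then \<bar>J (X n) y - J x0 y - J' x0 y \<bullet> (X n - x0)\<bar> / norm (X n - x0) else 0)" for n y
  have ev: "\<forall>\<^sub>F n in sequentially. X n \<in> ball x0 d"
   using X d by (metis centre_in_ball open_ball topological_tendstoD)
  have wm[measurable]: "w n \<in> borel_measurable M" for n
   unfolding w_def using x0 by (cases "X n \<in> ball x0 d") (simp_all del: mem_ball)
  have wb: "\<bar>w n y\<bar> <= 2 * B" if "y \<in> space M" for n y
  proof (cases "X n \<in> ball x0 d")
   case True
   have "\<bar>J (X n) y - J x0 y - J' x0 y \<bullet> (X n - x0)\<bar> <= B * norm (X n - x0) + B * norm (X n - x0)"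
   using lip[OF True that] Cauchy_Schwarz_ineq2[of "J' x0 y" "X n - x0"]
   mult_right_mono[OF B[OF x0 that] norm_ge_zero, of "X n - x0"] by linarith
   moreover have "norm (X n - x0) > 0" using Xn by auto
   ultimately show ?thesis using True by (simp add: w_def divide_le_eq)
  qed (use Bp in \<open>simp add: w_def\<close>)
  have w0: "(%n. w n y) \<longlonglongrightarrow> 0" if "y \<in> space M" for y
  proof -
   have "((%x. norm (J x y - J x0 y - J' x0 y \<bullet> (x - x0)) / norm (x - x0)) \<longlongrightarrow> 0) (at x0)"
   using der[OF x0 that] by (simp add: has_derivative_iff_norm)
   hence "(%n. norm (J (X n) y - J x0 y - J' x0 y \<bullet> (X n - x0)) / norm (X n - x0)) \<longlonglongrightarrow> 0"
   using Xn X unfolding tendsto_at_iff_sequentially by (simp add: o_def)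
   thus ?thesis
   by (rule Lim_transform_eventually) (use ev in \<open>auto elim!: eventually_mono simp: w_def\<close>)
  qed
  have L: "(%n. \<integral>y. w n y * \<bar>v y\<bar> \<partial>M) \<longlonglongrightarrow> (\<integral>y. 0 * \<bar>v y\<bar> \<partial>M)"
  proof (rule integral_dominated_convergence[where w = "%y. 2 * B * \<bar>v y\<bar>"])
   show "integrable M (%y. 2 * B * \<bar>v y\<bar>)" using v by simp
   show "AE y in M. (%n. w n y * \<bar>v y\<bar>) \<longlonglongrightarrow> 0 * \<bar>v y\<bar>"
   using w0 by (intro AE_I2 tendsto_intros) auto
   show "AE y in M. norm (w n y * \<bar>v y\<bar>) <= 2 * B * \<bar>v y\<bar>" for n
   using wb by (intro AE_I2) (simp add: abs_mult mult_right_mono)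
  qed simp_all
  have wint: "integrable M (%y. w n y * \<bar>v y\<bar>)" for n
   by (rule Bochner_Integration.integrable_bound[where f = "%y. 2 * B * v y"])
   (use v wb Bp in \<open>auto simp: abs_mult intro!: AE_I2 mult_right_mono\<close>)
  have bd: "norm (?I (X n) - ?I x0 - ?D \<bullet> (X n - x0)) / norm (X n - x0) <= (\<integral>y. w n y * \<bar>v y\<bar> \<partial>M)"
   if Xb: "X n \<in> ball x0 d" for n
  proof -
   have pos: "norm (X n - x0) > 0" using Xn by auto
   have i3: "integrable M (%y. (v y *R J' x0 y) \<bullet> (X n - x0))"
   by (rule integrable_inner_left) (use intJ' in auto)
   have i4: "?D \<bullet> (X n - x0) = (\<integral>y. (v y *R J' x0 y) \<bullet> (X n - x0) \<partial>M)"
   by (rule integral_inner_left[symmetric]) (use intJ' in auto)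
   have "?I (X n) - ?I x0 - ?D \<bullet> (X n - x0) = (\<integral>y. J (X n) y * v y - J x0 y * v y - (v y *R J' x0 y) \<bullet> (X n - x0) \<partial>M)"
   unfolding i4 using intJ[OF Xb] intJ[OF x0] i3 by simp
   also have "\<bar>...\<bar> <= (\<integral>y. norm (X n - x0) * (w n y * \<bar>v y\<bar>) \<partial>M)"
   proof (rule order_trans[OF integral_abs_bound integral_mono])
   show "integrable M (%y. \<bar>J (X n) y * v y - J x0 y * v y - (v y *R J' x0 y) \<bullet> (X n - x0)\<bar>)"
   using intJ[OF Xb] intJ[OF x0] i3 by simp
   show "integrable M (%y. norm (X n - x0) * (w n y * \<bar>v y\<bar>))" using wint by simp
   show "\<bar>J (X n) y * v y - J x0 y * v y - (v y *R J' x0 y) \<bullet> (X n - x0)\<bar> <= norm (X n - x0) * (w n y * \<bar>v y\<bar>)" for y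
   proof -
   have "J (X n) y * v y - J x0 y * v y - (v y *R J' x0 y) \<bullet> (X n - x0) = (J (X n) y - J x0 y - J' x0 y \<bullet> (X n - x0)) * v y"
   by (simp add: algebra_simps)
   thus ?thesis using Xb pos by (simp add: w_def abs_mult)
   qed
   qed
   finally show ?thesis using pos by (simp add: divide_le_eq mult.commute)
  qed
  show "((%x. norm (?I x - ?I x0 - ?D \<bullet> (x - x0)) / norm (x - x0)) \<circ> X) \<longlonglongrightarrow> 0"
  proof (rule tendsto_sandwich[where f = "%_. 0" and h = "%n. \<integral>y. w n y * \<bar>v y\<bar> \<partial>M"])
   show "\<forall>\<^sub>F n in sequentially. ((%x. norm (?I x - ?I x0 - ?D \<bullet> (x - x0)) / norm (x - x0)) \<circ> X) n <= (\<integral>y. w n y * \<bar>v y\<bar> \<partial>M)"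
   using ev bd by (auto elim!: eventually_mono)
  qed (use L in auto)
 qed
 moreover have "bounded_linear (%h. ?D \<bullet> h)" by (rule bounded_linear_inner_right)
 ultimately show ?thesis by (simp add: has_derivative_iff_norm)
qed

section \<open>Mollification\<close>

lemma lborel_integral_affine:
 fixes f :: "'a::euclidean_space => 'b::{banach, second_countable_topology}"
 assumes c: "c ~= 0" and [measurable]: "f \<in> bmb"
 shows "(LB x. f x) = \<bar>c\<bar>^DIM('a) *R (LB x. f (t + c *R x))"
 by (subst lborel_affine[OF c, of t]) (simp add: integral_density integral_distr)

lemma lborel_nn_integral_affine:
 fixes f :: "'a::euclidean_space => ennreal"
 assumes c: "c ~= 0" and [measurable]: "f \<in> bmb"
 shows "(NB x. f x) = ennreal (\<bar>c\<bar>^DIM('a)) * (NB x. f (t + c *R x))"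
 by (subst lborel_affine[OF c, of t]) (simp add: nn_integral_density nn_integral_distr nn_integral_cmult)

lemma lborel_integrable_affine:
 fixes f :: "'a::euclidean_space => 'b::{banach, second_countable_topology}"
 assumes c: "c ~= 0" and f: "integrable lborel f"
 shows "intb (%x. f (t + c *R x))"
proof -
 have [measurable]: "f \<in> bmb" using f by auto
 have "(NB x. ennreal (norm (f x))) < \<infinity>" using f by (simp add: integrable_iff_bounded)
 hence "(NB x. ennreal (norm (f (t + c *R x)))) < \<infinity>"
  using c by (subst (asm) lborel_nn_integral_affine[OF c, of _ t]) (auto simp: ennreal_mult_less_top)
 thus ?thesis by (simp add: integrable_iff_bounded)
qed

lemma compact_support_bounded:
 fixes f :: "'a::topological_space => 'b::real_normed_vector"
 assumes "continuous_on UNIV f" "compact K" "!!x. x ~: K ==> f x = 0"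
 obtains B where "B > 0" "!!x. norm (f x) <= B"
proof -
 have "bounded (f ` K)"
  by (rule compact_imp_bounded[OF compact_continuous_image]) (use assms in \<open>auto intro: continuous_on_subset\<close>)
 then obtain B where B: "B > 0" "!!x. x \<in> K ==> norm (f x) <= B" by (auto simp: bounded_pos)
 have "norm (f x) <= B" for x using B assms(3)[of x] by (cases "x \<in> K") auto
 thus ?thesis using that B by blast
qed

lemma compact_support_integrable:
 fixes f :: "'a::euclidean_space => real"
 assumes "continuous_on UNIV f" "compact K" "!!x. x ~: K ==> f x = 0"
 shows "integrable lborel f"
proof -
 have "intb (%x. indicator K x *R f x)"
  by (rule borel_integrable_compact) (use assms in \<open>auto intro: continuous_on_subset\<close>)
 moreover have "(%x. indicator K x *R f x) = f" using assms(3) by (auto simp: indicator_def fun_eq_iff)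
 ultimately show ?thesis by simp
qed

lemma integrable_mult_bounded:
 fixes f g :: "'a => real"
 assumes "integrable M f" "g \<in> borel_measurable M" "!!x. \<bar>g x\<bar> <= B"
 shows "integrable M (%x. f x * g x)" "integrable M (%x. g x * f x)"
proof -
 show "integrable M (%x. f x * g x)"
 proof (rule Bochner_Integration.integrable_bound[where f = "%x. B * f x"])
  show "AE x in M. norm (f x * g x) <= norm (B * f x)"
  proof (rule AE_I2)
   fix x
   have "\<bar>g x\<bar> <= \<bar>B\<bar>" using assms(3)[of x] by linarith
   from mult_right_mono[OF this, of "\<bar>f x\<bar>"] show "norm (f x * g x) <= norm (B * f x)"
   by (simp add: abs_mult mult.commute)
  qed
 qed (use assms in auto)
 thus "integrable M (%x. g x * f x)" by (simp add: mult.commute)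
qed

text \<open>The functions exp(-1/t) / t^k, extended by 0, form a family whose derivatives are
  combinations of members (\<open>expk_deriv\<close>). Smoothness of the bump then needs no formula
  for higher derivatives.\<close>

definition expk :: "nat => real => real" where
 "expk k t = (if t > 0 then exp (- (1 / t)) / t ^ k else 0)"

text \<open>The single term of order k + 2 of the exponential series at 1/t already beats t^(-k) and
  leaves a factor t^2. This makes the derivative at 0 vanish.\<close>

lemma expk_quadratic: "\<bar>expk k t\<bar> <= fact (k + 2) * t\<^sup>2"
proof (cases "t > 0")
 case True
 have "(1 / t) ^ (k + 2) / fact (k + 2) <= exp (1 / t)"
 proof -
  have s: "summable (%n. (1 / t) ^ n /\<^sub>R fact n)" by (rule summable_exp_generic)
  have "(\<Sum>n\<in>{k + 2}. (1 / t) ^ n /\<^sub>R fact n) <= (\<Sum>n. (1 / t) ^ n /\<^sub>R fact n)"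
   by (rule sum_le_suminf[OF s]) (use True in auto)
  thus ?thesis by (simp add: exp_def divide_inverse mult.commute)
 qed
 moreover define F where "F = (fact (k + 2) :: real)"
 ultimately have "1 / (t ^ (k + 2) * F) <= exp (1 / t)" by (simp only: power_divide) (simp add: divide_simps)
 hence "exp (- (1 / t)) <= F * t ^ (k + 2)"
  using True by (simp add: exp_minus F_def field_simps del: fact_Suc power_Suc)
 hence "exp (- (1 / t)) <= fact (k + 2) * t ^ (k + 2)" by (simp add: F_def)
 hence "exp (- (1 / t)) / t ^ k <= fact (k + 2) * t ^ (k + 2) / t ^ k"
  using True by (intro divide_right_mono) auto
 also have "... = fact (k + 2) * t\<^sup>2" using True by (simp only: power_add) simp
 finally show ?thesis using True by (simp add: expk_def)
qed (simp add: expk_def)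

lemma expk_deriv: "(expk k has_real_derivative (expk (k + 2) t - real k * expk (k + 1) t)) (at t)"
proof (cases t "0::real" rule: linorder_cases)
 case less
 have "((%t. 0) has_real_derivative 0) (at t)" by simp
 hence "(expk k has_real_derivative 0) (at t)"
  by (rule has_field_derivative_transform_within_open[where S = "{..<0}"]) (use less in \<open>auto simp: expk_def\<close>)
 thus ?thesis using less by (simp add: expk_def)
next
 case equal
 have "(expk k has_derivative (%h. 0)) (at 0)"
  by (rule has_derivative_quadratic[where C = "fact (k + 2)"]) (use expk_quadratic[of k] in \<open>simp add: expk_def\<close>)
 moreover have "(*) (0::real) = (%h. 0)" by auto
 ultimately show ?thesis using equal by (simp add: expk_def has_field_derivative_def)
next
 case greater
 have "((%t. exp (- (1 / t)) / t ^ k) has_real_derivative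
  ((exp (- (1 / t)) * (1 / t\<^sup>2)) * t ^ k - exp (- (1 / t)) * (real k * t ^ (k - 1))) / (t ^ k * t ^ k)) (at t)"
  using greater by (auto intro!: derivative_eq_intros simp: power2_eq_square divide_simps)
 hence "(expk k has_real_derivative
  ((exp (- (1 / t)) * (1 / t\<^sup>2)) * t ^ k - exp (- (1 / t)) * (real k * t ^ (k - 1))) / (t ^ k * t ^ k)) (at t)"
  by (rule has_field_derivative_transform_within_open[where S = "{0<..}"]) (use greater in \<open>auto simp: expk_def\<close>)
 moreover have "((exp (- (1 / t)) * (1 / t\<^sup>2)) * t ^ k - exp (- (1 / t)) * (real k * t ^ (k - 1))) / (t ^ k * t ^ k)
  = expk (k + 2) t - real k * expk (k + 1) t"
  using greater by (cases k) (simp_all add: expk_def field_simps power2_eq_square)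
 ultimately show ?thesis by simp
qed

text \<open>An algebra generated by constants, coordinates and radial bumps that is stable under
  partial derivatives. As \<open>smooth_fun\<close> asks for differentiability of all iterated
  partials, stability together with differentiability gives smoothness.\<close>

inductive Sm :: "(real^'n => real) => bool" where
 Sm_const: "Sm (%x. c)"
| Sm_coord: "Sm (%x. x $ i)"
| Sm_expk: "Sm (%x. expk k (1 - x \<bullet> x))"
| Sm_add: "Sm f ==> Sm g ==> Sm (%x. f x + g x)"
| Sm_mult: "Sm f ==> Sm g ==> Sm (%x. f x * g x)"

lemma C1_ball_arg: "C1 (%x::real^'n. 1 - x \<bullet> x) (%x. - 2 *R x)"
 unfolding C1_def by (auto intro!: derivative_eq_intros continuous_intros simp: inner_commute)

lemma Sm_deriv: "Sm f ==> \<exists>f'. C1 f f' & (\<forall>i. Sm (%x. f' x $ i))"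
proof (induction rule: Sm.induct)
 case (Sm_const c)
 have "Sm (%x. (0::real^'a) $ i)" for i by (simp add: Sm.Sm_const)
 thus ?case using C1_const by blast
next
 case (Sm_coord i)
 have "Sm (%x. (axis i 1 :: real^'a) $ j)" for j by (simp add: Sm.Sm_const)
 thus ?case using C1_coord by blast
next
 case (Sm_expk k)
 have "continuous_on UNIV (expk k)" for k
  using expk_deriv by (meson DERIV_isCont continuous_at_imp_continuous_on)
 hence c: "C1 (%x. expk k (1 - x \<bullet> x)) (%x::real^'a. (expk (k + 2) (1 - x \<bullet> x) - real k * expk (k + 1) (1 - x \<bullet> x)) *R (- 2 *R x))"
  by (intro C1_comp[OF expk_deriv _ C1_ball_arg] continuous_intros) auto
 have "Sm (%x. (expk (k + 2) (1 - x \<bullet> x) + (- real k) * expk (k + 1) (1 - x \<bullet> x)) * ((- 2) * x $ i))" for i :: 'a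
  by (intro Sm.intros)
 moreover have "(%x. (expk (k + 2) (1 - x \<bullet> x) + (- real k) * expk (k + 1) (1 - x \<bullet> x)) * ((- 2) * x $ i))
  = (%x::real^'a. ((expk (k + 2) (1 - x \<bullet> x) - real k * expk (k + 1) (1 - x \<bullet> x)) *R (- 2 *R x)) $ i)" for i :: 'a
  by (auto simp: algebra_simps)
 ultimately have "Sm (%x::real^'a. ((expk (k + 2) (1 - x \<bullet> x) - real k * expk (k + 1) (1 - x \<bullet> x)) *R (- 2 *R x)) $ i)" for i :: 'a
  by simp
 thus ?case using c by blast
next
 case (Sm_add f g)
 then obtain f' g' where "C1 f f'" "C1 g g'" "!!i. Sm (%x. f' x $ i)" "!!i. Sm (%x. g' x $ i)" by blast
 thus ?case by (intro exI[of _ "%x. f' x + g' x"]) (auto intro: C1_add Sm.Sm_add)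
next
 case (Sm_mult f g)
 then obtain f' g' where "C1 f f'" "C1 g g'" "!!i. Sm (%x. f' x $ i)" "!!i. Sm (%x. g' x $ i)" by blast
 thus ?case using Sm_mult(1,2)
  by (intro exI[of _ "%x. f x *R g' x + g x *R f' x"]) (auto intro!: C1_mult Sm.Sm_add Sm.Sm_mult)
qed

lemma foldr_Dp_Cons: "foldr (%i g. Dp g i) (i # is) f = Dp (foldr (%i g. Dp g i) is f) i"
 by simp

lemma smooth_fun_foldr:
 assumes "smooth_fun f" shows "smooth_fun (foldr (%i g. Dp g i) is f)"
 unfolding smooth_fun_def
proof (intro allI)
 fix js x
 show "foldr (%i g. Dp g i) js (foldr (%i g. Dp g i) is f) differentiable at x"
  using assms[unfolded smooth_fun_def, rule_format, of "js @ is" x] by simp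
qed

lemma Sm_smooth: assumes "Sm f" shows "smooth_fun f"
proof -
 have "Sm (foldr (%i g. Dp g i) is f)" for "is"
 proof (induction "is")
  case (Cons i "is")
  obtain f' where "C1 (foldr (%i g. Dp g i) is f) f'" "!!i. Sm (%x. f' x $ i)"
   using Sm_deriv[OF Cons] by blast
  moreover have "Dp (foldr (%i g. Dp g i) is f) i = (%x. f' x $ i)"
   using calculation(1) by (auto simp: C1_Dp)
  ultimately show ?case by simp
 qed (use assms in simp)
 from Sm_deriv[OF this] show ?thesis
  unfolding smooth_fun_def by (meson C1_D differentiable_def)
qed

text \<open>The predicate \<open>smooth_fun\<close> speaks of differentiability only; the partials
  are continuous because each of them is again differentiable.\<close>

lemma smooth_C1:
 assumes "smooth_fun f" shows "C1 f (%x. \<chi> i. Dp f i x)"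
proof -
 have d: "(foldr (%i g. Dp g i) is f) differentiable (at x)" for "is" x
  using assms by (auto simp: smooth_fun_def)
 have D: "(f has_derivative (%h. (\<chi> i. Dp f i x) \<bullet> h)) (at x)" for x
 proof -
  obtain F where F: "(f has_derivative F) (at x)" using d[of "[]" x] by (auto simp: differentiable_def)
  interpret bounded_linear F using F by (rule has_derivative_bounded_linear)
  have "F (axis i 1) = Dp f i x" for i
  proof -
   have "((%t. x + t *R axis i 1) has_derivative (%h. h *R axis i 1)) (at 0)"
   by (auto intro!: derivative_eq_intros)
   from has_derivative_compose[OF this, of f F] F
   have "((%t. f (x + t *R axis i 1)) has_real_derivative F (axis i 1)) (at 0)"
   by (simp add: has_field_derivative_def scaleR mult.commute[of _ "F _"])
   thus ?thesis unfolding Dp_def by (rule DERIV_imp_deriv[symmetric])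
  qed
  hence "F h = (\<chi> i. Dp f i x) \<bullet> h" for h
   by (subst (1) basis_expansion[symmetric])
   (simp add: sum scaleR inner_vec_def mult.commute scalar_mult_eq_scaleR)
  hence "F = (%h. (\<chi> i. Dp f i x) \<bullet> h)" by blast
  thus ?thesis using F by simp
 qed
 have "continuous_on UNIV (%x. Dp f i x)" for i
  using d[of "[i]"] by (auto intro!: continuous_at_imp_continuous_on differentiable_imp_continuous_within)
 thus ?thesis using D by (auto simp: C1_def intro!: continuous_on_vec_lambda)
qed

lemma C1_bounded_support:
 assumes "C1 f f'" "compact K" "!!x. x ~: K ==> f x = 0"
 obtains B where "B > 0" "!!x. \<bar>f x\<bar> <= B" "!!x. norm (f' x) <= B"
proof -
 have z: "f' x = 0" if "x ~: K" for x
  by (rule C1_zero_outside[OF assms(1) compact_imp_closed[OF assms(2)] assms(3) that])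
 obtain B1 where "B1 > 0" "!!x. norm (f x) <= B1"
  using compact_support_bounded[OF C1_cont[OF assms(1)] assms(2,3)] by blast
 moreover obtain B2 where "B2 > 0" "!!x. norm (f' x) <= B2"
  using compact_support_bounded[OF C1_cont'[OF assms(1)] assms(2) z] by blast
 ultimately show ?thesis
  by (intro that[of "max B1 B2"]) (auto simp: le_max_iff_disj)
qed

text \<open>Every derivative falls on \<open>ps\<close>, whose iterated partials keep the same
  support and so stay bounded. Hence the rule for one derivative iterates over the list of
  directions.\<close>

lemma smooth_convolution:
 fixes ps :: "real^'n => real"
 assumes ps: "smooth_fun ps" "!!x. norm x > R ==> ps x = 0" and ph: "integrable lborel ph"
 shows "smooth_fun (%x. (LB y. ps (x - y) * ph y))"
proof -
 let ?D = "%is ps. foldr (%i g. Dp g i) is ps"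
 have sm: "smooth_fun (?D is ps)" for "is"
  by (rule smooth_fun_foldr[OF ps(1)])
 have supp: "?D is ps x = 0" if "norm x > R" for "is" x
  using that
 proof (induction "is" arbitrary: x)
  case (Cons i "is")
  have "(\<chi> i. Dp (?D is ps) i x) = 0"
   by (rule C1_zero_outside[OF smooth_C1[OF sm], of "cball 0 R"]) (use Cons in auto)
  thus ?case by (simp add: vec_eq_iff)
 qed (use ps in simp)
 have der: "((%x. (LB y. ?D is ps (x - y) * ph y)) has_derivative
   (%h. (LB y. ph y *R (\<chi> i. Dp (?D is ps) i (x - y))) \<bullet> h)) (at x)" for "is" x
 proof -
  note c = smooth_C1[OF sm[of "is"]]
  obtain B where B: "B > 0" "!!x. \<bar>?D is ps x\<bar> <= B" "!!x. norm (\<chi> i. Dp (?D is ps) i x) <= B"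
   using C1_bounded_support[OF c compact_cball[of 0 R]] supp by (metis mem_cball_0 not_le)
  note [measurable] = C1_borel[OF c]
  show ?thesis
  proof (rule has_derivative_under_integral[OF ph, of 1])
   fix x y
   show "((%x. ?D is ps (x - y)) has_derivative (%h. (\<chi> i. Dp (?D is ps) i (x - y)) \<bullet> h)) (at x)"
   proof -
   have "((%x. x - y) has_derivative (%h. h)) (at x)" by (auto intro!: derivative_eq_intros)
   from has_derivative_compose[OF this C1_D[OF c]] show ?thesis .
   qed
  qed (use B in auto)
 qed
 have Dint: "Dp (%x. (LB y. ?D is ps (x - y) * ph y)) i = (%x. (LB y. ?D (i # is) ps (x - y) * ph y))" for "is" i
 proof
  fix x :: "real^'n"
  have "((%t. x + t *R axis i 1) has_derivative (%h. h *R axis i 1)) (at 0)"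
   by (auto intro!: derivative_eq_intros)
  from has_derivative_compose[OF this, OF der[of "is" "x + (0::real) *R axis i 1"]]
  have "((%t. (LB y. ?D is ps (x + t *R axis i 1 - y) * ph y)) has_real_derivative
   (LB y. ph y *R (\<chi> i. Dp (?D is ps) i (x - y))) $ i) (at 0)"
   by (simp add: has_field_derivative_def inner_axis mult.commute[of _ "_ $ i"])
  moreover have "(LB y. ph y *R (\<chi> i. Dp (?D is ps) i (x - y))) $ i = (LB y. ?D (i # is) ps (x - y) * ph y)"
  proof -
   note c = smooth_C1[OF sm[of "is"]]
   obtain B where B: "B > 0" "!!x. norm (\<chi> i. Dp (?D is ps) i x) <= B"
   using C1_bounded_support[OF c compact_cball[of 0 R]] supp by (metis mem_cball_0 not_le)
   note [measurable] = C1_borel[OF c]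
   have "intb (%y. ph y *R (\<chi> i. Dp (?D is ps) i (x - y)))"
   by (rule Bochner_Integration.integrable_bound[where f = "%y. B * ph y"])
   (use ph B in \<open>auto simp: abs_mult mult.commute[of B] intro!: AE_I2 mult_left_mono\<close>)
   from integral_bounded_linear[OF bounded_linear_vec_nth[of i] this]
   show ?thesis by (simp add: mult.commute)
  qed
  ultimately show "Dp (%x. (LB y. ?D is ps (x - y) * ph y)) i x = (LB y. ?D (i # is) ps (x - y) * ph y)"
   unfolding Dp_def by (simp add: DERIV_imp_deriv)
 qed
 have "?D is (%x. (LB y. ps (x - y) * ph y)) = (%x. (LB y. ?D is ps (x - y) * ph y))" for "is"
 proof (induction "is")
  case (Cons i "is")
  show ?case using Dint[of "is" i] Cons by simp
 qed simp
 note E = this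
 show ?thesis unfolding smooth_fun_def E differentiable_def using der by blast
qed

lemma ex_mollifier:
 obtains tht :: "real^'n => real" where "smooth_fun tht" "!!x. tht x >= 0" "!!x. norm x >= 1 ==> tht x = 0"
  "integrable lborel tht" "(LB x. tht x) = 1" "continuous_on UNIV tht"
proof -
 let ?b = "%x::real^'n. expk 0 (1 - x \<bullet> x)"
 have sm: "Sm ?b" by (rule Sm_expk)
 have ge: "?b x >= 0" for x by (simp add: expk_def)
 have z: "?b x = 0" if "norm x >= 1" for x
 proof -
  have "x \<bullet> x >= 1" using that by (metis dot_square_norm one_le_power)
  thus ?thesis by (simp add: expk_def)
 qed
 note c = C1_cont[OF smooth_C1[OF Sm_smooth[OF sm]]]
 have i: "integrable lborel ?b"
  by (rule compact_support_integrable[OF c compact_cball[of 0 1]]) (use z in auto)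
 \<comment> \<open>A vanishing integral would make the open unit ball negligible, since the
   nonnegative bump is positive there.\<close>
 have "(LB x. ?b x) > 0"
 proof (rule ccontr)
  assume "\<not> (LB x. ?b x) > 0"
  moreover have "(LB x. ?b x) >= 0" by (rule Bochner_Integration.integral_nonneg) (use ge in auto)
  ultimately have "(LB x. ?b x) = 0" by linarith
  hence "AE x in lborel. ?b x = 0" using integral_nonneg_eq_0_iff_AE[OF i] ge by auto
  hence "AE x in lborel. x ~: ball (0::real^'n) 1"
  proof eventually_elim
   case (elim x)
   show ?case
   proof
   assume "x \<in> ball 0 1"
   hence "(norm x)\<^sup>2 < 1" by (simp add: power_less_one_iff)
   hence "x \<bullet> x < 1" by (simp add: dot_square_norm)
   thus False using elim by (simp add: expk_def)
   qed
  qed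
  hence "emeasure lborel (ball (0::real^'n) 1) = 0"
   by (subst (asm) AE_iff_measurable[where N = "ball 0 1"]) auto
  hence "(ball (0::real^'n) 1) \<in> null_sets lborel" by auto
  hence "negligible (ball (0::real^'n) 1)"
   by (simp add: negligible_iff_null_sets null_sets_completionI)
  thus False using open_not_negligible[of "ball (0::real^'n) 1"] by auto
 qed
 note pos = this
 define I where "I = (LB x. ?b x)"
 have "Sm (%x. (1 / I) * ?b x)" by (intro Sm.intros)
 from Sm_smooth[OF this] show ?thesis
  by (intro that[of "%x. (1 / I) * ?b x"])
   (use ge z i pos c in \<open>auto simp: I_def[symmetric] intro!: continuous_intros\<close>)
qed

lemma C1_affine:
 fixes F :: "real^'m => real^'n"
 assumes F: "!!x. (F has_derivative A) (at x)" and g: "C1 g g'"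
 shows "C1 (%x. g (F x)) (%x. adjoint A (g' (F x)))"
proof -
 have lin: "linear A" using F has_derivative_linear by blast
 have "((%x. g (F x)) has_derivative (%h. adjoint A (g' (F x)) \<bullet> h)) (at x)" for x
  using has_derivative_compose[OF F C1_D[OF g]] by (simp add: adjoint_works[OF lin] inner_commute)
 moreover have "continuous_on UNIV F"
  using F by (meson continuous_at_imp_continuous_on has_derivative_continuous)
 hence "continuous_on UNIV (%x. g' (F x))"
  using continuous_on_compose2[OF C1_cont'[OF g]] by auto
 hence "continuous_on UNIV (%x. adjoint A (g' (F x)))"
  using linear_continuous_on_compose[OF _ adjoint_linear[OF lin]] by blast
 ultimately show ?thesis by (simp add: C1_def)
qed

lemma C1_scale_arg:
 fixes g :: "real^'n => real"
 assumes "C1 g g'" shows "C1 (%x. g (c *R x)) (%x. c *R g' (c *R x))"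
proof -
 have d: "((%x. c *R x) has_derivative (%h. c *R h)) (at x)" for x :: "real^'n"
  by (auto intro!: derivative_eq_intros)
 have "adjoint (%h::real^'n. c *R h) = (%h. c *R h)" by (rule adjoint_unique) simp
 thus ?thesis using C1_affine[OF d assms] by simp
qed

text \<open>Convolution at scale \<open>s n\<close>, packaged as an operator on functions: the same
  operator has to be applied to a test function and to its partial derivatives, with which it
  commutes.\<close>

lemma moll_C1_tests:
 fixes U :: "(real^'n) set" and ph :: "real^'n => real"
 assumes U: "open U" and K: "compact K" "K \<subseteq> U" "!!x. x ~: K ==> ph x = 0" and c: "continuous_on UNIV ph"
 obtains M :: "nat => (real^'n => real) => real^'n => real" where
  "!!n. test_fun U (M n ph)"
  "!!f L x. continuous_on UNIV f ==> compact L ==> (!!x. x ~: L ==> f x = 0) ==>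
   (%n. M n f x) \<longlonglongrightarrow> f x"
  "!!f B n x. continuous_on UNIV f ==> (!!x. \<bar>f x\<bar> <= B) ==> \<bar>M n f x\<bar> <= B"
  "!!f f' n i L x. C1 f f' ==> compact L ==> (!!x. x ~: L ==> f x = 0) ==> Dp (M n f) i x = M n (%x. f' x $ i) x"
  "!!n f. continuous_on UNIV f ==> M n f \<in> bmb"
proof -
 obtain tht :: "real^'n => real" where th: "smooth_fun tht" "!!x. tht x >= 0" "!!x. norm x >= 1 ==> tht x = 0"
  "integrable lborel tht" "(LB x. tht x) = 1" "continuous_on UNIV tht"
  by (rule ex_mollifier) (rule that, (assumption | blast)+)
 have [measurable]: "tht \<in> bmb" using th(4) by auto
 obtain r where r: "r > 0" "(\<Union>x\<in>K. cball x r) \<subseteq> U" using compact_subset_open_imp_cball_epsilon_subset[OF K(1) U K(2)] by blast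
 \<comment> \<open>Scales at most \<open>r\<close> keep the mollified function supported in the
   closed \<open>r\<close>-neighbourhood of K, hence inside U.\<close>
 define s where "s n = min r 1 / (real n + 1)" for n
 have s: "s n > 0" "s n <= r" for n
 proof -
  show "s n > 0" using r by (simp add: s_def)
  have "min r 1 / (real n + 1) <= min r 1 / 1" using r by (intro divide_left_mono) auto
  thus "s n <= r" by (simp add: s_def)
 qed
 have s0: "s \<longlonglongrightarrow> 0"
 proof -
  have "(%n. min r 1 * inverse (real (Suc n))) \<longlonglongrightarrow> min r 1 * 0"
   by (intro tendsto_mult tendsto_const LIMSEQ_inverse_real_of_nat)
  thus ?thesis by (simp add: s_def[abs_def] divide_inverse add.commute)
 qed
 define M where "M n f x = (LB z. f (x - s n *R z) * tht z)" for n f x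
 have bm: "f \<in> bmb" if "continuous_on UNIV f" for f :: "real^'n => real"
  using that by (rule borel_measurable_continuous_onI)
 have sm: "smooth_fun (M n f)" if f: "continuous_on UNIV f" "compact L" "!!x. x ~: L ==> f x = 0" for f L n
 proof -
  have [measurable]: "f \<in> bmb" by (rule bm[OF f(1)])
  let ?c = "1 / s n" and ?N = "CARD('n)"
  have Sm1: "smooth_fun (%x. ?c ^ ?N * tht (?c *R x))"
  proof -
   have sc: "Dp (%x. a * g (?c *R x)) i = (%x. (a * ?c) * Dp g i (?c *R x)) & (%x. a * g (?c *R x)) differentiable (at x)"
   if "C1 g (%x. \<chi> i. Dp g i x)" for g :: "real^'n => real" and a i x
   proof -
   have "C1 (%x. a * g (?c *R x)) (%x. a *R (?c *R (\<chi> i. Dp g i (?c *R x))))"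
   by (rule C1_cmult[OF C1_scale_arg[OF that]])
   note C = this
   show ?thesis using C1_Dp[OF C] C1_D[OF C] by (auto simp: differentiable_def)
   qed
   have C: "C1 (foldr (%i g. Dp g i) is tht) (%x. \<chi> i. Dp (foldr (%i g. Dp g i) is tht) i x)" for "is"
   by (rule smooth_C1[OF smooth_fun_foldr[OF th(1)]])
   have "foldr (%i g. Dp g i) is (%x. ?c ^ ?N * tht (?c *R x)) = (%x. (?c ^ ?N * ?c ^ length is) * foldr (%i g. Dp g i) is tht (?c *R x))" for "is"
   proof (induction "is")
   case (Cons i "is")
   show ?case unfolding foldr_Dp_Cons Cons using sc[OF C[of "is"], of "?c ^ ?N * ?c ^ length is" i] by (auto simp: mult_ac)
   qed simp
   note E = this
   show ?thesis unfolding smooth_fun_def E using sc[OF C] by blast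
  qed
  \<comment> \<open>Smoothness is proved in the form with x - y inside the kernel; the substitution
    y = x - s z then gives the form of \<open>M\<close>, in which derivatives can fall on f.\<close>
  have "smooth_fun (%x. (LB y. (?c ^ ?N * tht (?c *R (x - y))) * f y))"
  proof (rule smooth_convolution[OF Sm1])
   fix x :: "real^'n" assume "norm x > s n"
   hence "norm (?c *R x) >= 1" using s(1)[of n] by (simp add: field_simps)
   thus "?c ^ ?N * tht (?c *R x) = 0" using th(3) by (metis mult_zero_right)
  qed (rule compact_support_integrable[OF f])
  moreover have "(LB y. (?c ^ ?N * tht (?c *R (x - y))) * f y) = M n f x" for x
  proof -
   have "(LB y. (?c ^ ?N * tht (?c *R (x - y))) * f y)
   = \<bar>- s n\<bar> ^ ?N * (LB z. (?c ^ ?N * tht (?c *R (x - (x + (- s n) *R z)))) * f (x + (- s n) *R z))"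
   using lborel_integral_affine[of "- s n" "%y. (?c ^ ?N * tht (?c *R (x - y))) * f y" x] s(1)[of n]
   by simp
   also have "... = \<bar>- s n\<bar> ^ ?N * (LB z. ?c ^ ?N * (f (x - s n *R z) * tht z))"
   using s(1)[of n] by (simp add: mult_ac)
   also have "... = M n f x" using s(1)[of n] by (simp add: M_def power_divide)
   finally show ?thesis .
  qed
  ultimately show ?thesis by (simp add: fun_eq_iff[symmetric])
 qed
 show ?thesis
 proof (rule that[of M])
  show "test_fun U (M n ph)" for n
  proof -
   let ?L = "{x + y |x y. x \<in> K & y \<in> cball 0 r}"
   have "M n ph x = 0" if x: "x ~: ?L" for x
   proof -
   have "ph (x - s n *R z) * tht z = 0" for z
   proof (cases "norm z >= 1")
   case False
   have "s n * norm z <= r * 1" using False s[of n] r by (intro mult_mono) auto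
   hence "s n *R z \<in> cball 0 r" using s(1)[of n] by simp
   hence "x - s n *R z ~: K" using x by (metis (mono_tags, lifting) diff_add_cancel mem_Collect_eq)
   thus ?thesis using K by simp
   qed (use th in simp)
   hence "(%z. ph (x - s n *R z) * tht z) = (%z. 0)" by blast
   thus ?thesis by (simp only: M_def) simp
   qed
   moreover have "compact ?L" by (rule compact_sums[OF K(1) compact_cball])
   moreover have "?L \<subseteq> U"
   proof
   fix w assume "w \<in> ?L"
   then obtain x y where "w = x + y" "x \<in> K" "y \<in> cball 0 r" by blast
   hence "w \<in> cball x r" by (simp add: dist_norm)
   thus "w \<in> U" using r \<open>x \<in> K\<close> by blast
   qed
   ultimately show ?thesis unfolding test_fun_def using sm[OF c K(1,3)] by blast
  qed
  show "(%n. M n f x) \<longlonglongrightarrow> f x" if f: "continuous_on UNIV f" "compact L" "!!x. x ~: L ==> f x = 0" for f L x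
  proof -
   have [measurable]: "f \<in> bmb" by (rule bm[OF f(1)])
   obtain B where B: "B > 0" "!!x. norm (f x) <= B" using compact_support_bounded[OF f] by blast
   have "(%n. M n f x) \<longlonglongrightarrow> (LB z. f x * tht z)" unfolding M_def
   proof (rule integral_dominated_convergence[where w = "%z. B * tht z"])
   show "AE z in lborel. (%n. f (x - s n *R z) * tht z) \<longlonglongrightarrow> f x * tht z"
   proof (rule AE_I2)
   fix z
   have "isCont f x" using f(1) by (simp add: continuous_on_eq_continuous_at)
   moreover have "(%n. x - s n *R z) \<longlonglongrightarrow> x - 0 *R z" by (intro tendsto_intros s0)
   ultimately have "(%n. f (x - s n *R z)) \<longlonglongrightarrow> f x" by (intro isCont_tendsto_compose[of x f]) simp_all
   thus "(%n. f (x - s n *R z) * tht z) \<longlonglongrightarrow> f x * tht z" by (rule tendsto_mult_right)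
   qed
   show "AE z in lborel. norm (f (x - s n *R z) * tht z) <= B * tht z" for n
   using B th(2) by (auto simp: abs_mult intro!: mult_right_mono)
   qed (use th in auto)
   thus ?thesis using th by simp
  qed
  show "\<bar>M n f x\<bar> <= B" if f: "continuous_on UNIV f" "!!x. \<bar>f x\<bar> <= B" for f B n x
  proof -
   have [measurable]: "f \<in> bmb" by (rule bm[OF f(1)])
   have "\<bar>M n f x\<bar> <= (LB z. B * tht z)" unfolding M_def
   proof (rule order_trans[OF integral_abs_bound integral_mono])
   show "intb (%z. \<bar>f (x - s n *R z) * tht z\<bar>)"
   using integrable_mult_bounded(2)[OF th(4), of "%z. f (x - s n *R z)" B] f(2) by auto
   show "\<bar>f (x - s n *R z) * tht z\<bar> <= B * tht z" for z
   using f(2) th(2) by (auto simp: abs_mult intro!: mult_right_mono)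
   qed (use th in auto)
   thus ?thesis using th by simp
  qed
  show "Dp (M n f) i x = M n (%x. f' x $ i) x"
   if f: "C1 f f'" "compact L" "!!x. x ~: L ==> f x = 0" for f f' n i L x
  proof -
   obtain B where B: "B > 0" "!!x. \<bar>f x\<bar> <= B" "!!x. norm (f' x) <= B" using C1_bounded_support[OF f] by blast
   note [measurable] = C1_borel[OF f(1)]
   have d: "((%t. (LB z. f (x + t *R axis i 1 - s n *R z) * tht z)) has_derivative
   (%h. (LB z. tht z *R (f' (x + 0 *R axis i 1 - s n *R z) $ i)) \<bullet> h)) (at 0)"
   proof (rule has_derivative_under_integral[OF th(4), of 1 0 _ "%t z. f' (x + t *R axis i 1 - s n *R z) $ i" B B])
   fix t :: real and z
   show "((%t. f (x + t *R axis i 1 - s n *R z)) has_derivative (%h. f' (x + t *R axis i 1 - s n *R z) $ i \<bullet> h)) (at t)"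
   using C1_partial[OF f(1), of "x - s n *R z" i t]
   by (simp add: has_field_derivative_def add_diff_eq diff_add_eq mult.commute[of _ "f' _ $ i"])
   show "norm (f' (x + t *R axis i 1 - s n *R z) $ i) <= B"
   using B(3) component_le_norm_cart[of "f' (x + t *R axis i 1 - s n *R z)" i] by (metis order_trans real_norm_def)
   qed (use B in auto)
   have "((%t. M n f (x + t *R axis i 1)) has_real_derivative M n (%x. f' x $ i) x) (at 0)"
   unfolding M_def has_field_derivative_def
   by (rule has_derivative_eq_rhs[OF d]) (auto simp: fun_eq_iff mult.commute)
   thus ?thesis unfolding Dp_def by (rule DERIV_imp_deriv)
  qed
  show "M n f \<in> bmb" if "continuous_on UNIV f" for f n
  proof -
   have [measurable]: "f \<in> bmb" by (rule bm[OF that])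
   show ?thesis unfolding M_def by measurable
  qed
 qed
qed

section \<open>Weak gradients\<close>

definition ctest :: "(real^'n) set => (real^'n => real) => (real^'n => real^'n) => bool" where
 "ctest U ph ph' \<longleftrightarrow> C1 ph ph' & (\<exists>K. compact K & K \<subseteq> U & (\<forall>x. x ~: K --> ph x = 0))"

text \<open>Integrals run over the whole space: a test function vanishes off a compact part of U, so
  only the values on U are seen. Functions are then changed outside U at will, in particular by
  indicators.\<close>

definition wd :: "(real^'n) set => (real^'n => real) => (real^'n => real^'n) => bool" where
 "wd U f g \<longleftrightarrow> (\<forall>ph ph' i. ctest U ph ph' -->
  (LB x. f x * ph' x $ i) = - (LB x. g x $ i * ph x))"

lemma test_fun_ctest: "test_fun U ph ==> ctest U ph (%x. \<chi> i. Dp ph i x)"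
 unfolding test_fun_def ctest_def using smooth_C1 by blast

lemma ctest_mono: "ctest U ph ph' ==> U \<subseteq> V ==> ctest V ph ph'"
 unfolding ctest_def by blast

lemma wd_mono: "wd V f g ==> U \<subseteq> V ==> wd U f g"
 unfolding wd_def using ctest_mono by blast

lemma ctestE:
 assumes "ctest U ph ph'"
 obtains K B where "compact K" "K \<subseteq> U" "!!x. x ~: K ==> ph x = 0" "!!x. x ~: K ==> ph' x = 0"
  "B > 0" "!!x. \<bar>ph x\<bar> <= B" "!!x i. \<bar>ph' x $ i\<bar> <= B" "C1 ph ph'"
proof -
 from assms obtain K where K: "C1 ph ph'" "compact K" "K \<subseteq> U" "!!x. x ~: K ==> ph x = 0" by (auto simp: ctest_def)
 obtain B where B: "B > 0" "!!x. \<bar>ph x\<bar> <= B" "!!x. norm (ph' x) <= B" using C1_bounded_support[OF K(1,2,4)] by blast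
 have "\<bar>ph' x $ i\<bar> <= B" for x i
  using B(3) component_le_norm_cart[of "ph' x" i] order_trans by blast
 moreover have "ph' x = 0" if "x ~: K" for x
  by (rule C1_zero_outside[OF K(1) compact_imp_closed[OF K(2)] K(4) that])
 ultimately show ?thesis using that K B by blast
qed

text \<open>Enlarges the class of tests from smooth to C1. Mollified tests and their partials
  converge pointwise with uniform bounds, and \<open>f\<close> and \<open>g\<close> are integrable,
  so both sides pass to the limit.\<close>

lemma wdI_test_fun:
 fixes f :: "real^'n => real"
 assumes U: "open U" and f: "integrable lborel f" and g: "!!i. intb (%x. g x $ i)"
  and w: "!!ph i. test_fun U ph ==> (LB x. f x * Dp ph i x) = - (LB x. g x $ i * ph x)"
 shows "wd U f g"
 unfolding wd_def
proof (intro allI impI)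
 fix ph ph' i assume "ctest U ph ph'"
 then obtain K B where K: "compact K" "K \<subseteq> U" "!!x. x ~: K ==> ph x = 0" "!!x. x ~: K ==> ph' x = 0"
  "B > 0" "!!x. \<bar>ph x\<bar> <= B" "!!x i. \<bar>ph' x $ i\<bar> <= B" "C1 ph ph'" by (elim ctestE) blast
 note c = C1_cont[OF K(8)] C1_contI[OF K(8), of i]
 have [measurable]: "f \<in> bmb" "(%x. g x $ i) \<in> bmb" using f g by auto
 show "(LB x. f x * ph' x $ i) = - (LB x. g x $ i * ph x)"
 proof (rule moll_C1_tests[OF U K(1-3) c(1)])
 fix M :: "nat => (real^'n => real) => real^'n => real" assume M:
  "!!n. test_fun U (M n ph)"
  "!!f L x. continuous_on UNIV f ==> compact L ==> (!!x. x ~: L ==> f x = 0) ==> (%n. M n f x) \<longlonglongrightarrow> f x"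
  "!!f B n x. continuous_on UNIV f ==> (!!x. \<bar>f x\<bar> <= B) ==> \<bar>M n f x\<bar> <= B"
  "!!f f' n i L x. C1 f f' ==> compact L ==> (!!x. x ~: L ==> f x = 0) ==> Dp (M n f) i x = M n (%x. f' x $ i) x"
  "!!n f. continuous_on UNIV f ==> M n f \<in> bmb"
 have lim: "(%n. (LB x. u x * M n h x)) \<longlonglongrightarrow> (LB x. u x * h x)"
  if u: "integrable lborel u" and h: "continuous_on UNIV h" "!!x. x ~: K ==> h x = 0" "!!x. \<bar>h x\<bar> <= B" for u h
 proof (rule integral_dominated_convergence[where w = "%x. B * \<bar>u x\<bar>"])
  have [measurable]: "u \<in> bmb" "h \<in> bmb" "M n h \<in> bmb" for n
   using u h M by (auto intro: borel_measurable_continuous_onI)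
  show "(%x. u x * h x) \<in> borel_measurable lborel" "(%x. u x * M n h x) \<in> borel_measurable lborel" for n by measurable
  show "AE x in lborel. (%n. u x * M n h x) \<longlonglongrightarrow> u x * h x"
   using M(2)[OF h(1) K(1) h(2)] by (intro AE_I2 tendsto_intros) auto
  show "AE x in lborel. norm (u x * M n h x) <= B * \<bar>u x\<bar>" for n
   using M(3)[OF h(1,3)] by (auto simp: abs_mult mult.commute[of B] intro!: AE_I2 mult_left_mono)
 qed (use u in auto)
 have "(%n. (LB x. f x * M n (%x. ph' x $ i) x)) \<longlonglongrightarrow> (LB x. f x * ph' x $ i)"
  by (rule lim[OF f c(2)]) (use K in auto)
 moreover have "(LB x. f x * M n (%x. ph' x $ i) x) = - (LB x. g x $ i * M n ph x)" for n
  using w[OF M(1)] M(4)[OF K(8,1,3)] by simp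
 moreover have "(%n. - (LB x. g x $ i * M n ph x)) \<longlonglongrightarrow> - (LB x. g x $ i * ph x)"
  by (intro tendsto_minus lim[OF g c(1)]) (use K in auto)
 ultimately show "(LB x. f x * ph' x $ i) = - (LB x. g x $ i * ph x)"
  using LIMSEQ_unique by simp
 qed
qed

text \<open>Density in L1, by induction over integrable functions. For an indicator, outer
  regularity of the set and of its complement leaves a region of small measure outside which a
  Urysohn function agrees with it.\<close>

lemma integrable_approx_continuous:
 fixes f :: "'a::euclidean_space => real"
 assumes "integrable lborel f" "0 < e"
 shows "\<exists>c. continuous_on UNIV c & (\<exists>B. \<forall>x. \<bar>c x\<bar> <= B) & integrable lborel c & (LB x. \<bar>f x - c x\<bar>) < e"
 using assms
proof (induction arbitrary: e rule: integrable_induct)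
 case (base A c)
 define d where "d = e / (2 * (\<bar>c\<bar> + 1))"
 have d: "d > 0" using base by (simp add: d_def)
 have A: "A \<in> sets borel" "- A \<in> sets borel" using base by auto
 obtain U where U: "open U" "A \<subseteq> U" "emeasure lborel (U - A) < d" using outer_regular_lborel[OF A(1) d] by blast
 obtain V where V: "open V" "- A \<subseteq> V" "emeasure lborel (V - - A) < d" using outer_regular_lborel[OF A(2) d] by blast
 obtain f :: "'a => real" where f: "continuous_on UNIV f" "!!x. f x \<in> closed_segment 1 0" "!!x. x \<in> - V ==> f x = 1" "!!x. x \<in> - U ==> f x = 0"
  by (rule Urysohn[of "- V" "- U" "1::real" 0]) (use U V in auto)
 have f01: "0 <= f x" "f x <= 1" for x using f(2)[of x] by (auto simp: closed_segment_eq_real_ivl split: if_splits)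
 have [measurable]: "A \<in> sets borel" "U \<in> sets borel" "V \<in> sets borel" "f \<in> bmb"
  using A U V f by (auto intro: borel_measurable_continuous_onI)
 have eU: "emeasure lborel U < \<infinity>"
 proof -
  have "U = A \<union> (U - A)" using U by auto
  hence "emeasure lborel U <= emeasure lborel A + emeasure lborel (U - A)"
   by (metis emeasure_subadditive A(1) \<open>U \<in> sets borel\<close> sets.Diff sets_lborel)
  also have "... < \<infinity>" using base(2) less_trans[OF U(3) ennreal_less_top]
   by (auto simp: ennreal_add_less_top)
  finally show ?thesis .
 qed
 have fi: "integrable lborel f"
  by (rule Bochner_Integration.integrable_bound[where f = "indicat_real U"])
   (use eU f f01 in \<open>auto simp: indicator_def\<close>)
 let ?W = "(U - A) \<union> (V - - A)"
 have eW: "emeasure lborel ?W < ennreal (2 * d)"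
 proof -
  have "emeasure lborel ?W <= emeasure lborel (U - A) + emeasure lborel (V - - A)"
   by (rule emeasure_subadditive) auto
  also have "... < ennreal d + ennreal d" using U(3) V(3) by (rule add_strict_mono)
  finally show ?thesis using d by (simp add: ennreal_plus[symmetric])
 qed
 have Wi: "intb (indicat_real ?W)"
  using less_trans[OF eW ennreal_less_top] by auto
 have mW: "measure lborel ?W < 2 * d"
  using eW d by (metis emeasure_eq_ennreal_measure ennreal_less_iff ennreal_less_top less_irrefl less_trans measure_nonneg)
 have "(LB x. \<bar>indicat_real A x *R c - c * f x\<bar>) <= (LB x. \<bar>c\<bar> * indicat_real ?W x)"
 proof (rule integral_mono)
  show "intb (%x. \<bar>indicat_real A x *R c - c * f x\<bar>)" using base fi by auto
  show "intb (%x. \<bar>c\<bar> * indicat_real ?W x)" using Wi by simp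
  show "\<bar>indicat_real A x *R c - c * f x\<bar> <= \<bar>c\<bar> * indicat_real ?W x" for x
  proof -
   have "\<bar>indicat_real A x - f x\<bar> <= indicat_real ?W x"
   using f01[of x] f(3,4)[of x] U(2) V(2) by (auto simp: indicator_def)
   moreover have "\<bar>indicat_real A x *R c - c * f x\<bar> = \<bar>c\<bar> * \<bar>indicat_real A x - f x\<bar>"
   by (simp add: abs_mult[symmetric] algebra_simps)
   ultimately show ?thesis by (simp add: mult_left_mono)
  qed
 qed
 also have "... = \<bar>c\<bar> * measure lborel ?W" by simp
 also have "... <= \<bar>c\<bar> * (2 * d)" using mW by (intro mult_left_mono) auto
 also have "... < e" using base(3) by (simp add: d_def field_simps add_pos_nonneg)
 finally have "(LB x. \<bar>indicat_real A x *R c - c * f x\<bar>) < e" .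
 moreover have "\<exists>B. \<forall>x. \<bar>c * f x\<bar> <= B"
  using f01 by (intro exI[of _ "\<bar>c\<bar>"]) (auto simp: abs_mult mult_left_le)
 ultimately show ?case using f(1) fi by (intro exI[of _ "%x. c * f x"]) (auto intro!: continuous_intros)
next
 case (add f g)
 have e2: "e / 2 > 0" using add.prems by simp
 obtain c1 B1 where c1: "continuous_on UNIV c1" "!!x. \<bar>c1 x\<bar> <= B1" "integrable lborel c1" "(LB x. \<bar>f x - c1 x\<bar>) < e / 2"
  using add.IH(1)[OF e2] by blast
 obtain c2 B2 where c2: "continuous_on UNIV c2" "!!x. \<bar>c2 x\<bar> <= B2" "integrable lborel c2" "(LB x. \<bar>g x - c2 x\<bar>) < e / 2"
  using add.IH(2)[OF e2] by blast
 have "(LB x. \<bar>f x + g x - (c1 x + c2 x)\<bar>) <= (LB x. \<bar>f x - c1 x\<bar> + \<bar>g x - c2 x\<bar>)"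
  by (rule integral_mono) (use add.hyps c1(3) c2(3) in auto)
 also have "... < e" using add.hyps c1(3,4) c2(3,4) by simp
 finally have "(LB x. \<bar>f x + g x - (c1 x + c2 x)\<bar>) < e" .
 moreover have "\<bar>c1 x + c2 x\<bar> <= B1 + B2" for x using c1(2)[of x] c2(2)[of x] by linarith
 ultimately show ?case using c1 c2
  by (intro exI[of _ "%x. c1 x + c2 x"]) (auto intro!: continuous_intros)
next
 case (lim f s)
 have "(%i. (LB x. \<bar>f x - s i x\<bar>)) \<longlonglongrightarrow> (\<integral>x. 0 \<partial>(lborel :: 'a measure))"
 proof (rule integral_dominated_convergence[where w = "%x. 3 * \<bar>f x\<bar>"])
  show "AE x in lborel. (%i. \<bar>f x - s i x\<bar>) \<longlonglongrightarrow> 0"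
   using lim.hyps(2) by (intro AE_I2 tendsto_rabs_zero) (auto intro!: tendsto_eq_intros)
  show "AE x in lborel. norm \<bar>f x - s i x\<bar> <= 3 * \<bar>f x\<bar>" for i
  proof (rule AE_I2)
   fix x show "norm \<bar>f x - s i x\<bar> <= 3 * \<bar>f x\<bar>" using lim.hyps(3)[of x i] by simp
  qed
 qed (use lim.hyps in auto)
 hence "\<forall>\<^sub>F i in sequentially. (LB x. \<bar>f x - s i x\<bar>) < e / 2"
  using lim.prems by (intro order_tendstoD) auto
 then obtain i where i: "(LB x. \<bar>f x - s i x\<bar>) < e / 2" by (auto simp: eventually_sequentially)
 obtain c B where c: "continuous_on UNIV c" "!!x. \<bar>c x\<bar> <= B" "integrable lborel c" "(LB x. \<bar>s i x - c x\<bar>) < e / 2"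
  using lim.IH[of "e / 2" i] lim.prems by auto
 have "(LB x. \<bar>f x - c x\<bar>) <= (LB x. \<bar>f x - s i x\<bar> + \<bar>s i x - c x\<bar>)"
  by (rule integral_mono) (use lim.hyps(1,4) c(3) in auto)
 also have "... < e" using lim.hyps(1,4) c(3,4) i by simp
 finally show ?case using c by blast
qed

text \<open>Fundamental lemma of the calculus of variations. A continuous L1 approximation c of h
  yields the continuous substitute c / (|c| + 1/(n+1)) for the sign of h; testing with it times a
  cut-off shows that the integral of |h| against the cut-off is arbitrarily small.\<close>

lemma wd_unique_aux:
 fixes h :: "real^'n => real"
 assumes U: "open U" "bounded U" and h: "integrable lborel h"
  and z: "!!ph. test_fun U ph ==> (LB x. h x * ph x) = 0"
 shows "AE x in lborel. x \<in> U --> h x = 0"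
proof -
 have [measurable]: "h \<in> bmb" using h by auto
 have z2: "(LB x. h x * ph x) = 0"
  if K: "compact K" "K \<subseteq> U" "!!x. x ~: K ==> ph x = 0" and c: "continuous_on UNIV ph" for ph K
 proof (rule moll_C1_tests[OF U(1) K c])
  fix M :: "nat => (real^'n => real) => real^'n => real" assume M:
   "!!n. test_fun U (M n ph)"
   "!!f L x. continuous_on UNIV f ==> compact L ==> (!!x. x ~: L ==> f x = 0) ==> (%n. M n f x) \<longlonglongrightarrow> f x"
   "!!f B n x. continuous_on UNIV f ==> (!!x. \<bar>f x\<bar> <= B) ==> \<bar>M n f x\<bar> <= B"
   "!!n f. continuous_on UNIV f ==> M n f \<in> bmb"
  obtain B where B: "B > 0" "!!x. norm (ph x) <= B" using compact_support_bounded[OF c K(1,3)] by blast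
  have [measurable]: "ph \<in> bmb" "M n ph \<in> bmb" for n
   using c M(4) by (auto intro: borel_measurable_continuous_onI)
  have "(%n. (LB x. h x * M n ph x)) \<longlonglongrightarrow> (LB x. h x * ph x)"
  proof (rule integral_dominated_convergence[where w = "%x. B * \<bar>h x\<bar>"])
   show "AE x in lborel. (%n. h x * M n ph x) \<longlonglongrightarrow> h x * ph x"
   using M(2)[OF c K(1,3)] by (intro AE_I2 tendsto_intros) auto
   show "AE x in lborel. norm (h x * M n ph x) <= B * \<bar>h x\<bar>" for n
   using M(3)[OF c, of B] B by (auto simp: abs_mult mult.commute[of B] intro!: AE_I2 mult_left_mono)
  qed (use h in auto)
  moreover have "(%n. (LB x. h x * M n ph x)) \<longlonglongrightarrow> 0" by (simp add: z[OF M(1)])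
  ultimately show ?thesis by (rule LIMSEQ_unique)
 qed
 \<comment> \<open>Continuous cut-offs, positive exactly where the distance to the complement of U
   exceeds 1/(m+1). They have compact support in U, and every point of U is reached for large
   m.\<close>
 define et where "et m x = max 0 (min 1 (infdist x (- U) - 1 / (real m + 1)))" for m :: nat and x
 have ne: "- U ~= {}" using U(2) not_bounded_UNIV by (metis Compl_empty_eq double_complement)
 have etc: "continuous_on UNIV (et m)" for m unfolding et_def by (intro continuous_intros)
 have [measurable]: "et m \<in> bmb" for m by (rule borel_measurable_continuous_onI[OF etc])
 have et01: "0 <= et m x" "et m x <= 1" for m x by (auto simp: et_def)
 have K: "compact {x. infdist x (- U) >= 1 / (real m + 1)}" "{x. infdist x (- U) >= 1 / (real m + 1)} \<subseteq> U" for m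
 proof -
  have "infdist x (- U) = 0" if "x \<in> - U" for x using that by simp
  moreover have "1 / (real m + 1) > 0" by simp
  ultimately show *: "{x. infdist x (- U) >= 1 / (real m + 1)} \<subseteq> U"
   by (metis (mono_tags, lifting) ComplI linorder_not_le mem_Collect_eq subsetI)
  have "closed {x. infdist x (- U) >= 1 / (real m + 1)}"
   by (intro closed_Collect_le continuous_intros)
  thus "compact {x. infdist x (- U) >= 1 / (real m + 1)}"
   using bounded_subset[OF U(2) *] by (simp add: compact_eq_bounded_closed)
 qed
 have main: "(LB x. \<bar>h x\<bar> * et m x) = 0" for m
 proof -
  have i1: "intb (%x. \<bar>h x\<bar> * et m x)"
   by (rule integrable_mult_bounded[of _ _ _ 1]) (use h et01 in auto)
  have "(LB x. \<bar>h x\<bar> * et m x) <= 2 * e" if e: "e > 0" for e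
  proof -
   obtain c B where c: "continuous_on UNIV c" "!!x. \<bar>c x\<bar> <= B" "integrable lborel c" "(LB x. \<bar>h x - c x\<bar>) < e"
   using integrable_approx_continuous[OF h e] by blast
   have [measurable]: "c \<in> bmb" using c by auto
   define s where "s n x = c x / (\<bar>c x\<bar> + 1 / (real n + 1))" for n :: nat and x
   have pos: "\<bar>c x\<bar> + 1 / (real n + 1) > 0" for n x by (simp add: add_nonneg_pos)
   have sc: "continuous_on UNIV (s n)" for n unfolding s_def using pos[THEN less_imp_neq] c(1)
   by (intro continuous_intros) auto
   have [measurable]: "s n \<in> bmb" for n by (rule borel_measurable_continuous_onI[OF sc])
   have s1: "\<bar>s n x\<bar> <= 1" for n x using pos[of x n] by (simp add: s_def divide_le_eq)
   have i2: "intb (%x. \<bar>h x - c x\<bar>)" using h c by auto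
   have b: "(LB x. c x * (s n x * et m x)) <= e" for n
   proof -
   have b1: "\<bar>s n x * et m x\<bar> <= 1" for x using s1[of n x] et01[of m x] by (simp add: abs_mult mult_le_one)
   have i3: "intb (%x. h x * (s n x * et m x))" "intb (%x. c x * (s n x * et m x))"
   by (rule integrable_mult_bounded[of _ _ _ 1]; use h c b1 in simp)+
   have "(LB x. h x * (s n x * et m x)) = 0"
   by (rule z2[OF K[of m]]) (use sc etc in \<open>auto simp: et_def intro!: continuous_intros\<close>)
   hence "(LB x. c x * (s n x * et m x)) = (LB x. c x * (s n x * et m x) - h x * (s n x * et m x))"
   using i3 by simp
   also have "... <= (LB x. \<bar>h x - c x\<bar>)"
   proof (rule integral_mono)
   show "c x * (s n x * et m x) - h x * (s n x * et m x) <= \<bar>h x - c x\<bar>" for x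
   proof -
   have "(c x - h x) * (s n x * et m x) <= \<bar>c x - h x\<bar> * \<bar>s n x * et m x\<bar>" by (metis abs_ge_self abs_mult)
   also have "... <= \<bar>c x - h x\<bar> * 1" using b1 by (intro mult_left_mono) auto
   finally show ?thesis by (simp add: algebra_simps abs_minus_commute)
   qed
   qed (use i3 i2 in auto)
   finally show ?thesis using c(4) by simp
   qed
   have "(%n. (LB x. c x * (s n x * et m x))) \<longlonglongrightarrow> (LB x. \<bar>c x\<bar> * et m x)"
   proof (rule integral_dominated_convergence[where w = "%x. \<bar>c x\<bar>"])
   show "AE x in lborel. (%n. c x * (s n x * et m x)) \<longlonglongrightarrow> \<bar>c x\<bar> * et m x"
   proof (rule AE_I2)
   fix x
   show "(%n. c x * (s n x * et m x)) \<longlonglongrightarrow> \<bar>c x\<bar> * et m x"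
   proof (cases "c x = 0")
   case False
   have "(%n. c x / (\<bar>c x\<bar> + inverse (real (Suc n)))) \<longlonglongrightarrow> c x / (\<bar>c x\<bar> + 0)"
   using False by (intro tendsto_intros LIMSEQ_inverse_real_of_nat) auto
   hence "(%n. s n x) \<longlonglongrightarrow> c x / \<bar>c x\<bar>" by (simp add: s_def inverse_eq_divide add.commute)
   hence "(%n. c x * (s n x * et m x)) \<longlonglongrightarrow> c x * (c x / \<bar>c x\<bar> * et m x)" by (intro tendsto_intros)
   moreover have "c x * (c x / \<bar>c x\<bar> * et m x) = \<bar>c x\<bar> * et m x"
   using False by (cases "c x > 0") auto
   ultimately show ?thesis by simp
   qed simp
   qed
   show "AE x in lborel. norm (c x * (s n x * et m x)) <= \<bar>c x\<bar>" for n
   using s1 et01 by (intro AE_I2) (simp add: abs_mult mult_left_le mult_le_one)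
   qed (use c in auto)
   hence ce: "(LB x. \<bar>c x\<bar> * et m x) <= e" using b by (intro LIMSEQ_le_const2) auto
   have i4: "intb (%x. \<bar>c x\<bar> * et m x)"
   by (rule integrable_mult_bounded[of _ _ _ 1]) (use c et01 in auto)
   have "(LB x. \<bar>h x\<bar> * et m x) <= (LB x. \<bar>h x - c x\<bar> + \<bar>c x\<bar> * et m x)"
   proof (rule integral_mono)
   show "\<bar>h x\<bar> * et m x <= \<bar>h x - c x\<bar> + \<bar>c x\<bar> * et m x" for x
   proof -
   have "\<bar>h x\<bar> * et m x <= (\<bar>h x - c x\<bar> + \<bar>c x\<bar>) * et m x" using et01 by (intro mult_right_mono) auto
   also have "... <= \<bar>h x - c x\<bar> + \<bar>c x\<bar> * et m x" using et01[of m x] by (simp add: distrib_right mult_left_le)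
   finally show ?thesis .
   qed
   qed (use i1 i2 i4 in auto)
   also have "... <= 2 * e" using i2 i4 ce c(4) by simp
   finally show ?thesis .
  qed
  hence "(LB x. \<bar>h x\<bar> * et m x) <= 0 + e" if "e > 0" for e
   using that by (metis add_0 half_gt_zero mult_2 field_sum_of_halves)
  hence "(LB x. \<bar>h x\<bar> * et m x) <= 0" by (rule field_le_epsilon)
  moreover have "(LB x. \<bar>h x\<bar> * et m x) >= 0"
   by (rule Bochner_Integration.integral_nonneg) (use et01 in auto)
  ultimately show ?thesis by linarith
 qed
 have "AE x in lborel. \<forall>m. \<bar>h x\<bar> * et m x = 0"
  unfolding AE_all_countable
 proof
  fix m
  have i1: "intb (%x. \<bar>h x\<bar> * et m x)"
   by (rule integrable_mult_bounded[of _ _ _ 1]) (use h et01 in auto)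
  show "AE x in lborel. \<bar>h x\<bar> * et m x = 0"
   using integral_nonneg_eq_0_iff_AE[OF i1] main et01 by auto
 qed
 thus ?thesis
 proof eventually_elim
  case (elim x)
  show ?case
  proof
   assume "x \<in> U"
   hence "infdist x (- U) > 0" using infdist_pos_not_in_closed[of "- U" x] U(1) ne by (simp add: closed_def)
   then obtain m where "inverse (real (Suc m)) < infdist x (- U)" using reals_Archimedean by blast
   hence "et m x > 0" by (auto simp: et_def divide_inverse add.commute)
   thus "h x = 0" using elim by (metis abs_eq_0 less_irrefl mult_eq_0_iff)
  qed
 qed
qed

lemma wd_unique:
 assumes U: "open U" "bounded U" and w: "wd U f g" "wd U f g'"
  and g: "intb (%x. g x $ i)" "intb (%x. g' x $ i)"
 shows "AE x in lborel. x \<in> U --> g x $ i = g' x $ i"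
proof -
 have "AE x in lborel. x \<in> U --> g x $ i - g' x $ i = 0"
 proof (rule wd_unique_aux[OF U])
  fix ph assume "test_fun U ph"
  hence t: "ctest U ph (%x. \<chi> i. Dp ph i x)" by (rule test_fun_ctest)
  then obtain B where B: "!!x. \<bar>ph x\<bar> <= B" "C1 ph (%x. \<chi> i. Dp ph i x)" by (elim ctestE) blast
  have i: "intb (%x. g x $ i * ph x)" "intb (%x. g' x $ i * ph x)"
   using g B(1) C1_borel(1)[OF B(2)] by (auto intro!: integrable_mult_bounded(1)[of _ _ _ B])
  have "(LB x. g x $ i * ph x) = (LB x. g' x $ i * ph x)"
   using w(1)[unfolded wd_def, rule_format, OF t, of i] w(2)[unfolded wd_def, rule_format, OF t, of i] by simp
  thus "(LB x. (g x $ i - g' x $ i) * ph x) = 0" using i by (simp add: left_diff_distrib)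
 qed (use g in auto)
 thus ?thesis by simp
qed

lemma integrable_compact_support_mult:
 fixes f u :: "real^'n => real"
 assumes "integrable lborel f" "continuous_on UNIV u" "compact K" "!!x. x ~: K ==> u x = 0"
 shows "intb (%x. f x * u x)"
proof -
 obtain B where "!!x. norm (u x) <= B" using compact_support_bounded[OF assms(2-4)] by blast
 thus ?thesis using assms by (intro integrable_mult_bounded(1)[of _ _ _ B]) (auto intro: borel_measurable_continuous_onI)
qed

text \<open>A test function on W, multiplied by \<open>et\<close>, is used as a test on U. The
  closed set \<open>S\<close> carries \<open>et\<close>, so the support of the product stays in a
  compact part of U although W need not be contained in U.\<close>

lemma wd_product:
 fixes f :: "real^'n => real"
 assumes w: "wd U f g" and f: "integrable lborel f" and g: "!!i. intb (%x. g x $ i)"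
  and et: "C1 et et'" and S: "closed S" "!!x. x \<in> W ==> x ~: S ==> et x = 0" "W \<inter> S \<subseteq> U"
 shows "wd W (%x. et x * f x) (%x. et x *R g x + f x *R et' x)"
 unfolding wd_def
proof (intro allI impI)
 fix ph ph' i assume "ctest W ph ph'"
 then obtain K B where K: "compact K" "K \<subseteq> W" "!!x. x ~: K ==> ph x = 0" "!!x. x ~: K ==> ph' x = 0" "C1 ph ph'"
  by (elim ctestE) blast
 let ?p = "%x. et x * ph x" and ?p' = "%x. et x *R ph' x + ph x *R et' x"
 have "ctest U ?p ?p'"
  unfolding ctest_def
 proof (intro conjI exI[of _ "K \<inter> S"] allI impI)
  show "C1 ?p ?p'" by (rule C1_mult[OF et K(5)])
  show "compact (K \<inter> S)" using K S by (simp add: compact_Int_closed)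
  show "K \<inter> S \<subseteq> U" using K S by blast
  show "et x * ph x = 0" if "x ~: K \<inter> S" for x using that K S by auto
 qed
 hence e: "(LB x. f x * ?p' x $ i) = - (LB x. g x $ i * ?p x)" using w unfolding wd_def by blast
 have i1: "intb (%x. f x * (et x * ph' x $ i))" "intb (%x. f x * (ph x * et' x $ i))"
  "intb (%x. g x $ i * (et x * ph x))"
  by (rule integrable_compact_support_mult[OF _ _ K(1)];
   use f g K(3,4) C1_cont[OF et] C1_cont[OF K(5)] C1_contI[OF et, of i] C1_contI[OF K(5), of i]
   in \<open>auto intro!: continuous_intros\<close>)+
 have "(LB x. (et x * f x) * ph' x $ i) = (LB x. f x * ?p' x $ i - f x * (ph x * et' x $ i))"
  by (rule Bochner_Integration.integral_cong) (auto simp: algebra_simps)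
 also have "... = (LB x. f x * ?p' x $ i) - (LB x. f x * (ph x * et' x $ i))"
  using i1 by (intro Bochner_Integration.integral_diff) (auto simp: distrib_left)
 also have "... = - ((LB x. g x $ i * (et x * ph x)) + (LB x. f x * (ph x * et' x $ i)))"
  using e by simp
 also have "... = - (LB x. g x $ i * (et x * ph x) + f x * (ph x * et' x $ i))"
  using i1 by simp
 also have "(LB x. g x $ i * (et x * ph x) + f x * (ph x * et' x $ i)) = (LB x. (et x *R g x + f x *R et' x) $ i * ph x)"
  by (rule Bochner_Integration.integral_cong) (auto simp: algebra_simps)
 finally show "(LB x. (et x * f x) * ph' x $ i) = - (LB x. (et x *R g x + f x *R et' x) $ i * ph x)" .
qed

lemma wd_add:
 assumes "wd U f g" "wd U f2 g2"
  and f: "integrable lborel f" "integrable lborel f2" and g: "!!i. intb (%x. g x $ i)" "!!i. intb (%x. g2 x $ i)"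
 shows "wd U (%x. f x + f2 x) (%x. g x + g2 x)"
 unfolding wd_def
proof (intro allI impI)
 fix ph ph' i assume t: "ctest U ph ph'"
 then obtain K where K: "compact K" "!!x. x ~: K ==> ph x = 0" "!!x. x ~: K ==> ph' x = 0" "C1 ph ph'"
  by (elim ctestE) blast
 note i = integrable_compact_support_mult[OF _ C1_cont[OF K(4)] K(1,2)] integrable_compact_support_mult[OF _ C1_contI[OF K(4), of i] K(1)]
 show "(LB x. (f x + f2 x) * ph' x $ i) = - (LB x. (g x + g2 x) $ i * ph x)"
  using assms(1,2)[unfolded wd_def, rule_format, OF t, of i] f g K(3)
  by (simp add: distrib_right i)
qed

lemma wd_zero: "wd U (%x. 0) (%x. 0)"
 by (simp add: wd_def)

lemma wd_cong_on:
 assumes "wd U f g" "!!x. x \<in> U ==> f2 x = f x" "!!x. x \<in> U ==> g2 x = g x"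
 shows "wd U f2 g2"
 unfolding wd_def
proof (intro allI impI)
 fix ph ph' i assume t: "ctest U ph ph'"
 then obtain K where K: "compact K" "K \<subseteq> U" "!!x. x ~: K ==> ph x = 0" "!!x. x ~: K ==> ph' x = 0"
  by (elim ctestE) blast
 have "(%x. f2 x * ph' x $ i) = (%x. f x * ph' x $ i)" "(%x. g2 x $ i * ph x) = (%x. g x $ i * ph x)"
 proof -
  have "f2 x * ph' x $ i = f x * ph' x $ i & g2 x $ i * ph x = g x $ i * ph x" for x
   by (cases "x \<in> K") (use assms(2,3)[of x] K(2) K(3,4)[of x] in auto)
  thus "(%x. f2 x * ph' x $ i) = (%x. f x * ph' x $ i)" "(%x. g2 x $ i * ph x) = (%x. g x $ i * ph x)" by auto
 qed
 thus "(LB x. f2 x * ph' x $ i) = - (LB x. g2 x $ i * ph x)"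
  using assms(1)[unfolded wd_def, rule_format, OF t, of i] by simp
qed

text \<open>Difference quotients have integral 0 by translation invariance, and they converge
  boundedly to the partial derivative. A derivative along one coordinate is all that
  \<open>wd_classical\<close> knows of its integrand.\<close>

lemma integral_partial_zero:
 fixes ps D :: "real^'n => real"
 assumes c: "continuous_on UNIV ps" "continuous_on UNIV D" and K: "compact K" "!!x. x ~: K ==> ps x = 0" "!!x. x ~: K ==> D x = 0"
  and d: "!!x. ((%t. ps (x + t *R axis i 1)) has_real_derivative D x) (at 0)"
 shows "(LB x. D x) = 0"
proof -
 obtain B where B: "B > 0" "!!x. norm (D x) <= B" using compact_support_bounded[OF c(2) K(1,3)] by blast
 let ?e = "axis i (1::real) :: real^'n"
 have dt: "((%t. ps (x + t *R ?e)) has_real_derivative D (x + t *R ?e)) (at t)" for x t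
 proof -
  have "((%s. ps ((x + t *R ?e) + (s - t) *R ?e)) has_real_derivative D (x + t *R ?e) * 1) (at t)"
   by (rule DERIV_chain2[where f = "%s. ps ((x + t *R ?e) + s *R ?e)"])
   (use d[of "x + t *R ?e"] in \<open>auto intro!: derivative_eq_intros\<close>)
  thus ?thesis by (simp add: algebra_simps)
 qed
 have lip: "\<bar>ps (x + t *R ?e) - ps x\<bar> <= B * \<bar>t\<bar>" for x t
 proof -
  have "norm (ps (x + t *R ?e) - ps (x + 0 *R ?e)) <= B * norm (t - 0)"
   by (rule field_differentiable_bound[of UNIV _ "%t. D (x + t *R ?e)"])
   (use dt B in \<open>auto intro: has_field_derivative_at_within\<close>)
  thus ?thesis by simp
 qed
 define q where "q n x = (ps (x + (1 / real (Suc n)) *R ?e) - ps x) / (1 / real (Suc n))" for n x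
 have [measurable]: "ps \<in> bmb" "D \<in> bmb" using c by (auto intro: borel_measurable_continuous_onI)
 let ?L = "{x + y |x y. x \<in> K & y \<in> cball 0 1}"
 have cL: "compact ?L" by (rule compact_sums[OF K(1) compact_cball])
 have psi: "integrable lborel ps" by (rule compact_support_integrable[OF c(1) K(1,2)])
 have "(%n. (LB x. q n x)) \<longlonglongrightarrow> (LB x. D x)"
 proof (rule integral_dominated_convergence[where w = "%x. B * indicat_real ?L x"])
  show "intb (%x. B * indicat_real ?L x)"
   by (intro integrable_mult_right integrable_real_indicator)
   (use emeasure_compact_finite[OF cL] borel_compact[OF cL] in auto)
  show "AE x in lborel. (%n. q n x) \<longlonglongrightarrow> D x"
  proof (rule AE_I2)
   fix x
   have "((%h. (ps (x + (0 + h) *R ?e) - ps (x + 0 *R ?e)) / h) \<longlongrightarrow> D x) (at 0)"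
   using d[of x] unfolding DERIV_def by simp
   moreover have "filterlim (%n. 1 / real (Suc n)) (at 0) sequentially"
   using LIMSEQ_inverse_real_of_nat by (auto simp: filterlim_at inverse_eq_divide)
   ultimately have "(%n. (ps (x + (0 + 1 / real (Suc n)) *R ?e) - ps (x + 0 *R ?e)) / (1 / real (Suc n))) \<longlonglongrightarrow> D x"
   by (rule filterlim_compose)
   thus "(%n. q n x) \<longlonglongrightarrow> D x" by (simp add: q_def)
  qed
  show "AE x in lborel. norm (q n x) <= B * indicat_real ?L x" for n
  proof (rule AE_I2)
   fix x
   have "norm (q n x) <= B"
   unfolding q_def real_norm_def abs_divide
   by (subst pos_divide_le_eq) (use lip[of x "1 / real (Suc n)"] in auto)
   moreover have "q n x = 0" if x: "x ~: ?L"
   proof -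
   have "x = (x + (1 / real (Suc n)) *R ?e) + (- (1 / real (Suc n)) *R ?e)" "x = x + 0" by simp_all
   moreover have "(- (1 / real (Suc n)) *R ?e) \<in> cball 0 1" "0 \<in> cball (0::real^'n) 1" by simp_all
   ultimately have "x + (1 / real (Suc n)) *R ?e ~: K" "x ~: K" using x by blast+
   thus ?thesis using K(2) by (simp add: q_def)
   qed
   ultimately show "norm (q n x) <= B * indicat_real ?L x" using B(1) by (cases "x \<in> ?L") auto
  qed
 qed (auto simp: q_def)
 moreover have "(LB x. q n x) = 0" for n
 proof -
  let ?v = "(1 / real (Suc n)) *R ?e"
  have s: "intb (%x. ps (x + ?v))"
   using lborel_integrable_affine[OF _ psi, of 1 ?v] by (simp add: add.commute)
  have "(LB x. ps x) = (LB x. ps (x + ?v))"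
   using lborel_integral_affine[of 1 ps ?v] by (simp add: add.commute)
  moreover have "(LB x. q n x) = ((LB x. ps (x + ?v)) - (LB x. ps x)) / (1 / real (Suc n))"
   unfolding q_def using s psi by simp
  ultimately show ?thesis by simp
 qed
 ultimately have "(%n. 0) \<longlonglongrightarrow> (LB x. D x)" by simp
 thus ?thesis by (rule LIMSEQ_unique[OF _ tendsto_const])
qed

text \<open>Continuous derivatives along the axes suffice, without total differentiability. They are
  asked for on X only: near points outside the support of the test function the product is
  constantly 0.\<close>

lemma wd_classical:
 fixes F :: "real^'n => real"
 assumes c: "continuous_on UNIV F" "!!i. continuous_on UNIV (%x. G x $ i)"
  and d: "!!x i. x \<in> X ==> ((%t. F (x + t *R axis i 1)) has_real_derivative G x $ i) (at 0)"
 shows "wd X F G"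
 unfolding wd_def
proof (intro allI impI)
 fix ph ph' i assume "ctest X ph ph'"
 then obtain K B where K: "compact K" "K \<subseteq> X" "!!x. x ~: K ==> ph x = 0" "!!x. x ~: K ==> ph' x = 0" "C1 ph ph'"
  by (elim ctestE) blast
 note c2 = c C1_cont[OF K(5)] C1_contI[OF K(5), of i]
 have 0: "(LB x. F x * ph' x $ i + G x $ i * ph x) = 0"
 proof (rule integral_partial_zero[where ps = "%x. F x * ph x" and K = K and i = i])
  fix x
  show "((%t. F (x + t *R axis i 1) * ph (x + t *R axis i 1)) has_real_derivative F x * ph' x $ i + G x $ i * ph x) (at 0)"
  proof (cases "x \<in> K")
   case True
   show ?thesis
   using DERIV_mult[OF d[of x i] C1_partial[OF K(5), of x i 0]] True K(2) by (auto simp: algebra_simps)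
  next
   case False
   have "((%t. x + t *R axis i 1) \<longlongrightarrow> x + 0 *R axis i 1) (at (0::real))" by (intro tendsto_intros)
   moreover have "open (- K)" using K(1) by (simp add: compact_imp_closed open_Compl)
   ultimately have ev: "\<forall>\<^sub>F t in at 0. x + t *R axis i 1 \<in> - K" using False
   by (intro topological_tendstoD) auto
   have "((%t. 0) has_real_derivative 0) (at (0::real))" by simp
   moreover have "\<forall>\<^sub>F t in nhds 0. F (x + t *R axis i 1) * ph (x + t *R axis i 1) = 0"
   using ev False K(3) by (auto simp: eventually_at_filter elim!: eventually_mono)
   ultimately show ?thesis using False K(3,4) DERIV_cong_ev[OF refl, of _ "%t. 0" 0 0 0] by force
  qed
 next
  show "continuous_on UNIV (%x. F x * ph' x $ i + G x $ i * ph x)" by (intro continuous_intros c2)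
 qed (use c2 K in \<open>auto intro!: continuous_intros\<close>)
 have "intb (%x. F x * ph' x $ i)" "intb (%x. G x $ i * ph x)"
  by (rule compact_support_integrable[OF _ K(1)]; (intro continuous_intros c2)?; use K in auto)+
 thus "(LB x. F x * ph' x $ i) = - (LB x. G x $ i * ph x)" using 0 by simp
qed

section \<open>Affine changes of variables\<close>

text \<open>Diagonal affine maps are enough for the anisotropic rescaling of a cell, which has
  different horizontal and vertical factors.\<close>

definition daff :: "real^'n => real^'n => real^'n => real^'n" where
 "daff b c y = b + (\<chi> k. c $ k * y $ k)"

lemma daff_nth [simp]: "daff b c y $ k = b $ k + c $ k * y $ k"
 by (simp add: daff_def)

lemma daff_measurable [measurable]: "daff b c \<in> bmb"
 unfolding daff_def by (intro borel_measurable_continuous_onI continuous_intros)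

lemma daff_continuous: "continuous_on S (daff b c)"
 unfolding daff_def by (intro continuous_intros)

lemma daff_inverse:
 assumes "!!k. c $ k ~= 0"
 shows "daff b c (daff (\<chi> k. - b $ k / c $ k) (\<chi> k. 1 / c $ k) x) = x"
  "daff (\<chi> k. - b $ k / c $ k) (\<chi> k. 1 / c $ k) (daff b c y) = y"
 using assms by (auto simp: vec_eq_iff field_simps)

lemma lborel_daff:
 fixes b c :: "real^'n"
 assumes c: "!!k. c $ k ~= 0"
 shows "lborel = density (distr lborel borel (daff b c)) (%_. ennreal (\<Prod>k\<in>UNIV. \<bar>c $ k\<bar>))"
proof -
 have ax: "j \<in> Basis ==> \<exists>k. j = axis k (1::real)" for j :: "real^'n" by (auto simp: Basis_vec_def)
 have "daff b c = (%x. b + (\<Sum>j\<in>Basis. ((c \<bullet> j) * (x \<bullet> j)) *R j))"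
 proof
  fix x
  have "(\<chi> k. c $ k * x $ k) = (\<Sum>j\<in>Basis. ((\<chi> k. c $ k * x $ k) \<bullet> j) *R j)" by (rule euclidean_representation[symmetric])
  also have "... = (\<Sum>j\<in>Basis. ((c \<bullet> j) * (x \<bullet> j)) *R j)"
   by (rule sum.cong) (auto dest!: ax simp: inner_axis)
  finally show "daff b c x = b + (\<Sum>j\<in>Basis. ((c \<bullet> j) * (x \<bullet> j)) *R j)" by (simp add: daff_def)
 qed
 moreover have "(\<Prod>j\<in>Basis. \<bar>c \<bullet> j\<bar>) = (\<Prod>k\<in>UNIV. \<bar>c $ k\<bar>)"
 proof -
  have B: "(Basis :: (real^'n) set) = (%k. axis k 1) ` UNIV" by (auto simp: Basis_vec_def)
  have "inj (%k. axis k (1::real) :: real^'n)" by (auto simp: inj_def axis_eq_axis)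
  thus ?thesis unfolding B by (subst prod.reindex) (simp_all add: inner_axis)
 qed
 moreover have "c \<bullet> j ~= 0" if "j \<in> Basis" for j using ax[OF that] c by (auto simp: inner_axis)
 ultimately show ?thesis using lborel_affine_euclidean[of "%j. c \<bullet> j" b] by simp
qed

lemma integral_daff:
 fixes f :: "real^'n => real"
 assumes c: "!!k. c $ k ~= 0" and [measurable]: "f \<in> bmb"
 shows "(LB x. f x) = (\<Prod>k\<in>UNIV. \<bar>c $ k\<bar>) * (LB y. f (daff b c y))"
 by (subst lborel_daff[OF c, of b]) (simp_all add: integral_density integral_distr prod_nonneg)

lemma nn_integral_daff:
 fixes f :: "real^'n => ennreal"
 assumes c: "!!k. c $ k ~= 0" and [measurable]: "f \<in> bmb"
 shows "(NB x. f x) = ennreal (\<Prod>k\<in>UNIV. \<bar>c $ k\<bar>) * (NB y. f (daff b c y))"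
 by (subst lborel_daff[OF c, of b]) (simp_all add: nn_integral_density nn_integral_distr nn_integral_cmult)

lemma integrable_daff:
 fixes f :: "real^'n => real"
 assumes c: "!!k. c $ k ~= 0" and f: "integrable lborel f"
 shows "intb (%y. f (daff b c y))"
proof -
 have [measurable]: "f \<in> bmb" using f by auto
 have "(\<Prod>k\<in>UNIV. \<bar>c $ k\<bar>) > 0" using c by (intro prod_pos) auto
 moreover have "(NB x. ennreal (norm (f x))) < \<infinity>" using f by (simp add: integrable_iff_bounded)
 ultimately have "(NB x. ennreal (norm (f (daff b c x)))) < \<infinity>"
  using c by (subst (asm) nn_integral_daff[OF c, of _ b]) (auto simp: ennreal_mult_less_top)
 thus ?thesis by (simp add: integrable_iff_bounded)
qed

lemma daff_has_derivative: "(daff b c has_derivative (%h. \<chi> k. c $ k * h $ k)) (at x)"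
proof -
 have "linear (%h. \<chi> k. c $ k * h $ k)"
  by (auto simp: linear_iff vec_eq_iff algebra_simps)
 hence "bounded_linear (%h. \<chi> k. c $ k * h $ k)" by (simp add: linear_conv_bounded_linear)
 from bounded_linear_imp_has_derivative[OF this] show ?thesis
  unfolding daff_def[abs_def] by (auto intro!: derivative_eq_intros)
qed

lemma C1_daff:
 fixes b c :: "real^'n"
 assumes "C1 g g'" shows "C1 (%x. g (daff b c x)) (%x. \<chi> k. c $ k * g' (daff b c x) $ k)"
proof -
 have "adjoint (%h::real^'n. \<chi> k. c $ k * h $ k) = (%h. \<chi> k. c $ k * h $ k)"
  by (rule adjoint_unique) (simp add: inner_vec_def algebra_simps)
 thus ?thesis using C1_affine[OF daff_has_derivative assms, of b c] by simp
qed

text \<open>Tests are transported by the inverse map; the Jacobian appears on both sides of the weak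
  identity and cancels.\<close>

lemma wd_daff:
 fixes f :: "real^'n => real"
 assumes w: "wd U f g" and c: "!!k. c $ k ~= 0" and f: "integrable lborel f" "!!i. intb (%x. g x $ i)"
 shows "wd (daff b c -` U) (%y. f (daff b c y)) (%y. \<chi> k. c $ k * g (daff b c y) $ k)"
 unfolding wd_def
proof (intro allI impI)
 fix ph ph' i assume "ctest (daff b c -` U) ph ph'"
 then obtain K where K: "compact K" "K \<subseteq> daff b c -` U" "!!x. x ~: K ==> ph x = 0" "C1 ph ph'"
  by (elim ctestE) blast
 let ?b = "\<chi> k. - b $ k / c $ k" and ?c = "\<chi> k. 1 / c $ k"
 let ?P = "\<Prod>k\<in>UNIV. \<bar>c $ k\<bar>"
 have P: "?P > 0" using c by (intro prod_pos) auto
 have "ctest U (%x. ph (daff ?b ?c x)) (%x. \<chi> k. ?c $ k * ph' (daff ?b ?c x) $ k)"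
  unfolding ctest_def
 proof (intro conjI exI[of _ "daff b c ` K"] allI impI)
  show "C1 (%x. ph (daff ?b ?c x)) (%x. \<chi> k. ?c $ k * ph' (daff ?b ?c x) $ k)" by (rule C1_daff[OF K(4)])
  show "compact (daff b c ` K)" by (rule compact_continuous_image[OF daff_continuous K(1)])
  show "daff b c ` K \<subseteq> U" using K(2) by blast
  show "ph (daff ?b ?c x) = 0" if "x ~: daff b c ` K" for x
  proof (rule K(3), rule notI)
   assume "daff ?b ?c x \<in> K"
   hence "daff b c (daff ?b ?c x) \<in> daff b c ` K" by (rule imageI)
   thus False using that unfolding daff_inverse[OF c] by simp
  qed
 qed
 from w[unfolded wd_def, rule_format, OF this, of i]
 have e: "(LB x. f x * (1 / c $ i * ph' (daff ?b ?c x) $ i)) = - (LB x. g x $ i * ph (daff ?b ?c x))"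
  by simp
 note [measurable] = C1_borel[OF K(4)] borel_measurable_integrable[OF f(1)] borel_measurable_integrable[OF f(2)[of i]]
 note m = daff_measurable[of ?b ?c, measurable]
 have 1: "(LB x. f x * (1 / c $ i * ph' (daff ?b ?c x) $ i)) = ?P * (LB y. f (daff b c y) * (1 / c $ i * ph' y $ i))"
 proof -
  have "(%x. f x * (1 / c $ i * ph' (daff ?b ?c x) $ i)) \<in> bmb" by measurable
  from integral_daff[OF c this, of b] show ?thesis by (simp only: daff_inverse[OF c])
 qed
 have 2: "(LB x. g x $ i * ph (daff ?b ?c x)) = ?P * (LB y. g (daff b c y) $ i * ph y)"
 proof -
  have "(%x. g x $ i * ph (daff ?b ?c x)) \<in> bmb" by measurable
  from integral_daff[OF c this, of b] show ?thesis by (simp only: daff_inverse[OF c])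
 qed
 have "(LB y. f (daff b c y) * (1 / c $ i * ph' y $ i)) = (1 / c $ i) * (LB y. f (daff b c y) * ph' y $ i)"
  by (subst integral_mult_right_zero[symmetric]) (simp add: mult_ac)
 hence "(1 / c $ i) * (LB y. f (daff b c y) * ph' y $ i) = - (LB y. g (daff b c y) $ i * ph y)"
 proof -
  assume q: "(LB y. f (daff b c y) * (1 / c $ i * ph' y $ i)) = (1 / c $ i) * (LB y. f (daff b c y) * ph' y $ i)"
  have "?P * ((1 / c $ i) * (LB y. f (daff b c y) * ph' y $ i) + (LB y. g (daff b c y) $ i * ph y)) = 0"
   using e unfolding 1 2 q by (simp add: distrib_left)
  thus ?thesis using P by (simp only: mult_eq_0_iff) linarith
 qed
 hence "(LB y. f (daff b c y) * ph' y $ i) = - (c $ i * (LB y. g (daff b c y) $ i * ph y))"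
  using c[of i] by (simp add: field_simps)
 also have "c $ i * (LB y. g (daff b c y) $ i * ph y) = (LB y. (\<chi> k. c $ k * g (daff b c y) $ k) $ i * ph y)"
  by (subst integral_mult_right_zero[symmetric]) (simp add: mult_ac)
 finally show "(LB y. f (daff b c y) * ph' y $ i) = - (LB y. (\<chi> k. c $ k * g (daff b c y) $ k) $ i * ph y)" .
qed

section \<open>Averages at a point and scale\<close>

text \<open>Pulled back to the unit ball, where the kernels live, so that radius 0 makes sense: the
  average is then the integral of the kernel times \<open>v p\<close>. The extension uses radius 0
  outside the hole, and one formula describes both sides of the boundary.\<close>

definition A :: "(real^3 => real) => (real^3 => real) => real^3 => real => real" where
 "A k v p l = (LB z. k z * v (p + l *R z))"

definition kern :: "(real^3 => real) => bool" where
 "kern k \<longleftrightarrow> continuous_on UNIV k & (\<forall>z. norm z >= 1 --> k z = 0)"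

lemma kern_zero: "kern k ==> norm z >= 1 ==> k z = 0"
 by (simp add: kern_def)

lemma kern_borel: "kern k ==> k \<in> bmb"
 unfolding kern_def by (auto intro: borel_measurable_continuous_onI)

lemma kern_bound:
 assumes "kern k" shows "\<exists>B>0. (\<forall>z. \<bar>k z\<bar> <= B) & (\<forall>z. \<bar>k z\<bar> <= B * indicat_real (cball 0 1) z)"
proof -
 have z: "k z = 0" if "z ~: cball 0 1" for z using assms that by (auto simp: kern_def)
 have c: "continuous_on UNIV k" using assms by (simp add: kern_def)
 obtain B where B: "B > 0" "!!z. norm (k z) <= B"
  using compact_support_bounded[OF c compact_cball z] by blast
 have "\<bar>k z\<bar> <= B * indicat_real (cball 0 1) z" for z
  using B(2)[of z] z[of z] by (cases "z \<in> cball 0 1") auto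
 thus ?thesis using B by auto
qed

lemma kern_integrable: "kern k ==> integrable lborel k"
 by (rule compact_support_integrable[OF _ compact_cball[of 0 1]]) (auto simp: kern_def)

lemma kern_mult: "kern k ==> continuous_on UNIV f ==> kern (%z. f z * k z)"
 unfolding kern_def by (auto intro!: continuous_intros)

text \<open>Moves centre and radius into the kernel, where they can be differentiated although
  \<open>v\<close> cannot.\<close>

lemma A_y:
 assumes l: "l > 0" and [measurable]: "v \<in> bmb" "k \<in> bmb"
 shows "A k v p l = (LB y. k ((1 / l) *R (y - p)) / l ^ 3 * v y)"
proof -
 have "(LB y. k ((1 / l) *R (y - p)) / l ^ 3 * v y) = l ^ 3 * (LB z. k z / l ^ 3 * v (p + l *R z))"
  using lborel_integral_affine[of l "%y. k ((1 / l) *R (y - p)) / l ^ 3 * v y" p] l by simp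
 also have "(LB z. k z / l ^ 3 * v (p + l *R z)) = (LB z. (k z * v (p + l *R z)) / l ^ 3)" by simp
 also have "l ^ 3 * ... = A k v p l" using l by (simp add: A_def)
 finally show ?thesis by simp
qed

lemma A_zero_scale: "A k v p 0 = (LB z. k z) * v p"
 by (simp add: A_def)

lemma A_integrable:
 assumes "kern k" "integrable lborel v" "l > 0"
 shows "intb (%z. k z * v (p + l *R z))"
proof -
 obtain B where "!!z. \<bar>k z\<bar> <= B" using kern_bound[OF assms(1)] by blast
 thus ?thesis using assms(3) kern_borel[OF assms(1)]
  by (intro integrable_mult_bounded(2)[OF lborel_integrable_affine[OF _ assms(2)], of l k B p]) auto
qed

lemma A_lin:
 assumes "kern k" "integrable lborel v" "integrable lborel w" "l > 0"
 shows "A k (%y. a * v y + b * w y) p l = a * A k v p l + b * A k w p l"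
proof -
 note i = A_integrable[OF assms(1,2,4), of p] A_integrable[OF assms(1,3,4), of p]
 have "A k (%y. a * v y + b * w y) p l = (LB z. a * (k z * v (p + l *R z)) + b * (k z * w (p + l *R z)))"
  unfolding A_def by (rule Bochner_Integration.integral_cong) (auto simp: algebra_simps)
 thus ?thesis using i by (simp add: A_def)
qed

lemma A_AE_cong:
 assumes l: "l > 0" and [measurable]: "v \<in> bmb" "w \<in> bmb" "k \<in> bmb"
  and e: "AE y in lborel. v y = w y"
 shows "A k v p l = A k w p l"
 unfolding A_y[OF l assms(2,4)] A_y[OF l assms(3,4)]
proof (rule integral_cong_AE)
 show "AE y in lborel. k ((1 / l) *R (y - p)) / l ^ 3 * v y = k ((1 / l) *R (y - p)) / l ^ 3 * w y"
  using e by eventually_elim simp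
qed measurable

lemma A_measurable[measurable]:
 assumes [measurable]: "k \<in> bmb" "v \<in> bmb" "p \<in> borel_measurable M" "l \<in> borel_measurable M"
 shows "(%x. A k v (p x) (l x)) \<in> borel_measurable M"
 unfolding A_def by measurable

lemma A_continuous:
 fixes p :: "'a::metric_space => real^3"
 assumes k: "kern k" and v: "integrable lborel v" and c: "continuous_on UNIV p" "continuous_on UNIV l" and l: "!!x. l x > 0"
 shows "continuous_on UNIV (%x. A k v (p x) (l x))"
proof (rule continuous_on_sequentiallyI)
 fix u a assume u: "u \<longlonglongrightarrow> (a :: 'a)"
 have [measurable]: "v \<in> bmb" "k \<in> bmb" using v kern_borel[OF k] by auto
 have t: "(%n. p (u n)) \<longlonglongrightarrow> p a" "(%n. l (u n)) \<longlonglongrightarrow> l a"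
  using u c by (auto simp: continuous_on_eq_continuous_at isCont_tendsto_compose)
 obtain B where B: "B > 0" "!!z. \<bar>k z\<bar> <= B" using kern_bound[OF k] by blast
 have "(%n. 1 / l (u n) ^ 3) \<longlonglongrightarrow> 1 / l a ^ 3" using l[of a] t by (intro tendsto_intros) auto
 hence "Bseq (%n. 1 / l (u n) ^ 3)" by (rule convergent_imp_Bseq[OF convergentI])
 then obtain C where C: "!!n. norm (1 / l (u n) ^ 3) <= C" by (auto simp: Bseq_def)
 have "(%n. (LB y. k ((1 / l (u n)) *R (y - p (u n))) / l (u n) ^ 3 * v y)) \<longlonglongrightarrow> (LB y. k ((1 / l a) *R (y - p a)) / l a ^ 3 * v y)"
 proof (rule integral_dominated_convergence[where w = "%y. B * C * \<bar>v y\<bar>"])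
  show "AE y in lborel. (%n. k ((1 / l (u n)) *R (y - p (u n))) / l (u n) ^ 3 * v y) \<longlonglongrightarrow> k ((1 / l a) *R (y - p a)) / l a ^ 3 * v y"
  proof (rule AE_I2)
   fix y
   have "isCont k ((1 / l a) *R (y - p a))" using k by (simp add: kern_def continuous_on_eq_continuous_at)
   moreover have "(%n. (1 / l (u n)) *R (y - p (u n))) \<longlonglongrightarrow> (1 / l a) *R (y - p a)"
   using l[of a] t by (intro tendsto_intros) auto
   ultimately have "(%n. k ((1 / l (u n)) *R (y - p (u n)))) \<longlonglongrightarrow> k ((1 / l a) *R (y - p a))"
   by (rule isCont_tendsto_compose)
   thus "(%n. k ((1 / l (u n)) *R (y - p (u n))) / l (u n) ^ 3 * v y) \<longlonglongrightarrow> k ((1 / l a) *R (y - p a)) / l a ^ 3 * v y"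
   using l[of a] t by (intro tendsto_intros) auto
  qed
  show "AE y in lborel. norm (k ((1 / l (u n)) *R (y - p (u n))) / l (u n) ^ 3 * v y) <= B * C * \<bar>v y\<bar>" for n
  proof (rule AE_I2)
   fix y
   have "\<bar>k ((1 / l (u n)) *R (y - p (u n)))\<bar> * norm (1 / l (u n) ^ 3) <= B * C"
   using B C[of n] by (intro mult_mono) auto
   from mult_right_mono[OF this, of "\<bar>v y\<bar>"]
   show "norm (k ((1 / l (u n)) *R (y - p (u n))) / l (u n) ^ 3 * v y) <= B * C * \<bar>v y\<bar>"
   by (simp add: abs_mult)
  qed
 qed (use v in auto)
 thus "(%n. A k v (p (u n)) (l (u n))) \<longlonglongrightarrow> A k v (p a) (l a)"
  by (simp add: A_y l)
qed

text \<open>The scaled kernel is itself an admissible test function on V, since it vanishes off the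
  closed ball. The factor l is the chain rule.\<close>

lemma A_ibp:
 assumes k: "kern k" "C1 k k'" and w: "wd V v g" and l: "l > 0" and V: "cball p l \<subseteq> V"
  and [measurable]: "v \<in> bmb" "(%y. g y $ j) \<in> bmb"
 shows "A (%z. k' z $ j) v p l = - l * A k (%y. g y $ j) p l"
proof -
 let ?b = "- (1 / l) *R p" and ?c = "\<chi> j::3. 1 / l"
 have e: "daff ?b ?c y = (1 / l) *R (y - p)" for y
  using l by (simp add: vec_eq_iff field_simps)
 note [measurable] = kern_borel[OF k(1)] C1_borel(2)[OF k(2)]
 have C: "C1 (%y. (1 / l ^ 3) * k ((1 / l) *R (y - p))) (%y. (1 / l ^ 3) *R (\<chi> j. (1 / l) * k' ((1 / l) *R (y - p)) $ j))"
  using C1_cmult[OF C1_daff[OF k(2), of ?b ?c], of "1 / l ^ 3"] unfolding e by simp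
 have "ctest V (%y. (1 / l ^ 3) * k ((1 / l) *R (y - p))) (%y. (1 / l ^ 3) *R (\<chi> j. (1 / l) * k' ((1 / l) *R (y - p)) $ j))"
  unfolding ctest_def
 proof (intro conjI exI[of _ "cball p l"] allI impI)
  fix y assume "y ~: cball p l"
  hence "norm ((1 / l) *R (y - p)) >= 1" using l by (simp add: dist_norm norm_minus_commute)
  thus "(1 / l ^ 3) * k ((1 / l) *R (y - p)) = 0" using kern_zero[OF k(1)] by (metis mult_zero_right)
 qed (use C V in auto)
 from w[unfolded wd_def, rule_format, OF this, of j]
 have "(LB y. v y * (1 / l ^ 3 * (1 / l * k' ((1 / l) *R (y - p)) $ j))) = - A k (%y. g y $ j) p l"
  by (simp add: A_y[OF l] mult.commute)
 moreover have "(LB y. v y * (1 / l ^ 3 * (1 / l * k' ((1 / l) *R (y - p)) $ j))) = (1 / l) * A (%z. k' z $ j) v p l"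
  unfolding A_y[OF l assms(6) borel_measurable_vec_component[OF C1_borel(2)[OF k(2)]]]
  by (subst integral_mult_right_zero[symmetric]) (simp add: mult_ac)
 ultimately show ?thesis using l by (simp add: field_simps)
qed

text \<open>Beyond the closed ball the kernel vanishes on an open set; on the sphere itself
  continuity of the gradient decides.\<close>

lemma kern_deriv:
 assumes "kern k" "C1 k k'" "norm z >= 1" shows "k' z = 0"
proof -
 have s: "k' z = 0" if "norm z > 1" for z
  by (rule C1_zero_outside[OF assms(2) closed_cball[of 0 1]]) (use that assms(1) in \<open>auto simp: kern_def\<close>)
 show ?thesis
 proof (cases "norm z > 1")
  case False
  hence n1: "norm z = 1" using assms by auto
  have t: "(%n. (1 + inverse (real (Suc n))) *R z) \<longlonglongrightarrow> (1 + 0) *R z"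
   by (intro tendsto_intros LIMSEQ_inverse_real_of_nat)
  have "isCont k' z" using C1_cont'[OF assms(2)] by (simp add: continuous_on_eq_continuous_at)
  hence "(%n. k' ((1 + inverse (real (Suc n))) *R z)) \<longlonglongrightarrow> k' z"
   by (rule isCont_tendsto_compose) (use t in simp)
  moreover have "norm ((1 + inverse (real (Suc n))) *R z) > 1" for n
   using n1 by (simp add: field_simps)
  hence "(%n. k' ((1 + inverse (real (Suc n))) *R z)) = (%n. 0)" using s by blast
  ultimately show ?thesis using LIMSEQ_unique[OF _ tendsto_const] by fastforce
 qed (use s in auto)
qed

lemma kern_deriv_kern: "kern k ==> C1 k k' ==> kern (%z. k' z $ j)"
 using kern_deriv[of k k'] C1_contI[of k k' j] by (auto simp: kern_def)

text \<open>Up to the factor -1/l both sides are the average of \<open>v\<close> with a second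
  derivative of the kernel, and these are symmetric. This exchange of indices is what later trades
  full gradients for symmetrised ones.\<close>

lemma A_symmetric_second:
 assumes k: "kern k" "C1 k k'" "!!i. C1 (%z. k' z $ i) (k'' i)" "!!i j z. k'' i z $ j = k'' j z $ i"
  and w: "wd V v g" and l: "l > 0" and V: "cball p l \<subseteq> V"
  and m: "v \<in> bmb" "!!j. (%y. g y $ j) \<in> bmb"
 shows "A (%z. k' z $ i) (%y. g y $ j) p l = A (%z. k' z $ j) (%y. g y $ i) p l"
proof -
 have "A (%z. k'' i z $ j) v p l = - l * A (%z. k' z $ i) (%y. g y $ j) p l" for i j
  by (rule A_ibp[OF kern_deriv_kern[OF k(1,2)] k(3) w l V m])
 from this[of i j] this[of j i] show ?thesis using k(4)[of i _ j] l by simp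
qed

text \<open>Formally the derivative is the average of the gradient of v in direction p' + l' z. As v
  has weak derivatives only, the kernel is differentiated instead; its derivative is a divergence,
  which is integrated by parts.\<close>

lemma A_curve_deriv:
 fixes p p' :: "real => real^3" and l l' :: "real => real"
 assumes k: "kern k" "C1 k k'" and w: "wd V v g" and v: "integrable lborel v" and gi: "!!j. intb (%y. g y $ j)"
  and p: "!!t. (p has_vector_derivative p' t) (at t)" "continuous_on UNIV p'"
  and l: "!!t. (l has_real_derivative l' t) (at t)" "continuous_on UNIV l'" "!!t. l t > 0"
  and V: "cball (p t0) (l t0) \<subseteq> V"
 shows "((%t. A k v (p t) (l t)) has_real_derivative
  (\<Sum>j\<in>UNIV. p' t0 $ j * A k (%y. g y $ j) (p t0) (l t0) + l' t0 * A (%z. z $ j * k z) (%y. g y $ j) (p t0) (l t0))) (at t0)"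
proof -
 have [measurable]: "v \<in> bmb" using v by auto
 have gm[measurable]: "(%y. g y $ j) \<in> bmb" for j using gi by auto
 note [measurable] = kern_borel[OF k(1)] C1_borel(2)[OF k(2)]
 have cp: "continuous_on UNIV p" "continuous_on UNIV l"
  using p(1) l(1) by (meson continuous_at_imp_continuous_on has_vector_derivative_continuous DERIV_isCont)+
 \<comment> \<open>Derivative in t of the scaled kernel \<open>k (\<zeta> t y) / l t ^ 3\<close>,
   written in the variable z = \<open>\<zeta> t y\<close>; the term with 3 l' comes from the
   normalising power.\<close>
 define \<Phi> where "\<Phi> t z = - (k' z \<bullet> (p' t + l' t *R z) + 3 * l' t * k z) / l t ^ 4" for t z
 define \<zeta> where "\<zeta> t y = (1 / l t) *R (y - p t)" for t y
 have \<Phi>0: "\<Phi> t z = 0" if "norm z >= 1" for t z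
  using that kern_zero[OF k(1)] kern_deriv[OF k] by (simp add: \<Phi>_def)
 have "compact ({t0 - 1..t0 + 1} \<times> cball (0::real^3) 1)" by (intro compact_Times) auto
 moreover have "continuous_on ({t0 - 1..t0 + 1} \<times> cball (0::real^3) 1) (%(t, z). \<Phi> t z)"
 proof -
  have "continuous_on UNIV (%x::real \<times> (real^3). k' (snd x))" "continuous_on UNIV (%x::real \<times> (real^3). k (snd x))"
   "continuous_on UNIV (%x::real \<times> (real^3). p' (fst x))" "continuous_on UNIV (%x::real \<times> (real^3). l' (fst x))" "continuous_on UNIV (%x::real \<times> (real^3). l (fst x))"
   by (rule continuous_on_compose2[OF C1_cont'[OF k(2)]] continuous_on_compose2[OF C1_cont[OF k(2)]] continuous_on_compose2[OF p(2)]
   continuous_on_compose2[OF l(2)] continuous_on_compose2[OF cp(2)]; auto intro!: continuous_intros)+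
  hence "continuous_on UNIV (%x::real \<times> (real^3). \<Phi> (fst x) (snd x))"
   unfolding \<Phi>_def using l(3)[THEN less_imp_neq, symmetric] by (intro continuous_intros) auto
  thus ?thesis unfolding case_prod_unfold by (rule continuous_on_subset) simp
 qed
 ultimately have "bounded ((%(t, z). \<Phi> t z) ` ({t0 - 1..t0 + 1} \<times> cball (0::real^3) 1))"
  by (intro compact_imp_bounded compact_continuous_image)
 then obtain B where B: "B > 0" "!!t z. t \<in> {t0 - 1..t0 + 1} ==> z \<in> cball 0 1 ==> \<bar>\<Phi> t z\<bar> <= B"
  unfolding bounded_pos by fastforce
 have B2: "\<bar>\<Phi> t z\<bar> <= B" if "t \<in> {t0 - 1..t0 + 1}" for t z
  using B(1) B(2)[OF that, of z] \<Phi>0[of z t] by (cases "norm z <= 1") auto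
 obtain Bk where Bk: "!!z. \<bar>k z\<bar> <= Bk" using kern_bound[OF k(1)] by blast
 have "((%t. (LB y. k (\<zeta> t y) / l t ^ 3 * v y)) has_derivative (%h. (LB y. v y *R \<Phi> t0 (\<zeta> t0 y)) \<bullet> h)) (at t0)"
 proof (rule has_derivative_under_integral[OF v, of 1])
  fix t y assume t: "t \<in> ball t0 1"
  show "norm (\<Phi> t (\<zeta> t y)) <= B"
  proof -
   have "t \<in> {t0 - 1..t0 + 1}" using t unfolding ball_def dist_real_def by (simp only: mem_Collect_eq atLeastAtMost_iff) linarith
   thus ?thesis using B2 by simp
  qed
  have l0: "l t ~= 0" using l(3)[of t] by simp
  have "((%t. 1 / l t) has_real_derivative - l' t / (l t)\<^sup>2) (at t)"
   using l0 by (auto intro!: derivative_eq_intros l(1) simp: power2_eq_square)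
  moreover have "((%t. y - p t) has_vector_derivative - p' t) (at t)"
   using has_vector_derivative_diff[OF has_vector_derivative_const p(1)] by simp
  ultimately have "((%t. (1 / l t) *R (y - p t)) has_vector_derivative (1 / l t) *R (- p' t) + (- l' t / (l t)\<^sup>2) *R (y - p t)) (at t)"
   by (rule has_vector_derivative_scaleR)
  moreover have "(1 / l t) *R (- p' t) + (- l' t / (l t)\<^sup>2) *R (y - p t) = - (1 / l t) *R (p' t + l' t *R \<zeta> t y)"
   using l0 by (simp add: \<zeta>_def vec_eq_iff field_simps power2_eq_square)
  ultimately have dz: "((%t. \<zeta> t y) has_vector_derivative - (1 / l t) *R (p' t + l' t *R \<zeta> t y)) (at t)"
   by (simp add: \<zeta>_def)
  have dk: "((%t. k (\<zeta> t y)) has_real_derivative - (1 / l t) * (k' (\<zeta> t y) \<bullet> (p' t + l' t *R \<zeta> t y))) (at t)"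
   using has_derivative_compose[OF dz[unfolded has_vector_derivative_def] C1_D[OF k(2)]]
   unfolding has_field_derivative_def by (rule has_derivative_eq_rhs) (auto simp: fun_eq_iff)
  have "((%t. k (\<zeta> t y) / l t ^ 3) has_real_derivative \<Phi> t (\<zeta> t y)) (at t)"
  proof (rule DERIV_cong[OF DERIV_divide[OF dk DERIV_power[OF l(1), of 3]]])
   define Q where "Q = k' (\<zeta> t y) \<bullet> (p' t + l' t *R \<zeta> t y)"
   show "(- (1 / l t) * (k' (\<zeta> t y) \<bullet> (p' t + l' t *R \<zeta> t y)) * l t ^ 3 - k (\<zeta> t y) * (of_nat 3 * (l' t * l t ^ (3 - Suc 0)))) / (l t ^ 3 * l t ^ 3) = \<Phi> t (\<zeta> t y)"
   unfolding \<Phi>_def Q_def[symmetric] using l0 by (simp add: field_simps power_def numeral_eq_Suc)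
  qed (use l0 in simp)
  thus "((%t. k (\<zeta> t y) / l t ^ 3) has_derivative (%h. \<Phi> t (\<zeta> t y) \<bullet> h)) (at t)"
   unfolding has_field_derivative_def by (rule has_derivative_eq_rhs) (auto simp: fun_eq_iff)
 next
  show "\<bar>k (\<zeta> t0 y) / l t0 ^ 3\<bar> <= Bk / l t0 ^ 3" for y
   using Bk[of "\<zeta> t0 y"] l(3)[of t0] by (simp add: divide_right_mono)
 qed (auto simp: \<zeta>_def \<Phi>_def)
 hence 1: "((%t. A k v (p t) (l t)) has_real_derivative (LB y. v y * \<Phi> t0 (\<zeta> t0 y))) (at t0)"
  unfolding has_field_derivative_def A_y[OF l(3) \<open>v \<in> bmb\<close> kern_borel[OF k(1)]] \<zeta>_def
  by (rule has_derivative_eq_rhs) (auto simp: fun_eq_iff)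
 define P L where "P = p' t0" and "L = l' t0"
 \<comment> \<open>Components of the vector field (P + L z) k(z). Its divergence is the numerator of
   \<open>\<Phi>\<close>, the factor 3 being the divergence of z.\<close>
 define kj kj' where "kj j z = (P $ j + L * z $ j) * k z" and "kj' j z = (P $ j + L * z $ j) *R k' z + k z *R (L *R axis j 1)" for j z
 have Cj: "C1 (kj j) (kj' j)" for j
  unfolding kj_def[abs_def] kj'_def[abs_def]
  using C1_mult[OF C1_add[OF C1_const C1_cmult[OF C1_coord]] k(2), of "P $ j" L j] by simp
 have Kj: "kern (kj j)" for j
  unfolding kj_def[abs_def] by (rule kern_mult[OF k(1)]) (intro continuous_intros)
 note l0 = l(3)[of t0]
 have "\<Phi> t0 z = - (1 / l t0 ^ 4) * (\<Sum>j\<in>UNIV. kj' j z $ j)" for z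
 proof -
  have "k' z \<bullet> (P + L *R z) = (\<Sum>j\<in>UNIV. (P $ j + L * z $ j) * k' z $ j)"
   by (simp add: inner_vec_def mult.commute)
  moreover have "(\<Sum>j\<in>UNIV. kj' j z $ j) = (\<Sum>j\<in>UNIV. (P $ j + L * z $ j) * k' z $ j) + 3 * L * k z"
   by (simp add: kj'_def sum.distrib)
  ultimately have e: "(\<Sum>j\<in>UNIV. kj' j z $ j) = k' z \<bullet> (P + L *R z) + 3 * L * k z" by simp
  have "- a / b = - (1 / b) * a" for a b :: real by simp
  thus ?thesis unfolding e \<Phi>_def P_def[symmetric] L_def[symmetric] .
 qed
 hence "(LB y. v y * \<Phi> t0 (\<zeta> t0 y)) = (LB y. - (1 / l t0) * (\<Sum>j\<in>UNIV. kj' j (\<zeta> t0 y) $ j / l t0 ^ 3 * v y))"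
  using l0 by (intro Bochner_Integration.integral_cong)
   (auto simp: sum_distrib_left sum_distrib_right sum_divide_distrib power_def numeral_eq_Suc mult_ac sum_negf)
 also have "... = - (1 / l t0) * (\<Sum>j\<in>UNIV. (LB y. kj' j (\<zeta> t0 y) $ j / l t0 ^ 3 * v y))"
 proof -
  have "intb (%y. kj' j (\<zeta> t0 y) $ j / l t0 ^ 3 * v y)" for j
  proof -
   note K = kern_deriv_kern[OF Kj Cj, of j j]
   obtain B where B: "!!z. \<bar>kj' j z $ j\<bar> <= B" using kern_bound[OF K] by blast
   show ?thesis
   by (rule integrable_mult_bounded(2)[OF v, of _ "B / l t0 ^ 3"])
   (use l0 B kern_borel[OF K] in \<open>auto simp: \<zeta>_def abs_divide intro!: divide_right_mono\<close>)
  qed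
  thus ?thesis by simp
 qed
 also have "(\<Sum>j\<in>UNIV. (LB y. kj' j (\<zeta> t0 y) $ j / l t0 ^ 3 * v y)) = (\<Sum>j\<in>UNIV. A (%z. kj' j z $ j) v (p t0) (l t0))"
  unfolding A_y[OF l0 \<open>v \<in> bmb\<close> kern_borel[OF kern_deriv_kern[OF Kj Cj]]] \<zeta>_def ..
 also have "... = (\<Sum>j\<in>UNIV. - l t0 * A (kj j) (%y. g y $ j) (p t0) (l t0))"
  by (rule sum.cong[OF refl]) (rule A_ibp[OF Kj Cj w l0 V \<open>v \<in> bmb\<close> gm])
 also have "- (1 / l t0) * ... = (\<Sum>j\<in>UNIV. A (kj j) (%y. g y $ j) (p t0) (l t0))"
  using l0 by (simp add: sum_negf sum_distrib_left[symmetric])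
 also have "... = (\<Sum>j\<in>UNIV. P $ j * A k (%y. g y $ j) (p t0) (l t0) + L * A (%z. z $ j * k z) (%y. g y $ j) (p t0) (l t0))"
 proof (rule sum.cong[OF refl])
  fix j :: 3
  have "kern (%z. z $ j * k z)" by (rule kern_mult[OF k(1)]) (intro continuous_intros)
  note i = A_integrable[OF k(1) gi[of j] l0, of "p t0"] A_integrable[OF this gi[of j] l0, of "p t0"]
  have "A (kj j) (%y. g y $ j) (p t0) (l t0) = (LB z. P $ j * (k z * g (p t0 + l t0 *R z) $ j) + L * (z $ j * k z * g (p t0 + l t0 *R z) $ j))"
   unfolding A_def kj_def by (rule Bochner_Integration.integral_cong) (auto simp: algebra_simps)
  thus "A (kj j) (%y. g y $ j) (p t0) (l t0) = P $ j * A k (%y. g y $ j) (p t0) (l t0) + L * A (%z. z $ j * k z) (%y. g y $ j) (p t0) (l t0)"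
   using i by (simp add: A_def)
 qed
 finally show ?thesis using 1 unfolding P_def L_def by simp
qed

section \<open>Local rigid motions\<close>

text \<open>Truncated powers rather than a smooth bump: the gradient of the m-th is a multiple of z
  times the (m-1)-th, so that all kernels stay explicit polynomials on the ball.\<close>

definition bmp :: "nat => real^3 => real" where
 "bmp m z = (max 0 (1 - z \<bullet> z)) ^ m"

lemma max_power_deriv:
 assumes "m >= 2"
 shows "((%t::real. (max 0 t) ^ m) has_real_derivative real m * (max 0 t) ^ (m - 1)) (at t)"
 using assms
proof (induction m rule: dec_induct)
 case base
 consider "t < 0" | "t = 0" | "t > 0" by linarith
 thus ?case
 proof cases
  case 1
  have "((%t::real. 0) has_real_derivative 0) (at t)" by simp
  hence "((%t. (max 0 t)\<^sup>2) has_real_derivative 0) (at t)"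
   by (rule has_field_derivative_transform_within_open[where S = "{..<0}"]) (use 1 in auto)
  thus ?thesis using 1 by simp
 next
  case 2
  have "((%t::real. (max 0 t)\<^sup>2) has_derivative (%h. 0)) (at 0)"
   by (rule has_derivative_quadratic[where C = 1]) (auto simp: max_def)
  moreover have "(*) (0::real) = (%h. 0)" by auto
  ultimately show ?thesis using 2 by (simp add: has_field_derivative_def)
 next
  case 3
  have "((%t::real. t\<^sup>2) has_real_derivative 2 * t) (at t)" by (auto intro!: derivative_eq_intros)
  hence "((%t. (max 0 t)\<^sup>2) has_real_derivative 2 * t) (at t)"
   by (rule has_field_derivative_transform_within_open[where S = "{0<..}"]) (use 3 in auto)
  thus ?thesis using 3 by simp
 qed
next
 case (step m)
 have e: "t * (max 0 t) ^ k = (max 0 t) ^ Suc k" if "k >= 1" for t :: real and k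
  using that by (cases "t > 0") (auto simp: max_def)
 have "((%t. t * (max 0 t) ^ m) has_real_derivative 1 * (max 0 t) ^ m + real m * (max 0 t) ^ (m - 1) * t) (at t)"
  by (rule DERIV_mult[OF DERIV_ident step.IH])
 moreover have "1 * (max 0 t) ^ m + real m * (max 0 t) ^ (m - 1) * t = real (Suc m) * (max 0 t) ^ (Suc m - 1)"
  using e[of "m - 1" t] step(1) by (simp add: algebra_simps)
 moreover have "(%t::real. t * (max 0 t) ^ m) = (%t. (max 0 t) ^ Suc m)"
  by (rule ext, rule e) (use step(1) in simp)
 ultimately show ?case by simp
qed

lemma C1_bmp: "m >= 2 ==> C1 (bmp m) (%z. (- 2 * real m * bmp (m - 1) z) *R z)"
 using C1_comp[OF max_power_deriv _ C1_ball_arg, of m]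
 by (simp add: bmp_def[abs_def] continuous_intros mult_ac)

lemma kern_bmp: "m >= 1 ==> kern (bmp m)"
proof -
 assume m: "m >= 1"
 have "bmp m z = 0" if "norm z >= 1" for z
 proof -
  have "z \<bullet> z >= 1" using that by (metis dot_square_norm one_le_power)
  thus ?thesis using m by (simp add: bmp_def)
 qed
 thus ?thesis by (auto simp: kern_def bmp_def[abs_def] intro!: continuous_intros)
qed

definition kI :: real where "kI = (LB z. bmp 4 z)"

lemma kI_pos: "kI > 0"
proof (rule ccontr)
 assume "\<not> kI > 0"
 have n: "bmp 4 z >= 0" for z by (simp add: bmp_def)
 have i: "intb (bmp 4)" by (rule kern_integrable[OF kern_bmp]) simp
 have "kI >= 0" unfolding kI_def by (rule Bochner_Integration.integral_nonneg) (use n in auto)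
 hence "(LB z. bmp 4 z) = 0" using \<open>\<not> kI > 0\<close> by (simp add: kI_def)
 hence "AE z in lborel. bmp 4 z = 0" using integral_nonneg_eq_0_iff_AE[OF i] n by auto
 hence "AE z in lborel. z ~: ball (0::real^3) 1"
 proof eventually_elim
  case (elim z)
  show ?case
  proof
   assume "z \<in> ball 0 1"
   hence "(norm z)\<^sup>2 < 1" by (simp add: power_less_one_iff)
   hence "z \<bullet> z < 1" by (simp add: dot_square_norm)
   thus False using elim by (simp add: bmp_def)
  qed
 qed
 hence "(ball (0::real^3) 1) \<in> null_sets lborel"
  by (subst (asm) AE_iff_null_sets[symmetric]) auto
 hence "negligible (ball (0::real^3) 1)" by (simp add: negligible_iff_null_sets null_sets_completionI)
 thus False using open_not_negligible[of "ball (0::real^3) 1"] by auto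
qed

text \<open>All kernels derive from \<open>kap\<close>; since it is radial, \<open>z \<^sub>k kap\<close> is again a gradient,
 namely of \<open>Lam\<close>. This is what makes the derivatives of the local rigid motion depend on the
 symmetrised gradient only.\<close>

definition kap :: "real^3 => real" where "kap z = (1 / kI) * bmp 4 z"
definition dkap :: "3 => real^3 => real" where "dkap j z = (- 8 / kI) * (bmp 3 z * z $ j)"
definition Lam :: "real^3 => real" where "Lam z = (- 1 / (10 * kI)) * bmp 5 z"
definition zkap :: "3 => real^3 => real" where "zkap k z = z $ k * kap z"
definition zdkap :: "3 => 3 => real^3 => real" where "zdkap k j z = z $ k * dkap j z"

lemma kern_kap: "kern kap"
 unfolding kap_def[abs_def] by (rule kern_mult[OF kern_bmp]) (auto intro!: continuous_intros)

lemma kern_dkap: "kern (dkap j)"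
proof -
 have "kern (%z. (- 8 / kI * z $ j) * bmp 3 z)" by (rule kern_mult[OF kern_bmp]) (use kI_pos in \<open>auto intro!: continuous_intros\<close>)
 thus ?thesis by (simp add: dkap_def[abs_def] mult_ac)
qed

lemma kern_zkap: "kern (zkap k)"
 unfolding zkap_def[abs_def] by (rule kern_mult[OF kern_kap]) (auto intro!: continuous_intros)

lemma kern_zdkap: "kern (zdkap k j)"
 unfolding zdkap_def[abs_def] by (rule kern_mult[OF kern_dkap]) (auto intro!: continuous_intros)

lemma kern_Lam: "kern Lam"
 unfolding Lam_def[abs_def] by (rule kern_mult[OF kern_bmp]) (auto intro!: continuous_intros)

lemma C1_eqD: "C1 f f' ==> (!!x. f' x = f'' x) ==> C1 f f''"
 by (metis ext)

lemma C1_kap: "C1 kap (%z. \<chi> j. dkap j z)"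
 unfolding kap_def[abs_def]
 by (rule C1_eqD[OF C1_cmult[OF C1_bmp]]) (use kI_pos in \<open>auto simp: vec_eq_iff dkap_def\<close>)

definition d2kap :: "3 => real^3 => real^3" where
 "d2kap j z = (- 8 / kI) *R (bmp 3 z *R axis j 1 + z $ j *R ((- 6 * bmp 2 z) *R z))"

lemma C1_dkap: "C1 (dkap j) (d2kap j)"
 unfolding dkap_def[abs_def]
 by (rule C1_eqD[OF C1_cmult[OF C1_mult[OF C1_bmp C1_coord]]]) (auto simp: d2kap_def)

lemma d2kap_sym: "d2kap i z $ j = d2kap j z $ i"
 by (simp add: d2kap_def axis_def)

lemma C1_Lam: "C1 Lam (%z. \<chi> j. zkap j z)"
 unfolding Lam_def[abs_def]
 by (rule C1_eqD[OF C1_cmult[OF C1_bmp]]) (use kI_pos in \<open>auto simp: vec_eq_iff zkap_def kap_def\<close>)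

lemma C1_zkap: "C1 (zkap k) (%z. \<chi> j. (if j = k then kap z else 0) + zdkap k j z)"
 unfolding zkap_def[abs_def]
 by (rule C1_eqD[OF C1_mult[OF C1_coord C1_kap]]) (auto simp: vec_eq_iff zdkap_def axis_def)

definition d2zkap :: "3 => 3 => real^3 => real^3" where
 "d2zkap k i z = (if i = k then 1 else 0) *R (\<chi> j. dkap j z) + (z $ k *R d2kap i z + dkap i z *R axis k 1)"

lemma C1_dzkap: "C1 (%z. (if i = k then kap z else 0) + zdkap k i z) (d2zkap k i)"
proof -
 have "C1 (%z. (if i = k then 1 else 0) * kap z + z $ k * dkap i z) (d2zkap k i)"
  by (rule C1_eqD[OF C1_add[OF C1_cmult[OF C1_kap] C1_mult[OF C1_coord C1_dkap]]]) (auto simp: d2zkap_def)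
 moreover have "(%z. (if i = k then 1 else 0) * kap z + z $ k * dkap i z) = (%z. (if i = k then kap z else 0) + zdkap k i z)"
  by (auto simp: zdkap_def)
 ultimately show ?thesis by simp
qed

lemma d2zkap_sym: "d2zkap k i z $ j = d2zkap k j z $ i"
 by (auto simp: d2zkap_def axis_def d2kap_sym)

lemma integral_gradient_zero:
 assumes "kern k" "C1 k k'" shows "(LB z. k' z $ j) = 0"
proof (rule integral_partial_zero[where ps = k and K = "cball 0 1" and i = j])
 show "continuous_on UNIV k" "continuous_on UNIV (%z. k' z $ j)"
  using assms C1_contI by (auto simp: kern_def)
 show "k z = 0" if "z ~: cball 0 1" for z using that assms(1) by (auto simp: kern_def)
 show "k' z $ j = 0" if "z ~: cball 0 1" for z using that kern_deriv[OF assms, of z] by auto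
 show "((%t. k (x + t *R axis j 1)) has_real_derivative k' x $ j) (at 0)" for x
  using C1_partial[OF assms(2), of x j 0] by simp
qed simp

lemma integral_kap: "(LB z. kap z) = 1"
 using kI_pos by (simp add: kap_def kI_def)

lemma integral_dkap: "(LB z. dkap j z) = 0"
 using integral_gradient_zero[OF kern_kap C1_kap, of j] by simp

text \<open>Value at x = p + l d of the local rigid motion: mean displacement plus mean rotation
  applied to x - p. By integration by parts the bracket is 2 l times the averaged skew gradient
  \<open>Wr\<close>; written through \<open>u\<close> it requires no choice of a gradient. The
  offset \<open>d\<close> is a separate argument because it keeps a meaning when l is 0.\<close>

definition Fr :: "(real^3 => real^3) => real^3 => real^3 => real => 3 => real" where
 "Fr u d p l i = A kap (%y. u y $ i) p l
  + (\<Sum>j\<in>UNIV. d $ j * (A (dkap i) (%y. u y $ j) p l - A (dkap j) (%y. u y $ i) p l)) / 2"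

text \<open>Mean infinitesimal rotation. It is skew, hence disappears from the symmetrised gradient
  of the extension.\<close>

definition Wr :: "(real^3 => real^3^3) => real^3 => real => 3 => 3 => real" where
 "Wr g p l i j = (A kap (%y. g y $ i $ j) p l - A kap (%y. g y $ j $ i) p l) / 2"

definition Ae :: "(real^3 => real) => (real^3 => real^3^3) => real^3 => real => 3 => 3 => real" where
 "Ae k g p l i j = (A k (%y. g y $ i $ j) p l + A k (%y. g y $ j $ i) p l) / 2"

text \<open>What remains of the derivative of \<open>Fr\<close> along a curve after the rotation is
  split off. It is linear in the velocities of centre and radius, and the gradient enters through
  its symmetrised entries \<open>Ae\<close>.\<close>

definition Sr :: "(real^3 => real^3^3) => real^3 => real^3 => real => real^3 => real => 3 => real" where
 "Sr g d p l p' l' i =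
  (\<Sum>k\<in>UNIV. p' $ k * Ae kap g p l i k + l' * (2 * Ae (zkap k) g p l i k - Ae (zkap i) g p l k k))
  - (\<Sum>j\<in>UNIV. \<Sum>k\<in>UNIV. d $ j *
   (p' $ k * (Ae (dkap j) g p l i k - Ae (dkap i) g p l j k)
   + l' * (Ae (zdkap k j) g p l i k - Ae (zdkap k i) g p l j k)))"

text \<open>The identity behind \<open>Fr_curve_deriv\<close>, freed from integrals:
  \<open>a\<close>, \<open>b\<close>, \<open>c\<close>, \<open>e\<close> stand for averages of the
  gradient with the kernels \<open>kap\<close>, \<open>zkap\<close>, \<open>dkap\<close>,
  \<open>zdkap\<close>, and the hypotheses are the exchanges of indices supplied by
  \<open>A_symmetric_second\<close>.\<close>

lemma rigid_algebra:
 fixes a :: "3 => 3 => real" and b c :: "3 => 3 => 3 => real" and e :: "3 => 3 => 3 => 3 => real" and P d X :: "3 => real"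
 assumes c: "!!i m j. c i m j = c j m i"
  and e: "!!m i q j. (if i = m then a q j else 0) + e m i q j = (if j = m then a q i else 0) + e m j q i"
  and b: "!!i m j. b i m j = b j m i"
 shows "(\<Sum>k\<in>UNIV. P k * a i k + L * b k i k) + (\<Sum>j\<in>UNIV. (X j - P j - L * d j) * ((a i j - a j i) / 2))
  + (\<Sum>j\<in>UNIV. d j * ((\<Sum>k\<in>UNIV. P k * c i j k + L * e k i j k) - (\<Sum>k\<in>UNIV. P k * c j i k + L * e k j i k))) / 2
 = (\<Sum>j\<in>UNIV. (a i j - a j i) / 2 * X j)
  + ((\<Sum>k\<in>UNIV. P k * ((a i k + a k i) / 2) + L * (2 * ((b k i k + b k k i) / 2) - (b i k k + b i k k) / 2))
  - (\<Sum>j\<in>UNIV. \<Sum>k\<in>UNIV. d j * (P k * ((c j i k + c j k i) / 2 - (c i j k + c i k j) / 2)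
   + L * ((e k j i k + e k j k i) / 2 - (e k i j k + e k i k j) / 2))))"
proof -
 \<comment> \<open>Trace of the exchange rule for \<open>e\<close>: it produces the antisymmetric
   part of \<open>a\<close> that absorbs the rotation multiplied by L d.\<close>
 have e2: "(\<Sum>k\<in>UNIV. e k j k i) = (\<Sum>k\<in>UNIV. e k i k j) + a i j - a j i" for j
 proof -
  have "(\<Sum>k\<in>UNIV. (if j = k then a k i else 0) + e k j k i) = (\<Sum>k\<in>UNIV. (if i = k then a k j else 0) + e k i k j)"
   by (rule sum.cong[OF refl]) (use e in auto)
  thus ?thesis by (simp add: sum.distrib)
 qed
 have t1: "(\<Sum>k\<in>UNIV. P k * a i k + L * b k i k) =
   (\<Sum>k\<in>UNIV. P k * ((a i k + a k i) / 2) + L * (2 * ((b k i k + b k k i) / 2) - (b i k k + b i k k) / 2))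
   + (\<Sum>k\<in>UNIV. P k * ((a i k - a k i) / 2))"
 proof -
  have "P k * a i k + L * b k i k =
   (P k * ((a i k + a k i) / 2) + L * (2 * ((b k i k + b k k i) / 2) - (b i k k + b i k k) / 2)) + P k * ((a i k - a k i) / 2)" for k
   using b[of k k i] by (simp add: field_simps)
  thus ?thesis by (simp only: sum.distrib[symmetric])
 qed
 have t2: "(\<Sum>j\<in>UNIV. (X j - P j - L * d j) * ((a i j - a j i) / 2)) = (\<Sum>j\<in>UNIV. (a i j - a j i) / 2 * X j)
   - (\<Sum>k\<in>UNIV. P k * ((a i k - a k i) / 2)) - (\<Sum>j\<in>UNIV. d j * (L * ((a i j - a j i) / 2)))"
 proof -
  have "(X j - P j - L * d j) * ((a i j - a j i) / 2) = (a i j - a j i) / 2 * X j - P j * ((a i j - a j i) / 2) - d j * (L * ((a i j - a j i) / 2))" for j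
   by (simp add: field_simps)
  thus ?thesis by (simp only: sum_subtractf[symmetric])
 qed
 have t3: "(\<Sum>j\<in>UNIV. d j * ((\<Sum>k\<in>UNIV. P k * c i j k + L * e k i j k) - (\<Sum>k\<in>UNIV. P k * c j i k + L * e k j i k))) / 2
   - (\<Sum>j\<in>UNIV. d j * (L * ((a i j - a j i) / 2)))
   = - (\<Sum>j\<in>UNIV. \<Sum>k\<in>UNIV. d j * (P k * ((c j i k + c j k i) / 2 - (c i j k + c i k j) / 2)
   + L * ((e k j i k + e k j k i) / 2 - (e k i j k + e k i k j) / 2)))"
 proof -
  have q: "d j * ((\<Sum>k\<in>UNIV. P k * c i j k + L * e k i j k) - (\<Sum>k\<in>UNIV. P k * c j i k + L * e k j i k)) / 2 - d j * (L * ((a i j - a j i) / 2))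
   = - (\<Sum>k\<in>UNIV. d j * (P k * ((c j i k + c j k i) / 2 - (c i j k + c i k j) / 2)
   + L * ((e k j i k + e k j k i) / 2 - (e k i j k + e k i k j) / 2)))" for j
  proof -
  have "(\<Sum>k\<in>UNIV. P k * ((c j i k + c j k i) / 2 - (c i j k + c i k j) / 2)
   + L * ((e k j i k + e k j k i) / 2 - (e k i j k + e k i k j) / 2))
   = (\<Sum>k\<in>UNIV. (P k * c j i k + L * e k j i k) / 2 - (P k * c i j k + L * e k i j k) / 2 + L / 2 * (e k j k i - e k i k j))"
   by (rule sum.cong[OF refl]) (use c[of j _ i] in \<open>simp add: field_simps\<close>)
  also have "... = (\<Sum>k\<in>UNIV. P k * c j i k + L * e k j i k) / 2 - (\<Sum>k\<in>UNIV. P k * c i j k + L * e k i j k) / 2 + L / 2 * ((\<Sum>k\<in>UNIV. e k j k i) - (\<Sum>k\<in>UNIV. e k i k j))"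
   by (simp add: sum.distrib sum_subtractf sum_divide_distrib[symmetric] sum_distrib_left[symmetric])
  finally have "(\<Sum>k\<in>UNIV. P k * ((c j i k + c j k i) / 2 - (c i j k + c i k j) / 2)
   + L * ((e k j i k + e k j k i) / 2 - (e k i j k + e k i k j) / 2))
   = (\<Sum>k\<in>UNIV. P k * c j i k + L * e k j i k) / 2 - (\<Sum>k\<in>UNIV. P k * c i j k + L * e k i j k) / 2 + L / 2 * (a i j - a j i)"
   unfolding e2 by simp
  moreover have "(\<Sum>k\<in>UNIV. d j * (P k * ((c j i k + c j k i) / 2 - (c i j k + c i k j) / 2)
   + L * ((e k j i k + e k j k i) / 2 - (e k i j k + e k i k j) / 2))) = d j * (\<Sum>k\<in>UNIV. P k * ((c j i k + c j k i) / 2 - (c i j k + c i k j) / 2)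
   + L * ((e k j i k + e k j k i) / 2 - (e k i j k + e k i k j) / 2))" by (simp add: sum_distrib_left)
  moreover have "D * (s1 - s2) / 2 - D * (L * (w / 2)) = - T" if "S = s2 / 2 - s1 / 2 + L / 2 * w" "T = D * S" for D s1 s2 w S T
   unfolding that by (simp add: field_simps)
  ultimately show ?thesis by blast
  qed
  have "(\<Sum>j\<in>UNIV. d j * ((\<Sum>k\<in>UNIV. P k * c i j k + L * e k i j k) - (\<Sum>k\<in>UNIV. P k * c j i k + L * e k j i k)) / 2 - d j * (L * ((a i j - a j i) / 2)))
   = (\<Sum>j\<in>UNIV. - (\<Sum>k\<in>UNIV. d j * (P k * ((c j i k + c j k i) / 2 - (c i j k + c i k j) / 2)
   + L * ((e k j i k + e k j k i) / 2 - (e k i j k + e k i k j) / 2))))"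
   by (rule sum.cong[OF refl]) (rule q)
  thus ?thesis unfolding sum_subtractf sum_negf sum_divide_distrib[of "%j. d j * _ j" UNIV] .
 qed
 show ?thesis using t1 t2 t3 by linarith
qed

text \<open>Integrability is global while the weak derivative is tested on V only; in the
  application both fields are extended by 0 from V.\<close>

definition adm :: "(real^3) set => (real^3 => real^3) => (real^3 => real^3^3) => bool" where
 "adm V u g \<longleftrightarrow> (\<forall>i. wd V (%x. u x $ i) (%x. g x $ i) & intb (%x. u x $ i)
  & (\<forall>j. intb (%x. g x $ i $ j) & intb (%x. (g x $ i $ j)\<^sup>2)))"

lemma admD:
 assumes "adm V u g"
 shows "wd V (%x. u x $ i) (%x. g x $ i)" "intb (%x. u x $ i)"
  "intb (%x. g x $ i $ j)" "intb (%x. (g x $ i $ j)\<^sup>2)"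
  "(%x. u x $ i) \<in> bmb" "(%x. g x $ i $ j) \<in> bmb"
proof -
 show "wd V (%x. u x $ i) (%x. g x $ i)" and u: "intb (%x. u x $ i)"
  and g: "intb (%x. g x $ i $ j)" and "intb (%x. (g x $ i $ j)\<^sup>2)"
  using assms unfolding adm_def by blast+
 show "(%x. u x $ i) \<in> bmb" "(%x. g x $ i $ j) \<in> bmb"
  using borel_measurable_integrable[OF u] borel_measurable_integrable[OF g] by simp_all
qed

text \<open>Evaluation point, centre and radius move independently. With the point at rest only
  \<open>Sr\<close> survives, which controls changes of the rigid motion; with the point moving
  along an axis the additional term is a column of the skew matrix \<open>Wr\<close>.\<close>

lemma Fr_curve_deriv:
 fixes x x' p p' :: "real => real^3" and l l' :: "real => real"
 assumes ad: "adm V u g"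
  and x: "!!t. (x has_vector_derivative x' t) (at t)"
  and p: "!!t. (p has_vector_derivative p' t) (at t)" "continuous_on UNIV p'"
  and l: "!!t. (l has_real_derivative l' t) (at t)" "continuous_on UNIV l'" "!!t. l t > 0"
  and V: "cball (p t0) (l t0) \<subseteq> V"
 shows "((%t. Fr u ((1 / l t) *R (x t - p t)) (p t) (l t) i) has_real_derivative
  (\<Sum>j\<in>UNIV. Wr g (p t0) (l t0) i j * x' t0 $ j) + Sr g ((1 / l t0) *R (x t0 - p t0)) (p t0) (l t0) (p' t0) (l' t0) i) (at t0)"
proof -
 note ad' = admD[OF ad]
 let ?P = "p t0" and ?L = "l t0"
 define d where "d = (1 / ?L) *R (x t0 - ?P)"
 have l0: "?L > 0" "?L ~= 0" using l(3)[of t0] by auto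
 let ?a = "%i j. A kap (%y. g y $ i $ j) ?P ?L"
 let ?b = "%m i j. A (zkap m) (%y. g y $ i $ j) ?P ?L"
 let ?c = "%m i j. A (dkap m) (%y. g y $ i $ j) ?P ?L"
 let ?e = "%m n i j. A (zdkap m n) (%y. g y $ i $ j) ?P ?L"
 have c: "?c i m j = ?c j m i" for i m j
  using A_symmetric_second[OF kern_kap C1_kap _ _ ad'(1) l0(1) V ad'(5,6), of d2kap i m j]
  by (simp add: C1_dkap d2kap_sym)
 \<comment> \<open>Here the exchange rule is applied to the kernel \<open>Lam\<close>, whose first
   derivatives are the \<open>zkap\<close>.\<close>
 have b: "?b i m j = ?b j m i" for i m j
 proof -
  have "A (%z. (\<chi> j. zkap j z) $ i) (%y. g y $ m $ j) ?P ?L = A (%z. (\<chi> j. zkap j z) $ j) (%y. g y $ m $ i) ?P ?L"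
  proof (rule A_symmetric_second[OF kern_Lam C1_Lam _ _ ad'(1) l0(1) V ad'(5,6)])
   show "C1 (%z. (\<chi> j. zkap j z) $ i) (%z. \<chi> j. (if j = i then kap z else 0) + zdkap i j z)" for i
   using C1_zkap[of i] by simp
  qed (auto simp: zdkap_def dkap_def)
  thus ?thesis by simp
 qed
 have e: "(if i = m then ?a q j else 0) + ?e m i q j = (if j = m then ?a q i else 0) + ?e m j q i" for m i q j
 proof -
  have s: "A (%z. (if i = m then kap z else 0) + zdkap m i z) (%y. g y $ q $ j) ?P ?L = (if i = m then ?a q j else 0) + ?e m i q j" for i j
   using A_integrable[OF kern_kap ad'(3)[of q j] l0(1), of ?P] A_integrable[OF kern_zdkap[of m i] ad'(3)[of q j] l0(1), of ?P]
   by (auto simp: A_def distrib_right)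
  show ?thesis
  proof -
   have "A (%z. (\<chi> j. (if j = m then kap z else 0) + zdkap m j z) $ i) (%y. g y $ q $ j) ?P ?L
   = A (%z. (\<chi> j. (if j = m then kap z else 0) + zdkap m j z) $ j) (%y. g y $ q $ i) ?P ?L"
   proof (rule A_symmetric_second[OF kern_zkap C1_zkap _ _ ad'(1) l0(1) V ad'(5,6)])
   show "C1 (%z. (\<chi> j. (if j = m then kap z else 0) + zdkap m j z) $ i) (d2zkap m i)" for i
   using C1_dzkap[of i m] by simp
   qed (rule d2zkap_sym)
   thus ?thesis using s by simp
  qed
 qed
 have dj: "((%t. ((1 / l t) *R (x t - p t)) $ j) has_real_derivative (x' t0 $ j - p' t0 $ j - l' t0 * d $ j) / ?L) (at t0)" for j
 proof -
  have xc: "((%t. x t $ j) has_real_derivative x' t0 $ j) (at t0)" "((%t. p t $ j) has_real_derivative p' t0 $ j) (at t0)"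
   using bounded_linear.has_vector_derivative[OF bounded_linear_vec_nth x] bounded_linear.has_vector_derivative[OF bounded_linear_vec_nth p(1)]
   by (auto simp: has_real_derivative_iff_has_vector_derivative)
  have "((%t. (x t $ j - p t $ j) / l t) has_real_derivative ((x' t0 $ j - p' t0 $ j) * ?L - (x t0 $ j - ?P $ j) * l' t0) / (?L * ?L)) (at t0)"
   by (rule DERIV_divide[OF DERIV_diff[OF xc] l(1)]) (use l0 in simp)
  moreover have "((x' t0 $ j - p' t0 $ j) * ?L - (x t0 $ j - ?P $ j) * l' t0) / (?L * ?L) = (x' t0 $ j - p' t0 $ j - l' t0 * d $ j) / ?L"
   using l0 by (simp add: d_def field_simps)
  ultimately show ?thesis by simp
 qed
 have ib: "A (dkap m) (%y. u y $ j) ?P ?L = - ?L * ?a j m" for j m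
  using A_ibp[OF kern_kap C1_kap ad'(1) l0(1) V ad'(5,6), of m j] by simp
 have dk: "((%t. A kap (%y. u y $ i) (p t) (l t)) has_real_derivative (\<Sum>k\<in>UNIV. p' t0 $ k * ?a i k + l' t0 * ?b k i k)) (at t0)" for i
  using A_curve_deriv[OF kern_kap C1_kap ad'(1) ad'(2) ad'(3) p l V] by (simp add: zkap_def[abs_def])
 have dd: "((%t. A (dkap m) (%y. u y $ i) (p t) (l t)) has_real_derivative (\<Sum>k\<in>UNIV. p' t0 $ k * ?c m i k + l' t0 * ?e k m i k)) (at t0)" for m i
  using A_curve_deriv[OF kern_dkap C1_dkap ad'(1) ad'(2) ad'(3) p l V] by (simp add: zdkap_def[abs_def])
 let ?D = "(\<Sum>k\<in>UNIV. p' t0 $ k * ?a i k + l' t0 * ?b k i k)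
  + (\<Sum>j\<in>UNIV. (x' t0 $ j - p' t0 $ j - l' t0 * d $ j) / ?L * (A (dkap i) (%y. u y $ j) ?P ?L - A (dkap j) (%y. u y $ i) ?P ?L)
   + ((\<Sum>k\<in>UNIV. p' t0 $ k * ?c i j k + l' t0 * ?e k i j k) - (\<Sum>k\<in>UNIV. p' t0 $ k * ?c j i k + l' t0 * ?e k j i k)) * d $ j) / 2"
 have "((%t. Fr u ((1 / l t) *R (x t - p t)) (p t) (l t) i) has_real_derivative ?D) (at t0)"
  unfolding Fr_def
 proof (intro DERIV_add DERIV_cdivide DERIV_sum dk)
  fix j :: 3
  show "((%t. ((1 / l t) *R (x t - p t)) $ j * (A (dkap i) (%y. u y $ j) (p t) (l t) - A (dkap j) (%y. u y $ i) (p t) (l t)))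
   has_real_derivative (x' t0 $ j - p' t0 $ j - l' t0 * d $ j) / ?L * (A (dkap i) (%y. u y $ j) ?P ?L - A (dkap j) (%y. u y $ i) ?P ?L)
   + ((\<Sum>k\<in>UNIV. p' t0 $ k * ?c i j k + l' t0 * ?e k i j k) - (\<Sum>k\<in>UNIV. p' t0 $ k * ?c j i k + l' t0 * ?e k j i k)) * d $ j) (at t0)"
   using DERIV_mult[OF dj DERIV_diff[OF dd dd], of j i j j i] by (simp only: d_def)
 qed
 moreover have "?D = (\<Sum>j\<in>UNIV. Wr g ?P ?L i j * x' t0 $ j) + Sr g d ?P ?L (p' t0) (l' t0) i"
 proof -
  have "?D = (\<Sum>k\<in>UNIV. p' t0 $ k * ?a i k + l' t0 * ?b k i k)
   + (\<Sum>j\<in>UNIV. (x' t0 $ j - p' t0 $ j - l' t0 * d $ j) * ((?a i j - ?a j i) / 2))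
   + (\<Sum>j\<in>UNIV. d $ j * ((\<Sum>k\<in>UNIV. p' t0 $ k * ?c i j k + l' t0 * ?e k i j k) - (\<Sum>k\<in>UNIV. p' t0 $ k * ?c j i k + l' t0 * ?e k j i k))) / 2"
  proof -
   have "(x' t0 $ j - p' t0 $ j - l' t0 * d $ j) / ?L * (A (dkap i) (%y. u y $ j) ?P ?L - A (dkap j) (%y. u y $ i) ?P ?L)
   = 2 * ((x' t0 $ j - p' t0 $ j - l' t0 * d $ j) * ((?a i j - ?a j i) / 2))" for j
   unfolding ib using l0 by (simp add: field_simps)
   thus ?thesis by (simp only: sum.distrib add_divide_distrib sum_distrib_left[symmetric] mult.commute[of _ "d $ _"])
  qed
  also have "... = (\<Sum>j\<in>UNIV. Wr g ?P ?L i j * x' t0 $ j) + Sr g d ?P ?L (p' t0) (l' t0) i"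
   unfolding Wr_def Sr_def Ae_def by (rule rigid_algebra[OF c e b])
  finally show ?thesis .
 qed
 ultimately show ?thesis unfolding d_def by simp
qed

section \<open>Bounds by the symmetrised gradient\<close>

lemma integral_Cauchy_Schwarz_set:
 fixes f :: "'a::euclidean_space => real"
 assumes S: "S \<in> sets borel" "emeasure lborel S < \<infinity>" and [measurable]: "f \<in> bmb"
  and f: "intb (%x. indicator S x * (f x)\<^sup>2)"
 shows "intb (%x. indicator S x * \<bar>f x\<bar>)"
  and "(LB x. indicator S x * \<bar>f x\<bar>)\<^sup>2 <= measure lborel S * (LB x. indicator S x * (f x)\<^sup>2)"
proof -
 have [measurable]: "S \<in> sets borel" by (rule S)
 have iS: "intb (indicat_real S)" using S by auto
 show i1: "intb (%x. indicator S x * \<bar>f x\<bar>)"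
 proof (rule Bochner_Integration.integrable_bound[where f = "%x. indicator S x + indicator S x * (f x)\<^sup>2"])
  show "intb (%x. indicator S x + indicator S x * (f x)\<^sup>2 :: real)" using iS f by simp
  show "AE x in lborel. norm (indicator S x * \<bar>f x\<bar>) <= norm (indicator S x + indicator S x * (f x)\<^sup>2 :: real)"
  proof (rule AE_I2)
   fix x
   have "0 <= (\<bar>f x\<bar> - 1)\<^sup>2" by simp
   hence "\<bar>f x\<bar> <= 1 + (f x)\<^sup>2" by (simp add: power2_diff)
   thus "norm (indicator S x * \<bar>f x\<bar>) <= norm (indicator S x + indicator S x * (f x)\<^sup>2 :: real)"
   by (auto simp: indicator_def)
  qed
 qed measurable
 define I J m where "I = (LB x. indicator S x * \<bar>f x\<bar>)" and "J = (LB x. indicator S x * (f x)\<^sup>2)" and "m = measure lborel S"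
 have q: "0 <= J - 2 * c * I + c\<^sup>2 * m" for c
 proof -
  have "0 <= (LB x. indicator S x * (\<bar>f x\<bar> - c)\<^sup>2)" by (rule Bochner_Integration.integral_nonneg) auto
  also have "... = (LB x. indicator S x * (f x)\<^sup>2 - 2 * c * (indicator S x * \<bar>f x\<bar>) + c\<^sup>2 * indicator S x)"
   by (rule Bochner_Integration.integral_cong) (auto simp: power2_eq_square algebra_simps)
  also have "... = J - 2 * c * I + c\<^sup>2 * m" using iS f i1 S by (simp add: I_def J_def m_def)
  finally show ?thesis .
 qed
 show "I\<^sup>2 <= m * J"
 proof (cases "m = 0")
  case True
  have "J >= 0" unfolding J_def by (rule Bochner_Integration.integral_nonneg) auto
  have "I = 0"
  proof (rule ccontr)
   assume "I ~= 0"
   have "J - 2 * ((J + 1) / (2 * I)) * I = -1" using \<open>I ~= 0\<close> by (simp add: field_simps)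
   thus False using q[of "(J + 1) / (2 * I)"] True by simp
  qed
  thus ?thesis using True by simp
 next
  case False
  hence m: "m > 0" unfolding m_def by (simp add: zero_less_measure_iff)
  have "0 <= m * (J - 2 * (I / m) * I + (I / m)\<^sup>2 * m)" using q[of "I / m"] m by simp
  also have "... = m * J - I\<^sup>2" using m by (simp add: field_simps power2_eq_square)
  finally show ?thesis by simp
 qed
qed

text \<open>Squared strain over the ball, pulled back to the unit ball and not normalised: bounds by
  it carry no power of the radius.\<close>

definition Er :: "(real^3 => real^3^3) => real^3 => real => real" where
 "Er g p l = (LB z. indicator (cball 0 1) z * (norm (symm (g (p + l *R z))))\<^sup>2)"

lemma symm_nth: "symm M $ i $ j = (M $ i $ j + M $ j $ i) / 2"
 by (simp add: symm_def transpose_def)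

lemma norm_matrix_sq: "(norm (M :: real^3^3))\<^sup>2 = (\<Sum>i\<in>UNIV. \<Sum>j\<in>UNIV. (M $ i $ j)\<^sup>2)"
 by (simp add: norm_vec_def L2_set_def sum_nonneg real_sqrt_pow2)

lemma matrix_entry_le: "\<bar>(M :: real^3^3) $ i $ j\<bar> <= norm M"
proof -
 have "norm (M $ i) <= norm M" by (rule Finite_Cartesian_Product.norm_nth_le)
 thus ?thesis using component_le_norm_cart[of "M $ i" j] by linarith
qed

lemma adm_symm_measurable:
 assumes "adm V u g" shows "(%y. (norm (symm (g y)))\<^sup>2) \<in> bmb"
 unfolding norm_matrix_sq symm_nth using admD(6)[OF assms] by measurable

lemma adm_symm_integrable:
 assumes "adm V u g" shows "intb (%y. (norm (symm (g y)))\<^sup>2)"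
proof (rule Bochner_Integration.integrable_bound[where f = "%y. \<Sum>i\<in>UNIV. \<Sum>j\<in>UNIV. (g y $ i $ j)\<^sup>2 + (g y $ j $ i)\<^sup>2"])
 show "intb (%y. \<Sum>i\<in>UNIV. \<Sum>j\<in>UNIV. (g y $ i $ j)\<^sup>2 + (g y $ j $ i)\<^sup>2)"
  using admD(4)[OF assms] by (intro Bochner_Integration.integrable_sum Bochner_Integration.integrable_add)
 show "AE y in lborel. norm ((norm (symm (g y)))\<^sup>2) <= norm (\<Sum>i\<in>UNIV. \<Sum>j\<in>UNIV. (g y $ i $ j)\<^sup>2 + (g y $ j $ i)\<^sup>2)"
 proof (rule AE_I2)
  fix y
  have "((a + b) / 2)\<^sup>2 <= a\<^sup>2 + b\<^sup>2" for a b :: real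
  proof -
   have "a\<^sup>2 + b\<^sup>2 - ((a + b) / 2)\<^sup>2 = ((a - b) / 2)\<^sup>2 + (a\<^sup>2 + b\<^sup>2) / 2"
   by (simp add: power2_eq_square field_simps)
   moreover have "((a - b) / 2)\<^sup>2 + (a\<^sup>2 + b\<^sup>2) / 2 >= 0" by simp
   ultimately show ?thesis by linarith
  qed
  hence "(norm (symm (g y)))\<^sup>2 <= (\<Sum>i\<in>UNIV. \<Sum>j\<in>UNIV. (g y $ i $ j)\<^sup>2 + (g y $ j $ i)\<^sup>2)"
   unfolding norm_matrix_sq symm_nth by (intro sum_mono)
  thus "norm ((norm (symm (g y)))\<^sup>2) <= norm (\<Sum>i\<in>UNIV. \<Sum>j\<in>UNIV. (g y $ i $ j)\<^sup>2 + (g y $ j $ i)\<^sup>2)" by simp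
 qed
qed (use adm_symm_measurable[OF assms] in simp)

lemma Er_integrable:
 assumes "adm V u g" "l > 0"
 shows "intb (%z. indicator (cball 0 1) z * (norm (symm (g (p + l *R z))))\<^sup>2)"
 using lborel_integrable_affine[OF _ adm_symm_integrable[OF assms(1)], of l p] assms(2)
 by (intro integrable_mult_bounded(2)[of _ _ _ 1]) (auto simp: indicator_def)

lemma Er_nonneg: "Er g p l >= 0"
 unfolding Er_def by (rule Bochner_Integration.integral_nonneg) auto

lemma Ae_bound:
 assumes ad: "adm V u g" and l: "l > 0" and k: "kern k" "!!z. \<bar>k z\<bar> <= B"
 shows "\<bar>Ae k g p l i j\<bar> <= B * sqrt (measure lborel (cball (0::real^3) 1)) * sqrt (Er g p l)"
proof -
 let ?S = "cball (0::real^3) 1" and ?f = "%z. symm (g (p + l *R z)) $ i $ j"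
 have B: "B >= 0" using k(2)[of 0] by linarith
 note [measurable] = admD(6)[OF ad] kern_borel[OF k(1)]
 have fm[measurable]: "?f \<in> bmb" unfolding symm_nth by measurable
 have em: "emeasure lborel ?S < \<infinity>" using emeasure_lborel_cball_finite[of "0::real^3" 1] by simp
 have le: "(?f z)\<^sup>2 <= (norm (symm (g (p + l *R z))))\<^sup>2" for z
  using power_mono[OF matrix_entry_le abs_ge_zero, of "symm (g (p + l *R z))" i j 2] by simp
 have [measurable]: "?S \<in> sets borel" by simp
 have m2: "(%z. indicat_real ?S z * (?f z)\<^sup>2) \<in> borel_measurable lborel" by measurable
 have i2: "intb (%z. indicator ?S z * (?f z)\<^sup>2)"
  by (rule Bochner_Integration.integrable_bound[OF Er_integrable[OF ad l, of p] m2]) (use le in \<open>auto intro!: AE_I2 mult_left_mono\<close>)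
 note CS = integral_Cauchy_Schwarz_set[OF _ em fm i2, simplified]
 have "A k (%y. (1 / 2) * g y $ i $ j + (1 / 2) * g y $ j $ i) p l = Ae k g p l i j"
  using A_lin[OF k(1) admD(3)[OF ad, of i j] admD(3)[OF ad, of j i] l, of "1/2" "1/2" p] by (simp add: Ae_def)
 hence "Ae k g p l i j = (LB z. k z * ?f z)" by (simp add: A_def symm_nth add_divide_distrib)
 also have "\<bar>...\<bar> <= (LB z. B * (indicator ?S z * \<bar>?f z\<bar>))"
 proof (rule order_trans[OF integral_abs_bound integral_mono'])
  show "intb (%z. B * (indicator ?S z * \<bar>?f z\<bar>))" using CS(1) by simp
  show "\<bar>k z * ?f z\<bar> <= B * (indicator ?S z * \<bar>?f z\<bar>)" for z
   using k(2)[of z] kern_zero[OF k(1), of z] by (cases "z \<in> ?S") (auto simp: abs_mult intro!: mult_right_mono)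
 qed (use B in auto)
 also have "... = B * (LB z. indicator ?S z * \<bar>?f z\<bar>)" by simp
 also have "... <= B * (sqrt (measure lborel ?S) * sqrt (Er g p l))"
 proof (rule mult_left_mono[OF _ B])
  have "(LB z. indicator ?S z * \<bar>?f z\<bar>)\<^sup>2 <= measure lborel ?S * Er g p l"
  proof (rule order_trans[OF CS(2)])
   have "(LB z. indicator ?S z * (?f z)\<^sup>2) <= Er g p l" unfolding Er_def
   by (rule integral_mono[OF i2 Er_integrable[OF ad l]]) (use le in \<open>auto intro!: mult_left_mono\<close>)
   thus "measure lborel ?S * (LB z. indicator ?S z * (?f z)\<^sup>2) <= measure lborel ?S * Er g p l"
   by (rule mult_left_mono) simp
  qed
  thus "(LB z. indicator ?S z * \<bar>?f z\<bar>) <= sqrt (measure lborel ?S) * sqrt (Er g p l)"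
   by (simp add: real_sqrt_mult[symmetric] real_le_rsqrt)
 qed
 finally show ?thesis by (simp add: mult.assoc)
qed

lemma kernel_bounds:
 "\<bar>kap z\<bar> <= 8 / kI" "\<bar>dkap j z\<bar> <= 8 / kI" "\<bar>zkap k z\<bar> <= 8 / kI" "\<bar>zdkap k j z\<bar> <= 8 / kI"
proof -
 have b: "0 <= bmp m z" "bmp m z <= 1" for m by (auto simp: bmp_def intro!: power_le_one)
 have z: "bmp m z = 0" if "norm z > 1" "m >= 1" for m using kern_bmp[OF that(2)] that(1) by (auto simp: kern_def)
 have c: "\<bar>z $ j\<bar> <= norm z" for j by (rule component_le_norm_cart)
 have zb: "bmp m z * \<bar>z $ j\<bar> <= 1" if "m >= 1" for m j
  using b[of m] z[OF _ that] c[of j] by (cases "norm z > 1") (auto intro!: mult_le_one)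
 have zzb: "bmp m z * \<bar>z $ j\<bar> * \<bar>z $ k\<bar> <= 1" if "m >= 1" for m j k
  using zb[OF that, of j] z[OF _ that] c[of k] b[of m] by (cases "norm z > 1") (auto intro!: mult_le_one)
 show "\<bar>kap z\<bar> <= 8 / kI" using b[of 4] kI_pos by (simp add: kap_def abs_mult divide_right_mono)
 show "\<bar>dkap j z\<bar> <= 8 / kI" using zb[of 3 j] b[of 3] kI_pos by (simp add: dkap_def abs_mult divide_right_mono)
 show "\<bar>zkap k z\<bar> <= 8 / kI" using zb[of 4 k] b[of 4] kI_pos
  by (simp add: zkap_def kap_def abs_mult divide_right_mono mult.commute)
 show "\<bar>zdkap k j z\<bar> <= 8 / kI" using zzb[of 3 j k] b[of 3] kI_pos
  by (simp add: zdkap_def dkap_def abs_mult divide_right_mono mult_ac)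
qed

text \<open>The value 8 / \<open>kI\<close> bounds all four families of kernels, the square root
  comes from Cauchy-Schwarz on the unit ball, and 100 generously covers the 12 and 36 unit
  contributions counted in \<open>Sr_bound\<close>.\<close>

definition cS :: real where "cS = 100 * (8 / kI * sqrt (measure lborel (cball (0::real^3) 1)))"

lemma cS_nonneg: "cS >= 0"
 using kI_pos by (simp add: cS_def)

lemma Sr_bound:
 assumes ad: "adm V u g" and l: "l > 0"
 shows "\<bar>Sr g d p l p' l' i\<bar> <= cS * (norm p' + \<bar>l'\<bar>) * (1 + norm d) * sqrt (Er g p l)"
proof -
 define H where "H = 8 / kI * sqrt (measure lborel (cball (0::real^3) 1)) * sqrt (Er g p l)"
 have H: "H >= 0" using kI_pos Er_nonneg by (simp add: H_def)
 have a: "\<bar>Ae kap g p l i j\<bar> <= H" "\<bar>Ae (dkap m) g p l i j\<bar> <= H" "\<bar>Ae (zkap m) g p l i j\<bar> <= H" "\<bar>Ae (zdkap m n) g p l i j\<bar> <= H" for i j m n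
  unfolding H_def by (intro Ae_bound[OF ad l] kern_kap kern_dkap kern_zkap kern_zdkap kernel_bounds)+
 define N where "N = norm p' + \<bar>l'\<bar>"
 have pN: "\<bar>p' $ k\<bar> <= N" "\<bar>l'\<bar> <= N" for k using component_le_norm_cart[of p' k] by (auto simp: N_def)
 have N: "N >= 0" by (simp add: N_def)
 have t1: "\<bar>p' $ k * Ae kap g p l i k + l' * (2 * Ae (zkap k) g p l i k - Ae (zkap i) g p l k k)\<bar> <= 4 * N * H" for k
 proof -
  have "\<bar>p' $ k * Ae kap g p l i k\<bar> <= N * H" unfolding abs_mult using pN a N by (intro mult_mono) auto
  moreover have "\<bar>l' * (2 * Ae (zkap k) g p l i k - Ae (zkap i) g p l k k)\<bar> <= N * (3 * H)"
  proof -
   have "\<bar>2 * Ae (zkap k) g p l i k - Ae (zkap i) g p l k k\<bar> <= 3 * H" using a(3)[of k i k] a(3)[of i k k] by linarith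
   thus ?thesis unfolding abs_mult using pN N by (intro mult_mono) auto
  qed
  ultimately show ?thesis by linarith
 qed
 have t2: "\<bar>d $ j * (p' $ k * (Ae (dkap j) g p l i k - Ae (dkap i) g p l j k)
   + l' * (Ae (zdkap k j) g p l i k - Ae (zdkap k i) g p l j k))\<bar> <= norm d * (4 * N * H)" for j k
 proof -
  have "\<bar>p' $ k * (Ae (dkap j) g p l i k - Ae (dkap i) g p l j k)\<bar> <= N * (2 * H)"
  proof -
   have "\<bar>Ae (dkap j) g p l i k - Ae (dkap i) g p l j k\<bar> <= 2 * H" using a(2)[of j i k] a(2)[of i j k] by linarith
   thus ?thesis unfolding abs_mult using pN N by (intro mult_mono) auto
  qed
  moreover have "\<bar>l' * (Ae (zdkap k j) g p l i k - Ae (zdkap k i) g p l j k)\<bar> <= N * (2 * H)"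
  proof -
   have "\<bar>Ae (zdkap k j) g p l i k - Ae (zdkap k i) g p l j k\<bar> <= 2 * H" using a(4)[of k j i k] a(4)[of k i j k] by linarith
   thus ?thesis unfolding abs_mult using pN N by (intro mult_mono) auto
  qed
  ultimately have "\<bar>p' $ k * (Ae (dkap j) g p l i k - Ae (dkap i) g p l j k)
   + l' * (Ae (zdkap k j) g p l i k - Ae (zdkap k i) g p l j k)\<bar> <= 4 * N * H" by linarith
  thus ?thesis unfolding abs_mult[of "d $ j"] using component_le_norm_cart[of d j] by (intro mult_mono) auto
 qed
 have "\<bar>Sr g d p l p' l' i\<bar> <= (\<Sum>k\<in>(UNIV::3 set). 4 * N * H) + (\<Sum>j\<in>(UNIV::3 set). \<Sum>k\<in>(UNIV::3 set). norm d * (4 * N * H))"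
  unfolding Sr_def
  by (intro order_trans[OF abs_triangle_ineq4] add_mono order_trans[OF sum_abs] sum_mono t1 t2)
 also have "... = 12 * N * H + 36 * norm d * (N * H)" by simp
 also have "... <= 100 * N * (1 + norm d) * H"
 proof -
  have "N * H >= 0" "norm d * (N * H) >= 0" using N H by simp_all
  thus ?thesis by (simp add: algebra_simps)
 qed
 also have "... = cS * (norm p' + \<bar>l'\<bar>) * (1 + norm d) * sqrt (Er g p l)"
  by (simp only: H_def N_def cS_def mult_ac)
 finally show ?thesis .
qed

lemma cball_borel [measurable]: "cball (x::'a::euclidean_space) r \<in> sets borel"
 by (rule borel_closed) simp

lemma Er_measurable:
 assumes ad: "adm V u g" and [measurable]: "p \<in> borel_measurable M" "l \<in> borel_measurable M"
 shows "(%x. Er g (p x) (l x)) \<in> borel_measurable M"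
proof -
 define e where "e y = (norm (symm (g y)))\<^sup>2" for y
 have [measurable]: "e \<in> bmb" unfolding e_def by (rule adm_symm_measurable[OF ad])
 show ?thesis unfolding Er_def e_def[symmetric] by measurable
qed

lemma Ae_continuous:
 fixes p :: "'a::metric_space => real^3"
 assumes ad: "adm V u g" and k: "kern k" and c: "continuous_on UNIV p" "continuous_on UNIV l" "!!x. l x > 0"
 shows "continuous_on UNIV (%x. Ae k g (p x) (l x) i j)"
 unfolding Ae_def by (intro continuous_intros A_continuous[OF k admD(3)[OF ad] c]) auto

lemma Sr_continuous:
 fixes p :: "'a::metric_space => real^3"
 assumes ad: "adm V u g" and c: "continuous_on UNIV p" "continuous_on UNIV l" "!!x. l x > 0"
  and d: "continuous_on UNIV d" "continuous_on UNIV p'" "continuous_on UNIV l'"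
 shows "continuous_on UNIV (%x. Sr g (d x) (p x) (l x) (p' x) (l' x) i)"
 unfolding Sr_def
 by (intro continuous_intros d Ae_continuous[OF ad _ c] kern_kap kern_dkap kern_zkap kern_zdkap)

lemma Wr_continuous:
 fixes p :: "'a::metric_space => real^3"
 assumes ad: "adm V u g" and c: "continuous_on UNIV p" "continuous_on UNIV l" "!!x. l x > 0"
 shows "continuous_on UNIV (%x. Wr g (p x) (l x) i j)"
 unfolding Wr_def by (intro continuous_intros A_continuous[OF kern_kap admD(3)[OF ad] c]) auto

lemma Fr_continuous:
 fixes p :: "'a::metric_space => real^3"
 assumes ad: "adm V u g" and c: "continuous_on UNIV p" "continuous_on UNIV l" "!!x. l x > 0" and d: "continuous_on UNIV d"
 shows "continuous_on UNIV (%x. Fr u (d x) (p x) (l x) i)"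
 unfolding Fr_def by (intro continuous_intros d A_continuous[OF _ admD(2)[OF ad] c] kern_kap kern_dkap) auto

lemma ennreal_Er:
 assumes "adm V u g" "l > 0"
 shows "ennreal (Er g p l) = (NB z. indicator (cball 0 1) z * ennreal ((norm (symm (g (p + l *R z))))\<^sup>2))"
proof -
 have "ennreal (Er g p l) = (NB z. ennreal (indicator (cball 0 1) z * (norm (symm (g (p + l *R z))))\<^sup>2))"
  unfolding Er_def by (rule nn_integral_eq_integral[symmetric, OF Er_integrable[OF assms]]) auto
 also have "... = (NB z. indicator (cball 0 1) z * ennreal ((norm (symm (g (p + l *R z))))\<^sup>2))"
  by (rule nn_integral_cong) (auto simp: indicator_def)
 finally show ?thesis .
qed

text \<open>Centre and radius run linearly from one pair to the other while \<open>x\<close> stays,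
  and the difference of the rigid motions at \<open>x\<close> is the integral of \<open>Sr\<close>.
  The bound keeps the path integral of the energies, so that the integration over x can later be
  done for each point of the path.\<close>

lemma segment_estimate:
 assumes ad: "adm V u g" and l: "l0 > 0" "l1 > 0"
  and V: "!!s. 0 <= s ==> s <= 1 ==> cball (p0 + s *R (p1 - p0)) (l0 + s * (l1 - l0)) \<subseteq> V"
  and M: "!!s. 0 <= s ==> s <= 1 ==> norm (x - (p0 + s *R (p1 - p0))) <= M * (l0 + s * (l1 - l0))"
  and N: "norm (p1 - p0) + \<bar>l1 - l0\<bar> <= N"
 shows "ennreal ((Fr u ((1 / l1) *R (x - p1)) p1 l1 i - Fr u ((1 / l0) *R (x - p0)) p0 l0 i)\<^sup>2)
  <= ennreal (2 * (cS * N * (1 + M))\<^sup>2) *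
   (NB t. indicator {0..pi/2} t * ennreal (Er g (p0 + (sin t)\<^sup>2 *R (p1 - p0)) (l0 + (sin t)\<^sup>2 * (l1 - l0))))"
proof -
 \<comment> \<open>Reparametrisation of the segment: the squared sine covers [0,1] on [0, pi/2] and
   never leaves it, so the curve is C1 on the whole line with positive radius, as the derivative
   formula requires. Its speed is |sin 2t| <= 1.\<close>
 define tht tht' where "tht t = (sin t)\<^sup>2" and "tht' t = 2 * sin t * cos t" for t :: real
 define p l where "p t = p0 + tht t *R (p1 - p0)" and "l t = l0 + tht t * (l1 - l0)" for t
 define p' l' where "p' t = tht' t *R (p1 - p0)" and "l' t = tht' t * (l1 - l0)" for t
 have th: "0 <= tht t" "tht t <= 1" for t
 proof -
  show "0 <= tht t" by (simp add: tht_def)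
  have "(sin t)\<^sup>2 + (cos t)\<^sup>2 = 1" "(cos t)\<^sup>2 >= 0" by simp_all
  thus "tht t <= 1" unfolding tht_def by linarith
 qed
 have th': "\<bar>tht' t\<bar> <= 1" for t unfolding tht'_def sin_double[symmetric] by simp
 have dth: "(tht has_real_derivative tht' t) (at t)" for t
  unfolding tht_def[abs_def] tht'_def by (auto intro!: derivative_eq_intros)
 have lpos: "l t > 0" for t
 proof -
  have "l t = (1 - tht t) * l0 + tht t * l1" by (simp add: l_def algebra_simps)
  moreover have "(1 - tht t) * l0 + tht t * l1 > 0"
   using th[of t] l by (cases "tht t = 0") (auto intro: add_nonneg_pos)
  ultimately show ?thesis by simp
 qed
 have dp: "(p has_vector_derivative p' t) (at t)" for t
  unfolding p_def[abs_def] p'_def by (auto intro!: derivative_eq_intros dth)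
 have dl: "(l has_real_derivative l' t) (at t)" for t
  unfolding l_def[abs_def] l'_def by (auto intro!: derivative_eq_intros dth)
 have ctht: "continuous_on UNIV tht" "continuous_on UNIV tht'"
  unfolding tht_def[abs_def] tht'_def[abs_def] by (intro continuous_intros)+
 have cc: "continuous_on UNIV p" "continuous_on UNIV l" "continuous_on UNIV p'" "continuous_on UNIV l'"
  unfolding p_def[abs_def] l_def[abs_def] p'_def[abs_def] l'_def[abs_def] by (intro continuous_intros ctht)+
 define d where "d t = (1 / l t) *R (x - p t)" for t
 have cd: "continuous_on UNIV d"
  unfolding d_def[abs_def] using lpos[THEN less_imp_neq, symmetric] by (intro continuous_intros cc) auto
 define F f where "F t = Fr u (d t) (p t) (l t) i" and "f t = Sr g (d t) (p t) (l t) (p' t) (l' t) i" for t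
 have cf: "continuous_on UNIV f" unfolding f_def by (rule Sr_continuous[OF ad cc(1,2) lpos cd cc(3,4)])
 have Ft: "(F has_real_derivative f t) (at t)" for t
 proof -
  have "cball (p t) (l t) \<subseteq> V" using V[OF th(1,2)] by (simp add: p_def l_def)
  from Fr_curve_deriv[OF ad _ dp cc(3) dl cc(4) lpos this, of "%_. x" "%_. 0" i]
  show ?thesis by (simp add: F_def[abs_def] f_def d_def)
 qed
 have [measurable]: "f \<in> bmb" using cf by (rule borel_measurable_continuous_onI)
 have FTC: "(LB t. f t * indicator {0..pi/2} t) = F (pi/2) - F 0"
  by (rule integral_FTC_Icc_real) (use Ft cf in \<open>auto simp: continuous_on_eq_continuous_at\<close>)
 have if2: "intb (%t. indicator {0..pi/2} t * (f t)\<^sup>2)"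
  using borel_integrable_compact[OF compact_Icc, of 0 "pi/2" "%t. (f t)\<^sup>2"]
  by (auto intro!: continuous_intros continuous_on_subset[OF cf])
 note CS = integral_Cauchy_Schwarz_set[OF _ _ \<open>f \<in> _\<close> if2, simplified]
 have "\<bar>F (pi/2) - F 0\<bar> <= (LB t. indicator {0..pi/2} t * \<bar>f t\<bar>)"
  unfolding FTC[symmetric] by (rule order_trans[OF integral_abs_bound]) (simp add: abs_mult mult.commute)
 hence "(F (pi/2) - F 0)\<^sup>2 <= (LB t. indicator {0..pi/2} t * \<bar>f t\<bar>)\<^sup>2"
  by (metis abs_ge_zero power2_abs power_mono)
 also have "... <= pi / 2 * (LB t. indicator {0..pi/2} t * (f t)\<^sup>2)" using CS(2) by simp
 also have "... <= 2 * (LB t. indicator {0..pi/2} t * (f t)\<^sup>2)"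
  using pi_less_4 by (intro mult_right_mono Bochner_Integration.integral_nonneg) auto
 finally have 1: "ennreal ((F (pi/2) - F 0)\<^sup>2) <= ennreal 2 * ennreal (LB t. indicator {0..pi/2} t * (f t)\<^sup>2)"
  by (simp add: ennreal_mult'[symmetric] ennreal_leI del: ennreal_numeral)
 have fb: "(f t)\<^sup>2 <= (cS * N * (1 + M))\<^sup>2 * Er g (p t) (l t)" for t
 proof -
  have nd: "norm (d t) <= M"
   using M[OF th(1,2), of t] lpos[of t] by (simp add: d_def p_def l_def divide_le_eq)
  have "norm (p' t) + \<bar>l' t\<bar> = \<bar>tht' t\<bar> * (norm (p1 - p0) + \<bar>l1 - l0\<bar>)"
   by (simp add: p'_def l'_def abs_mult distrib_left)
  also have "... <= 1 * (norm (p1 - p0) + \<bar>l1 - l0\<bar>)" using th' by (intro mult_right_mono) auto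
  finally have n: "norm (p' t) + \<bar>l' t\<bar> <= N" using N by simp
  have "\<bar>f t\<bar> <= cS * (norm (p' t) + \<bar>l' t\<bar>) * (1 + norm (d t)) * sqrt (Er g (p t) (l t))"
   unfolding f_def by (rule Sr_bound[OF ad lpos])
  also have "... <= cS * N * (1 + M) * sqrt (Er g (p t) (l t))"
   using n nd cS_nonneg Er_nonneg order_trans[OF _ n, of 0] order_trans[OF norm_ge_zero nd]
   by (intro mult_mono mult_nonneg_nonneg) auto
  finally have "\<bar>f t\<bar>\<^sup>2 <= (cS * N * (1 + M) * sqrt (Er g (p t) (l t)))\<^sup>2" by (intro power_mono) auto
  thus ?thesis using Er_nonneg by (simp add: power_mult_distrib)
 qed
 have "ennreal (LB t. indicator {0..pi/2} t * (f t)\<^sup>2) = (NB t. ennreal (indicator {0..pi/2} t * (f t)\<^sup>2))"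
  by (rule nn_integral_eq_integral[symmetric, OF if2]) auto
 also have "... <= (NB t. ennreal ((cS * N * (1 + M))\<^sup>2) * (indicator {0..pi/2} t * ennreal (Er g (p t) (l t))))"
  by (rule nn_integral_mono) (use fb in \<open>auto simp: indicator_def ennreal_mult'[symmetric] intro!: ennreal_leI\<close>)
 also have "... = ennreal ((cS * N * (1 + M))\<^sup>2) * (NB t. indicator {0..pi/2} t * ennreal (Er g (p t) (l t)))"
 proof (rule nn_integral_cmult)
  have [measurable]: "p \<in> bmb" "l \<in> bmb"
   using cc by (auto intro: borel_measurable_continuous_onI)
  note [measurable] = Er_measurable[OF ad]
  show "(%t. indicator {0..pi/2} t * ennreal (Er g (p t) (l t))) \<in> borel_measurable lborel" by measurable
 qed
 finally have 2: "ennreal (LB t. indicator {0..pi/2} t * (f t)\<^sup>2)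
  <= ennreal ((cS * N * (1 + M))\<^sup>2) * (NB t. indicator {0..pi/2} t * ennreal (Er g (p t) (l t)))" .
 have "F (pi/2) = Fr u ((1 / l1) *R (x - p1)) p1 l1 i" "F 0 = Fr u ((1 / l0) *R (x - p0)) p0 l0 i"
  by (auto simp: F_def d_def p_def l_def tht_def)
 moreover have "ennreal ((F (pi/2) - F 0)\<^sup>2) <= ennreal (2 * (cS * N * (1 + M))\<^sup>2) * (NB t. indicator {0..pi/2} t * ennreal (Er g (p t) (l t)))"
 proof -
  have "ennreal ((F (pi/2) - F 0)\<^sup>2) <= ennreal 2 * (ennreal ((cS * N * (1 + M))\<^sup>2) * (NB t. indicator {0..pi/2} t * ennreal (Er g (p t) (l t))))"
   using order_trans[OF 1 mult_left_mono[OF 2]] by simp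
  thus ?thesis by (simp only: ennreal_mult'[OF zero_le_numeral] mult.assoc)
 qed
 ultimately show ?thesis by (simp add: p_def l_def tht_def)
qed

section \<open>Averages over variable balls\<close>

text \<open>An L1 bound for the operator that averages over the balls of centre \<open>p x\<close>
  and radius \<open>l x\<close>. With nonnegative extended functions no integrability has to be
  carried along.\<close>

definition schur :: "(real^3) set => (real^3 => real^3) => (real^3 => real) => real => bool" where
 "schur X p l C \<longleftrightarrow> (\<forall>h \<in> bmb.
  (NB x. indicator X x * (NB z. indicator (cball 0 1) z * h (p x + l x *R z)))
   <= ennreal C * (NB y. h y))"

lemma schurD:
 assumes "schur X p l C" "h \<in> bmb"
 shows "(NB x. indicator X x * (NB z. indicator (cball 0 1) z * h (p x + l x *R z)))
   <= ennreal C * (NB y. h y)"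
 using assms unfolding schur_def by blast

definition vB :: real where "vB = measure lborel (cball (0::real^3) 1)"

lemma vB_nonneg: "vB >= 0"
 by (simp add: vB_def)

lemma emeasure_cball3: "r >= 0 ==> emeasure lborel (cball (x::real^3) r) = ennreal (vB * r ^ 3)"
 by (simp add: vB_def content_cball emeasure_cball)

text \<open>Schur test with an intrinsic length \<tau> at each target point y: every x whose ball
  contains y has radius at least \<tau>/a and lies within b \<tau> of y. After Fubini the weight
  1/l^3 and the volume of these x contribute a^3 b^3 \<open>vB\<close>, in which \<tau> has
  cancelled.\<close>

lemma schur_criterion:
 assumes [measurable]: "X \<in> sets borel" "p \<in> bmb" "l \<in> bmb"
  and l: "!!x. x \<in> X ==> l x > 0" and ab: "a >= 0" "b >= 0"
  and crit: "!!x y. x \<in> X ==> dist (p x) y <= l x ==> \<tau> y > 0 & \<tau> y <= a * l x & dist x y <= b * \<tau> y"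
 shows "schur X p l (a ^ 3 * b ^ 3 * vB)"
 unfolding schur_def
proof
 fix h :: "real^3 => ennreal" assume [measurable]: "h \<in> bmb"
 have 1: "indicator X x * (NB z. indicator (cball 0 1) z * h (p x + l x *R z))
  = (NB y. indicator X x * (if dist (p x) y <= l x then ennreal (1 / l x ^ 3) else 0) * h y)" for x
 proof (cases "x \<in> X")
  case True
  note lx = l[OF True]
  have "(NB y. (if dist (p x) y <= l x then ennreal (1 / l x ^ 3) else 0) * h y)
   = ennreal (l x ^ 3) * (NB z. (if dist (p x) (p x + l x *R z) <= l x then ennreal (1 / l x ^ 3) else 0) * h (p x + l x *R z))"
   using lborel_nn_integral_affine[of "l x" "%y. (if dist (p x) y <= l x then ennreal (1 / l x ^ 3) else 0) * h y" "p x"] lx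
   by simp
  also have "(%z. (if dist (p x) (p x + l x *R z) <= l x then ennreal (1 / l x ^ 3) else 0) * h (p x + l x *R z))
   = (%z. ennreal (1 / l x ^ 3) * (indicator (cball 0 1) z * h (p x + l x *R z)))"
   using lx by (auto simp: fun_eq_iff indicator_def dist_norm)
  also have "ennreal (l x ^ 3) * (NB z. ennreal (1 / l x ^ 3) * (indicator (cball 0 1) z * h (p x + l x *R z)))
   = (ennreal (l x ^ 3) * ennreal (1 / l x ^ 3)) * (NB z. indicator (cball 0 1) z * h (p x + l x *R z))"
   by (subst nn_integral_cmult) (auto simp: mult.assoc)
  also have "ennreal (l x ^ 3) * ennreal (1 / l x ^ 3) = 1"
   using lx by (subst ennreal_mult[symmetric]) auto
  finally show ?thesis using True by simp
 qed simp
 have "(NB x. indicator X x * (NB z. indicator (cball 0 1) z * h (p x + l x *R z)))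
  = (NB x. (NB y. indicator X x * (if dist (p x) y <= l x then ennreal (1 / l x ^ 3) else 0) * h y))"
  by (rule nn_integral_cong) (rule 1)
 also have "... = (NB y. (NB x. indicator X x * (if dist (p x) y <= l x then ennreal (1 / l x ^ 3) else 0) * h y))"
  by (rule lborel_pair.Fubini') measurable
 also have "... <= (NB y. ennreal (a ^ 3 * b ^ 3 * vB) * h y)"
 proof (rule nn_integral_mono)
  fix y
  have "(NB x. indicator X x * (if dist (p x) y <= l x then ennreal (1 / l x ^ 3) else 0)) <= ennreal (a ^ 3 * b ^ 3 * vB)"
  proof (cases "\<exists>x\<in>X. dist (p x) y <= l x")
   case True
   hence t: "\<tau> y > 0" using crit by blast
   have "(NB x. indicator X x * (if dist (p x) y <= l x then ennreal (1 / l x ^ 3) else 0))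
   <= (NB x. ennreal (a ^ 3 / \<tau> y ^ 3) * indicator (cball y (b * \<tau> y)) x)"
   proof (rule nn_integral_mono)
   fix x
   show "indicator X x * (if dist (p x) y <= l x then ennreal (1 / l x ^ 3) else 0) <= ennreal (a ^ 3 / \<tau> y ^ 3) * indicator (cball y (b * \<tau> y)) x"
   proof (cases "x \<in> X & dist (p x) y <= l x")
   case True
   hence c: "\<tau> y <= a * l x" "dist x y <= b * \<tau> y" using crit by blast+
   have "\<tau> y ^ 3 <= (a * l x) ^ 3" using c t by (intro power_mono) auto
   hence "1 / l x ^ 3 <= a ^ 3 / \<tau> y ^ 3" using t l[of x] True by (simp add: field_simps power_mult_distrib)
   thus ?thesis using True c by (auto simp: dist_commute intro!: ennreal_leI)
   qed (auto simp: indicator_def)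
   qed
   also have "... = ennreal (a ^ 3 / \<tau> y ^ 3) * emeasure lborel (cball y (b * \<tau> y))" by (simp add: nn_integral_cmult_indicator)
   also have "... = ennreal (a ^ 3 / \<tau> y ^ 3 * (vB * (b * \<tau> y) ^ 3))"
   using ab t vB_nonneg by (subst emeasure_cball3) (auto simp: ennreal_mult[symmetric])
   also have "a ^ 3 / \<tau> y ^ 3 * (vB * (b * \<tau> y) ^ 3) = a ^ 3 * b ^ 3 * vB" using t by (simp add: power_mult_distrib)
   finally show ?thesis .
  next
   case False
   hence "(%x. indicator X x * (if dist (p x) y <= l x then ennreal (1 / l x ^ 3) else 0)) = (%x. 0)"
   by (auto simp: indicator_def)
   thus ?thesis by simp
  qed
  thus "(NB x. indicator X x * (if dist (p x) y <= l x then ennreal (1 / l x ^ 3) else 0) * h y) <= ennreal (a ^ 3 * b ^ 3 * vB) * h y"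
   by (subst nn_integral_multc) (auto intro: mult_right_mono)
 qed
 also have "... = ennreal (a ^ 3 * b ^ 3 * vB) * (NB y. h y)" by (rule nn_integral_cmult) simp
 finally show "(NB x. indicator X x * (NB z. indicator (cball 0 1) z * h (p x + l x *R z)))
   <= ennreal (a ^ 3 * b ^ 3 * vB) * (NB y. h y)" .
qed

lemma schur_zero_scale:
 assumes "!!x. x \<in> X ==> p x = x" "!!x. x \<in> X ==> l x = 0"
 shows "schur X p l vB"
 unfolding schur_def
proof
 fix h :: "real^3 => ennreal" assume [measurable]: "h \<in> bmb"
 have "(NB x. indicator X x * (NB z. indicator (cball 0 1) z * h (p x + l x *R z)))
  <= (NB x. ennreal vB * h x)"
 proof (rule nn_integral_mono)
  fix x
  have "(NB z. indicator (cball (0::real^3) 1) z * h x) = ennreal vB * h x"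
   by (subst nn_integral_multc) (auto simp: emeasure_cball3)
  thus "indicator X x * (NB z. indicator (cball 0 1) z * h (p x + l x *R z)) <= ennreal vB * h x"
   using assms by (cases "x \<in> X") auto
 qed
 also have "... = ennreal vB * (NB y. h y)" by (rule nn_integral_cmult) simp
 finally show "(NB x. indicator X x * (NB z. indicator (cball 0 1) z * h (p x + l x *R z)))
   <= ennreal vB * (NB y. h y)" .
qed

lemma schur_union:
 assumes [measurable]: "X1 \<in> sets borel" "X2 \<in> sets borel" "p \<in> bmb" "l \<in> bmb"
  and s: "schur X1 p l Ca" "schur X2 p l Cb" "Ca >= 0" "Cb >= 0" and X: "X \<subseteq> X1 \<union> X2"
 shows "schur X p l (Ca + Cb)"
 unfolding schur_def
proof
 fix h :: "real^3 => ennreal" assume [measurable]: "h \<in> bmb"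
 let ?f = "%x. (NB z. indicator (cball 0 1) z * h (p x + l x *R z))"
 have "(NB x. indicator X x * ?f x) <= (NB x. indicator X1 x * ?f x + indicator X2 x * ?f x)"
  by (rule nn_integral_mono) (use X in \<open>auto simp: indicator_def\<close>)
 also have "... = (NB x. indicator X1 x * ?f x) + (NB x. indicator X2 x * ?f x)"
  by (rule nn_integral_add) measurable
 also have "... <= ennreal Ca * (NB y. h y) + ennreal Cb * (NB y. h y)"
  using s by (intro add_mono schurD) auto
 also have "... = ennreal (Ca + Cb) * (NB y. h y)"
  using s by (simp add: distrib_right[symmetric] ennreal_plus)
 finally show "(NB x. indicator X x * ?f x) <= ennreal (Ca + Cb) * (NB y. h y)" .
qed

lemma schur_mono: "schur X p l C ==> C <= C' ==> schur X p l C'"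
 unfolding schur_def by (meson ennreal_leI mult_right_mono order_trans zero_le)

lemma schur_subset: "schur X p l C ==> Y \<subseteq> X ==> schur Y p l C"
 unfolding schur_def
proof (intro ballI)
 fix h :: "real^3 => ennreal" assume s: "\<forall>h\<in>borel_measurable borel. (NB x. indicator X x * (NB z. indicator (cball 0 1) z * h (p x + l x *R z))) <= ennreal C * (NB y. h y)"
  and Y: "Y \<subseteq> X" and h: "h \<in> bmb"
 have "(NB x. indicator Y x * (NB z. indicator (cball 0 1) z * h (p x + l x *R z)))
  <= (NB x. indicator X x * (NB z. indicator (cball 0 1) z * h (p x + l x *R z)))"
  by (rule nn_integral_mono) (use Y in \<open>auto simp: indicator_def\<close>)
 thus "(NB x. indicator Y x * (NB z. indicator (cball 0 1) z * h (p x + l x *R z))) <= ennreal C * (NB y. h y)"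
  using s h order_trans by blast
qed

lemma schur_cong:
 "schur X p l C ==> (!!x. x \<in> X ==> p' x = p x) ==> (!!x. x \<in> X ==> l' x = l x) ==> schur X p' l' C"
proof -
 assume s: "schur X p l C" and e: "!!x. x \<in> X ==> p' x = p x" "!!x. x \<in> X ==> l' x = l x"
 have "(indicator X x :: ennreal) * (NB z. indicator (cball 0 1) z * h (p' x + l' x *R z))
  = indicator X x * (NB z. indicator (cball 0 1) z * h (p x + l x *R z))" for x h
  using e by (cases "x \<in> X") auto
 thus ?thesis using s by (simp add: schur_def)
qed

lemma schur_kernel:
 assumes s: "schur X p l C" and k: "!!z. \<bar>k z\<bar> <= B * indicat_real (cball 0 1) z" "B >= 0"
  and m: "k \<in> bmb" "v \<in> bmb" "p \<in> bmb" "l \<in> bmb" "X \<in> sets borel"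
 shows "(NB x. indicator X x * ennreal \<bar>A k v (p x) (l x)\<bar>) <= ennreal (B * C) * (NB y. ennreal \<bar>v y\<bar>)"
proof -
 note [measurable] = m
 have a: "ennreal \<bar>A k v p l\<bar> <= ennreal B * (NB z. indicator (cball 0 1) z * ennreal \<bar>v (p + l *R z)\<bar>)" for p l
 proof -
  have "ennreal (norm (A k v p l)) <= (NB z. ennreal (norm (k z * v (p + l *R z))))"
  proof (cases "intb (%z. k z * v (p + l *R z))")
   case True
   show ?thesis unfolding A_def by (rule integral_norm_bound_ennreal[OF True])
  qed (simp add: A_def not_integrable_integral_eq)
  also have "... <= (NB z. ennreal B * (indicator (cball 0 1) z * ennreal \<bar>v (p + l *R z)\<bar>))"
  proof (rule nn_integral_mono)
   fix z
   have "norm (k z * v (p + l *R z)) <= (B * indicat_real (cball 0 1) z) * \<bar>v (p + l *R z)\<bar>"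
   using mult_right_mono[OF k(1), of "\<bar>v (p + l *R z)\<bar>" z] by (simp add: abs_mult)
   hence "ennreal (norm (k z * v (p + l *R z))) <= ennreal ((B * indicat_real (cball 0 1) z) * \<bar>v (p + l *R z)\<bar>)"
   by (rule ennreal_leI)
   also have "... = ennreal B * (indicator (cball 0 1) z * ennreal \<bar>v (p + l *R z)\<bar>)"
   using k(2) by (auto simp: indicator_def ennreal_mult)
   finally show "ennreal (norm (k z * v (p + l *R z))) <= ennreal B * (indicator (cball 0 1) z * ennreal \<bar>v (p + l *R z)\<bar>)" .
  qed
  also have "... = ennreal B * (NB z. indicator (cball 0 1) z * ennreal \<bar>v (p + l *R z)\<bar>)"
   by (rule nn_integral_cmult) measurable
  finally show ?thesis by simp
 qed
 have "(NB x. indicator X x * ennreal \<bar>A k v (p x) (l x)\<bar>)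
  <= (NB x. ennreal B * (indicator X x * (NB z. indicator (cball 0 1) z * ennreal \<bar>v (p x + l x *R z)\<bar>)))"
  by (rule nn_integral_mono) (use a in \<open>auto simp: indicator_def\<close>)
 also have "... = ennreal B * (NB x. indicator X x * (NB z. indicator (cball 0 1) z * ennreal \<bar>v (p x + l x *R z)\<bar>))"
  by (rule nn_integral_cmult) measurable
 also have "... <= ennreal B * (ennreal C * (NB y. ennreal \<bar>v y\<bar>))"
  by (intro mult_left_mono schurD[OF s]) auto
 also have "... = ennreal (B * C) * (NB y. ennreal \<bar>v y\<bar>)" using k(2) by (simp add: ennreal_mult' mult.assoc)
 finally show ?thesis .
qed

lemma schur_Er:
 assumes ad: "adm V u g" and s: "schur X p l C" and l: "!!x. x \<in> X ==> l x > 0"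
 shows "(NB x. indicator X x * ennreal (Er g (p x) (l x))) <= ennreal C * (NB y. ennreal ((norm (symm (g y)))\<^sup>2))"
proof -
 have "(NB x. indicator X x * ennreal (Er g (p x) (l x)))
  = (NB x. indicator X x * (NB z. indicator (cball 0 1) z * ennreal ((norm (symm (g (p x + l x *R z))))\<^sup>2)))"
  by (rule nn_integral_cong) (use ennreal_Er[OF ad l] in \<open>auto simp: indicator_def\<close>)
 also have "... <= ennreal C * (NB y. ennreal ((norm (symm (g y)))\<^sup>2))"
  by (rule schurD[OF s]) (use adm_symm_measurable[OF ad] in measurable)
 finally show ?thesis .
qed

text \<open>Fubini exchanges the path parameter with x, after which the averaging bound is applied
  for each parameter separately, with the same constant.\<close>

lemma segment_schur:
 assumes ad: "adm V u g" and [measurable]: "X \<in> sets borel" "p0 \<in> bmb" "p1 \<in> bmb"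
   "l0 \<in> bmb" "l1 \<in> bmb"
  and l: "!!x. x \<in> X ==> l0 x > 0" "!!x. x \<in> X ==> l1 x > 0"
  and V: "!!x s. x \<in> X ==> 0 <= s ==> s <= 1 ==> cball (p0 x + s *R (p1 x - p0 x)) (l0 x + s * (l1 x - l0 x)) \<subseteq> V"
  and M: "!!x s. x \<in> X ==> 0 <= s ==> s <= 1 ==> norm (x - (p0 x + s *R (p1 x - p0 x))) <= M * (l0 x + s * (l1 x - l0 x))"
  and N: "!!x. x \<in> X ==> norm (p1 x - p0 x) + \<bar>l1 x - l0 x\<bar> <= N"
  and s: "!!s. 0 <= s ==> s <= 1 ==> schur X (%x. p0 x + s *R (p1 x - p0 x)) (%x. l0 x + s * (l1 x - l0 x)) C"
  and C: "C >= 0"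
 shows "(NB x. indicator X x * ennreal ((Fr u ((1 / l1 x) *R (x - p1 x)) (p1 x) (l1 x) i - Fr u ((1 / l0 x) *R (x - p0 x)) (p0 x) (l0 x) i)\<^sup>2))
  <= ennreal (2 * (cS * N * (1 + M))\<^sup>2 * (2 * C)) * (NB y. ennreal ((norm (symm (g y)))\<^sup>2))"
proof -
 define J where "J = (NB y. ennreal ((norm (symm (g y)))\<^sup>2))"
 define e where "e x t = Er g (p0 x + (sin t)\<^sup>2 *R (p1 x - p0 x)) (l0 x + (sin t)\<^sup>2 * (l1 x - l0 x))" for x t
 let ?K = "2 * (cS * N * (1 + M))\<^sup>2"
 have em[measurable]: "(%(x, t). e x t) \<in> borel_measurable (lborel \<Otimes>\<^sub>M lborel)"
  unfolding e_def case_prod_unfold by (rule Er_measurable[OF ad]) measurable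
 have sin01: "0 <= (sin t)\<^sup>2" "(sin t)\<^sup>2 <= 1" for t :: real
  by (auto simp: abs_square_le_1)
 have lp: "l0 x + s * (l1 x - l0 x) > 0" if "x \<in> X" "0 <= s" "s <= 1" for x s
 proof -
  have "l0 x + s * (l1 x - l0 x) = (1 - s) * l0 x + s * l1 x" by (simp add: algebra_simps)
  thus ?thesis using l[OF that(1)] that by (cases "s = 0") (auto intro: add_nonneg_pos)
 qed
 have "(NB x. indicator X x * ennreal ((Fr u ((1 / l1 x) *R (x - p1 x)) (p1 x) (l1 x) i - Fr u ((1 / l0 x) *R (x - p0 x)) (p0 x) (l0 x) i)\<^sup>2))
  <= (NB x. ennreal ?K * (NB t. indicator X x * (indicator {0..pi/2} t * ennreal (e x t))))"
 proof (rule nn_integral_mono)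
  fix x
  show "indicator X x * ennreal ((Fr u ((1 / l1 x) *R (x - p1 x)) (p1 x) (l1 x) i - Fr u ((1 / l0 x) *R (x - p0 x)) (p0 x) (l0 x) i)\<^sup>2)
   <= ennreal ?K * (NB t. indicator X x * (indicator {0..pi/2} t * ennreal (e x t)))"
  proof (cases "x \<in> X")
   case True
   show ?thesis using segment_estimate[OF ad l[OF True] V[OF True] M[OF True] N[OF True], of i] True by (simp add: e_def)
  qed simp
 qed
 also have "... = ennreal ?K * (NB x. (NB t. indicator X x * (indicator {0..pi/2} t * ennreal (e x t))))"
  by (rule nn_integral_cmult) measurable
 also have "(NB x. (NB t. indicator X x * (indicator {0..pi/2} t * ennreal (e x t))))
  = (NB t. (NB x. indicator X x * (indicator {0..pi/2} t * ennreal (e x t))))"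
  by (rule lborel_pair.Fubini') measurable
 also have "... <= (NB t. (ennreal C * J) * indicator {0..pi/2} t)"
 proof (rule nn_integral_mono)
  fix t :: real
  have "(NB x. indicator X x * ennreal (e x t)) <= ennreal C * J"
   unfolding e_def J_def by (rule schur_Er[OF ad s[OF sin01] lp[OF _ sin01]])
  thus "(NB x. indicator X x * (indicator {0..pi/2} t * ennreal (e x t))) <= (ennreal C * J) * indicator {0..pi/2} t"
   by (auto simp: indicator_def)
 qed
 also have "... = (ennreal C * J) * ennreal (pi / 2)" by (simp add: nn_integral_cmult_indicator)
 also have "... <= (ennreal C * J) * ennreal 2" using pi_less_4 by (intro mult_left_mono ennreal_leI) auto
 also have "... = ennreal (2 * C) * J" using C by (simp add: ennreal_mult' mult_ac)
 finally have "(NB x. indicator X x * ennreal ((Fr u ((1 / l1 x) *R (x - p1 x)) (p1 x) (l1 x) i - Fr u ((1 / l0 x) *R (x - p0 x)) (p0 x) (l0 x) i)\<^sup>2))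
  <= ennreal ?K * (ennreal (2 * C) * J)" by (simp add: mult_left_mono)
 also have "... = ennreal (?K * (2 * C)) * J"
 proof -
  have "ennreal (K * (2 * C)) = ennreal K * ennreal (2 * C)" if "K >= 0" for K using that C by (intro ennreal_mult) auto
  moreover have "?K >= 0" by simp
  ultimately have "ennreal (?K * (2 * C)) = ennreal ?K * ennreal (2 * C)" by blast
  thus ?thesis by (simp only: mult.assoc)
 qed
 finally show ?thesis unfolding J_def .
qed

section \<open>Passage to the limit in the averages\<close>

text \<open>Convergence tested with compactly supported continuous functions: both a C1 test
  function and its partial derivatives are of this kind.\<close>

definition dconv :: "(real^3) set => (nat => real^3 => real) => (real^3 => real) => bool" where
 "dconv X an a \<longleftrightarrow> (\<forall>ph. continuous_on UNIV ph --> (\<exists>K. compact K & K \<subseteq> X & (\<forall>x. x ~: K --> ph x = 0)) -->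
  (\<forall>n. intb (%x. an n x * ph x)) & intb (%x. a x * ph x) &
  (%n. (LB x. an n x * ph x)) \<longlonglongrightarrow> (LB x. a x * ph x))"

lemma dconv_add: "dconv X an a ==> dconv X bn b ==> dconv X (%n x. an n x + bn n x) (%x. a x + b x)"
 unfolding dconv_def by (auto simp: distrib_right intro!: tendsto_add)

text \<open>The model cases are the offset and the derivatives of centre and radius along an
  approximation of the geometry.\<close>

definition coef :: "(real^3) set => (nat => real^3 => real) => (real^3 => real) => bool" where
 "coef X cn c \<longleftrightarrow> (\<forall>n. cn n \<in> bmb) & c \<in> bmb &
  (\<exists>M. \<forall>x\<in>X. (\<forall>n. \<bar>cn n x\<bar> <= M) & \<bar>c x\<bar> <= M) & (\<forall>x\<in>X. (%n. cn n x) \<longlonglongrightarrow> c x)"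

lemma coef_const: "coef X (%n x. r) (%x. r)"
 by (auto simp: coef_def)

lemma coef_mult:
 assumes "coef X cn c" "coef X bn b" shows "coef X (%n x. cn n x * bn n x) (%x. c x * b x)"
proof -
 from assms obtain M1 M2 where M: "!!x n. x \<in> X ==> \<bar>cn n x\<bar> <= M1" "!!x. x \<in> X ==> \<bar>c x\<bar> <= M1"
  "!!x n. x \<in> X ==> \<bar>bn n x\<bar> <= M2" "!!x. x \<in> X ==> \<bar>b x\<bar> <= M2" unfolding coef_def by metis
 have "\<bar>s * t\<bar> <= \<bar>M1\<bar> * \<bar>M2\<bar>" if "\<bar>s\<bar> <= M1" "\<bar>t\<bar> <= M2" for s t
  unfolding abs_mult using that by (intro mult_mono) auto
 hence "\<forall>x\<in>X. (\<forall>n. \<bar>cn n x * bn n x\<bar> <= \<bar>M1\<bar> * \<bar>M2\<bar>) & \<bar>c x * b x\<bar> <= \<bar>M1\<bar> * \<bar>M2\<bar>" using M by blast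
 thus ?thesis using assms unfolding coef_def by (auto intro!: tendsto_mult borel_measurable_times)
qed

text \<open>Weak convergence does not survive products in general. Quantifying over all admissible
  coefficients makes it do so by definition, and \<open>Fr\<close> and \<open>Gr\<close>, being sums
  of coefficients times averages, can be treated term by term.\<close>

definition sconv :: "(real^3) set => (nat => real^3 => real) => (real^3 => real) => bool" where
 "sconv X an a \<longleftrightarrow> (\<forall>cn c. coef X cn c --> dconv X (%n x. cn n x * an n x) (%x. c x * a x))"

lemma sconv_dconv: "sconv X an a ==> dconv X an a"
 unfolding sconv_def using coef_const[of X 1] by fastforce

lemma sconv_add: "sconv X an a ==> sconv X bn b ==> sconv X (%n x. an n x + bn n x) (%x. a x + b x)"
 unfolding sconv_def by (auto simp: distrib_left intro: dconv_add)

lemma sconv_mult: "coef X cn c ==> sconv X an a ==> sconv X (%n x. cn n x * an n x) (%x. c x * a x)"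
 unfolding sconv_def using coef_mult by (auto simp: mult.assoc[symmetric])

lemma sconv_cmult: "sconv X an a ==> sconv X (%n x. r * an n x) (%x. r * a x)"
 by (rule sconv_mult[OF coef_const])

lemma sconv_diff: "sconv X an a ==> sconv X bn b ==> sconv X (%n x. an n x - bn n x) (%x. a x - b x)"
 using sconv_add[OF _ sconv_cmult, of X an a bn b "-1"] by simp

lemma sconv_half: "sconv X an a ==> sconv X (%n x. an n x / 2) (%x. a x / 2)"
 using sconv_cmult[of X an a "1/2"] by simp

lemma sconv_zero: "sconv X (%n x. 0) (%x. 0)"
 by (simp add: sconv_def dconv_def)

lemma sconv_sum: "(!!k. k \<in> S ==> sconv X (an k) (a k)) ==> sconv X (%n x. \<Sum>k\<in>S. an k n x) (%x. \<Sum>k\<in>S. a k x)"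
 by (induction S rule: infinite_finite_induct) (auto intro: sconv_zero sconv_add)

lemma schur_product_bound:
 assumes s: "schur X p l C" "C >= 0" and k: "kern k"
  and m: "p \<in> bmb" "l \<in> bmb" "X \<in> sets borel"
  and B: "!!z. \<bar>k z\<bar> <= B * indicat_real (cball 0 1) z" "B > 0" and v: "integrable lborel v"
  and w: "w \<in> bmb" "!!x. x ~: X ==> w x = 0" "!!x. \<bar>w x\<bar> <= D"
 shows "intb (%x. w x * A k v (p x) (l x))"
  "\<bar>(LB x. w x * A k v (p x) (l x))\<bar> <= D * (B * C) * (LB x. \<bar>v x\<bar>)"
proof -
 note [measurable] = m w(1) kern_borel[OF k]
 have [measurable]: "v \<in> bmb" using v by auto
 have D: "D >= 0" using w(3)[of 0] by linarith
 have "(NB x. ennreal (norm (w x * A k v (p x) (l x)))) <= (NB x. ennreal D * (indicator X x * ennreal \<bar>A k v (p x) (l x)\<bar>))"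
 proof (rule nn_integral_mono)
  fix x show "ennreal (norm (w x * A k v (p x) (l x))) <= ennreal D * (indicator X x * ennreal \<bar>A k v (p x) (l x)\<bar>)"
   using w(2,3)[of x] D by (cases "x \<in> X") (auto simp: abs_mult ennreal_mult'[symmetric] intro!: ennreal_leI mult_right_mono)
 qed
 also have "... = ennreal D * (NB x. indicator X x * ennreal \<bar>A k v (p x) (l x)\<bar>)"
  by (rule nn_integral_cmult) measurable
 also have "... <= ennreal D * (ennreal (B * C) * (NB y. ennreal \<bar>v y\<bar>))"
  by (intro mult_left_mono schur_kernel[OF s(1) B(1)]) (use B m kern_borel[OF k] in auto)
 also have "(NB y. ennreal \<bar>v y\<bar>) = ennreal (LB y. \<bar>v y\<bar>)"
  by (rule nn_integral_eq_integral) (use v in auto)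
 also have "ennreal D * (ennreal (B * C) * ennreal (LB y. \<bar>v y\<bar>)) = ennreal (D * (B * C) * (LB y. \<bar>v y\<bar>))"
  using D B(2) s(2) by (simp add: ennreal_mult'[symmetric] mult.assoc)
 finally have f: "(NB x. ennreal (norm (w x * A k v (p x) (l x)))) <= ennreal (D * (B * C) * (LB y. \<bar>v y\<bar>))" .
 show i: "intb (%x. w x * A k v (p x) (l x))"
  using f by (intro integrableI_bounded) (auto intro: le_less_trans)
 have "ennreal (norm (LB x. w x * A k v (p x) (l x))) <= ennreal (D * (B * C) * (LB y. \<bar>v y\<bar>))"
  by (rule order_trans[OF integral_norm_bound_ennreal[OF i] f])
 thus "\<bar>(LB x. w x * A k v (p x) (l x))\<bar> <= D * (B * C) * (LB x. \<bar>v x\<bar>)"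
  using D B(2) s(2) by (subst (asm) ennreal_le_iff) (auto intro!: mult_nonneg_nonneg Bochner_Integration.integral_nonneg)
qed

text \<open>For bounded continuous w the averages converge pointwise. For merely integrable v
  pointwise convergence is not at hand, but the Schur bound, uniform in n, makes the error of
  replacing v by an L1-close w small after testing.\<close>

lemma sconv_A:
 assumes k: "kern k" and v: "integrable lborel v" and X: "X \<in> sets borel"
  and m: "!!n. pn n \<in> bmb" "!!n. qn n \<in> bmb" "p \<in> bmb" "l \<in> bmb"
  and lim: "!!x. x \<in> X ==> (%n. pn n x) \<longlonglongrightarrow> p x" "!!x. x \<in> X ==> (%n. qn n x) \<longlonglongrightarrow> l x"
  and s: "!!n. schur X (pn n) (qn n) C" "schur X p l C" "C >= 0"
  and pos: "!!n x. x \<in> X ==> qn n x > 0" "!!x. x \<in> X ==> l x >= 0"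
 shows "sconv X (%n x. A k v (pn n x) (qn n x)) (%x. A k v (p x) (l x))"
 unfolding sconv_def dconv_def
proof (intro allI impI)
 fix cn c ph assume cf: "coef X cn c" and ph: "continuous_on UNIV ph" and "\<exists>K. compact K & K \<subseteq> X & (\<forall>x. x ~: K --> ph x = (0::real))"
 then obtain K where K: "compact K" "K \<subseteq> X" "!!x. x ~: K ==> ph x = 0" by blast
 obtain Bph where Bph: "Bph > 0" "!!x. norm (ph x) <= Bph" using compact_support_bounded[OF ph K(1,3)] by blast
 have phi: "integrable lborel ph" by (rule compact_support_integrable[OF ph K(1,3)])
 obtain M where M: "!!x n. x \<in> X ==> \<bar>cn n x\<bar> <= M" "!!x. x \<in> X ==> \<bar>c x\<bar> <= M" using cf unfolding coef_def by metis
 have cm[measurable]: "cn n \<in> bmb" "c \<in> bmb" for n using cf by (auto simp: coef_def)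
 obtain B where B: "B > 0" "!!z. \<bar>k z\<bar> <= B" "!!z. \<bar>k z\<bar> <= B * indicat_real (cball 0 1) z" using kern_bound[OF k] by blast
 note [measurable] = m kern_borel[OF k] borel_measurable_continuous_onI[OF ph] X
 have [measurable]: "v \<in> bmb" using v by auto
 define D where "D = \<bar>M\<bar> * Bph"
 have D: "\<bar>ph x * cn n x\<bar> <= D" "\<bar>ph x * c x\<bar> <= D" "x ~: X ==> ph x * cn n x = 0" "x ~: X ==> ph x * c x = 0" for x n
 proof -
  have g: "\<bar>ph x * t\<bar> <= D" if "x \<in> X ==> \<bar>t\<bar> <= M" for t
  proof (cases "x \<in> X")
   case True
   have "\<bar>ph x\<bar> * \<bar>t\<bar> <= Bph * \<bar>M\<bar>" using Bph(2)[of x] that[OF True] by (intro mult_mono) auto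
   thus ?thesis by (simp add: D_def abs_mult mult.commute)
  next
   case False
   hence "ph x = 0" using K(2,3) by blast
   thus ?thesis using Bph(1) by (simp add: D_def)
  qed
  show "\<bar>ph x * cn n x\<bar> <= D" "\<bar>ph x * c x\<bar> <= D" using g M by auto
  show "x ~: X ==> ph x * cn n x = 0" "x ~: X ==> ph x * c x = 0" using K by auto
 qed
 have Dn: "D >= 0" using Bph by (simp add: D_def)
 have bn: "intb (%x. (ph x * cn n x) * A k w (pn n x) (qn n x))"
  "\<bar>(LB x. (ph x * cn n x) * A k w (pn n x) (qn n x))\<bar> <= D * (B * C) * (LB x. \<bar>w x\<bar>)"
  if "integrable lborel w" for w n
  using schur_product_bound[OF s(1) s(3) k m(1,2) X B(3,1) that, of "%x. ph x * cn n x" D n] D by auto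
 have b: "intb (%x. (ph x * c x) * A k w (p x) (l x))"
  "\<bar>(LB x. (ph x * c x) * A k w (p x) (l x))\<bar> <= D * (B * C) * (LB x. \<bar>w x\<bar>)"
  if "integrable lborel w" for w
  using schur_product_bound[OF s(2,3) k m(3,4) X B(3,1) that, of "%x. ph x * c x" D] D by auto
 have cont: "(%n. (LB x. (ph x * cn n x) * A k w (pn n x) (qn n x))) \<longlonglongrightarrow> (LB x. (ph x * c x) * A k w (p x) (l x))"
  if w: "continuous_on UNIV w" "!!x. \<bar>w x\<bar> <= W" for w W
 proof (rule integral_dominated_convergence[where w = "%x. \<bar>ph x\<bar> * (\<bar>M\<bar> * (W * (LB z. \<bar>k z\<bar>)))"])
  have [measurable]: "w \<in> bmb" using w by (auto intro: borel_measurable_continuous_onI)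
  have W: "W >= 0" using w(2)[of 0] by linarith
  have ki: "intb (%z. \<bar>k z\<bar>)" using kern_integrable[OF k] by simp
  have Ab: "\<bar>A k w p l\<bar> <= W * (LB z. \<bar>k z\<bar>)" for p l
  proof -
   have "\<bar>A k w p l\<bar> <= (LB z. W * \<bar>k z\<bar>)" unfolding A_def
   by (rule order_trans[OF integral_abs_bound integral_mono'])
   (use ki w W in \<open>auto simp: abs_mult mult.commute[of W] intro!: mult_left_mono\<close>)
   thus ?thesis by simp
  qed
  show "AE x in lborel. (%n. (ph x * cn n x) * A k w (pn n x) (qn n x)) \<longlonglongrightarrow> (ph x * c x) * A k w (p x) (l x)"
  proof (rule AE_I2)
   fix x
   show "(%n. (ph x * cn n x) * A k w (pn n x) (qn n x)) \<longlonglongrightarrow> (ph x * c x) * A k w (p x) (l x)"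
   proof (cases "x \<in> X")
   case True
   have "(%n. A k w (pn n x) (qn n x)) \<longlonglongrightarrow> A k w (p x) (l x)" unfolding A_def
   proof (rule integral_dominated_convergence[where w = "%z. W * \<bar>k z\<bar>"])
   show "AE z in lborel. (%n. k z * w (pn n x + qn n x *R z)) \<longlonglongrightarrow> k z * w (p x + l x *R z)"
   proof (intro AE_I2 tendsto_mult_left)
   fix z
   have "isCont w (p x + l x *R z)" using w(1) by (simp add: continuous_on_eq_continuous_at)
   thus "(%n. w (pn n x + qn n x *R z)) \<longlonglongrightarrow> w (p x + l x *R z)"
   by (rule isCont_tendsto_compose) (intro tendsto_intros lim True)
   qed
   show "AE z in lborel. norm (k z * w (pn n x + qn n x *R z)) <= W * \<bar>k z\<bar>" for n
   using w(2) by (auto simp: abs_mult mult.commute[of W] intro!: AE_I2 mult_left_mono)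
   qed (use ki in auto)
   moreover have "(%n. cn n x) \<longlonglongrightarrow> c x" using cf True by (auto simp: coef_def)
   ultimately show ?thesis by (intro tendsto_intros)
   next
   case False
   hence "ph x = 0" using K by blast
   thus ?thesis by simp
   qed
  qed
  show "AE x in lborel. norm ((ph x * cn n x) * A k w (pn n x) (qn n x)) <= \<bar>ph x\<bar> * (\<bar>M\<bar> * (W * (LB z. \<bar>k z\<bar>)))" for n
  proof (rule AE_I2)
   fix x
   show "norm ((ph x * cn n x) * A k w (pn n x) (qn n x)) <= \<bar>ph x\<bar> * (\<bar>M\<bar> * (W * (LB z. \<bar>k z\<bar>)))"
   proof (cases "x \<in> X")
   case True
   have "\<bar>cn n x\<bar> * \<bar>A k w (pn n x) (qn n x)\<bar> <= \<bar>M\<bar> * (W * (LB z. \<bar>k z\<bar>))"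
   using M(1)[OF True, of n] Ab by (intro mult_mono) auto
   thus ?thesis by (simp add: abs_mult mult.assoc mult_left_mono)
   next
   case False
   hence "ph x = 0" using K by blast
   thus ?thesis by simp
   qed
  qed
  show "intb (%x. \<bar>ph x\<bar> * (\<bar>M\<bar> * (W * (LB z. \<bar>k z\<bar>))))" using phi by auto
  show "(%x. (ph x * c x) * A k w (p x) (l x)) \<in> borel_measurable lborel"
   "(%x. (ph x * cn n x) * A k w (pn n x) (qn n x)) \<in> borel_measurable lborel" for n by measurable
 qed
 have phi0: "ph x = 0" if "x ~: X" for x using K that by blast
 have A_diff: "A k (%y. v y - w y) p l = A k v p l - A k w p l" if "integrable lborel w" "l >= 0" for w p l
  using A_lin[OF k v that(1), of l 1 "-1" p] that(2) by (cases "l = 0") (auto simp: A_zero_scale algebra_simps)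
 have main: "(%n. (LB x. (ph x * cn n x) * A k v (pn n x) (qn n x))) \<longlonglongrightarrow> (LB x. (ph x * c x) * A k v (p x) (l x))"
 proof (rule LIMSEQ_I)
  fix r :: real assume r: "r > 0"
  define E where "E = D * (B * C)"
  have E: "E >= 0" using Dn B s(3) by (simp add: E_def)
  \<comment> \<open>The error has three parts: the replacement of v by w before and after the limit,
    and the convergence for w. \<open>E\<close> bounds the averaging operators, and E + 1 avoids a
    division by 0.\<close>
  obtain w W where w: "continuous_on UNIV w" "!!x. \<bar>w x\<bar> <= W" "integrable lborel w" "(LB x. \<bar>v x - w x\<bar>) < r / (4 * (E + 1))"
   using integrable_approx_continuous[OF v, of "r / (4 * (E + 1))"] r E by auto
  have vw: "intb (%x. v x - w x)" using v w by simp
  have small: "E * (LB x. \<bar>v x - w x\<bar>) <= r / 4"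
  proof -
   have "E * (LB x. \<bar>v x - w x\<bar>) <= (E + 1) * (r / (4 * (E + 1)))"
   using w(4) E by (intro mult_mono Bochner_Integration.integral_nonneg) auto
   moreover have "(E + 1) * (r / (4 * (E + 1))) = r / 4" using E by (simp add: divide_simps)
   ultimately show ?thesis by linarith
  qed
  obtain N where N: "!!n. n >= N ==> norm ((LB x. (ph x * cn n x) * A k w (pn n x) (qn n x)) - (LB x. (ph x * c x) * A k w (p x) (l x))) < r / 4"
   using LIMSEQ_D[OF cont[OF w(1,2)], of "r / 4"] r by auto
  have dn: "(LB x. (ph x * cn n x) * A k (%y. v y - w y) (pn n x) (qn n x))
   = (LB x. (ph x * cn n x) * A k v (pn n x) (qn n x)) - (LB x. (ph x * cn n x) * A k w (pn n x) (qn n x))" for n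
  proof -
   have "(ph x * cn n x) * A k (%y. v y - w y) (pn n x) (qn n x) = (ph x * cn n x) * A k v (pn n x) (qn n x) - (ph x * cn n x) * A k w (pn n x) (qn n x)" for x
   by (cases "x \<in> X") (use phi0 A_diff[OF w(3)] pos(1)[of x n] in \<open>auto simp: right_diff_distrib less_imp_le\<close>)
   thus ?thesis using bn(1)[OF v, of n] bn(1)[OF w(3), of n] by simp
  qed
  have d: "(LB x. (ph x * c x) * A k (%y. v y - w y) (p x) (l x))
   = (LB x. (ph x * c x) * A k v (p x) (l x)) - (LB x. (ph x * c x) * A k w (p x) (l x))"
  proof -
   have "(ph x * c x) * A k (%y. v y - w y) (p x) (l x) = (ph x * c x) * A k v (p x) (l x) - (ph x * c x) * A k w (p x) (l x)" for x
   by (cases "x \<in> X") (use phi0 A_diff[OF w(3)] pos(2)[of x] in \<open>auto simp: right_diff_distrib\<close>)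
   thus ?thesis using b(1)[OF v] b(1)[OF w(3)] by simp
  qed
  show "\<exists>N. \<forall>n\<ge>N. norm ((LB x. (ph x * cn n x) * A k v (pn n x) (qn n x)) - (LB x. (ph x * c x) * A k v (p x) (l x))) < r"
  proof (intro exI allI impI)
   fix n assume "n >= N"
   from N[OF this] bn(2)[OF vw, of n] b(2)[OF vw] small r
   show "norm ((LB x. (ph x * cn n x) * A k v (pn n x) (qn n x)) - (LB x. (ph x * c x) * A k v (p x) (l x))) < r"
   unfolding dn d E_def[symmetric] real_norm_def by linarith
  qed
 qed
 show "(\<forall>n. intb (%x. cn n x * A k v (pn n x) (qn n x) * ph x)) & intb (%x. c x * A k v (p x) (l x) * ph x) &
  (%n. (LB x. cn n x * A k v (pn n x) (qn n x) * ph x)) \<longlonglongrightarrow> (LB x. c x * A k v (p x) (l x) * ph x)"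
  using main bn(1)[OF v] b(1)[OF v] by (simp add: mult_ac)
qed

lemma coefI:
 assumes "!!n. cn n \<in> bmb" "c \<in> bmb"
  and b: "!!n x. x \<in> X ==> \<bar>cn n x\<bar> <= M" and t: "!!x. x \<in> X ==> (%n. cn n x) \<longlonglongrightarrow> c x"
 shows "coef X cn c"
proof -
 have "\<bar>c x\<bar> <= M" if "x \<in> X" for x
  using tendsto_rabs[OF t[OF that]] b[OF that] by (intro LIMSEQ_le_const2) auto
 thus ?thesis using assms unfolding coef_def by blast
qed

lemma vector_derivative_components:
 fixes f :: "real => real^'n"
 assumes "!!k. ((%t. f t $ k) has_real_derivative f' k) (at t)"
 shows "(f has_vector_derivative (\<chi> k. f' k)) (at t)"
proof -
 have "((%t. \<Sum>k\<in>UNIV. f t $ k *R axis k (1::real)) has_vector_derivative (\<Sum>k\<in>UNIV. f' k *R axis k 1)) (at t)"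
  by (intro has_vector_derivative_sum has_vector_derivative_eq_rhs[OF has_vector_derivative_scaleR[OF assms has_vector_derivative_const]]) simp
 moreover have "(\<Sum>k\<in>UNIV. y $ k *R axis k (1::real)) = y" for y :: "real^'n"
  using basis_expansion[of y] by (simp add: scalar_mult_eq_scaleR)
 from this[of "f _"] this[of "\<chi> k. f' k"] have "(%t. \<Sum>k\<in>UNIV. f t $ k *R axis k (1::real)) = f" "(\<Sum>k\<in>UNIV. f' k *R axis k (1::real)) = (\<chi> k. f' k)"
  by (auto simp: \<open>!!y. (\<Sum>k\<in>UNIV. y $ k *R axis k 1) = y\<close>)
 ultimately show ?thesis by simp
qed

text \<open>Row i of the gradient of \<open>Fr\<close> when centre and radius depend on x. As
  \<open>p' k\<close> is the gradient of the k-th coordinate of the centre, the vector collected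
  over k is the velocity of the centre in direction m.\<close>

definition Gr :: "(real^3 => real^3^3) => real^3 => real^3 => real => (3 => real^3) => real^3 => 3 => real^3" where
 "Gr g d p l p' l' i = (\<chi> m. Wr g p l i m + Sr g d p l (\<chi> k. p' k $ m) (l' $ m) i)"

lemma Fr_wd:
 assumes ad: "adm V u g"
  and p: "!!k. C1 (%x. p x $ k) (p' k)" and l: "C1 l l'" "!!x. l x > 0"
  and V: "!!x. x \<in> X ==> cball (p x) (l x) \<subseteq> V"
 shows "wd X (%x. Fr u ((1 / l x) *R (x - p x)) (p x) (l x) i) (%x. Gr g ((1 / l x) *R (x - p x)) (p x) (l x) (%k. p' k x) (l' x) i)"
  and "continuous_on UNIV (%x. Fr u ((1 / l x) *R (x - p x)) (p x) (l x) i)"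
  and "continuous_on UNIV (%x. Gr g ((1 / l x) *R (x - p x)) (p x) (l x) (%k. p' k x) (l' x) i $ m)"
proof -
 have "continuous_on UNIV (%x. \<chi> k. p x $ k)" by (intro continuous_on_vec_lambda C1_cont[OF p])
 hence cp: "continuous_on UNIV p" by simp
 have cl: "continuous_on UNIV l" by (rule C1_cont[OF l(1)])
 have cd: "continuous_on UNIV (%x. (1 / l x) *R (x - p x))"
  using l(2)[THEN less_imp_neq, symmetric] by (intro continuous_intros cp cl) auto
 have cp': "continuous_on UNIV (%x. \<chi> k. p' k x $ m)" for m by (intro continuous_on_vec_lambda C1_contI[OF p])
 show F: "continuous_on UNIV (%x. Fr u ((1 / l x) *R (x - p x)) (p x) (l x) i)"
  by (rule Fr_continuous[OF ad cp cl l(2) cd])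
 show G: "continuous_on UNIV (%x. Gr g ((1 / l x) *R (x - p x)) (p x) (l x) (%k. p' k x) (l' x) i $ m)" for m
  unfolding Gr_def vec_lambda_beta
  by (intro continuous_intros Wr_continuous[OF ad cp cl l(2)] Sr_continuous[OF ad cp cl l(2) cd cp' C1_contI[OF l(1)]])
 show "wd X (%x. Fr u ((1 / l x) *R (x - p x)) (p x) (l x) i) (%x. Gr g ((1 / l x) *R (x - p x)) (p x) (l x) (%k. p' k x) (l' x) i)"
 proof (rule wd_classical[OF F G])
  fix x and m :: 3 assume x: "x \<in> X"
  define e :: "real^3" where "e = axis m 1"
  have d1: "((%t. x + t *R e) has_vector_derivative e) (at t)" for t by (auto intro!: derivative_eq_intros)
  have d2: "((%t. p (x + t *R e)) has_vector_derivative (\<chi> k. p' k (x + t *R e) $ m)) (at t)" for t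
   unfolding e_def by (rule vector_derivative_components[OF C1_partial[OF p]])
  have d3: "((%t. l (x + t *R e)) has_real_derivative l' (x + t *R e) $ m) (at t)" for t
   unfolding e_def by (rule C1_partial[OF l(1)])
  have c1: "continuous_on UNIV (%t. x + t *R e)" by (intro continuous_intros)
  have c2: "continuous_on UNIV (%t. \<chi> k. p' k (x + t *R e) $ m)" "continuous_on UNIV (%t. l' (x + t *R e) $ m)"
   by (rule continuous_on_compose2[OF cp' c1] continuous_on_compose2[OF C1_contI[OF l(1)] c1]; simp)+
  have "cball (p (x + 0 *R e)) (l (x + 0 *R e)) \<subseteq> V" using V[OF x] by simp
  from Fr_curve_deriv[OF ad d1 d2 c2(1) d3 c2(2) l(2) this, of i]
  show "((%t. Fr u ((1 / l (x + t *R axis m 1)) *R (x + t *R axis m 1 - p (x + t *R axis m 1))) (p (x + t *R axis m 1)) (l (x + t *R axis m 1)) i)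
   has_real_derivative Gr g ((1 / l x) *R (x - p x)) (p x) (l x) (%k. p' k x) (l' x) i $ m) (at 0)"
   by (simp add: Gr_def e_def axis_def if_distrib cong: if_cong)
 qed
qed

text \<open>Admits a radius that vanishes: positive radii with classical derivatives approximate it,
  and the weak identity passes to the limit. The geometric data converge pointwise with uniform
  bounds, the averages through uniform Schur bounds.\<close>

lemma Fr_wd_limit:
 assumes ad: "adm V u g" and X: "X \<in> sets borel"
  and pn: "!!n k. C1 (%x. pn n x $ k) (pn' n k)" and qn: "!!n. C1 (qn n) (qn' n)" "!!n x. qn n x > 0"
  and V: "!!n x. x \<in> X ==> cball (pn n x) (qn n x) \<subseteq> V"
  and lim: "!!x. x \<in> X ==> (%n. pn n x) \<longlonglongrightarrow> p x" "!!x. x \<in> X ==> (%n. qn n x) \<longlonglongrightarrow> l x"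
   "!!x k. x \<in> X ==> (%n. pn' n k x) \<longlonglongrightarrow> p' k x" "!!x. x \<in> X ==> (%n. qn' n x) \<longlonglongrightarrow> l' x"
   "!!x. x \<in> X ==> (%n. (1 / qn n x) *R (x - pn n x)) \<longlonglongrightarrow> d x"
  and m: "p \<in> bmb" "l \<in> bmb" "!!k. p' k \<in> bmb"
   "l' \<in> bmb" "d \<in> bmb"
  and b: "!!n x. x \<in> X ==> norm ((1 / qn n x) *R (x - pn n x)) <= M" "!!n k x. x \<in> X ==> norm (pn' n k x) <= M"
   "!!n x. x \<in> X ==> norm (qn' n x) <= M"
  and s: "!!n. schur X (pn n) (qn n) C" "schur X p l C" "C >= 0" and l0: "!!x. x \<in> X ==> l x >= 0"
 shows "wd X (%x. Fr u (d x) (p x) (l x) i) (%x. Gr g (d x) (p x) (l x) (%k. p' k x) (l' x) i)"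
proof -
 let ?dn = "%n x. (1 / qn n x) *R (x - pn n x)"
 have "continuous_on UNIV (%x. \<chi> k. pn n x $ k)" for n by (intro continuous_on_vec_lambda C1_cont[OF pn])
 hence cp: "continuous_on UNIV (pn n)" for n by simp
 note [measurable] = m
 have mm[measurable]: "pn n \<in> bmb" "qn n \<in> bmb" "pn' n k \<in> bmb" "qn' n \<in> bmb" for n k
  using cp C1_borel[OF qn(1)] C1_borel(2)[OF pn] by (auto intro: borel_measurable_continuous_onI)
 have comp: "\<bar>y $ j\<bar> <= M" if "norm y <= M" for y :: "real^3" and j
  using component_le_norm_cart[of y j] that by linarith
 have cd: "coef X (%n x. ?dn n x $ j) (%x. d x $ j)" for j
 proof (rule coefI[where M = M])
  show "(%x. ?dn n x $ j) \<in> bmb" for n by measurable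
  show "(%x. d x $ j) \<in> bmb" by measurable
  show "\<bar>?dn n x $ j\<bar> <= M" if "x \<in> X" for n x by (rule comp[OF b(1)[OF that]])
  show "(%n. ?dn n x $ j) \<longlonglongrightarrow> d x $ j" if "x \<in> X" for x by (rule tendsto_vec_nth[OF lim(5)[OF that]])
 qed
 have cp': "coef X (%n x. pn' n k x $ j) (%x. p' k x $ j)" for k j
 proof (rule coefI[where M = M])
  show "(%x. pn' n k x $ j) \<in> bmb" for n by measurable
  show "(%x. p' k x $ j) \<in> bmb" by measurable
  show "\<bar>pn' n k x $ j\<bar> <= M" if "x \<in> X" for n x by (rule comp[OF b(2)[OF that]])
  show "(%n. pn' n k x $ j) \<longlonglongrightarrow> p' k x $ j" if "x \<in> X" for x by (rule tendsto_vec_nth[OF lim(3)[OF that]])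
 qed
 have cl': "coef X (%n x. qn' n x $ j) (%x. l' x $ j)" for j
 proof (rule coefI[where M = M])
  show "(%x. qn' n x $ j) \<in> bmb" for n by measurable
  show "(%x. l' x $ j) \<in> bmb" by measurable
  show "\<bar>qn' n x $ j\<bar> <= M" if "x \<in> X" for n x by (rule comp[OF b(3)[OF that]])
  show "(%n. qn' n x $ j) \<longlonglongrightarrow> l' x $ j" if "x \<in> X" for x by (rule tendsto_vec_nth[OF lim(4)[OF that]])
 qed
 have SA: "sconv X (%n x. A k v (pn n x) (qn n x)) (%x. A k v (p x) (l x))" if "kern k" "integrable lborel v" for k v
  by (rule sconv_A[OF that X mm(1,2) m(1,2) lim(1,2) s qn(2) l0])
 have SAe: "sconv X (%n x. Ae k g (pn n x) (qn n x) i j) (%x. Ae k g (p x) (l x) i j)" if "kern k" for k i j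
  unfolding Ae_def by (intro sconv_half sconv_add SA that admD(3)[OF ad])
 have F: "sconv X (%n x. Fr u (?dn n x) (pn n x) (qn n x) i) (%x. Fr u (d x) (p x) (l x) i)"
  unfolding Fr_def
  by (intro sconv_add sconv_half sconv_sum sconv_mult[OF cd] sconv_diff SA kern_kap kern_dkap admD(2)[OF ad])
 have G: "sconv X (%n x. Gr g (?dn n x) (pn n x) (qn n x) (%k. pn' n k x) (qn' n x) i $ r) (%x. Gr g (d x) (p x) (l x) (%k. p' k x) (l' x) i $ r)" for r
  unfolding Gr_def Wr_def Sr_def vec_lambda_beta
  by (intro sconv_add sconv_diff sconv_half sconv_sum sconv_mult[OF cd] sconv_mult[OF cp'] sconv_mult[OF cl'] sconv_cmult[of X _ _ 2]
   SA SAe kern_kap kern_dkap kern_zkap kern_zdkap admD(3)[OF ad])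
 show ?thesis
  unfolding wd_def
 proof (intro allI impI)
  fix ph ph' r assume t: "ctest X ph ph'"
  then obtain K where K: "compact K" "K \<subseteq> X" "!!x. x ~: K ==> ph x = 0" "!!x. x ~: K ==> ph' x = 0" "C1 ph ph'"
   by (elim ctestE) blast
  have e: "\<exists>K. compact K & K \<subseteq> X & (\<forall>x. x ~: K --> ph' x $ r = 0)" "\<exists>K. compact K & K \<subseteq> X & (\<forall>x. x ~: K --> ph x = 0)"
   using K by (auto intro!: exI[of _ K])
  have 1: "(%n. (LB x. Fr u (?dn n x) (pn n x) (qn n x) i * ph' x $ r)) \<longlonglongrightarrow> (LB x. Fr u (d x) (p x) (l x) i * ph' x $ r)"
   using sconv_dconv[OF F] C1_contI[OF K(5)] e(1) unfolding dconv_def by blast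
  have 2: "(%n. (LB x. Gr g (?dn n x) (pn n x) (qn n x) (%k. pn' n k x) (qn' n x) i $ r * ph x)) \<longlonglongrightarrow> (LB x. Gr g (d x) (p x) (l x) (%k. p' k x) (l' x) i $ r * ph x)"
   using sconv_dconv[OF G] C1_cont[OF K(5)] e(2) unfolding dconv_def by blast
  have 3: "(LB x. Fr u (?dn n x) (pn n x) (qn n x) i * ph' x $ r) = - (LB x. Gr g (?dn n x) (pn n x) (qn n x) (%k. pn' n k x) (qn' n x) i $ r * ph x)" for n
   using Fr_wd(1)[OF ad pn qn V, of X n i] t unfolding wd_def by blast
  show "(LB x. Fr u (d x) (p x) (l x) i * ph' x $ r) = - (LB x. Gr g (d x) (p x) (l x) (%k. p' k x) (l' x) i $ r * ph x)"
   by (rule LIMSEQ_unique[OF 1[unfolded 3] tendsto_minus[OF 2]])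
 qed
qed

lemma Fr_rigid_zero_scale: "Fr u d p 0 i = u p $ i"
 by (simp add: Fr_def A_zero_scale integral_kap integral_dkap)

text \<open>At radius 0, with the centre moving like x itself, skew and symmetric halves recombine
  to the given gradient, since the kernels \<open>dkap\<close> have integral 0. Off the hole the
  gradient field is therefore the original one.\<close>

lemma Gr_zero_scale:
 assumes "!!k m. p' k $ m = (if k = m then 1 else 0)" "l' = 0"
 shows "Gr g d p 0 p' l' i = g p $ i"
proof -
 have K: "Ae kap g p 0 a b = (g p $ a $ b + g p $ b $ a) / 2" and D: "Ae (dkap j) g p 0 a b = 0" for a b j
  by (simp_all add: Ae_def A_zero_scale integral_kap integral_dkap)
 have S0: "Sr g d p 0 (\<chi> k. p' k $ m) (l' $ m) i = (\<Sum>k\<in>UNIV. (if k = m then 1 else 0) * ((g p $ i $ k + g p $ k $ i) / 2))" for m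
  unfolding Sr_def vec_lambda_beta assms D K by simp
 have dl: "(\<Sum>k\<in>UNIV. (if k = m then 1 else 0) * f k) = f m" for f :: "3 => real" and m
  by (simp add: if_distrib[of "%x. x * _"] cong: if_cong)
 have "Sr g d p 0 (\<chi> k. p' k $ m) (l' $ m) i = (g p $ i $ m + g p $ m $ i) / 2" for m
  by (rule trans[OF S0 dl])
 moreover have "Wr g p 0 i m = (g p $ i $ m - g p $ m $ i) / 2" for m
  by (simp add: Wr_def A_zero_scale integral_kap)
 ultimately have "Wr g p 0 i m + Sr g d p 0 (\<chi> k. p' k $ m) (l' $ m) i = g p $ i $ m" for m
  by (simp add: add_divide_distrib diff_divide_distrib)
 thus ?thesis by (simp add: Gr_def vec_eq_iff)
qed

text \<open>The skew \<open>Wr\<close> cancels; 4 M is the sum of 3 M for the velocity of the centre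
  and M for that of the radius.\<close>

lemma Gr_symm_bound:
 assumes ad: "adm V u g" and l: "l > 0" and b: "norm d <= M" "!!k. norm (p' k) <= M" "norm l' <= M"
 shows "\<bar>(Gr g d p l p' l' i $ j + Gr g d p l p' l' j $ i) / 2\<bar> <= cS * (4 * M) * (1 + M) * sqrt (Er g p l)"
proof -
 have M: "M >= 0" using b(3) norm_ge_zero order_trans by blast
 have S: "\<bar>Sr g d p l (\<chi> k. p' k $ m) (l' $ m) i\<bar> <= cS * (4 * M) * (1 + M) * sqrt (Er g p l)" for i m
 proof -
  have "norm (\<chi> k. p' k $ m) <= (\<Sum>k\<in>UNIV. \<bar>(\<chi> k. p' k $ m) $ k\<bar>)" by (rule norm_le_l1_cart)
  also have "... <= (\<Sum>k\<in>(UNIV::3 set). M)"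
   using b(2) component_le_norm_cart order_trans by (intro sum_mono) fastforce
  finally have n: "norm (\<chi> k. p' k $ m) <= 3 * M" by simp
  have "\<bar>l' $ m\<bar> <= M" using b(3) component_le_norm_cart order_trans by blast
  with n have "norm (\<chi> k. p' k $ m) + \<bar>l' $ m\<bar> <= 4 * M" by linarith
  hence "cS * (norm (\<chi> k. p' k $ m) + \<bar>l' $ m\<bar>) * (1 + norm d) * sqrt (Er g p l) <= cS * (4 * M) * (1 + M) * sqrt (Er g p l)"
   using b(1) M cS_nonneg Er_nonneg by (intro mult_mono mult_nonneg_nonneg) auto
  thus ?thesis using Sr_bound[OF ad l, of d p "\<chi> k. p' k $ m" "l' $ m" i] by linarith
 qed
 have "(Gr g d p l p' l' i $ j + Gr g d p l p' l' j $ i) / 2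
  = (Sr g d p l (\<chi> k. p' k $ j) (l' $ j) i + Sr g d p l (\<chi> k. p' k $ i) (l' $ i) j) / 2"
  by (simp add: Gr_def Wr_def add_divide_distrib diff_divide_distrib)
 moreover have "\<bar>(a + b) / 2\<bar> <= B" if "\<bar>a\<bar> <= B" "\<bar>b\<bar> <= B" for a b B :: real
  using that unfolding abs_le_iff by (auto simp: field_simps)
 ultimately show ?thesis using S[of j i] S[of i j] by metis
qed

section \<open>Planar geometry\<close>

text \<open>A uniform exterior cone: from any point near b outside D, directions close to N lead out
  of the closure of D. N is the upward direction of the local graph.\<close>

lemma lipschitz_boundary_cone:
 assumes D: "lipschitz_boundary D" and b: "b \<in> frontier D"
 obtains N r c where "norm N = 1" "r > 0" "c > 0"
  "!!w t v. w \<in> ball b r ==> w ~: D ==> 0 < t ==> t < r ==> norm (v - N) < c ==> w + t *R v ~: closure D"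
proof -
 obtain R :: "real^2 => real^2" and \<delta> L :: real and g :: "real => real" where R: "orthogonal_transformation R" and \<delta>: "\<delta> > 0" and g: "L-lipschitz_on UNIV g"
  and D': "!!x. \<bar>R (x - b) $ 1\<bar> < \<delta> ==> \<bar>R (x - b) $ 2\<bar> < \<delta> ==> x \<in> D \<longleftrightarrow> R (x - b) $ 2 < g (R (x - b) $ 1)"
  using D b unfolding lipschitz_boundary_def by metis
 have L: "L >= 0" by (rule lipschitz_on_nonneg[OF g])
 have lin: "linear R" and nR: "!!x. norm (R x) = norm x" using R by (auto simp: orthogonal_transformation)
 obtain N where N: "R N = axis 2 1" using orthogonal_transformation_surj[OF R] by (metis surjD)
 have N1: "norm N = 1" using nR[of N] N by simp
 \<comment> \<open>Aperture with c (1 + L) = 1/2: the vertical gain 1 - c then exceeds the possible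
   rise L c of the graph.\<close>
 define c where "c = 1 / (2 + 2 * L)"
 have c: "c > 0" "c <= 1" "c * (1 + L) < 1" using L by (auto simp: c_def field_simps)
 define r where "r = \<delta> / 4"
 have r: "r > 0" using \<delta> by (simp add: r_def)
 have box: "\<bar>R (x - b) $ i\<bar> < \<delta>" if "x \<in> ball b \<delta>" for x i
  using component_le_norm_cart[of "R (x - b)" i] nR[of "x - b"] that by (simp add: dist_norm norm_minus_commute)
 \<comment> \<open>The part strictly above the graph is open and disjoint from D, hence from the
   closure of D. Membership in it excludes the closure and not just D.\<close>
 define O' where "O' = {x. g (R (x - b) $ 1) < R (x - b) $ 2} \<inter> ball b \<delta>"
 have cg: "continuous_on UNIV g" using g by (rule lipschitz_on_continuous_on)
 have cR: "continuous_on UNIV (%x. R (x - b) $ i)" for i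
  by (intro continuous_intros linear_continuous_on_compose[OF _ lin])
 have "continuous_on UNIV (%x. g (R (x - b) $ 1))" by (rule continuous_on_compose2[OF cg cR]) simp
 hence oO: "open O'" unfolding O'_def by (intro open_Int open_Collect_less cR) auto
 have disj: "O' \<inter> D = {}" using D' box unfolding O'_def by fastforce
 have "w + t *R v ~: closure D"
  if w: "w \<in> ball b r" "w ~: D" and t: "0 < t" "t < r" and v: "norm (v - N) < c" for w t v
 proof -
  have Rv: "R v = axis 2 1 + R (v - N)" using linear_diff[OF lin, of v N] N by simp
  have nv: "norm v <= 2" using norm_triangle_ineq[of N "v - N"] N1 v c by simp
  have "norm (w + t *R v - b) <= norm (w - b) + t * norm v" using norm_triangle_ineq[of "w - b" "t *R v"] t by (simp add: algebra_simps)
  also have "... < r + r * 2" using w t nv r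
   by (intro add_strict_mono) (auto simp: dist_norm norm_minus_commute intro: le_less_trans[OF mult_left_mono[OF nv]])
  finally have xb: "w + t *R v \<in> ball b \<delta>" using r by (simp add: r_def dist_norm norm_minus_commute)
  have wb: "w \<in> ball b \<delta>" using w r by (auto simp: r_def)
  have e: "R (w + t *R v - b) = R (w - b) + t *R R v"
  proof -
   have "w + t *R v - b = (w - b) + t *R v" by simp
   thus ?thesis by (simp only: linear_add[OF lin] linear_scale[OF lin])
  qed
  have v1: "\<bar>R v $ 1\<bar> < c" using component_le_norm_cart[of "R (v - N)" 1] nR[of "v - N"] v by (simp add: Rv axis_def)
  have v2: "R v $ 2 > 1 - c" using component_le_norm_cart[of "R (v - N)" 2] nR[of "v - N"] v by (simp add: Rv axis_def)
  have "R (w - b) $ 2 >= g (R (w - b) $ 1)" using D'[OF box[OF wb] box[OF wb]] w(2) by simp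
  moreover have "g (R (w - b) $ 1 + t * R v $ 1) <= g (R (w - b) $ 1) + L * (t * c)"
  proof -
   have "\<bar>g (R (w - b) $ 1 + t * R v $ 1) - g (R (w - b) $ 1)\<bar> <= L * \<bar>t * R v $ 1\<bar>"
   using lipschitz_onD[OF g, of "R (w - b) $ 1 + t * R v $ 1" "R (w - b) $ 1"] by (simp add: dist_real_def)
   also have "... <= L * (t * c)" using v1 t L by (intro mult_left_mono) (auto simp: abs_mult)
   finally show ?thesis by linarith
  qed
  moreover have "t * (1 - c) < t * R v $ 2" using v2 t by simp
  moreover have "L * (t * c) < t * (1 - c)"
  proof -
   have "t * (c * (1 + L)) < t * 1" using c t by (intro mult_strict_left_mono) auto
   thus ?thesis by (simp add: algebra_simps)
  qed
  ultimately have "g (R (w + t *R v - b) $ 1) < R (w + t *R v - b) $ 2" by (simp add: e)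
  hence "w + t *R v \<in> O'" using xb by (simp add: O'_def)
  thus ?thesis using open_Int_closure_eq_empty[OF oO] disj by blast
 qed
 thus ?thesis using that N1 r c by blast
qed

lemma isCont_under_integral:
 fixes K :: "'a::metric_space => 'b => 'c::{banach, second_countable_topology}"
 assumes v: "integrable M v" and d: "0 < d"
  and c: "!!y. y \<in> space M ==> isCont (%x. K x y) x0"
  and B: "!!x y. x \<in> ball x0 d ==> y \<in> space M ==> norm (K x y) <= B"
  and meas[measurable]: "!!x. x \<in> ball x0 d ==> K x \<in> borel_measurable M"
 shows "isCont (%x. \<integral>y. (v y :: real) *R K x y \<partial>M) x0"
 unfolding continuous_at_sequentially
proof (intro allI impI)
 fix X assume X: "X \<longlonglongrightarrow> x0"
 have [measurable]: "v \<in> borel_measurable M" using v by auto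
 have x0: "x0 \<in> ball x0 d" using d by simp
 have ev: "\<forall>\<^sub>F n in sequentially. X n \<in> ball x0 d"
  using X d by (metis centre_in_ball open_ball topological_tendstoD)
 define Z where "Z n = (if X n \<in> ball x0 d then X n else x0)" for n
 have Zb: "Z n \<in> ball x0 d" for n using x0 by (simp add: Z_def)
 have Z: "Z \<longlonglongrightarrow> x0"
  by (rule Lim_transform_eventually[OF X]) (use ev in \<open>auto simp: Z_def elim!: eventually_mono\<close>)
 have "(%n. \<integral>y. v y *R K (Z n) y \<partial>M) \<longlonglongrightarrow> (\<integral>y. v y *R K x0 y \<partial>M)"
 proof (rule integral_dominated_convergence[where w = "%y. \<bar>v y\<bar> * \<bar>B\<bar>"])
  show "integrable M (%y. \<bar>v y\<bar> * \<bar>B\<bar>)" using v by simp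
  show "AE y in M. (%n. v y *R K (Z n) y) \<longlonglongrightarrow> v y *R K x0 y"
   using isCont_tendsto_compose[OF c Z] by (intro AE_I2 tendsto_intros) auto
  show "AE y in M. norm (v y *R K (Z n) y) <= \<bar>v y\<bar> * \<bar>B\<bar>" for n
  proof (rule AE_I2)
   fix y assume "y \<in> space M"
   from B[OF Zb this] have "norm (K (Z n) y) <= \<bar>B\<bar>" by (rule order_trans) simp
   thus "norm (v y *R K (Z n) y) <= \<bar>v y\<bar> * \<bar>B\<bar>" by (simp add: mult_left_mono)
  qed
  show "(%y. v y *R K (Z n) y) \<in> borel_measurable M" for n using meas[OF Zb] by measurable
  show "(%y. v y *R K x0 y) \<in> borel_measurable M" using meas[OF x0] by measurable
 qed
 thus "((%x. \<integral>y. v y *R K x y \<partial>M) \<circ> X) \<longlonglongrightarrow> (\<integral>y. v y *R K x0 y \<partial>M)"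
  by (rule Lim_transform_eventually) (use ev in \<open>auto simp: Z_def elim!: eventually_mono\<close>)
qed

lemma measure_cball2: "r >= 0 ==> measure lborel (cball (x::real^2) r) = unit_ball_vol 2 * r\<^sup>2"
 using content_cball[of r x] by (simp add: measure_completion)

text \<open>The weight makes the integrand invariant under scaling, so that the integral over the plane
 scales like the squared distance.\<close>

lemma ex_regularised_distance:
 fixes D :: "(real^2) set"
 assumes D: "open D" "bounded D"
 shows "\<exists>Q Q' c1 c2 c3. C1 Q Q' & 0 < c1 & 0 < c2 & 0 < c3 &
  (\<forall>x. c1 * (infdist x (- D))\<^sup>2 <= Q x & Q x <= c2 * (infdist x (- D))\<^sup>2 & norm (Q' x) <= c3 * infdist x (- D))"
proof -
 define d where "d x = infdist x (- D)" for x
 have ne: "- D ~= {}" using D(2) not_bounded_UNIV by (metis Compl_empty_eq double_complement)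
 have d0: "d x >= 0" for x by (simp add: d_def infdist_nonneg)
 have dD: "d x > 0" if "x \<in> D" for x
  using infdist_pos_not_in_closed[of "- D" x] D(1) ne that by (simp add: d_def closed_def)
 have dnD: "d x = 0" if "x ~: D" for x using that by (simp add: d_def)
 have tri: "d x <= d y + dist x y" for x y unfolding d_def by (rule infdist_triangle)
 have dc: "continuous_on UNIV d" unfolding d_def[abs_def] by (intro continuous_intros)
 have [measurable]: "d \<in> bmb" by (rule borel_measurable_continuous_onI[OF dc])
 have [measurable]: "D \<in> sets borel" using D by auto
 \<comment> \<open>The positive part of q is supported, as a function of x, in the ball of radius d
   y / 2 about y. Squaring it makes it C1 across the edge.\<close>
 define q where "q x y = 1 - 4 * ((y - x) \<bullet> (y - x)) / (d y)\<^sup>2" for x y :: "real^2"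
 define J where "J x y = (max 0 (q x y))\<^sup>2" for x y :: "real^2"
 define J' where "J' x y = (2 * max 0 (q x y) * (8 / (d y)\<^sup>2)) *R (y - x)" for x y :: "real^2"
 have J01: "0 <= J x y" "J x y <= 1" for x y
  by (auto simp: J_def q_def intro!: power_le_one)
 have supp: "dist x y < d y / 2 & dist x y <= d x & 2 / 3 * d x <= d y" if "y \<in> D" "q x y > 0" for x y
 proof -
  have "4 * (norm (y - x))\<^sup>2 < (d y)\<^sup>2" using that dD[OF that(1)] by (simp add: q_def power2_norm_eq_inner field_simps)
  hence "(2 * norm (y - x))\<^sup>2 < (d y)\<^sup>2" by (simp add: power_mult_distrib)
  hence "2 * norm (y - x) < d y" using d0 power_less_imp_less_base by blast
  hence 1: "dist x y < d y / 2" by (simp add: dist_norm norm_minus_commute)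
  with tri[of y x] tri[of x y] show ?thesis by (simp add: dist_commute)
 qed
 have J'b: "norm (J' x y) <= 12 / d x * indicator (cball x (d x)) y" if "y \<in> D" "x \<in> D" for x y
 proof (cases "q x y > 0")
  case True
  note s = supp[OF that(1) True]
  have dy: "d y > 0" by (rule dD[OF that(1)])
  have "norm (J' x y) = 2 * max 0 (q x y) * (8 / (d y)\<^sup>2) * dist x y" by (simp add: J'_def dist_norm norm_minus_commute)
  also have "... <= 2 * 1 * (8 / (d y)\<^sup>2) * (d y / 2)"
   using s dy by (intro mult_mono) (auto simp: q_def)
  also have "... = 8 / d y" using dy by (simp add: power2_eq_square)
  also have "... <= 8 / (2 / 3 * d x)" using s dD[OF that(2)] by (intro divide_left_mono) auto
  finally show ?thesis using s by simp
 next
  case False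
  thus ?thesis using d0[of x] by (simp add: J'_def max_def)
 qed
 define Q where "Q x = (LB y. J x y * indicator D y)" for x
 define Q' where "Q' x = (if x \<in> D then (LB y. indicat_real D y *R J' x y) else 0)" for x
 let ?u = "unit_ball_vol 2"
 have u: "?u > 0" by (rule unit_ball_vol_pos) simp
 have iD: "intb (indicat_real D)"
  using emeasure_bounded_finite[OF D(2)] by (intro integrable_real_indicator) auto
 have cbi: "intb (indicat_real (cball (x::real^2) r))" for x r
  using emeasure_lborel_cball_finite[of x r] by (intro integrable_real_indicator) auto
 have JDi: "intb (%y. J x y * indicat_real D y)" for x
  by (rule integrable_mult_bounded(2)[OF iD, of _ 1]) (use J01 in \<open>auto simp: J_def q_def\<close>)
 have up: "Q x <= ?u * (d x)\<^sup>2" for x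
 proof -
  have "Q x <= (LB y. indicat_real (cball x (d x)) y)" unfolding Q_def
  proof (rule integral_mono[OF JDi cbi])
   fix y show "J x y * indicat_real D y <= indicat_real (cball x (d x)) y"
   proof (cases "y \<in> D & q x y > 0")
   case True
   thus ?thesis using supp[of y x] J01[of x y] by simp
   qed (auto simp: J_def max_def)
  qed
  thus ?thesis using measure_cball2[OF d0, of x x] by simp
 qed
 \<comment> \<open>On the ball of radius d x / 4 the triangle inequality gives d y >= 3/4 d x, hence
   q >= 5/9. The constant is (5/9)^2 times the area of that ball.\<close>
 have low: "25 / 81 * (?u / 16) * (d x)\<^sup>2 <= Q x" for x
 proof (cases "x \<in> D")
  case True
  have "(LB y. 25 / 81 * indicat_real (cball x (d x / 4)) y) <= Q x" unfolding Q_def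
  proof (rule integral_mono[OF _ JDi])
   show "intb (%y. 25 / 81 * indicat_real (cball x (d x / 4)) y)" using cbi by simp
   fix y show "25 / 81 * indicat_real (cball x (d x / 4)) y <= J x y * indicat_real D y"
   proof (cases "y \<in> cball x (d x / 4)")
   case True
   have dx: "d x > 0" by (rule dD[OF \<open>x \<in> D\<close>])
   have dy: "d y >= 3 / 4 * d x" using tri[of x y] True by simp
   have yD: "y \<in> D" using dnD[of y] dy dx by (cases "y \<in> D") auto
   have "(y - x) \<bullet> (y - x) <= (d x / 4)\<^sup>2" unfolding power2_norm_eq_inner[symmetric] using True
   by (intro power_mono) (auto simp: dist_norm norm_minus_commute)
   hence "4 * ((y - x) \<bullet> (y - x)) / (d y)\<^sup>2 <= 4 * (d x / 4)\<^sup>2 / (3 / 4 * d x)\<^sup>2"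
   using dx dy by (intro frac_le power_mono) auto
   also have "... = 4 / 9" using dx by (simp add: power2_eq_square)
   finally have "q x y >= 5 / 9" by (simp add: q_def)
   hence "(max 0 (q x y))\<^sup>2 >= (5 / 9)\<^sup>2" by (intro power_mono) auto
   thus ?thesis using True yD by (simp add: J_def power2_eq_square)
   qed (use J01 in auto)
  qed
  thus ?thesis using measure_cball2[of "d x / 4" x] d0[of x] by (simp add: power_divide)
 next
  case False
  have "Q x >= 0" unfolding Q_def by (rule Bochner_Integration.integral_nonneg) (use J01 in auto)
  thus ?thesis using dnD[OF False] by simp
 qed
 have mJ': "J' x \<in> bmb" for x unfolding J'_def q_def by measurable
 have Q'b: "norm (Q' x) <= 12 * ?u * d x" for x
 proof (cases "x \<in> D")
  case True
  have dx: "d x > 0" by (rule dD[OF True])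
  have "norm (Q' x) <= (LB y. norm (indicat_real D y *R J' x y))"
   using True integral_norm_bound[of lborel "%y. indicat_real D y *R J' x y"] by (simp only: Q'_def if_True)
  also have "... <= (LB y. 12 / d x * indicat_real (cball x (d x)) y)"
  proof (rule integral_mono')
   show "intb (%y. 12 / d x * indicat_real (cball x (d x)) y)" by (intro integrable_mult_right cbi)
   show "norm (indicat_real D y *R J' x y) <= 12 / d x * indicat_real (cball x (d x)) y" for y
   using J'b[OF _ True, of y] dx by (cases "y \<in> D") simp_all
   show "0 <= 12 / d x * indicat_real (cball x (d x)) y" for y using dx by simp
  qed
  also have "... = 12 / d x * (?u * (d x)\<^sup>2)" using measure_cball2[OF d0, of x x] by simp
  also have "... = 12 * ?u * d x" using dx by (simp add: power2_eq_square)
  finally show ?thesis .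
 next
  case False
  thus ?thesis using dnD[OF False] by (simp add: Q'_def)
 qed
 have half: "d x >= d x0 / 2" "x \<in> D" if "x \<in> ball x0 (d x0 / 2)" "x0 \<in> D" for x x0
 proof -
  show *: "d x >= d x0 / 2" using tri[of x0 x] that by simp
  show "x \<in> D" using * dnD[of x] dD[OF that(2)] by (cases "x \<in> D") auto
 qed
 have J'b2: "norm (J' x y) <= 24 / d x0" if "x \<in> ball x0 (d x0 / 2)" "x0 \<in> D" "y \<in> D" for x x0 y
 proof -
  have "norm (J' x y) <= 12 / d x * 1"
   by (rule order_trans[OF J'b[OF that(3) half(2)[OF that(1,2)]]]) (use d0[of x] in \<open>simp add: indicator_def\<close>)
  also have "... <= 12 / (d x0 / 2) * 1" using half(1)[OF that(1,2)] dD[OF that(2)] by (intro mult_right_mono divide_left_mono) auto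
  finally show ?thesis by simp
 qed
 have der: "(Q has_derivative (%h. Q' x \<bullet> h)) (at x)" for x
 proof (cases "x \<in> D")
  case True
  let ?K = "%x y. if y \<in> D then J x y else 0" and ?K' = "%x y. if y \<in> D then J' x y else 0"
  have "((%x. (LB y. ?K x y * indicat_real D y)) has_derivative (%h. (LB y. indicat_real D y *R ?K' x y) \<bullet> h)) (at x)"
  proof (rule has_derivative_under_integral[OF iD, of "d x / 2"])
   show "0 < d x / 2" using dD[OF True] by simp
   fix z y assume z: "z \<in> ball x (d x / 2)"
   show "((%z. ?K z y) has_derivative (%h. ?K' z y \<bullet> h)) (at z)"
   proof (cases "y \<in> D")
   case y: True
   have dy: "(d y)\<^sup>2 ~= 0" using dD[OF y] by simp
   have "((%z. q z y) has_derivative (%h. 8 / (d y)\<^sup>2 * ((y - z) \<bullet> h))) (at z)"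
   unfolding q_def using dy by (auto intro!: derivative_eq_intros simp: inner_commute field_simps)
   from DERIV_compose_FDERIV[OF max_power_deriv[OF order_refl] this]
   have "((%z. J z y) has_derivative (%h. (8 / (d y)\<^sup>2 * ((y - z) \<bullet> h)) * (2 * max 0 (q z y)))) (at z)"
   by (simp add: J_def)
   thus ?thesis using y by (simp add: J'_def mult_ac)
   qed simp
   show "norm (?K' z y) <= 24 / d x" using J'b2[OF z True, of y] dD[OF True] by auto
  next
   show "\<bar>?K x y\<bar> <= 1" for y using J01[of x y] by auto
  next
   show "?K z \<in> borel_measurable lborel" for z unfolding J_def q_def by measurable
   show "?K' x \<in> borel_measurable lborel" using mJ' by measurable
  qed
  moreover have "(%y. ?K x y * indicat_real D y) = (%y. J x y * indicat_real D y)" "(%y. indicat_real D y *R ?K' x y) = (%y. indicat_real D y *R J' x y)" for x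
   by (auto simp: indicator_def)
  ultimately show ?thesis using True by (simp add: Q_def[abs_def] Q'_def)
 next
  case False
  have Qx: "Q x = 0" using up[of x] low[of x] dnD[OF False] by simp
  \<comment> \<open>Outside D the function is squeezed between 0 and a multiple of the squared
    distance to x, so the integrand, singular near the boundary, need not be analysed there.\<close>
  have "(Q has_derivative (%h. 0)) (at x)"
  proof (rule has_derivative_quadratic[where C = ?u])
   fix y
   have "0 <= Q y" unfolding Q_def by (rule Bochner_Integration.integral_nonneg) (use J01 in auto)
   moreover have "(d y)\<^sup>2 <= (norm (y - x))\<^sup>2" using tri[of y x] dnD[OF False] d0[of y]
   by (intro power_mono) (auto simp: dist_norm)
   hence "?u * (d y)\<^sup>2 <= ?u * (norm (y - x))\<^sup>2" using u by simp
   ultimately show "norm (Q y - Q x) <= ?u * (norm (y - x))\<^sup>2" using up[of y] unfolding Qx real_norm_def by linarith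
  qed
  thus ?thesis using False by (simp add: Q'_def)
 qed
 have "isCont Q' x" for x
 proof (cases "x \<in> D")
  case True
  let ?K' = "%x y. if y \<in> D then J' x y else 0"
  have "isCont (%x. (LB y. indicat_real D y *R ?K' x y)) x"
  proof (rule isCont_under_integral[OF iD, of "d x / 2"])
   show "0 < d x / 2" using dD[OF True] by simp
   show "isCont (%x. ?K' x y) x" for y unfolding J'_def q_def
   using dD[of y] by (cases "y \<in> D") (auto intro!: continuous_intros)
   show "norm (?K' z y) <= 24 / d x" if "z \<in> ball x (d x / 2)" for z y using J'b2[OF that True, of y] dD[OF True] by auto
   show "?K' z \<in> borel_measurable lborel" for z using mJ' by measurable
  qed
  moreover have "(%y. indicat_real D y *R ?K' x y) = (%y. indicat_real D y *R J' x y)" for x by (auto simp: indicator_def)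
  ultimately have "isCont (%x. (LB y. indicat_real D y *R J' x y)) x" by simp
  moreover have "\<forall>\<^sub>F z in nhds x. Q' z = (LB y. indicat_real D y *R J' z y)"
   using eventually_nhds_in_open[OF D(1) True] by eventually_elim (simp add: Q'_def)
  ultimately show ?thesis by (simp add: isCont_cong)
 next
  case False
  have "(Q' \<longlongrightarrow> 0) (at x)"
  proof (rule Lim_null_comparison)
   have "norm (Q' z) <= 12 * ?u * dist z x" for z
   using order_trans[OF Q'b[of z] mult_left_mono[of "d z" "dist z x" "12 * ?u"]] tri[of z x] dnD[OF False] u by simp
   thus "\<forall>\<^sub>F z in at x. norm (Q' z) <= 12 * ?u * dist z x" by simp
   have "((%z. 12 * ?u * dist z x) \<longlongrightarrow> 12 * ?u * dist x x) (at x)" by (intro tendsto_intros)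
   thus "((%z. 12 * ?u * dist z x) \<longlongrightarrow> 0) (at x)" by simp
  qed
  thus ?thesis using False by (simp add: isCont_def Q'_def)
 qed
 hence "C1 Q Q'" using der by (simp add: C1_def continuous_on_eq_continuous_at)
 moreover have "0 < 25 / 81 * (?u / 16)" "0 < 12 * ?u" using u by simp_all
 ultimately show ?thesis using up low Q'b u unfolding d_def[symmetric] by blast
qed

lemma C1_local:
 assumes "!!x. \<exists>U h h'. open U & x \<in> U & C1 h h' & (\<forall>y\<in>U. f y = h y & f' y = h' y)"
 shows "C1 f f'"
 unfolding C1_def
proof (intro conjI allI)
 fix x
 obtain U h h' where U: "open U" "x \<in> U" "C1 h h'" "\<forall>y\<in>U. f y = h y & f' y = h' y" using assms[of x] by blast
 show "(f has_derivative (%k. f' x \<bullet> k)) (at x)"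
 proof -
  have "(f has_derivative (%k. h' x \<bullet> k)) (at x)"
   by (rule has_derivative_transform_within_open[OF C1_D[OF U(3)] U(1,2)]) (use U(4) in auto)
  thus ?thesis using U(2,4) by simp
 qed
next
 have "isCont f' x" for x
 proof -
  obtain U h h' where U: "open U" "x \<in> U" "C1 h h'" "\<forall>y\<in>U. f y = h y & f' y = h' y" using assms[of x] by blast
  have "isCont h' x" using C1_cont'[OF U(3)] by (simp add: continuous_on_eq_continuous_at)
  moreover have "\<forall>\<^sub>F y in nhds x. f' y = h' y"
   using eventually_nhds_in_open[OF U(1,2)] by eventually_elim (use U(4) in blast)
  ultimately show ?thesis by (simp add: isCont_cong)
 qed
 thus "continuous_on UNIV f'" by (simp add: continuous_on_eq_continuous_at)
qed

lemma C1_sqrt: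
 assumes f: "C1 f f'" and pos: "!!x. f x > 0"
 shows "C1 (%x. sqrt (f x)) (%x. (1 / (2 * sqrt (f x))) *R f' x)"
proof -
 have "((%x. sqrt (f x)) has_derivative (%h. (1 / (2 * sqrt (f x))) *R f' x \<bullet> h)) (at x)" for x
  using DERIV_compose_FDERIV[OF DERIV_real_sqrt[OF pos] C1_D[OF f]]
  by (simp add: inverse_eq_divide mult.commute field_simps)
 moreover have "continuous_on UNIV (%x. (1 / (2 * sqrt (f x))) *R f' x)"
  using pos[THEN less_imp_neq, symmetric] by (intro continuous_intros C1_cont[OF f] C1_cont'[OF f]) auto
 ultimately show ?thesis by (simp add: C1_def)
qed

text \<open>The adjoint of \<open>hat\<close>: it turns gradients of planar functions into gradients
  in space.\<close>

definition hatT :: "real^2 => real^3" where "hatT y = vector [y $ 1, y $ 2, 0]"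

lemma hat_nth [simp]: "hat x $ 1 = x $ 1" "hat x $ 2 = x $ 2"
 by (simp_all add: hat_def)

lemma hatT_nth [simp]: "hatT y $ 1 = y $ 1" "hatT y $ 2 = y $ 2" "hatT y $ 3 = 0"
 by (simp_all add: hatT_def)

lemma vec2_eq: "(x :: real^2) = y \<longleftrightarrow> x $ 1 = y $ 1 & x $ 2 = y $ 2"
 by (simp add: vec_eq_iff forall_2)

lemma vec3_eq: "(x :: real^3) = y \<longleftrightarrow> x $ 1 = y $ 1 & x $ 2 = y $ 2 & x $ 3 = y $ 3"
 by (simp add: vec_eq_iff forall_3)

lemma hat_linear: "linear hat"
 by (simp add: linear_iff vec2_eq)

lemma hat_add: "hat (x + y) = hat x + hat y" and hat_scale: "hat (r *R x) = r *R hat x" and hat_diff: "hat (x - y) = hat x - hat y"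
 by (simp_all add: vec2_eq)

lemma hat_hatT [simp]: "hat (hatT y) = y"
 by (simp add: vec2_eq)

lemma norm_sq2: "(norm (x :: real^2))\<^sup>2 = (x $ 1)\<^sup>2 + (x $ 2)\<^sup>2"
 by (simp add: norm_vec_def L2_set_def sum_2)

lemma norm_sq3: "(norm (x :: real^3))\<^sup>2 = (x $ 1)\<^sup>2 + (x $ 2)\<^sup>2 + (x $ 3)\<^sup>2"
 by (simp add: norm_vec_def L2_set_def sum_3)

lemma norm_hat_le: "norm (hat x) <= norm x"
 by (rule power2_le_imp_le) (simp_all add: norm_sq2 norm_sq3)

lemma norm_le_hat: "norm x <= norm (hat x) + \<bar>x $ 3\<bar>"
 by (rule power2_le_imp_le) (simp_all add: norm_sq2 norm_sq3 power2_sum)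

lemma dist_hat_le: "dist (hat x) (hat y) <= dist x y"
 using norm_hat_le[of "x - y"] by (simp add: dist_norm hat_diff)

lemma norm_hatT [simp]: "norm (hatT y) = norm y"
 by (rule power2_eq_imp_eq) (simp_all add: norm_sq2 norm_sq3)

lemma hat_continuous [continuous_intros]: "continuous_on S f ==> continuous_on S (%x. hat (f x))"
proof -
 assume f: "continuous_on S f"
 have "continuous_on UNIV hat"
  by (rule linear_continuous_on) (use hat_linear in \<open>simp add: linear_conv_bounded_linear\<close>)
 from continuous_on_compose2[OF this f] show ?thesis by simp
qed

lemma hat_measurable [measurable]: "hat \<in> bmb"
 by (rule borel_measurable_continuous_onI) (intro continuous_intros)

lemma C1_hat:
 assumes "C1 f f'" shows "C1 (%x. f (hat x)) (%x. hatT (f' (hat x)))"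
proof -
 have "(hat has_derivative hat) (at x)" for x
  by (rule bounded_linear_imp_has_derivative) (use hat_linear in \<open>simp add: linear_conv_bounded_linear\<close>)
 moreover have "adjoint hat = hatT"
  by (rule adjoint_unique) (simp add: inner_vec_def sum_2 sum_3)
 ultimately show ?thesis using C1_affine[of hat hat f f'] assms by simp
qed

text \<open>The sum is 1 on a neighbourhood of F and not only on F: the remainder then vanishes near
  F, which is needed to cut it along the boundary of the hole.\<close>

lemma ex_partition:
 fixes F :: "(real^2) set" and \<rho> :: "real^2 => real"
 assumes S: "finite S" "!!b. b \<in> S ==> \<rho> b > 0" and F: "compact F" "F \<subseteq> (\<Union>b\<in>S. ball b (\<rho> b))"
 shows "\<exists>\<chi>k \<chi>k' U. (\<forall>b\<in>S. C1 (\<chi>k b) (\<chi>k' b) & (\<forall>x. x ~: cball b (\<rho> b) --> \<chi>k b x = 0))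
  & open U & F \<subseteq> U & (\<forall>x\<in>U. (\<Sum>b\<in>S. \<chi>k b x) = 1)"
proof -
 define \<beta> where "\<beta> b x = (max 0 ((\<rho> b)\<^sup>2 - (x - b) \<bullet> (x - b)))\<^sup>2" for b x :: "real^2"
 define \<beta>' where "\<beta>' b x = (2 * max 0 ((\<rho> b)\<^sup>2 - (x - b) \<bullet> (x - b))) *R (- 2 *R (x - b))" for b x :: "real^2"
 have C\<beta>: "C1 (\<beta> b) (\<beta>' b)" for b
 proof -
  have "C1 (%x. (\<rho> b)\<^sup>2 - (x - b) \<bullet> (x - b)) (%x. - 2 *R (x - b))"
   unfolding C1_def by (auto intro!: derivative_eq_intros continuous_intros simp: inner_commute algebra_simps)
  from C1_comp[OF max_power_deriv[OF order_refl] _ this] show ?thesis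
   unfolding \<beta>_def[abs_def] \<beta>'_def[abs_def] by (simp add: continuous_intros)
 qed
 have \<beta>0: "\<beta> b x >= 0" for b x by (simp add: \<beta>_def)
 have \<beta>z: "\<beta> b x = 0" if "x ~: cball b (\<rho> b)" "b \<in> S" for b x
 proof -
  have "(\<rho> b)\<^sup>2 <= (norm (x - b))\<^sup>2" using that S(2)[OF that(2)] by (intro power_mono) (auto simp: dist_norm norm_minus_commute)
  thus ?thesis by (simp add: \<beta>_def power2_norm_eq_inner)
 qed
 have \<beta>p: "\<beta> b x > 0" if "x \<in> ball b (\<rho> b)" for b x
 proof -
  have "(norm (x - b))\<^sup>2 < (\<rho> b)\<^sup>2" using that by (intro power_strict_mono) (auto simp: dist_norm norm_minus_commute)
  thus ?thesis by (simp add: \<beta>_def power2_norm_eq_inner)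
 qed
 define s where "s x = (\<Sum>b\<in>S. \<beta> b x)" for x
 have Cs: "C1 s (%x. \<Sum>b\<in>S. \<beta>' b x)" unfolding s_def[abs_def] by (rule C1_sum[OF C\<beta>])
 have sp: "s x > 0" if xF: "x \<in> F" for x
 proof -
  obtain b where b: "b \<in> S" "x \<in> ball b (\<rho> b)" using F(2) xF by blast
  show ?thesis unfolding s_def by (rule sum_pos2[where i = b]) (use S(1) b \<beta>p \<beta>0 in auto)
 qed
 obtain s0 where s0: "s0 > 0" "!!x. x \<in> F ==> s0 < s x"
 proof (cases "F = {}")
  case False
  obtain x0 where x0: "x0 \<in> F" "!!x. x \<in> F ==> s x0 <= s x"
   using continuous_attains_inf[OF F(1) False continuous_on_subset[OF C1_cont[OF Cs]]] by blast
  show ?thesis using that[of "s x0 / 2"] sp[OF x0(1)] x0(2) by fastforce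
 qed (use that[of 1] in auto)
 \<comment> \<open>The reciprocal, continued below s0 by its tangent line at s0. Division by the sum
   of bumps becomes C1 on the whole plane, also where the sum vanishes.\<close>
 define m where "m t = (if t >= s0 then 1 / t else (2 * s0 - t) / s0\<^sup>2)" for t
 define m' where "m' t = - 1 / (max t s0)\<^sup>2" for t
 have md: "(m has_real_derivative m' t) (at t)" for t
 proof (cases "t < s0")
  case True
  have "((%t. (2 * s0 - t) / s0\<^sup>2) has_real_derivative m' t) (at t)"
   using True s0(1) by (auto intro!: derivative_eq_intros simp: m'_def power2_eq_square)
  thus ?thesis by (rule has_field_derivative_transform_within_open[where S = "{..<s0}"]) (use True in \<open>auto simp: m_def\<close>)
 next
  case False
  hence ts: "t >= s0" by simp
  have d1: "((%t. 1 / t) has_real_derivative m' t) (at t)"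
   using ts s0(1) by (auto intro!: derivative_eq_intros simp: m'_def power2_eq_square)
  show ?thesis
  proof (cases "t = s0")
   case True
   have d2: "((%t. (2 * s0 - t) / s0\<^sup>2) has_real_derivative m' t) (at t)"
   using True s0(1) by (auto intro!: derivative_eq_intros simp: m'_def power2_eq_square)
   \<comment> \<open>At the junction the two branches differ by a second-order term only.\<close>
   define r where "r t = m t - (2 * s0 - t) / s0\<^sup>2" for t
   have rq: "norm (r y - r t) <= (1 / s0 ^ 3) * (norm (y - t))\<^sup>2" for y
   proof (cases "y >= s0")
   case y: True
   have "r y = (y - s0)\<^sup>2 / (y * s0\<^sup>2)" using y s0(1) by (simp add: r_def m_def power2_eq_square field_simps)
   moreover have "r t = 0" using True s0(1) by (simp add: r_def m_def power2_eq_square field_simps)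
   moreover have "(y - s0)\<^sup>2 / (y * s0\<^sup>2) <= (y - s0)\<^sup>2 / (s0 * s0\<^sup>2)"
   using y s0(1) by (intro divide_left_mono mult_right_mono) auto
   moreover have "(y - s0)\<^sup>2 / (y * s0\<^sup>2) >= 0" using y s0(1) by simp
   ultimately show ?thesis using True by (simp add: power3_eq_cube power2_eq_square)
   next
   case False
   hence "r y = 0" "r t = 0" using True s0(1) by (simp_all add: r_def m_def power2_eq_square field_simps)
   thus ?thesis using s0(1) by simp
   qed
   have "(*) (0::real) = (%h. 0)" by auto
   hence "(r has_real_derivative 0) (at t)"
   using has_derivative_quadratic[OF rq] by (simp add: has_field_derivative_def)
   from DERIV_add[OF d2 this] show ?thesis by (simp add: r_def)
  next
   case False
   show ?thesis by (rule has_field_derivative_transform_within_open[OF d1, of "{s0<..}"]) (use False ts in \<open>auto simp: m_def\<close>)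
  qed
 qed
 have mc: "continuous_on UNIV m'" unfolding m'_def using s0(1) by (intro continuous_intros) auto
 define et et' where "et b x = \<beta> b x * m (s x)" and "et' b x = \<beta> b x *R (m' (s x) *R (\<Sum>b\<in>S. \<beta>' b x)) + m (s x) *R \<beta>' b x" for b x
 have "C1 (et b) (et' b)" for b
  unfolding et_def[abs_def] et'_def[abs_def] by (rule C1_mult[OF C\<beta> C1_comp[OF md mc Cs]])
 moreover have "open {x. s0 < s x}" by (intro open_Collect_less continuous_intros C1_cont[OF Cs])
 moreover have "(\<Sum>b\<in>S. et b x) = 1" if "s0 < s x" for x
 proof -
  have "(\<Sum>b\<in>S. et b x) = s x * m (s x)" by (simp add: et_def s_def sum_distrib_right)
  thus ?thesis using that s0(1) by (simp add: m_def)
 qed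
 ultimately show ?thesis using \<beta>z s0(2) by (intro exI[of _ et] exI[of _ et'] exI[of _ "{x. s0 < s x}"]) (auto simp: et_def)
qed

section \<open>Square integrability of averages\<close>

definition L2X :: "(real^3) set => (real^3 => real) => bool" where
 "L2X X f \<longleftrightarrow> f \<in> bmb & (NB x. indicator X x * ennreal ((f x)\<^sup>2)) < \<infinity>"

lemma L2X_add:
 assumes "L2X X f" "L2X X g" and [measurable]: "X \<in> sets borel" shows "L2X X (%x. f x + g x)"
proof -
 have [measurable]: "f \<in> bmb" "g \<in> bmb" using assms by (auto simp: L2X_def)
 have "(NB x. indicator X x * ennreal ((f x + g x)\<^sup>2))
  <= (NB x. 2 * (indicator X x * ennreal ((f x)\<^sup>2)) + 2 * (indicator X x * ennreal ((g x)\<^sup>2)))"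
 proof (rule nn_integral_mono)
  fix x
  have "(f x + g x)\<^sup>2 <= 2 * (f x)\<^sup>2 + 2 * (g x)\<^sup>2"
   using zero_le_power2[of "f x - g x"] by (simp add: power2_eq_square algebra_simps)
  hence "ennreal ((f x + g x)\<^sup>2) <= ennreal (2 * (f x)\<^sup>2 + 2 * (g x)\<^sup>2)" by (rule ennreal_leI)
  also have "... = 2 * ennreal ((f x)\<^sup>2) + 2 * ennreal ((g x)\<^sup>2)" by (simp add: ennreal_mult')
  finally show "indicator X x * ennreal ((f x + g x)\<^sup>2) <= 2 * (indicator X x * ennreal ((f x)\<^sup>2)) + 2 * (indicator X x * ennreal ((g x)\<^sup>2))"
   by (auto simp: indicator_def)
 qed
 also have "... = 2 * (NB x. indicator X x * ennreal ((f x)\<^sup>2)) + 2 * (NB x. indicator X x * ennreal ((g x)\<^sup>2))"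
  by (subst nn_integral_add) (auto simp: nn_integral_cmult)
 also have "... < \<infinity>" using assms(1,2) by (auto simp: L2X_def ennreal_mult_less_top)
 finally show ?thesis by (simp add: L2X_def)
qed

lemma L2X_mult:
 assumes "L2X X f" "c \<in> bmb" "!!x. x \<in> X ==> \<bar>c x\<bar> <= M" and [measurable]: "X \<in> sets borel"
 shows "L2X X (%x. c x * f x)"
proof -
 have [measurable]: "f \<in> bmb" "c \<in> bmb" using assms by (auto simp: L2X_def)
 have "(NB x. indicator X x * ennreal ((c x * f x)\<^sup>2)) <= (NB x. ennreal (M\<^sup>2) * (indicator X x * ennreal ((f x)\<^sup>2)))"
 proof (rule nn_integral_mono)
  fix x
  show "indicator X x * ennreal ((c x * f x)\<^sup>2) <= ennreal (M\<^sup>2) * (indicator X x * ennreal ((f x)\<^sup>2))"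
  proof (cases "x \<in> X")
   case True
   have "\<bar>c x\<bar>\<^sup>2 <= M\<^sup>2" using assms(3)[OF True] by (intro power_mono) auto
   hence "(c x * f x)\<^sup>2 <= M\<^sup>2 * (f x)\<^sup>2" by (simp add: power_mult_distrib mult_right_mono)
   thus ?thesis using True by (simp add: ennreal_mult'[symmetric] ennreal_leI)
  qed simp
 qed
 also have "... = ennreal (M\<^sup>2) * (NB x. indicator X x * ennreal ((f x)\<^sup>2))" by (rule nn_integral_cmult) measurable
 also have "... < \<infinity>" using assms(1) by (auto simp: L2X_def ennreal_mult_less_top)
 finally show ?thesis by (simp add: L2X_def)
qed

lemma L2X_cmult: "L2X X f ==> X \<in> sets borel ==> L2X X (%x. r * f x)"
 by (rule L2X_mult[where M = "\<bar>r\<bar>"]) auto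

lemma L2X_diff: "L2X X f ==> L2X X g ==> X \<in> sets borel ==> L2X X (%x. f x - g x)"
 using L2X_add[OF _ L2X_cmult, of X f g "-1"] by simp

lemma L2X_half: "L2X X f ==> X \<in> sets borel ==> L2X X (%x. f x / 2)"
 using L2X_cmult[of X f "1/2"] by simp

lemma L2X_zero: "L2X X (%x. 0)"
 by (simp add: L2X_def)

lemma L2X_sum: "(!!k. k \<in> S ==> L2X X (f k)) ==> X \<in> sets borel ==> L2X X (%x. \<Sum>k\<in>S. f k x)"
 by (induction S rule: infinite_finite_induct) (auto intro: L2X_zero L2X_add)

lemma L2X_integrable:
 assumes "L2X X f" and [measurable]: "X \<in> sets borel" and "emeasure lborel X < \<infinity>"
 shows "intb (%x. (indicator X x * f x)\<^sup>2)" "intb (%x. indicator X x * f x)"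
proof -
 have [measurable]: "f \<in> bmb" using assms by (auto simp: L2X_def)
 have e: "(%x. (indicat_real X x * f x)\<^sup>2) = (%x. indicator X x * (f x)\<^sup>2)" by (auto simp: indicator_def)
 have "(NB x. ennreal (norm (indicat_real X x * (f x)\<^sup>2))) = (NB x. indicator X x * ennreal ((f x)\<^sup>2))"
  by (rule nn_integral_cong) (auto simp: indicator_def)
 hence i: "intb (%x. indicat_real X x * (f x)\<^sup>2)" using assms(1) by (intro integrableI_bounded) (auto simp: L2X_def)
 thus "intb (%x. (indicator X x * f x)\<^sup>2)" by (simp add: e)
 have "intb (%x. indicator X x * \<bar>f x\<bar>)"
  by (rule integral_Cauchy_Schwarz_set(1)) (use assms i in auto)
 thus "intb (%x. indicator X x * f x)"
  by (rule Bochner_Integration.integrable_bound) (auto simp: abs_mult)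
qed

text \<open>Cauchy-Schwarz on the unit ball bounds the squared average by an average of squares, to
  which the L1 Schur bound applies. In this way the L1 bound yields L2.\<close>

lemma L2X_A:
 assumes s: "schur X p l C" and k: "kern k"
  and m: "v \<in> bmb" "p \<in> bmb" "l \<in> bmb" "X \<in> sets borel"
  and v2: "intb (%y. (v y)\<^sup>2)"
 shows "L2X X (%x. A k v (p x) (l x))"
proof -
 note [measurable] = m kern_borel[OF k]
 obtain B where B: "B > 0" "!!z. \<bar>k z\<bar> <= B * indicat_real (cball 0 1) z" using kern_bound[OF k] by blast
 have a: "ennreal ((A k v p l)\<^sup>2) <= ennreal (B\<^sup>2 * vB) * (NB z. indicator (cball 0 1) z * ennreal ((v (p + l *R z))\<^sup>2))" for p l
 proof -
  let ?I = "(NB z. ennreal (norm (k z * v (p + l *R z))))"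
  have "ennreal (norm (A k v p l)) <= ?I"
  proof (cases "intb (%z. k z * v (p + l *R z))")
   case True
   show ?thesis unfolding A_def by (rule integral_norm_bound_ennreal[OF True])
  qed (simp add: A_def not_integrable_integral_eq)
  also have "?I <= (NB z. (ennreal B * indicator (cball 0 1) z) * (indicator (cball 0 1) z * ennreal \<bar>v (p + l *R z)\<bar>))"
  proof (rule nn_integral_mono)
   fix z
   have "norm (k z * v (p + l *R z)) <= (B * indicat_real (cball 0 1) z) * \<bar>v (p + l *R z)\<bar>"
   using mult_right_mono[OF B(2), of "\<bar>v (p + l *R z)\<bar>" z] by (simp add: abs_mult)
   hence "ennreal (norm (k z * v (p + l *R z))) <= ennreal ((B * indicat_real (cball 0 1) z) * \<bar>v (p + l *R z)\<bar>)"
   by (rule ennreal_leI)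
   also have "... = (ennreal B * indicator (cball 0 1) z) * (indicator (cball 0 1) z * ennreal \<bar>v (p + l *R z)\<bar>)"
   using B(1) by (auto simp: indicator_def ennreal_mult)
   finally show "ennreal (norm (k z * v (p + l *R z))) <= (ennreal B * indicator (cball 0 1) z) * (indicator (cball 0 1) z * ennreal \<bar>v (p + l *R z)\<bar>)" .
  qed
  finally have "(ennreal (norm (A k v p l)))\<^sup>2 <= (NB z. (ennreal B * indicator (cball 0 1) z) * (indicator (cball 0 1) z * ennreal \<bar>v (p + l *R z)\<bar>))\<^sup>2"
   by (rule power_mono) simp
  also have "... <= (NB z. (ennreal B * indicator (cball (0::real^3) 1) z)\<^sup>2) * (NB z. (indicator (cball 0 1) z * ennreal \<bar>v (p + l *R z)\<bar>)\<^sup>2)"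
  proof -
   define f1 f2 where "f1 z = ennreal B * indicator (cball 0 1) z" and "f2 z = indicator (cball 0 1) z * ennreal \<bar>v (p + l *R z)\<bar>" for z :: "real^3"
   have "f1 \<in> borel_measurable lborel" "f2 \<in> borel_measurable lborel" unfolding f1_def f2_def by measurable
   from Cauchy_Schwarz_nn_integral[OF this] show ?thesis by (simp only: f1_def f2_def)
  qed
  also have "(%z::real^3. (ennreal B * indicator (cball 0 1) z)\<^sup>2) = (%z. ennreal (B\<^sup>2) * indicator (cball 0 1) z)"
   using B(1) by (auto simp: indicator_def ennreal_power fun_eq_iff)
  also have "(NB z. ennreal (B\<^sup>2) * indicator (cball (0::real^3) 1) z) = ennreal (B\<^sup>2 * vB)"
   by (subst nn_integral_cmult_indicator) (auto simp: emeasure_cball3 ennreal_mult')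
  also have "(%z. (indicator (cball 0 1) z * ennreal \<bar>v (p + l *R z)\<bar>)\<^sup>2) = (%z. indicator (cball 0 1) z * ennreal ((v (p + l *R z))\<^sup>2))"
   by (auto simp: indicator_def ennreal_power fun_eq_iff)
  finally show ?thesis by (simp add: ennreal_power)
 qed
 have "(NB x. indicator X x * ennreal ((A k v (p x) (l x))\<^sup>2))
  <= (NB x. ennreal (B\<^sup>2 * vB) * (indicator X x * (NB z. indicator (cball 0 1) z * ennreal ((v (p x + l x *R z))\<^sup>2))))"
  by (rule nn_integral_mono) (use a in \<open>auto simp: indicator_def\<close>)
 also have "... = ennreal (B\<^sup>2 * vB) * (NB x. indicator X x * (NB z. indicator (cball 0 1) z * ennreal ((v (p x + l x *R z))\<^sup>2)))"
  by (rule nn_integral_cmult) measurable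
 also have "... <= ennreal (B\<^sup>2 * vB) * (ennreal C * (NB y. ennreal ((v y)\<^sup>2)))"
  by (intro mult_left_mono schurD[OF s]) auto
 also have "(NB y. ennreal ((v y)\<^sup>2)) = ennreal (LB y. (v y)\<^sup>2)"
  by (rule nn_integral_eq_integral) (use v2 in auto)
 finally have "(NB x. indicator X x * ennreal ((A k v (p x) (l x))\<^sup>2)) < \<infinity>"
  by (rule le_less_trans) (simp add: ennreal_mult_less_top)
 thus ?thesis by (simp add: L2X_def)
qed

lemma L2X_Fr_Gr:
 assumes ad: "adm V u g" and u2: "!!i. intb (%x. (u x $ i)\<^sup>2)"
  and s: "schur X p l C" and X: "X \<in> sets borel"
  and m: "p \<in> bmb" "l \<in> bmb" "d \<in> bmb" "!!k. p' k \<in> bmb" "l' \<in> bmb"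
  and b: "!!x. x \<in> X ==> norm (d x) <= M" "!!k x. x \<in> X ==> norm (p' k x) <= M" "!!x. x \<in> X ==> norm (l' x) <= M"
 shows "L2X X (%x. Fr u (d x) (p x) (l x) i)" "L2X X (%x. Gr g (d x) (p x) (l x) (%k. p' k x) (l' x) i $ j)"
proof -
 note [measurable] = m
 have comp: "\<bar>y $ j\<bar> <= M" if "norm y <= M" for y :: "real^3" and j
  using component_le_norm_cart[of y j] that by linarith
 have cm: "(%x. d x $ j) \<in> bmb" "(%x. p' k x $ j) \<in> bmb" "(%x. l' x $ j) \<in> bmb" for j k
  by measurable
 have cd: "L2X X f ==> L2X X (%x. d x $ j * f x)" and cp: "L2X X f ==> L2X X (%x. p' k x $ j * f x)" and cl: "L2X X f ==> L2X X (%x. l' x $ j * f x)" for f j k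
  by (rule L2X_mult[where M = M]; use b comp cm X in blast)+
 have LA: "L2X X (%x. A k v (p x) (l x))" if "kern k" "integrable lborel v" "intb (%y. (v y)\<^sup>2)" for k v
  by (rule L2X_A[OF s that(1) _ m(1,2) X that(3)]) (use borel_measurable_integrable[OF that(2)] in simp)
 have LAe: "L2X X (%x. Ae k g (p x) (l x) i j)" if "kern k" for k i j
  unfolding Ae_def by (intro L2X_half L2X_add LA that admD(3,4)[OF ad] X)
 show "L2X X (%x. Fr u (d x) (p x) (l x) i)"
  unfolding Fr_def by (intro L2X_add L2X_half L2X_sum cd L2X_diff LA kern_kap kern_dkap admD(2)[OF ad] u2 X)
 show "L2X X (%x. Gr g (d x) (p x) (l x) (%k. p' k x) (l' x) i $ j)"
  unfolding Gr_def Wr_def Sr_def vec_lambda_beta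
  by (intro L2X_add L2X_diff L2X_half L2X_sum cd cp cl L2X_cmult[of X _ 2] LA LAe kern_kap kern_dkap kern_zkap kern_zdkap admD(3,4)[OF ad] X)
qed

section \<open>Charts\<close>

text \<open>The displacement v is the exterior direction N stretched by a constant. If t is at least
  sqrt c1 times the distance of x to the complement of D, the ball of radius 2 t about x + t v
  misses the closed hole; the factor 2 leaves a gap t around the averaging ball of radius t.\<close>

lemma ex_chart:
 fixes D Z :: "(real^2) set"
 assumes D: "open D" "lipschitz_boundary D" and b: "b \<in> frontier D" and Z: "open Z" "closure D \<subseteq> Z"
  and c: "c1 > 0" "c2 > 0" and lam0: "lam0 > 0"
 shows "\<exists>v r lam. 0 < r & 0 < lam & lam <= lam0 & c2 * r\<^sup>2 <= lam\<^sup>2 / 4 & c1 * r\<^sup>2 <= lam\<^sup>2 &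
  (\<forall>x\<in>ball b r. \<forall>t. 0 < t --> t <= lam --> c1 * (infdist x (- D))\<^sup>2 <= t\<^sup>2 --> cball (x + t *R v) (2 * t) \<subseteq> Z - closure D)"
proof -
 obtain N r0 c where N: "norm N = 1" "r0 > 0" "c > 0"
  and cone: "!!w t v. w \<in> ball b r0 ==> w ~: D ==> 0 < t ==> t < r0 ==> norm (v - N) < c ==> w + t *R v ~: closure D"
  using lipschitz_boundary_cone[OF D(2) b] by metis
 have bD: "b ~: D" using b D(1) by (simp add: frontier_def interior_open)
 have bZ: "b \<in> Z" using b Z(2) by (auto simp: frontier_def)
 obtain e where e: "e > 0" "ball b e \<subseteq> Z" using Z(1) bZ open_contains_ball by blast
 define s1 where "s1 = sqrt c1"
 have s1: "s1 > 0" "s1\<^sup>2 = c1" using c by (auto simp: s1_def)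
 \<comment> \<open>Seen from the nearest point w outside D, a point of the ball deviates from the
   push t K N by at most 2 t + t / s1, and K makes this equal to t K times half the aperture
   c.\<close>
 define K where "K = 2 * (1 / s1 + 2) / c"
 have K: "K > 0" using s1 N by (simp add: K_def add_pos_pos)
 define lam where "lam = min lam0 (min (r0 / (2 * K)) (e / (4 * (K + 2))))"
 have lam: "lam > 0" "lam <= lam0" "lam <= r0 / (2 * K)" "lam <= e / (4 * (K + 2))"
  using lam0 N K e by (auto simp: lam_def)
 \<comment> \<open>The first two bounds keep the chart in the cone neighbourhood and in Z; the last
   two compare \<open>lam\<close> with the radius function, which lies between sqrt c1 and sqrt c2
   times the distance.\<close>
 define r where "r = min (min (r0 / 4) (e / 4)) (min (lam / (2 * sqrt c2)) (lam / s1))"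
 have r: "r <= r0 / 4" "r <= e / 4" "r <= lam / (2 * sqrt c2)" "r <= lam / s1"
  unfolding r_def
  by (rule min.coboundedI1, rule min.cobounded1) (rule min.coboundedI1, rule min.cobounded2,
   rule min.coboundedI2, rule min.cobounded1, rule min.coboundedI2, rule min.cobounded2)
 have r0: "r > 0" using N e lam s1 c by (simp add: r_def)
 have "(r * (2 * sqrt c2))\<^sup>2 <= lam\<^sup>2" using r c r0 by (intro power_mono) (auto simp: field_simps)
 hence 1: "c2 * r\<^sup>2 <= lam\<^sup>2 / 4" using c by (simp add: power_mult_distrib field_simps)
 have "(r * s1)\<^sup>2 <= lam\<^sup>2" using r r0 s1 by (intro power_mono) (auto simp: field_simps)
 hence 2: "c1 * r\<^sup>2 <= lam\<^sup>2" by (simp add: power_mult_distrib s1 mult.commute)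
 have main: "cball (x + t *R (K *R N)) (2 * t) \<subseteq> Z - closure D"
  if x: "x \<in> ball b r" and t: "0 < t" "t <= lam" "c1 * (infdist x (- D))\<^sup>2 <= t\<^sup>2" for x t
 proof
  fix y assume y: "y \<in> cball (x + t *R (K *R N)) (2 * t)"
  define d where "d = infdist x (- D)"
  have "closed (- D)" "- D ~= {}" using D(1) bD by (auto simp: closed_def)
  then obtain w where w: "w \<in> - D" "d = dist x w" using infdist_attains_inf unfolding d_def by blast
  have "d <= dist x b" unfolding d_def by (rule infdist_le) (use bD in simp)
  hence wb: "dist w b < 2 * r" using dist_triangle[of w b x] w(2) x by (simp add: dist_commute)
  have "(s1 * d)\<^sup>2 <= t\<^sup>2" using t(3) s1 by (simp add: power_mult_distrib d_def)
  hence sd: "s1 * d <= t" using t(1) by (simp add: power2_le_iff_abs_le)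
  \<comment> \<open>Writes y as w + (t K) v: the cone is attached at w, which lies outside D as the
    cone property demands, and not at x.\<close>
  define v where "v = N + (1 / (t * K)) *R (y - w - t *R (K *R N))"
  have yw: "y = w + (t * K) *R v" using t K by (simp add: v_def algebra_simps)
  define G where "G = y - w - t *R (K *R N)"
  have vG: "v - N = (1 / (t * K)) *R G" by (simp add: v_def G_def)
  have "norm G <= norm (y - (x + t *R (K *R N))) + norm (x - w)"
   using norm_triangle_ineq[of "y - (x + t *R (K *R N))" "x - w"] by (simp add: G_def algebra_simps)
  also have "... <= 2 * t + t / s1"
   using y w(2) sd s1 by (auto simp: dist_norm norm_minus_commute field_simps intro!: add_mono)
  also have "... = (t * K) * (c / 2)" using N by (simp add: K_def field_simps)
  finally have "norm (v - N) <= c / 2" unfolding vG using t K by (simp add: field_simps)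
  hence vN: "norm (v - N) < c" using N by simp
  have "t * K <= r0 / (2 * K) * K" using t lam K by (intro mult_right_mono) auto
  hence tK: "t * K < r0" using K N by simp
  have "w \<in> ball b r0" using wb r(1) N(2) by (simp add: dist_commute)
  hence yD: "y ~: closure D" using cone[OF _ _ _ tK vN, of w] w(1) t K yw by simp
  have "dist b y <= dist b x + dist x (x + t *R (K *R N)) + dist (x + t *R (K *R N)) y"
   using dist_triangle[of b y x] dist_triangle[of x y "x + t *R (K *R N)"] by linarith
  also have "dist x (x + t *R (K *R N)) = t * K" using t K N by (simp add: dist_norm)
  also have "dist b x + t * K + dist (x + t *R (K *R N)) y < e / 4 + t * K + 2 * t + e / 4" using x y r e by simp
  also have "t * K + 2 * t <= e / 4"
  proof -
   have "t * (K + 2) <= e / (4 * (K + 2)) * (K + 2)" using t lam K by (intro mult_right_mono) auto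
   also have "e / (4 * (K + 2)) * (K + 2) = e / 4" using K by (simp add: divide_simps)
   finally show ?thesis by (simp add: algebra_simps)
  qed
  hence "e / 4 + t * K + 2 * t + e / 4 < e" using e by simp
  finally have "y \<in> ball b e" by simp
  thus "y \<in> Z - closure D" using yD e by blast
 qed
 thus ?thesis using r0 lam(1,2) 1 2 by blast
qed

section \<open>Layers, vertical tilt and columns of balls\<close>

definition VT :: "(real^2) set => real => (real^3) set" where
 "VT Y T = {x. hat x \<in> Y & \<bar>x $ 3\<bar> < T / 2}"

lemma VT_open: "open Y ==> open (VT Y T)"
proof -
 assume Y: "open Y"
 have "open (hat -` Y)" using continuous_on_open_vimage[of UNIV hat] Y by (auto intro!: continuous_intros)
 moreover have "open {x :: real^3. \<bar>x $ 3\<bar> < T / 2}" by (intro open_Collect_less continuous_intros)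
 moreover have "VT Y T = hat -` Y \<inter> {x. \<bar>x $ 3\<bar> < T / 2}" by (auto simp: VT_def)
 ultimately show ?thesis by auto
qed

lemma VT_borel [measurable]: "Y \<in> sets borel ==> VT Y T \<in> sets borel"
proof -
 assume "Y \<in> sets borel"
 hence "hat -` Y \<inter> space borel \<in> sets borel" by (rule measurable_sets[OF hat_measurable])
 moreover have "open {x :: real^3. \<bar>x $ 3\<bar> < T / 2}" by (intro open_Collect_less continuous_intros)
 moreover have "VT Y T = (hat -` Y \<inter> space borel) \<inter> {x. \<bar>x $ 3\<bar> < T / 2}" by (auto simp: VT_def)
 ultimately show ?thesis by auto
qed

lemma VT_bounded: "bounded Y ==> bounded (VT Y T)"
proof -
 assume "bounded Y"
 then obtain B where B: "!!y. y \<in> Y ==> norm y <= B" by (auto simp: bounded_iff)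
 have "norm x <= B + T / 2" if "x \<in> VT Y T" for x
  using norm_le_hat[of x] B[of "hat x"] that by (auto simp: VT_def)
 thus ?thesis by (auto simp: bounded_iff)
qed

text \<open>Keeps a ball of radius t inside the layer. At heights beyond c0/4 the tilt B arctan s is
  at least 1 in modulus, so the shift towards the mid-plane makes up for the radius; at lower
  heights there is room, as the total displacement is at most c0/4 and T/2 >= c0/2. The boundedness
  of arctan keeps the constants independent of T.\<close>

lemma vertical_shift:
 assumes c0: "c0 > 0" and B: "B = 1 / arctan (c0 / 4)" and lam: "lam = c0 / (4 * (2 * B + 1))"
  and T: "T >= c0" and s: "\<bar>s\<bar> < T / 2" and t: "0 < t" "t <= lam" and s': "\<bar>s' - (s - t * (B * arctan s))\<bar> <= t"
 shows "\<bar>s'\<bar> < T / 2"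
proof -
 have B0: "B > 0" using c0 B by simp
 have a2: "\<bar>arctan s\<bar> <= 2" using arctan_lbound[of s] arctan_ubound[of s] pi_less_4 by linarith
 \<comment> \<open>\<open>lam\<close> is chosen for this inequality: 2 bounds |arctan|, so t (2 B +
   1) bounds the tilt plus the radius.\<close>
 have tl: "t * (2 * B + 1) <= c0 / 4"
 proof -
  have "t * (2 * B + 1) <= lam * (2 * B + 1)" using t B0 by (intro mult_right_mono) auto
  moreover have "c0 / (4 * X) * X = c0 / 4" if "X ~= 0" for X using that by simp
  from this[of "2 * B + 1"] have "lam * (2 * B + 1) = c0 / 4" using B0 unfolding lam by simp
  ultimately show ?thesis by simp
 qed
 have ta: "\<bar>t * (B * arctan s)\<bar> <= t * (B * 2)" unfolding abs_mult using t B0 a2 by (intro mult_mono) auto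
 consider "s >= c0 / 4" | "s <= - (c0 / 4)" | "\<bar>s\<bar> < c0 / 4" by linarith
 thus ?thesis
 proof cases
  case 1
  have "arctan (c0 / 4) <= arctan s" using 1 by (simp add: arctan_le_iff)
  hence "B * arctan s >= 1" using c0 by (simp add: B field_simps)
  hence "t * (B * arctan s) >= t" using t by simp
  thus ?thesis using s' s ta tl T c0 1 by (simp add: algebra_simps abs_le_iff abs_less_iff)
 next
  case 2
  have "arctan (c0 / 4) <= arctan (- s)" using 2 by (simp only: arctan_le_iff)
  hence "B * arctan (- s) >= 1" using c0 by (simp add: B field_simps)
  hence "t * (B * (- arctan s)) >= t * 1" using t by (intro mult_left_mono) (auto simp: arctan_minus)
  thus ?thesis using s' s ta tl T c0 2 by (simp add: algebra_simps abs_le_iff abs_less_iff)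
 next
  case 3
  thus ?thesis using s' ta tl T c0 by (simp add: algebra_simps abs_le_iff abs_less_iff) linarith
 qed
qed

text \<open>Direction of the push to the centre of the averaging ball, per unit of radius: out of
  the hole horizontally, towards the mid-plane vertically.\<close>

definition nu :: "real^2 => real => real^3 => real^3" where
 "nu v B x = vector [v $ 1, v $ 2, - (B * arctan (x $ 3))]"

lemma nu_nth [simp]: "nu v B x $ 1 = v $ 1" "nu v B x $ 2 = v $ 2" "nu v B x $ 3 = - (B * arctan (x $ 3))"
 by (simp_all add: nu_def)

lemma hat_nu [simp]: "hat (nu v B x) = v"
 by (simp add: vec2_eq)

lemma norm_nu: assumes "B >= 0" shows "norm (nu v B x) <= norm v + 2 * B"
proof -
 have "\<bar>arctan (x $ 3)\<bar> <= 2" using arctan_lbound[of "x $ 3"] arctan_ubound[of "x $ 3"] pi_less_4 by linarith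
 hence "B * \<bar>arctan (x $ 3)\<bar> <= B * 2" using assms by (intro mult_left_mono)
 thus ?thesis using norm_le_hat[of "nu v B x"] assms by (simp add: abs_mult)
qed

definition nu' :: "real => real^3 => 3 => real^3" where
 "nu' B x k = (if k = 3 then (- B * inverse (1 + (x $ 3)\<^sup>2)) *R axis 3 1 else 0)"

lemma C1_nu: "C1 (%x. nu v B x $ k) (%x. nu' B x k)"
proof -
 have "C1 (%x::real^3. arctan (x $ 3)) (%x. inverse (1 + (x $ 3)\<^sup>2) *R axis 3 1)"
  by (rule C1_comp[OF DERIV_arctan _ C1_coord])
   (auto intro!: continuous_intros simp: add_nonneg_eq_0_iff)
 from C1_cmult[OF this, of "- B"] have 3: "C1 (%x. nu v B x $ 3) (%x. nu' B x 3)" by (simp add: nu'_def)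
 have "k = 1 \<or> k = 2 \<or> k = 3" by (rule exhaust_3)
 thus ?thesis using 3 C1_const[of "v $ 1"] C1_const[of "v $ 2"] by (auto simp: nu'_def)
qed

lemma norm_nu': assumes "B >= 0" shows "norm (nu' B x k) <= B"
proof -
 have "inverse (1 + (x $ 3)\<^sup>2) <= 1" by (intro inverse_le_1_iff[THEN iffD2]) auto
 hence "B * inverse (1 + (x $ 3)\<^sup>2) <= B * 1" using assms by (intro mult_left_mono)
 thus ?thesis using assms by (simp add: nu'_def)
qed

lemma nu_measurable [measurable]: "nu v B \<in> bmb"
proof -
 have "continuous_on UNIV (%x. \<chi> k. nu v B x $ k)" by (intro continuous_on_vec_lambda C1_cont[OF C1_nu])
 thus ?thesis by (intro borel_measurable_continuous_onI) simp
qed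

text \<open>Centre over the planar point \<open>q\<close>, at the height of x tilted by m. It is
  affine in (q, m), so the segment between two such centres consists of centres of the same form
  (\<open>col_segment\<close>), and all balls along it stay in the layer.\<close>

definition col :: "real => real^2 => real => real^3 => real^3" where
 "col B q m x = hatT q + (x $ 3 - m * (B * arctan (x $ 3))) *R axis 3 1"

lemma col_nth [simp]: "col B q m x $ 1 = q $ 1" "col B q m x $ 2 = q $ 2" "col B q m x $ 3 = x $ 3 - m * (B * arctan (x $ 3))"
 by (simp_all add: col_def axis_def)

lemma hat_col [simp]: "hat (col B q m x) = q"
 by (simp add: vec2_eq)

lemma col_nu: "x + t *R nu v B x = col B (hat x + t *R v) t x"
 by (simp add: vec3_eq)

lemma col_segment: "col B q0 m0 x + s *R (col B q1 m1 x - col B q0 m0 x) = col B (q0 + s *R (q1 - q0)) (m0 + s * (m1 - m0)) x"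
 by (simp add: vec3_eq algebra_simps)

lemma hatT_measurable [measurable]: "hatT \<in> bmb"
proof -
 have "linear hatT" by (rule linearI) (auto simp: vec3_eq)
 thus ?thesis by (intro borel_measurable_continuous_onI linear_continuous_on) (simp add: linear_conv_bounded_linear)
qed

lemma col_measurable:
 assumes [measurable]: "q \<in> bmb" "m \<in> bmb"
 shows "(%x. col B (q x) (m x) x) \<in> bmb"
 unfolding col_def by measurable

lemma norm_col:
 assumes "B >= 0" "m >= 0" shows "norm (x - col B q m x) <= norm (hat x - q) + 2 * B * m"
proof -
 have "\<bar>arctan (x $ 3)\<bar> <= 2" using arctan_lbound[of "x $ 3"] arctan_ubound[of "x $ 3"] pi_less_4 by linarith
 hence "m * (B * \<bar>arctan (x $ 3)\<bar>) <= m * (B * 2)" using assms by (intro mult_left_mono)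
 thus ?thesis using norm_le_hat[of "x - col B q m x"] assms by (simp add: hat_diff abs_mult mult.commute mult.left_commute)
qed

lemma norm_col_diff:
 assumes "B >= 0" shows "norm (col B q1 m1 x - col B q0 m0 x) <= norm (q1 - q0) + 2 * B * \<bar>m1 - m0\<bar>"
proof -
 have "\<bar>arctan (x $ 3)\<bar> <= 2" using arctan_lbound[of "x $ 3"] arctan_ubound[of "x $ 3"] pi_less_4 by linarith
 hence a: "\<bar>m0 - m1\<bar> * (B * \<bar>arctan (x $ 3)\<bar>) <= \<bar>m0 - m1\<bar> * (B * 2)" using assms by (intro mult_left_mono) auto
 have e: "(col B q1 m1 x - col B q0 m0 x) $ 3 = (m0 - m1) * (B * arctan (x $ 3))" by (simp add: algebra_simps)
 have "\<bar>(col B q1 m1 x - col B q0 m0 x) $ 3\<bar> <= 2 * B * \<bar>m1 - m0\<bar>"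
  unfolding e abs_mult using a assms by (simp add: mult.commute mult.left_commute abs_minus_commute)
 thus ?thesis using norm_le_hat[of "col B q1 m1 x - col B q0 m0 x"] by (simp add: hat_diff)
qed

text \<open>A rigid motion for each height: the averaging ball stands over \<open>q\<close> but
  follows x vertically. Two such fields are compared locally in x_3, which makes the constants
  independent of T.\<close>

definition Rg :: "real => (real^3 => real^3) => real^2 => real => real^3 => real^3" where
 "Rg B u q m x = (\<chi> i. Fr u ((1 / m) *R (x - col B q m x)) (col B q m x) m i)"

definition JJ :: "(real^3 => real^3^3) => ennreal" where
 "JJ g = (NB y. ennreal ((norm (symm (g y)))\<^sup>2))"

lemma Fr_measurable:
 assumes ad: "adm V u g" and [measurable]: "d \<in> bmb" "p \<in> bmb" "l \<in> bmb"
 shows "(%x. Fr u (d x) (p x) (l x) i) \<in> bmb"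
proof -
 note [measurable] = admD(5)[OF ad] kern_borel[OF kern_kap] kern_borel[OF kern_dkap]
 show ?thesis unfolding Fr_def by measurable
qed

text \<open>At positive radius averages do not see null sets, so an almost everywhere relation gives
  an identity at every point.\<close>

lemma Fr_lin:
 assumes l: "l > 0" and i: "!!i. intb (%x. u x $ i)" "!!i. intb (%x. w x $ i)" "!!i. intb (%x. v x $ i)"
  and e: "AE y in lborel. v y = a *R u y + c *R w y"
 shows "Fr v d p l i = a * Fr u d p l i + c * Fr w d p l i"
proof -
 have k: "A k (%y. v y $ j) p l = a * A k (%y. u y $ j) p l + c * A k (%y. w y $ j) p l" if k: "kern k" for k j
 proof -
  note [measurable] = borel_measurable_integrable[OF i(1)] borel_measurable_integrable[OF i(2)] borel_measurable_integrable[OF i(3)]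
  have "AE y in lborel. v y $ j = a * u y $ j + c * w y $ j" using e by eventually_elim simp
  from A_AE_cong[OF l _ _ kern_borel[OF k] this] have "A k (%y. v y $ j) p l = A k (%y. a * u y $ j + c * w y $ j) p l"
   using i by simp
  thus ?thesis using A_lin[OF k i(1) i(2) l, of a _ c _ p] by simp
 qed
 show ?thesis unfolding Fr_def k[OF kern_kap] k[OF kern_dkap] sum_3 by (simp add: algebra_simps add_divide_distrib diff_divide_distrib)
qed

lemma nn_integral_norm3:
 fixes f :: "real^3 => real^3"
 assumes [measurable]: "X \<in> sets borel" "!!i. (%x. f x $ i) \<in> bmb"
  and b: "!!i. (NB x. indicator X x * ennreal ((f x $ i)\<^sup>2)) <= K"
 shows "(NB x. indicator X x * ennreal ((norm (f x))\<^sup>2)) <= 3 * K"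
proof -
 have m: "(%x. indicator X x * ennreal ((f x $ i)\<^sup>2)) \<in> borel_measurable lborel" for i by measurable
 have "(NB x. indicator X x * ennreal ((norm (f x))\<^sup>2))
  = (NB x. indicator X x * ennreal ((f x $ 1)\<^sup>2) + indicator X x * ennreal ((f x $ 2)\<^sup>2) + indicator X x * ennreal ((f x $ 3)\<^sup>2))"
  by (rule nn_integral_cong) (auto simp: norm_sq3 ennreal_plus indicator_def)
 also have "... = (NB x. indicator X x * ennreal ((f x $ 1)\<^sup>2)) + (NB x. indicator X x * ennreal ((f x $ 2)\<^sup>2)) + (NB x. indicator X x * ennreal ((f x $ 3)\<^sup>2))"
  by (subst nn_integral_add[OF borel_measurable_add[OF m m] m], subst nn_integral_add[OF m m]) (rule refl)
 also have "... <= K + K + K" by (intro add_mono b)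
 also have "K + K + K = 3 * K"
 proof -
  have "(3::ennreal) = 1 + 1 + 1" by simp
  thus ?thesis by (simp only: distrib_right mult_1)
 qed
 finally show ?thesis .
qed

lemma nn_integral_two_sq:
 fixes f g :: "real^3 => real^3"
 assumes [measurable]: "X \<in> sets borel" "f \<in> bmb" "g \<in> bmb"
  and "(NB x. indicator X x * ennreal ((norm (f x))\<^sup>2)) <= a" "(NB x. indicator X x * ennreal ((norm (g x))\<^sup>2)) <= b"
 shows "(NB x. indicator X x * ennreal ((norm (f x + g x))\<^sup>2)) <= 2 * a + 2 * b"
proof -
 have "(NB x. indicator X x * ennreal ((norm (f x + g x))\<^sup>2))
  <= (NB x. 2 * (indicator X x * ennreal ((norm (f x))\<^sup>2)) + 2 * (indicator X x * ennreal ((norm (g x))\<^sup>2)))"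
 proof (rule nn_integral_mono)
  fix x
  have "(norm (f x + g x))\<^sup>2 <= (norm (f x) + norm (g x))\<^sup>2" by (intro power_mono norm_triangle_ineq) auto
  also have "... <= 2 * (norm (f x))\<^sup>2 + 2 * (norm (g x))\<^sup>2"
   using sum_squares_bound[of "norm (f x)" "norm (g x)"] by (simp add: power2_sum)
  finally have "ennreal ((norm (f x + g x))\<^sup>2) <= 2 * ennreal ((norm (f x))\<^sup>2) + 2 * ennreal ((norm (g x))\<^sup>2)"
   by (simp add: ennreal_plus[symmetric] ennreal_mult'[symmetric] numeral_mult_ennreal ennreal_leI del: ennreal_plus)
  thus "indicator X x * ennreal ((norm (f x + g x))\<^sup>2) <= 2 * (indicator X x * ennreal ((norm (f x))\<^sup>2)) + 2 * (indicator X x * ennreal ((norm (g x))\<^sup>2))"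
   by (auto simp: indicator_def)
 qed
 also have "... = 2 * (NB x. indicator X x * ennreal ((norm (f x))\<^sup>2)) + 2 * (NB x. indicator X x * ennreal ((norm (g x))\<^sup>2))"
  by (simp add: nn_integral_add nn_integral_cmult)
 also have "... <= 2 * a + 2 * b" by (intro add_mono mult_left_mono assms) auto
 finally show ?thesis .
qed

lemma Rg_measurable:
 assumes ad: "adm V u g" and [measurable]: "q \<in> bmb" "m \<in> bmb"
 shows "(%x. Rg B u (q x) (m x) x) \<in> bmb"
proof -
 note [measurable] = col_measurable[OF assms(2,3)]
 have "(%x. Rg B u (q x) (m x) x $ i) \<in> bmb" for i
  unfolding Rg_def vec_lambda_beta by (rule Fr_measurable[OF ad]) measurable
 thus ?thesis by (subst borel_measurable_euclidean_space) (auto simp: Basis_vec_def inner_axis)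
qed

section \<open>Averaging and comparison of rigid motions in a layer with one hole\<close>

locale hole_cell =
 fixes D Z Y :: "(real^2) set" and c0 B lam0 :: real
 assumes D: "open D" "bounded D" "D ~= {}" "lipschitz_boundary D"
  and Z: "open Z" "bounded Z" "closure D \<subseteq> Z" and c0: "c0 > 0"
  and B_def: "B = 1 / arctan (c0 / 4)" and lam0_def: "lam0 = c0 / (4 * (2 * B + 1))"
  and Y_def: "Y = Z - closure D" and Yconn: "connected Y"
begin

lemma B0: "B > 0" and lam0_pos: "lam0 > 0"
proof -
 show "B > 0" using c0 by (simp add: B_def)
 thus "lam0 > 0" using c0 by (simp add: lam0_def)
qed

lemma Yopen: "open Y" using Z D by (simp add: Y_def open_Diff)

lemma col_ball:
 assumes T: "T >= c0" "\<bar>x $ 3\<bar> < T / 2" and m: "0 < m" "m <= lam0" and q: "cball q m \<subseteq> W"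
 shows "cball (col B q m x) m \<subseteq> VT W T"
proof
 fix y assume y: "y \<in> cball (col B q m x) m"
 have "dist q (hat y) <= m" using dist_hat_le[of "col B q m x" y] y by simp
 hence 1: "hat y \<in> W" using q by auto
 have "\<bar>(y - col B q m x) $ 3\<bar> <= norm (y - col B q m x)" by (rule component_le_norm_cart)
 hence "\<bar>y $ 3 - (x $ 3 - m * (B * arctan (x $ 3)))\<bar> <= m" using y by (simp add: dist_norm norm_minus_commute)
 from vertical_shift[OF c0 B_def lam0_def T(1) T(2) m this] show "y \<in> VT W T" using 1 by (simp add: VT_def)
qed

definition CK :: "real => real" where "CK K = (K + 1) ^ 3 * (K + 2 * B + 1) ^ 3 * vB"

lemma CK_nonneg: "K >= 0 ==> CK K >= 0"
 using B0 vB_nonneg by (simp add: CK_def)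

text \<open>The intrinsic length at y is the horizontal distance to the closed hole. The gap between
  the ball and the hole bounds it below by m; x, which lies over the closed hole within K m of the
  centre, bounds it above by (K + 1) m.\<close>

lemma schur_col:
 assumes X: "X \<in> sets borel" and q: "q \<in> bmb" "m \<in> bmb" and K: "K >= 0"
  and x: "!!x. x \<in> X ==> 0 < m x" "!!x. x \<in> X ==> hat x \<in> closure D"
   "!!x. x \<in> X ==> cball (q x) (2 * m x) \<inter> closure D = {}" "!!x. x \<in> X ==> norm (hat x - q x) <= K * m x"
 shows "schur X (%x. col B (q x) (m x) x) m (CK K)"
 unfolding CK_def
proof (rule schur_criterion[OF X col_measurable[OF q] q(2) x(1), where \<tau> = "%y. infdist (hat y) (closure D)"])
 show "K + 1 >= 0" "K + 2 * B + 1 >= 0" using K B0 by auto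
 fix x y assume a: "x \<in> X" "dist (col B (q x) (m x) x) y <= m x"
 have d: "dist (q x) (hat y) <= m x" using dist_hat_le[of "col B (q x) (m x) x" y] a(2) by simp
 have ne: "closure D ~= {}" using D by simp
 obtain w where w: "w \<in> closure D" "infdist (hat y) (closure D) = dist (hat y) w"
  using infdist_attains_inf[OF closed_closure ne] by blast
 have "w ~: cball (q x) (2 * m x)" using x(3)[OF a(1)] w(1) by blast
 hence "m x <= dist (hat y) w" using d dist_triangle[of "q x" w "hat y"] by simp
 hence lo: "m x <= infdist (hat y) (closure D)" using w by simp
 have "infdist (hat y) (closure D) <= dist (hat y) (hat x)" by (rule infdist_le[OF x(2)[OF a(1)]])
 also have "... <= dist (q x) (hat y) + dist (hat x) (q x)" using dist_triangle[of "hat y" "hat x" "q x"] by (simp add: dist_commute)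
 also have "... <= m x + K * m x" using d x(4)[OF a(1)] by (simp add: dist_norm)
 finally have hi: "infdist (hat y) (closure D) <= (K + 1) * m x" by (simp add: algebra_simps)
 have "dist x y <= dist x (col B (q x) (m x) x) + dist (col B (q x) (m x) x) y" by (rule dist_triangle)
 also have "... <= K * m x + 2 * B * m x + m x"
  using norm_col[of B "m x" x "q x"] B0 x(1,4)[OF a(1)] a(2) by (simp add: dist_norm)
 also have "... = (K + 2 * B + 1) * m x" by (simp add: algebra_simps)
 also have "... <= (K + 2 * B + 1) * infdist (hat y) (closure D)" using lo K B0 by (intro mult_left_mono) auto
 finally show "0 < infdist (hat y) (closure D) & infdist (hat y) (closure D) <= (K + 1) * m x & dist x y <= (K + 2 * B + 1) * infdist (hat y) (closure D)"
  using lo hi x(1)[OF a(1)] by simp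
qed

text \<open>With a constant radius, the radius itself serves as intrinsic length, and the resulting
  constant is free of it.\<close>

lemma schur_const:
 assumes X: "X \<in> sets borel" and q: "q \<in> bmb" and K: "K >= 0" and m: "m > 0"
  and x: "!!x. x \<in> X ==> norm (hat x - q x) <= K * m"
 shows "schur X (%x. col B (q x) m x) (%x. m) (CK K)"
 unfolding CK_def
proof (rule schur_criterion[OF X col_measurable[OF q borel_measurable_const] borel_measurable_const m, where \<tau> = "%y. m"])
 show "K + 1 >= 0" "K + 2 * B + 1 >= 0" using K B0 by auto
 fix x y assume a: "x \<in> X" "dist (col B (q x) m x) y <= m"
 have "dist x y <= dist x (col B (q x) m x) + dist (col B (q x) m x) y" by (rule dist_triangle)
 also have "... <= K * m + 2 * B * m + m"
  using norm_col[of B m x "q x"] B0 x[OF a(1)] a(2) m by (simp add: dist_norm)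
 finally have "dist x y <= (K + 2 * B + 1) * m" by (simp add: algebra_simps)
 moreover have "m <= (K + 1) * m" using K m by simp
 ultimately show "0 < m & m <= (K + 1) * m & dist x y <= (K + 2 * B + 1) * m" using m by simp
qed

text \<open>The constant of \<open>segment_schur\<close> for columns, times 3 for the components:
  lam0 (2 B + 1) covers the vertical shift and the change of radius, K + 2 B the offset measured in
  radii.\<close>

definition CS :: "real => real => real => real" where
 "CS K N C = 3 * (2 * (cS * (N + lam0 * (2 * B + 1)) * (1 + (K + 2 * B)))\<^sup>2 * (2 * C))"

lemma col_segment_estimate:
 assumes ad: "adm (VT Y T) u g" and T: "T >= c0" and X: "X \<in> sets borel" "!!x. x \<in> X ==> \<bar>x $ 3\<bar> < T / 2"
  and q: "q0 \<in> bmb" "q1 \<in> bmb" and m: "m0 \<in> bmb" "m1 \<in> bmb"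
  and C: "C >= 0"
  and b: "!!x s. x \<in> X ==> 0 <= s ==> s <= 1 ==> 0 < m0 x + s * (m1 x - m0 x) & m0 x + s * (m1 x - m0 x) <= lam0
   & cball (q0 x + s *R (q1 x - q0 x)) (m0 x + s * (m1 x - m0 x)) \<subseteq> Y
   & norm (hat x - (q0 x + s *R (q1 x - q0 x))) <= K * (m0 x + s * (m1 x - m0 x))"
  and N: "!!x. x \<in> X ==> norm (q1 x - q0 x) <= N"
  and s: "!!s. 0 <= s ==> s <= 1 ==> schur X (%x. col B (q0 x + s *R (q1 x - q0 x)) (m0 x + s * (m1 x - m0 x)) x) (%x. m0 x + s * (m1 x - m0 x)) C"
 shows "(NB x. indicator X x * ennreal ((norm (Rg B u (q1 x) (m1 x) x - Rg B u (q0 x) (m0 x) x))\<^sup>2)) <= ennreal (CS K N C) * JJ g"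
proof -
 let ?E = "ennreal (2 * (cS * (N + lam0 * (2 * B + 1)) * (1 + (K + 2 * B)))\<^sup>2 * (2 * C)) * JJ g"
 note [measurable] = X(1) Rg_measurable[OF ad q(1) m(1)] Rg_measurable[OF ad q(2) m(2)]
 have m01: "0 < m0 x" "m0 x <= lam0" "0 < m1 x" "m1 x <= lam0" if "x \<in> X" for x
  using b[OF that, of 0] b[OF that, of 1] by auto
 have "(NB x. indicator X x * ennreal (((Rg B u (q1 x) (m1 x) x - Rg B u (q0 x) (m0 x) x) $ i)\<^sup>2)) <= ?E" for i
  unfolding Rg_def vector_minus_component vec_lambda_beta JJ_def
 proof (rule segment_schur[OF ad X(1) col_measurable[OF q(1) m(1)] col_measurable[OF q(2) m(2)] m _ _ _ _ _ _ C])
  show "0 < m0 x" "0 < m1 x" if "x \<in> X" for x using m01[OF that] by auto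
 next
  fix x and s :: real assume a: "x \<in> X" "0 <= s" "s <= 1"
  note b = b[OF a]
  show "cball (col B (q0 x) (m0 x) x + s *R (col B (q1 x) (m1 x) x - col B (q0 x) (m0 x) x)) (m0 x + s * (m1 x - m0 x)) \<subseteq> VT Y T"
   unfolding col_segment by (rule col_ball[OF T X(2)[OF a(1)]]) (use b in auto)
  show "norm (x - (col B (q0 x) (m0 x) x + s *R (col B (q1 x) (m1 x) x - col B (q0 x) (m0 x) x))) <= (K + 2 * B) * (m0 x + s * (m1 x - m0 x))"
   unfolding col_segment using norm_col[of B "m0 x + s * (m1 x - m0 x)" x "q0 x + s *R (q1 x - q0 x)"] B0 b by (simp add: distrib_right)
 next
  fix x assume a: "x \<in> X"
  have "\<bar>m1 x - m0 x\<bar> <= lam0" using m01[OF a] by auto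
  hence "(2 * B + 1) * \<bar>m1 x - m0 x\<bar> <= (2 * B + 1) * lam0" using B0 by (intro mult_left_mono) auto
  thus "norm (col B (q1 x) (m1 x) x - col B (q0 x) (m0 x) x) + \<bar>m1 x - m0 x\<bar> <= N + lam0 * (2 * B + 1)"
   using norm_col_diff[of B "q1 x" "m1 x" x "q0 x" "m0 x"] B0 N[OF a] by (simp add: algebra_simps)
 next
  fix s :: real assume "0 <= s" "s <= 1"
  from s[OF this] show "schur X (%x. col B (q0 x) (m0 x) x + s *R (col B (q1 x) (m1 x) x - col B (q0 x) (m0 x) x)) (%x. m0 x + s * (m1 x - m0 x)) C"
   by (simp only: col_segment)
 qed
 hence "(NB x. indicator X x * ennreal ((norm (Rg B u (q1 x) (m1 x) x - Rg B u (q0 x) (m0 x) x))\<^sup>2)) <= 3 * ?E"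
  by (intro nn_integral_norm3) measurable
 also have "3 * ?E = ennreal (CS K N C) * JJ g"
 proof -
  have "ennreal 3 * ennreal (2 * (cS * (N + lam0 * (2 * B + 1)) * (1 + (K + 2 * B)))\<^sup>2 * (2 * C)) = ennreal (CS K N C)"
   unfolding CS_def using C by (subst ennreal_mult[symmetric]) auto
  thus ?thesis by (simp add: mult.assoc[symmetric])
 qed
 finally show ?thesis .
qed

text \<open>The constant is chosen before T and u. The relation is symmetric and transitive, which
  turns the comparison of distant columns into a connectedness argument.\<close>

definition Rel :: "real^2 => real => real^2 => real => bool" where
 "Rel q0 m0 q1 m1 \<longleftrightarrow> (\<exists>C\<ge>0. \<forall>T u g. c0 <= T --> adm (VT Y T) u g -->
  (NB x. indicator (VT Z T) x * ennreal ((norm (Rg B u q1 m1 x - Rg B u q0 m0 x))\<^sup>2)) <= ennreal C * JJ g)"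

lemma Rel_sym: "Rel q0 m0 q1 m1 ==> Rel q1 m1 q0 m0"
 by (simp add: Rel_def norm_minus_commute)

lemma Rel_trans: assumes "Rel q0 m0 q1 m1" "Rel q1 m1 q2 m2" shows "Rel q0 m0 q2 m2"
proof -
 obtain C1 C2 where C: "C1 >= 0" "C2 >= 0"
  and b: "!!T u g. c0 <= T ==> adm (VT Y T) u g ==> (NB x. indicator (VT Z T) x * ennreal ((norm (Rg B u q1 m1 x - Rg B u q0 m0 x))\<^sup>2)) <= ennreal C1 * JJ g"
   "!!T u g. c0 <= T ==> adm (VT Y T) u g ==> (NB x. indicator (VT Z T) x * ennreal ((norm (Rg B u q2 m2 x - Rg B u q1 m1 x))\<^sup>2)) <= ennreal C2 * JJ g"
  using assms unfolding Rel_def by meson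
 have "(NB x. indicator (VT Z T) x * ennreal ((norm (Rg B u q2 m2 x - Rg B u q0 m0 x))\<^sup>2)) <= ennreal (2 * C1 + 2 * C2) * JJ g"
  if T: "c0 <= T" and ad: "adm (VT Y T) u g" for T u g
 proof -
  have [measurable]: "(%x. Rg B u q m x) \<in> bmb" for q m by (rule Rg_measurable[OF ad]) auto
  have [measurable]: "VT Z T \<in> sets borel" using Z by (intro VT_borel) auto
  have "(NB x. indicator (VT Z T) x * ennreal ((norm ((Rg B u q1 m1 x - Rg B u q0 m0 x) + (Rg B u q2 m2 x - Rg B u q1 m1 x)))\<^sup>2)) <= 2 * (ennreal C1 * JJ g) + 2 * (ennreal C2 * JJ g)"
   by (rule nn_integral_two_sq[OF _ _ _ b(1)[OF T ad] b(2)[OF T ad]]) measurable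
  also have "... = ennreal (2 * C1 + 2 * C2) * JJ g"
   using C by (simp add: ennreal_plus distrib_right ennreal_mult' mult.assoc)
  finally show ?thesis by simp
 qed
 thus ?thesis unfolding Rel_def using C by (intro exI[of _ "2 * C1 + 2 * C2"]) auto
qed

lemma Rel_segment:
 assumes m: "0 < m0" "m0 <= lam0" "0 < m1" "m1 <= lam0"
  and b: "!!s. 0 <= s ==> s <= 1 ==> cball (q0 + s *R (q1 - q0)) (m0 + s * (m1 - m0)) \<subseteq> Y"
 shows "Rel q0 m0 q1 m1"
proof -
 obtain R where R: "R > 0" "!!y. y \<in> Z ==> norm y <= R" using Z(2) by (auto simp: bounded_pos)
 \<comment> \<open>Z lies in a ball of radius R, so 2 R bounds the horizontal distance of any x to
   the moving centre; it is measured in the smaller of the two radii.\<close>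
 define K where "K = 2 * R / min m0 m1"
 have K: "K >= 0" using R m by (simp add: K_def)
 have ms: "min m0 m1 <= m0 + s * (m1 - m0)" "m0 + s * (m1 - m0) <= lam0" if "0 <= s" "s <= 1" for s :: real
 proof -
  have e: "m0 + s * (m1 - m0) = (1 - s) * m0 + s * m1" by (simp add: algebra_simps)
  show "m0 + s * (m1 - m0) <= lam0" unfolding e using convex_bound_le[OF m(2,4), of "1 - s" s] that by simp
  have "(1 - s) * min m0 m1 + s * min m0 m1 <= (1 - s) * m0 + s * m1" using that by (intro add_mono mult_left_mono) auto
  thus "min m0 m1 <= m0 + s * (m1 - m0)" unfolding e by (simp add: algebra_simps)
 qed
 have ms0: "0 < m0 + s * (m1 - m0)" if "0 <= s" "s <= 1" for s using ms[OF that] m by auto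
 have d: "norm (hat x - (q0 + s *R (q1 - q0))) <= K * (m0 + s * (m1 - m0))" if "x \<in> VT Z T" "0 <= s" "s <= 1" for x s T
 proof -
  have "q0 + s *R (q1 - q0) \<in> Y" using b[OF that(2,3)] ms0[OF that(2,3)] by auto
  hence "norm (hat x - (q0 + s *R (q1 - q0))) <= R + R"
   using R(2)[of "q0 + s *R (q1 - q0)"] R(2)[of "hat x"] that(1) norm_triangle_ineq4[of "hat x" "q0 + s *R (q1 - q0)"] by (auto simp: Y_def VT_def)
  also have "R + R = K * min m0 m1" using m by (simp add: K_def)
  also have "... <= K * (m0 + s * (m1 - m0))" using ms[OF that(2,3)] K by (intro mult_left_mono) auto
  finally show ?thesis .
 qed
 have VZ: "VT Z T \<in> sets borel" for T using Z by (intro VT_borel) auto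
 have "(NB x. indicator (VT Z T) x * ennreal ((norm (Rg B u q1 m1 x - Rg B u q0 m0 x))\<^sup>2)) <= ennreal (CS K (norm (q1 - q0)) (CK K)) * JJ g"
  if T: "c0 <= T" and ad: "adm (VT Y T) u g" for T u g
 proof (rule col_segment_estimate[OF ad T VZ _ _ _ _ _ CK_nonneg[OF K], where ?q0.0 = "%x. q0" and ?q1.0 = "%x. q1" and ?m0.0 = "%x. m0" and ?m1.0 = "%x. m1"])
  fix s :: real assume s: "0 <= s" "s <= 1"
  show "schur (VT Z T) (%x. col B (q0 + s *R (q1 - q0)) (m0 + s * (m1 - m0)) x) (%x. m0 + s * (m1 - m0)) (CK K)"
   by (rule schur_const[OF VZ borel_measurable_const K ms0[OF s]]) (rule d[OF _ s])
 next
  fix x and s :: real assume "x \<in> VT Z T" "0 <= s" "s <= 1"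
  thus "0 < m0 + s * (m1 - m0) & m0 + s * (m1 - m0) <= lam0 & cball (q0 + s *R (q1 - q0)) (m0 + s * (m1 - m0)) \<subseteq> Y
   & norm (hat x - (q0 + s *R (q1 - q0))) <= K * (m0 + s * (m1 - m0))" using ms ms0 b d by blast
 qed (auto simp: VT_def)
 moreover have "CS K (norm (q1 - q0)) (CK K) >= 0" using CK_nonneg[OF K] by (simp add: CS_def)
 ultimately show ?thesis unfolding Rel_def by blast
qed

text \<open>Neighbouring centres are linked by a segment with a common small radius, so the
  equivalence classes are open in the connected set Y. Different radii are reconciled by shrinking
  the balls about a fixed centre.\<close>

lemma Rel_all:
 assumes q: "cball q m \<subseteq> Y" "0 < m" "m <= lam0" and q': "cball q' m' \<subseteq> Y" "0 < m'" "m' <= lam0"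
 shows "Rel q m q' m'"
proof -
 \<comment> \<open>Demands the relation for all sufficiently small common radii, since transitivity
   needs one radius that serves both links.\<close>
 define E where "E a b \<longleftrightarrow> (\<exists>k>0. \<forall>m. 0 < m --> m <= k --> Rel a m b m)" for a b
 have shrink: "Rel q m q n" if "cball q m \<subseteq> Y" "0 < n" "n <= m" "m <= lam0" for q m n
 proof (rule Rel_segment)
  fix s :: real assume s: "0 <= s" "s <= 1"
  have "m + s * (n - m) <= m" using s that by (simp add: mult_nonneg_nonpos)
  thus "cball (q + s *R (q - q)) (m + s * (n - m)) \<subseteq> Y" using that(1) by force
 qed (use that in auto)
 have "E q q'"
 proof (rule connected_equivalence_relation[OF Yconn])
  show "q \<in> Y" "q' \<in> Y" using q q' by auto
 next
  fix a b assume "E a b" thus "E b a" unfolding E_def using Rel_sym by blast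
 next
  fix a b c assume "E a b" "E b c"
  then obtain k k' where k: "k > 0" "k' > 0" "!!m. 0 < m ==> m <= k ==> Rel a m b m" "!!m. 0 < m ==> m <= k' ==> Rel b m c m"
   unfolding E_def by auto
  have "\<forall>m. 0 < m --> m <= min k k' --> Rel a m c m" using k(3,4) Rel_trans by (metis min.bounded_iff)
  thus "E a c" unfolding E_def using k(1,2) by (intro exI[of _ "min k k'"]) auto
 next
  fix a assume "a \<in> Y"
  then obtain e where e: "e > 0" "ball a e \<subseteq> Y" using Yopen open_contains_ball by blast
  have "E a b" if b: "b \<in> ball a (e / 2)" for b
   unfolding E_def
  proof (intro exI conjI allI impI)
   show "min (e / 4) lam0 > 0" using e lam0_pos by simp
   fix m assume m: "0 < m" "m <= min (e / 4) lam0"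
   show "Rel a m b m"
   proof (rule Rel_segment)
   fix s :: real assume s: "0 <= s" "s <= 1"
   have "norm (s *R (b - a)) <= 1 * norm (b - a)" unfolding norm_scaleR using s by (intro mult_right_mono) auto
   hence "dist a (a + s *R (b - a)) < e / 2" using b by (simp add: dist_norm norm_minus_commute)
   hence "cball (a + s *R (b - a)) m \<subseteq> ball a e" proof -
   have "dist a y < e" if "dist (a + s *R (b - a)) y <= m" for y
   using that m dist_triangle[of a y "a + s *R (b - a)"] \<open>dist a (a + s *R (b - a)) < e / 2\<close> e by auto
   thus ?thesis by auto
   qed
   thus "cball (a + s *R (b - a)) (m + s * (m - m)) \<subseteq> Y" using e by simp
   qed (use m in auto)
  qed
  moreover have "ball a (e / 2) \<subseteq> Y" using e(1) order_trans[OF subset_ball[of "e / 2" e a] e(2)] by simp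
  ultimately show "\<exists>T. openin (top_of_set Y) T & a \<in> T & (\<forall>x\<in>T. E a x)"
   using e by (intro exI[of _ "ball a (e / 2)"]) (auto simp: Yopen openin_open_eq)
 qed
 then obtain k where k: "k > 0" "!!m. 0 < m ==> m <= k ==> Rel q m q' m" unfolding E_def by auto
 define n where "n = min k (min m m')"
 have n: "0 < n" "n <= k" "n <= m" "n <= m'" using k q q' by (auto simp: n_def)
 have "Rel q m q n" "Rel q n q' n" "Rel q' m' q' n"
  using shrink[OF q(1) n(1,3) q(3)] k(2)[OF n(1,2)] shrink[OF q'(1) n(1,4) q'(3)] by auto
 thus ?thesis using Rel_trans Rel_sym by blast
qed

end

section \<open>Extension near a boundary point of the hole\<close>

context hole_cell
begin

text \<open>Collects what the gluing needs of a local extension. The maps and the constant are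
  chosen before T and u; \<open>F\<close> sees u and not its gradient, so that it is an operator.
  Linearity is stated up to null sets, because it will be applied to chosen representatives.\<close>

definition is_chart where
 "is_chart b r q m F G C \<longleftrightarrow> (\<forall>T u g. c0 <= T --> adm (VT Y T) u g --> (\<forall>i. intb (%x. (u x $ i)\<^sup>2)) -->
   (\<forall>i. wd (VT (ball b r) T) (%x. F u x $ i) (%x. G g x $ i))
   & (\<forall>i. L2X (VT (ball b r) T) (%x. F u x $ i)) & (\<forall>i j. L2X (VT (ball b r) T) (%x. G g x $ i $ j))
   & (NB x. indicator (VT (ball b r \<inter> D) T) x * ennreal ((norm (symm (G g x)))\<^sup>2)) <= ennreal C * JJ g
   & (NB x. indicator (VT (ball b r \<inter> D) T) x * ennreal ((norm (F u x - Rg B u q m x))\<^sup>2)) <= ennreal C * JJ g)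
  & (\<forall>u g x. hat x ~: D --> F u x = u x & G g x = g x)
  & (\<forall>u v w a c x. (\<forall>i. intb (%x. u x $ i)) --> (\<forall>i. intb (%x. w x $ i)) --> (\<forall>i. intb (%x. v x $ i)) -->
   (AE y in lborel. v y = a *R u y + c *R w y) --> hat x \<in> D --> F v x = a *R F u x + c *R F w x)"

text \<open>The radius is the square root of the regularised squared distance. It is comparable to
  the distance and has a bounded gradient where positive, but need not be differentiable at the
  boundary of the hole; adding the square of \<open>e n\<close> under the root gives positive C1
  radii for the passage to the limit.\<close>

lemma ex_chart_map:
 assumes b: "b \<in> frontier D"
 shows "\<exists>r q m F G C. r > 0 & 0 < m & m <= lam0 & cball q m \<subseteq> Y & C >= 0 & is_chart b r q m F G C"
proof -
 obtain Q Q' c1 c2 c3 where Q: "C1 Q Q'" "0 < c1" "0 < c2" "0 < c3"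
  and Qb': "\<forall>x. c1 * (infdist x (- D))\<^sup>2 <= Q x & Q x <= c2 * (infdist x (- D))\<^sup>2 & norm (Q' x) <= c3 * infdist x (- D)"
  using ex_regularised_distance[OF D(1,2)] by auto
 define dst where "dst x = infdist x (- D)" for x :: "real^2"
 have Qb: "c1 * (dst x)\<^sup>2 <= Q x" "Q x <= c2 * (dst x)\<^sup>2" "norm (Q' x) <= c3 * dst x" for x using Qb' by (auto simp: dst_def)
 have d0: "dst x >= 0" for x by (simp add: dst_def infdist_nonneg)
 have Q0: "Q x >= 0" for x using order_trans[OF _ Qb(1), of 0 x] Q by simp
 have bD: "b \<in> - D" using b D(1) by (simp add: frontier_def interior_open)
 have dpos: "dst x > 0" if "x \<in> D" for x
  unfolding dst_def using infdist_pos_not_in_closed[of "- D" x] D(1) bD that by (auto simp: closed_def)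
 have Qoff: "Q x = 0 & Q' x = 0" if "dst x = 0" for x using Qb[of x] that by simp
 have doff: "dst x = 0" if "x ~: D" for x using that by (simp add: dst_def)
 have c12: "c1 <= c2"
 proof -
  obtain x where x: "x \<in> D" using D(3) by auto
  have "c1 * (dst x)\<^sup>2 <= c2 * (dst x)\<^sup>2" using Qb[of x] by linarith
  thus ?thesis using dpos[OF x] by simp
 qed
 obtain v r lam where R: "0 < r" "0 < lam" "lam <= lam0" "c2 * r\<^sup>2 <= lam\<^sup>2 / 4" "c1 * r\<^sup>2 <= lam\<^sup>2"
  and chart: "\<forall>x\<in>ball b r. \<forall>t. 0 < t --> t <= lam --> c1 * (infdist x (- D))\<^sup>2 <= t\<^sup>2 --> cball (x + t *R v) (2 * t) \<subseteq> Z - closure D"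
  using ex_chart[OF D(1,4) b Z(1,3) Q(2,3) lam0_pos] by blast
 have chart2: "cball (x + t *R v) (2 * t) \<subseteq> Y" "cball (x + t *R v) t \<subseteq> Y"
  if "x \<in> ball b r" "0 < t" "t <= lam" "c1 * (dst x)\<^sup>2 <= t\<^sup>2" for x t
 proof -
  show 1: "cball (x + t *R v) (2 * t) \<subseteq> Y" using chart that unfolding Y_def dst_def by blast
  have "cball (x + t *R v) t \<subseteq> cball (x + t *R v) (2 * t)" using that by (intro subset_cball) auto
  thus "cball (x + t *R v) t \<subseteq> Y" using 1 by blast
 qed
 define l where "l x = sqrt (Q (hat x))" for x :: "real^3"
 define l' where "l' x = (1 / (2 * l x)) *R hatT (Q' (hat x))" for x :: "real^3"
 define e where "e n = lam / 2 * inverse (real (Suc n))" for n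
 define qn where "qn n x = sqrt (Q (hat x) + (e n)\<^sup>2)" for n and x :: "real^3"
 define qn' where "qn' n x = (1 / (2 * qn n x)) *R hatT (Q' (hat x))" for n and x :: "real^3"
 define p where "p x = x + l x *R nu v B x" for x :: "real^3"
 define p' where "p' k x = axis k 1 + (l x *R nu' B x k + nu v B x $ k *R l' x)" for k and x :: "real^3"
 define pn where "pn n x = x + qn n x *R nu v B x" for n and x :: "real^3"
 define pn' where "pn' n k x = axis k 1 + (qn n x *R nu' B x k + nu v B x $ k *R qn' n x)" for n k and x :: "real^3"
 have e: "0 < e n" "e n <= lam / 2" for n
 proof -
  show "0 < e n" using R by (simp add: e_def)
  have "lam / 2 * inverse (real (Suc n)) <= lam / 2 * 1" using R by (intro mult_left_mono) (auto simp: field_simps)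
  thus "e n <= lam / 2" by (simp add: e_def)
 qed
 have qpos: "qn n x > 0" for n x using Q0[of "hat x"] e[of n] by (simp add: qn_def add_nonneg_pos)
 have l0: "l x >= 0" for x using Q0 by (simp add: l_def)
 have Cq: "C1 (qn n) (qn' n)" for n
 proof -
  have "C1 (%x. sqrt (Q (hat x) + (e n)\<^sup>2)) (%x. (1 / (2 * sqrt (Q (hat x) + (e n)\<^sup>2))) *R (hatT (Q' (hat x)) + 0))"
   by (rule C1_sqrt[OF C1_add[OF C1_hat[OF Q(1)] C1_const]]) (rule add_nonneg_pos[OF Q0 zero_less_power[OF e(1)]])
  thus ?thesis by (simp add: qn_def[abs_def] qn'_def[abs_def])
 qed
 have Cp: "C1 (%x. pn n x $ k) (pn' n k)" for n k
  using C1_add[OF C1_coord[of k] C1_mult[OF Cq[of n] C1_nu[of v B k]]] by (simp add: pn_def pn'_def[abs_def])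
 have dle: "dst x <= r" if "x \<in> ball b r" for x
  using infdist_le[OF bD, of x] that by (simp add: dst_def dist_commute)
 have Qle: "Q x <= lam\<^sup>2 / 4" if "x \<in> ball b r" for x
 proof -
  have "Q x <= c2 * r\<^sup>2" using order_trans[OF Qb(2)[of x], of "c2 * r\<^sup>2"] dle[OF that] d0[of x] Q by (simp add: power_mono)
  thus ?thesis using R by linarith
 qed
 have lle: "l x <= lam / 2" if "hat x \<in> ball b r" for x
  unfolding l_def by (rule real_le_lsqrt) (use R Qle[OF that] Q0 in \<open>auto simp: power_divide\<close>)
 have qle: "qn n x <= lam" if "hat x \<in> ball b r" for n x
  unfolding qn_def
 proof (rule real_le_lsqrt)
  have "(e n)\<^sup>2 <= (lam / 2)\<^sup>2" using e[of n] by (intro power_mono) auto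
  hence "Q (hat x) + (e n)\<^sup>2 <= lam\<^sup>2 / 2" using Qle[OF that] by (simp add: power_divide)
  moreover have "lam\<^sup>2 / 2 <= lam\<^sup>2" by simp
  ultimately show "Q (hat x) + (e n)\<^sup>2 <= lam\<^sup>2" by linarith
 qed (use R Q0 in auto)
 have cq: "c1 * (dst (hat x))\<^sup>2 <= (qn n x)\<^sup>2" for n x
  using Qb(1)[of "hat x"] Q0[of "hat x"] by (simp add: qn_def add_increasing2)
 have cl: "c1 * (dst (hat x))\<^sup>2 <= (l x)\<^sup>2" for x using Qb(1)[of "hat x"] Q0[of "hat x"] by (simp add: l_def)
 have lD: "l x > 0" if "hat x \<in> D" for x
 proof -
  have "c1 * (dst (hat x))\<^sup>2 > 0" using dpos[OF that] Q by simp
  hence "Q (hat x) > 0" using Qb(1)[of "hat x"] by linarith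
  thus ?thesis by (simp add: l_def)
 qed
 define M1 where "M1 = c3 / (2 * sqrt c1)"
 have M1: "M1 >= 0" using Q by (simp add: M1_def)
 have s1: "sqrt c1 > 0" "(sqrt c1)\<^sup>2 = c1" using Q by auto
 have sd: "sqrt c1 * dst x <= s" if "0 <= s" "c1 * (dst x)\<^sup>2 <= s\<^sup>2" for x s
  by (rule power2_le_imp_le) (use that s1 in \<open>simp_all add: power_mult_distrib\<close>)
 have gb: "norm ((1 / (2 * s)) *R hatT (Q' (hat x))) <= M1" if "0 <= s" "c1 * (dst (hat x))\<^sup>2 <= s\<^sup>2" for x s
 proof (cases "s = 0")
  case True thus ?thesis using M1 by simp
 next
  case False
  have "norm (Q' (hat x)) * sqrt c1 <= c3 * dst (hat x) * sqrt c1" using s1 Qb(3) by (intro mult_right_mono) auto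
  also have "... = c3 * (sqrt c1 * dst (hat x))" by simp
  also have "... <= c3 * s" using sd[OF that] Q by (intro mult_left_mono) auto
  finally have "norm (Q' (hat x)) <= c3 * s / sqrt c1" using s1 by (simp add: pos_le_divide_eq)
  hence "norm (Q' (hat x)) / (2 * s) <= c3 * s / sqrt c1 / (2 * s)" using that False by (intro divide_right_mono) auto
  also have "c3 * s / sqrt c1 / (2 * s) = M1" using False by (simp add: M1_def)
  finally show ?thesis using that by simp
 qed
 define Mn where "Mn = norm v + 2 * B"
 have Mn: "Mn >= 0" "norm (nu v B x) <= Mn" for x using B0 norm_nu[of B v x] by (auto simp: Mn_def)
 define M where "M = 1 + (lam0 * B + Mn * M1) + Mn + M1"
 have Ms: "1 + (lam0 * B + Mn * M1) <= M" "Mn <= M" "M1 <= M" using Mn(1) M1 B0 lam0_pos by (auto simp: M_def)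
 have pb: "norm (axis k 1 + (s *R nu' B x k + nu v B x $ k *R w)) <= M" if "0 <= s" "s <= lam" "norm w <= M1" for s k w and x :: "real^3"
 proof -
  have "norm (s *R nu' B x k) <= lam0 * B" unfolding norm_scaleR using that R norm_nu'[of B x k] B0 lam0_pos by (intro mult_mono) auto
  moreover have "norm (nu v B x $ k *R w) <= Mn * M1" unfolding norm_scaleR
   using that(3) order_trans[OF component_le_norm_cart Mn(2)] Mn(1) by (intro mult_mono) auto
  moreover have "norm (axis k (1::real) :: real^3) = 1" by (simp add: norm_axis_1)
  ultimately show ?thesis using Ms(1) norm_triangle_ineq[of "axis k 1 :: real^3" "s *R nu' B x k + nu v B x $ k *R w"] norm_triangle_ineq[of "s *R nu' B x k" "nu v B x $ k *R w"] by linarith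
 qed
 have [measurable]: "(%x. Q (hat x)) \<in> bmb" "(%x. hatT (Q' (hat x))) \<in> bmb"
  using C1_borel[OF C1_hat[OF Q(1)]] by auto
 have [measurable]: "(%x. nu' B x k) \<in> bmb" for k using C1_borel(2)[OF C1_nu] .
 have ml [measurable]: "l \<in> bmb" unfolding l_def[abs_def] by measurable
 have ml' [measurable]: "l' \<in> bmb" unfolding l'_def[abs_def] by measurable
 have mp [measurable]: "p \<in> bmb" unfolding p_def[abs_def] by measurable
 have mp' [measurable]: "p' k \<in> bmb" for k unfolding p'_def[abs_def] by measurable
 have mq [measurable]: "qn n \<in> bmb" for n unfolding qn_def[abs_def] by measurable
 have mpn [measurable]: "pn n \<in> bmb" for n unfolding pn_def[abs_def] by measurable
 have md [measurable]: "(%x. - nu v B x) \<in> bmb" by measurable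
 have D_borel [measurable]: "D \<in> sets borel" using D by simp
 have bor: "VT (ball b r) T \<in> sets borel" "VT (ball b r \<inter> D) T \<in> sets borel" "VT (ball b r - D) T \<in> sets borel" for T
  by (intro VT_borel; simp add: D_borel)+
 have nv: "norm v >= 0" by simp
 have schD: "schur (VT (ball b r \<inter> D) T) (%x. x + m x *R nu v B x) m (CK (norm v))"
  if m: "m \<in> bmb" "!!x. hat x \<in> ball b r ==> hat x \<in> D ==> 0 < m x & m x <= lam & c1 * (dst (hat x))\<^sup>2 <= (m x)\<^sup>2" for m T
  unfolding col_nu
 proof (rule schur_col[OF bor(2) _ m(1) nv])
  note [measurable] = m(1)
  show "(%x. hat x + m x *R v) \<in> bmb" by measurable
  fix x assume "x \<in> VT (ball b r \<inter> D) T"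
  hence x: "hat x \<in> ball b r" "hat x \<in> D" by (auto simp: VT_def)
  show "0 < m x" using m(2)[OF x] by simp
  show "hat x \<in> closure D" using x closure_subset by auto
  show "cball (hat x + m x *R v) (2 * m x) \<inter> closure D = {}" using chart2(1)[OF x(1), of "m x"] m(2)[OF x] by (auto simp: Y_def)
  show "norm (hat x - (hat x + m x *R v)) <= norm v * m x" using m(2)[OF x] by simp
 qed
 define Cc where "Cc = CK (norm v) + (CK (norm v) + vB)"
 have CKv: "CK (norm v) >= 0" by (rule CK_nonneg) simp
 have Cc: "Cc >= 0" using CKv vB_nonneg by (simp add: Cc_def)
 have VU: "VT (ball b r) T \<subseteq> VT (ball b r \<inter> D) T \<union> VT (ball b r - D) T" for T by (auto simp: VT_def)
 have schn: "schur (VT (ball b r) T) (pn n) (qn n) Cc" for T n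
 proof -
  have 1: "schur (VT (ball b r \<inter> D) T) (pn n) (qn n) (CK (norm v))"
   unfolding pn_def[abs_def] by (rule schD[OF mq]) (use qpos qle cq in auto)
  \<comment> \<open>Off the hole the regularised radius is the constant \<open>e n\<close>, which
    tends to 0; the criterion for constant radii gives a bound that does not depend on it.\<close>
  have "schur (VT (ball b r - D) T) (%x. col B (hat x + e n *R v) (e n) x) (%x. e n) (CK (norm v))"
   by (rule schur_const[OF bor(3) _ nv e(1)]) (use e[of n] in auto)
  moreover have "qn n x = e n" if "x \<in> VT (ball b r - D) T" for x
   using that Qoff[OF doff, of "hat x"] e[of n] by (auto simp: VT_def qn_def)
  ultimately have 2: "schur (VT (ball b r - D) T) (pn n) (qn n) (CK (norm v))"
   by (elim schur_cong) (auto simp: pn_def col_nu)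
  show ?thesis
   by (rule schur_mono[OF schur_union[OF bor(2,3) mpn mq 1 2 CKv CKv VU]]) (simp add: Cc_def vB_nonneg)
 qed
 have schl: "schur (VT (ball b r) T) p l Cc" for T
 proof -
  have 1: "schur (VT (ball b r \<inter> D) T) p l (CK (norm v))"
   unfolding p_def[abs_def] by (rule schD[OF ml]) (use lD lle R cl in fastforce)
  have 2: "schur (VT (ball b r - D) T) p l vB"
   by (rule schur_zero_scale) (use Qoff[OF doff] in \<open>auto simp: VT_def p_def l_def\<close>)
  show ?thesis
   by (rule schur_mono[OF schur_union[OF bor(2,3) mp ml 1 2 CKv vB_nonneg VU]]) (simp add: Cc_def CKv)
 qed
 have e_lim: "e \<longlonglongrightarrow> 0"
  unfolding e_def[abs_def] by (rule tendsto_mult_right_zero[OF LIMSEQ_inverse_real_of_nat])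
 have ql: "(%n. qn n x) \<longlonglongrightarrow> l x" for x
 proof -
  have "(%n. sqrt (Q (hat x) + (e n)\<^sup>2)) \<longlonglongrightarrow> sqrt (Q (hat x) + 0\<^sup>2)" by (intro tendsto_intros e_lim)
  thus ?thesis by (simp add: qn_def l_def)
 qed
 have ql': "(%n. qn' n x) \<longlonglongrightarrow> l' x" for x
 proof (cases "l x = 0")
  case True
  hence "c1 * (dst (hat x))\<^sup>2 <= 0" using cl[of x] by simp
  hence "dst (hat x) = 0" using Q by (simp add: mult_le_0_iff)
  hence "hatT (Q' (hat x)) = 0" using Qoff by (simp add: vec3_eq)
  thus ?thesis by (simp add: qn'_def l'_def)
 next
  case False
  thus ?thesis unfolding qn'_def l'_def by (intro tendsto_intros ql) simp
 qed
 \<comment> \<open>The offset (x - p) / l equals - \<open>nu\<close> whenever l > 0; this expression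
   is kept where l = 0, so the same formula covers points outside the hole.\<close>
 define F where "F u x = (\<chi> i. Fr u (- nu v B x) (p x) (l x) i)" for u and x :: "real^3"
 define G where "G g x = (\<chi> i. Gr g (- nu v B x) (p x) (l x) (%k. p' k x) (l' x) i)" for g and x :: "real^3"
 \<comment> \<open>Foot of the comparison column: the boundary point itself, pushed by the full
   \<open>lam\<close>.\<close>
 define q where "q = b + lam *R v"
 define K where "K = r / lam + norm v"
 have K: "K >= 0" using R by (simp add: K_def)
 have lb: "norm (- nu v B x) <= M" for x using Mn(2)[of x] Ms by (simp add: norm_minus_cancel)
 have l'b: "norm (l' x) <= M1" for x unfolding l'_def by (rule gb[OF l0 cl])
 have l'bM: "norm (l' x) <= M" for x using l'b[of x] Ms by linarith
 have p'b: "norm (p' k x) <= M" if "hat x \<in> ball b r" for k x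
  unfolding p'_def using lle[OF that] R by (intro pb l0 l'b) auto
 define kk where "kk = cS * (4 * M) * (1 + M)"
 define C where "C = 9 * kk\<^sup>2 * Cc + CS K (r + lam * norm v) (CK K)"
 have CSn: "CS K (r + lam * norm v) (CK K) >= 0" using CK_nonneg[OF K] by (simp add: CS_def)
 have Cn: "C >= 0" "9 * kk\<^sup>2 * Cc <= C" "CS K (r + lam * norm v) (CK K) <= C" using Cc CSn by (auto simp: C_def)
 \<comment> \<open>The segment from the moving centre to \<open>q\<close> is again of pushed form w
   + m v, with w between the projection of x and b. Along it m grows by at least s lam/2, while sqrt
   c1 times the distance of w to the complement grows by at most that, so the chart property applies
   throughout.\<close>
 have seg: "0 < l x + s * (lam - l x) & l x + s * (lam - l x) <= lam
   & cball (hat x + l x *R v + s *R (q - (hat x + l x *R v))) (2 * (l x + s * (lam - l x))) \<subseteq> Y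
   & norm (hat x - (hat x + l x *R v + s *R (q - (hat x + l x *R v)))) <= K * (l x + s * (lam - l x))"
  if x: "hat x \<in> ball b r" "hat x \<in> D" and s: "0 <= s" "s <= 1" for x s
 proof -
  define k where "k = s * (lam - l x)"
  define m where "m = l x + k"
  define w where "w = hat x + s *R (b - hat x)"
  have lx: "0 < l x" "l x <= lam / 2" using lD[OF x(2)] lle[OF x(1)] by auto
  have ls1: "s * (lam / 2) <= k" unfolding k_def by (rule mult_left_mono) (use lx s in auto)
  have "k <= 1 * (lam - l x)" unfolding k_def by (rule mult_right_mono) (use lx s R in auto)
  hence ls2: "k <= lam - l x" by simp
  have "0 <= s * (lam / 2)" using s R by simp
  hence m1: "0 < m" unfolding m_def using ls1 lx by linarith
  have m2: "m <= lam" unfolding m_def using ls2 by linarith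
  note m = m1 m2
  have "m = (1 - s) * l x + s * lam" by (simp add: m_def k_def algebra_simps)
  moreover have "(1 - s) * l x >= 0" using s lx by simp
  ultimately have ms: "s * lam <= m" by linarith
  have qe: "hat x + l x *R v + s *R (q - (hat x + l x *R v)) = w + m *R v"
   by (simp add: q_def w_def m_def k_def algebra_simps)
  have bx: "norm (b - hat x) < r" using x by (simp add: dist_norm)
  have sb: "norm (s *R (b - hat x)) <= s * r" using bx s by (simp add: mult_left_mono)
  have "b - w = (1 - s) *R (b - hat x)" by (simp add: w_def algebra_simps)
  hence "norm (b - w) <= 1 * norm (b - hat x)" using s by (simp only: norm_scaleR) (intro mult_right_mono, auto)
  hence wb: "w \<in> ball b r" using bx by (simp add: dist_norm)
  have "dst w <= dst (hat x) + dist w (hat x)" unfolding dst_def by (rule infdist_triangle)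
  also have "dist w (hat x) <= s * r" using sb by (simp add: w_def dist_norm)
  finally have "sqrt c1 * dst w <= sqrt c1 * (dst (hat x) + s * r)" using s1 by (intro mult_left_mono) auto
  also have "... = sqrt c1 * dst (hat x) + s * (sqrt c1 * r)" by (simp add: algebra_simps)
  also have "... <= l x + s * (lam / 2)"
  proof (intro add_mono sd l0 cl mult_left_mono s)
   have "c1 * r\<^sup>2 <= c2 * r\<^sup>2" using c12 by (intro mult_right_mono) auto
   hence "c1 * r\<^sup>2 <= lam\<^sup>2 / 4" using R(4) by linarith
   hence "(sqrt c1 * r)\<^sup>2 <= (lam / 2)\<^sup>2" unfolding power_mult_distrib s1(2) by (simp add: power_divide)
   thus "sqrt c1 * r <= lam / 2" by (rule power2_le_imp_le) (use R(2) in simp)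
  qed
  also have "... <= m" unfolding m_def using ls1 by linarith
  finally have "(sqrt c1 * dst w)\<^sup>2 <= m\<^sup>2" using s1 d0[of w] by (intro power_mono) auto
  hence "c1 * (dst w)\<^sup>2 <= m\<^sup>2" by (simp add: power_mult_distrib s1)
  from chart2(1)[OF wb m this] have 1: "cball (w + m *R v) (2 * m) \<subseteq> Y" .
  have "hat x - (w + m *R v) = - (s *R (b - hat x) + m *R v)" by (simp add: w_def)
  hence "norm (hat x - (w + m *R v)) <= norm (s *R (b - hat x)) + norm (m *R v)"
   using norm_triangle_ineq[of "s *R (b - hat x)" "m *R v"] by (simp only: norm_minus_cancel)
  also have "... <= s * r + m * norm v" using sb m by simp
  also have "s * r = (r / lam) * (s * lam)" using R by simp
  also have "... <= (r / lam) * m" using ms R by (intro mult_left_mono) auto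
  finally have "norm (hat x - (w + m *R v)) <= K * m" by (simp add: K_def algebra_simps)
  thus ?thesis using m 1 unfolding qe k_def[symmetric] m_def[symmetric] by blast
 qed
 have "is_chart b r q lam F G C"
  unfolding is_chart_def
 proof (intro conjI allI impI)
  fix T u g i assume T: "c0 <= T" and ad: "adm (VT Y T) u g" and u2: "\<forall>i. intb (%x. (u x $ i)\<^sup>2)"
  show "wd (VT (ball b r) T) (%x. F u x $ i) (%x. G g x $ i)"
   unfolding F_def G_def vec_lambda_beta
  proof (rule Fr_wd_limit[OF ad bor(1) Cp Cq qpos, where M = M and C = Cc])
   fix x n assume "x \<in> VT (ball b r) T"
   hence x: "hat x \<in> ball b r" "\<bar>x $ 3\<bar> < T / 2" by (auto simp: VT_def)
   show "cball (pn n x) (qn n x) \<subseteq> VT Y T" unfolding pn_def col_nu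
   using qle[OF x(1), of n] R by (intro col_ball[OF T x(2) qpos _ chart2(2)[OF x(1) qpos _ cq]]) auto
   show "(%n. pn n x) \<longlonglongrightarrow> p x" unfolding pn_def p_def by (intro tendsto_intros ql)
   show "(%n. qn n x) \<longlonglongrightarrow> l x" by (rule ql)
   show "(%n. qn' n x) \<longlonglongrightarrow> l' x" by (rule ql')
   show "(%n. pn' n k x) \<longlonglongrightarrow> p' k x" for k unfolding pn'_def p'_def by (intro tendsto_intros ql ql')
   have dd: "(1 / qn n x) *R (x - pn n x) = - nu v B x" for n using qpos[of n x] by (simp add: pn_def)
   show "(%n. (1 / qn n x) *R (x - pn n x)) \<longlonglongrightarrow> - nu v B x" unfolding dd by simp
   show "norm ((1 / qn n x) *R (x - pn n x)) <= M" unfolding dd by (rule lb)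
   have q'b: "norm (qn' n x) <= M1" unfolding qn'_def by (rule gb[OF less_imp_le[OF qpos] cq])
   show "norm (pn' n k x) <= M" for k unfolding pn'_def by (rule pb[OF less_imp_le[OF qpos] qle[OF x(1)] q'b])
   show "norm (qn' n x) <= M" using q'b Ms by simp
   show "l x >= 0" by (rule l0)
  qed (rule mp ml mp' ml' md schn schl Cc)+
 next
  fix T u g i assume T: "c0 <= T" and ad: "adm (VT Y T) u g" and u2: "\<forall>i. intb (%x. (u x $ i)\<^sup>2)"
  show "L2X (VT (ball b r) T) (%x. F u x $ i)" unfolding F_def vec_lambda_beta
   by (rule L2X_Fr_Gr(1)[OF ad u2[rule_format] schl bor(1) mp ml md mp' ml', where M = M])
   (use lb p'b l'bM in \<open>auto simp: VT_def\<close>)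
 next
  fix T u g i j assume T: "c0 <= T" and ad: "adm (VT Y T) u g" and u2: "\<forall>i. intb (%x. (u x $ i)\<^sup>2)"
  show "L2X (VT (ball b r) T) (%x. G g x $ i $ j)" unfolding G_def vec_lambda_beta
   by (rule L2X_Fr_Gr(2)[OF ad u2[rule_format] schl bor(1) mp ml md mp' ml', where M = M])
   (use lb p'b l'bM in \<open>auto simp: VT_def\<close>)
 next
  fix T u g assume T: "c0 <= T" and ad: "adm (VT Y T) u g" and u2: "\<forall>i. intb (%x. (u x $ i)\<^sup>2)"
  let ?X = "VT (ball b r \<inter> D) T"
  note [measurable] = bor(2)[of T] Er_measurable[OF ad mp ml]
  have pw: "(norm (symm (G g x)))\<^sup>2 <= 9 * kk\<^sup>2 * Er g (p x) (l x)" if "x \<in> ?X" for x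
  proof -
   have x: "hat x \<in> ball b r" "hat x \<in> D" using that by (auto simp: VT_def)
   have "(symm (G g x) $ i $ j)\<^sup>2 <= kk\<^sup>2 * Er g (p x) (l x)" for i j
   proof -
   have "\<bar>symm (G g x) $ i $ j\<bar> <= kk * sqrt (Er g (p x) (l x))"
   unfolding symm_nth G_def vec_lambda_beta kk_def
   by (rule Gr_symm_bound[OF ad lD[OF x(2)] lb p'b[OF x(1)]]) (use l'b[of x] Ms in linarith)
   hence "\<bar>symm (G g x) $ i $ j\<bar>\<^sup>2 <= (kk * sqrt (Er g (p x) (l x)))\<^sup>2" by (intro power_mono) auto
   thus ?thesis using Er_nonneg by (simp add: power_mult_distrib)
   qed
   hence "(norm (symm (G g x)))\<^sup>2 <= (\<Sum>i\<in>(UNIV::3 set). \<Sum>j\<in>(UNIV::3 set). kk\<^sup>2 * Er g (p x) (l x))"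
   unfolding norm_matrix_sq by (intro sum_mono)
   thus ?thesis by simp
  qed
  have "(NB x. indicator ?X x * ennreal ((norm (symm (G g x)))\<^sup>2))
   <= (NB x. ennreal (9 * kk\<^sup>2) * (indicator ?X x * ennreal (Er g (p x) (l x))))"
  proof (rule nn_integral_mono)
   fix x
   show "indicator ?X x * ennreal ((norm (symm (G g x)))\<^sup>2) <= ennreal (9 * kk\<^sup>2) * (indicator ?X x * ennreal (Er g (p x) (l x)))"
   using pw[of x] Er_nonneg by (auto simp: indicator_def ennreal_mult[symmetric] intro!: ennreal_leI)
  qed
  also have "... = ennreal (9 * kk\<^sup>2) * (NB x. indicator ?X x * ennreal (Er g (p x) (l x)))"
   by (rule nn_integral_cmult) measurable
  also have "... <= ennreal (9 * kk\<^sup>2) * (ennreal Cc * JJ g)"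
   unfolding JJ_def
   by (intro mult_left_mono schur_Er[OF ad schur_subset[OF schl[of T]]]) (use lD in \<open>auto simp: VT_def\<close>)
  also have "... = ennreal (9 * kk\<^sup>2 * Cc) * JJ g" using Cc by (simp add: ennreal_mult' mult.assoc)
  also have "... <= ennreal C * JJ g" using Cn by (intro mult_right_mono ennreal_leI) auto
  finally show "(NB x. indicator ?X x * ennreal ((norm (symm (G g x)))\<^sup>2)) <= ennreal C * JJ g" .
 next
  fix T u g assume T: "c0 <= T" and ad: "adm (VT Y T) u g" and u2: "\<forall>i. intb (%x. (u x $ i)\<^sup>2)"
  let ?X = "VT (ball b r \<inter> D) T"
  have "(NB x. indicator ?X x * ennreal ((norm (F u x - Rg B u q lam x))\<^sup>2))
   = (NB x. indicator ?X x * ennreal ((norm (Rg B u q lam x - Rg B u (hat x + l x *R v) (l x) x))\<^sup>2))"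
  proof (rule nn_integral_cong)
   fix x
   have "F u x = Rg B u (hat x + l x *R v) (l x) x" if "x \<in> ?X"
   proof -
   have "l x > 0" using that by (intro lD) (simp add: VT_def)
   thus ?thesis by (simp add: F_def Rg_def col_nu[symmetric] p_def)
   qed
   thus "indicator ?X x * ennreal ((norm (F u x - Rg B u q lam x))\<^sup>2) = indicator ?X x * ennreal ((norm (Rg B u q lam x - Rg B u (hat x + l x *R v) (l x) x))\<^sup>2)"
   by (auto simp: indicator_def norm_minus_commute)
  qed
  also have "... <= ennreal (CS K (r + lam * norm v) (CK K)) * JJ g"
  proof (rule col_segment_estimate[OF ad T bor(2) _ _ _ ml _ CK_nonneg[OF K], where ?q0.0 = "%x. hat x + l x *R v" and ?q1.0 = "%x. q" and ?m1.0 = "%x. lam"])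
   show "(%x. hat x + l x *R v) \<in> bmb" by measurable
  next
   fix x and s :: real assume "x \<in> ?X" and s: "0 <= s" "s <= 1"
   hence x: "hat x \<in> ball b r" "hat x \<in> D" by (auto simp: VT_def)
   let ?q = "hat x + l x *R v + s *R (q - (hat x + l x *R v))" and ?m = "l x + s * (lam - l x)"
   note sg = seg[OF x s]
   have "cball ?q ?m \<subseteq> cball ?q (2 * ?m)" using sg by (intro subset_cball) simp
   thus "0 < ?m & ?m <= lam0 & cball ?q ?m \<subseteq> Y & norm (hat x - ?q) <= K * ?m" using sg R(3) by auto
  next
   fix x assume "x \<in> ?X"
   hence x: "hat x \<in> ball b r" "hat x \<in> D" by (auto simp: VT_def)
   have "q - (hat x + l x *R v) = (b - hat x) + (lam - l x) *R v" by (simp add: q_def algebra_simps)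
   hence "norm (q - (hat x + l x *R v)) <= norm (b - hat x) + norm ((lam - l x) *R v)"
   using norm_triangle_ineq[of "b - hat x" "(lam - l x) *R v"] by (simp only:)
   also have "norm ((lam - l x) *R v) <= lam * norm v" unfolding norm_scaleR using l0[of x] lle[OF x(1)] R by (intro mult_right_mono) auto
   also have "norm (b - hat x) <= r" using x by (simp add: dist_norm)
   finally show "norm (q - (hat x + l x *R v)) <= r + lam * norm v" by simp
  next
   fix s :: real assume s: "0 <= s" "s <= 1"
   show "schur ?X (%x. col B (hat x + l x *R v + s *R (q - (hat x + l x *R v))) (l x + s * (lam - l x)) x) (%x. l x + s * (lam - l x)) (CK K)"
   proof (rule schur_col[OF bor(2) _ _ K])
   fix x assume "x \<in> ?X"
   hence x: "hat x \<in> ball b r" "hat x \<in> D" by (auto simp: VT_def)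
   note sg = seg[OF x s]
   show "0 < l x + s * (lam - l x)" using sg by simp
   show "hat x \<in> closure D" using x closure_subset by auto
   show "cball (hat x + l x *R v + s *R (q - (hat x + l x *R v))) (2 * (l x + s * (lam - l x))) \<inter> closure D = {}"
   using sg by (auto simp: Y_def)
   show "norm (hat x - (hat x + l x *R v + s *R (q - (hat x + l x *R v)))) <= K * (l x + s * (lam - l x))" using sg by blast
   qed measurable
  qed (auto simp: VT_def)
  also have "... <= ennreal C * JJ g" using Cn by (intro mult_right_mono ennreal_leI) auto
  finally show "(NB x. indicator ?X x * ennreal ((norm (F u x - Rg B u q lam x))\<^sup>2)) <= ennreal C * JJ g" .
 next
  fix u :: "real^3 => real^3" and g and x :: "real^3" assume "hat x ~: D"
  hence z: "Q (hat x) = 0" using Qoff doff by blast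
  hence l: "l x = 0" by (simp add: l_def)
  hence l': "l' x = 0" and p: "p x = x" by (simp_all add: l'_def p_def)
  show "F u x = u x" by (simp add: F_def l p Fr_rigid_zero_scale)
  have "Gr g (- nu v B x) x 0 (%k. p' k x) 0 i = g x $ i" for i
   by (rule Gr_zero_scale) (auto simp: p'_def l l' axis_def)
  thus "G g x = g x" by (simp add: G_def l l' p)
 next
  fix u v' w :: "real^3 => real^3" and a c :: real and x :: "real^3"
  assume i: "\<forall>i. intb (%x. u x $ i)" "\<forall>i. intb (%x. w x $ i)" "\<forall>i. intb (%x. v' x $ i)"
   and ae: "AE y in lborel. v' y = a *R u y + c *R w y" and x: "hat x \<in> D"
  have "Fr v' (- nu v B x) (p x) (l x) j = a * Fr u (- nu v B x) (p x) (l x) j + c * Fr w (- nu v B x) (p x) (l x) j" for j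
   by (rule Fr_lin[OF lD[OF x] i(1)[rule_format] i(2)[rule_format] i(3)[rule_format] ae])
  thus "F v' x = a *R F u x + c *R F w x" by (simp add: F_def vec_eq_iff)
 qed
 moreover have "cball q lam \<subseteq> Y"
 proof -
  have "dst b = 0" using doff bD by simp
  thus ?thesis unfolding q_def using R by (intro chart2(2)) auto
 qed
 ultimately show ?thesis using R Cn(1) by blast
qed

end

section \<open>Products and sums of square integrable functions with weak gradients\<close>

lemma L2X_local:
 assumes f: "L2X U f" and [measurable]: "U \<in> sets borel" "W \<in> sets borel" "c \<in> bmb"
  and M: "!!x. x \<in> W ==> \<bar>c x\<bar> <= M" and z: "!!x. x \<in> W ==> x ~: U ==> c x = 0"
 shows "L2X W (%x. c x * f x)"
proof -
 have [measurable]: "f \<in> bmb" using f by (simp add: L2X_def)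
 have "(NB x. indicator W x * ennreal ((c x * f x)\<^sup>2)) <= (NB x. ennreal (M\<^sup>2) * (indicator U x * ennreal ((f x)\<^sup>2)))"
 proof (rule nn_integral_mono)
  fix x
  show "indicator W x * ennreal ((c x * f x)\<^sup>2) <= ennreal (M\<^sup>2) * (indicator U x * ennreal ((f x)\<^sup>2))"
  proof (cases "x \<in> W & x \<in> U")
   case True
   hence "(c x)\<^sup>2 <= M\<^sup>2" using M[of x] by (metis abs_ge_zero power2_abs power_mono)
   hence "(c x * f x)\<^sup>2 <= M\<^sup>2 * (f x)\<^sup>2" by (simp add: power_mult_distrib mult_right_mono)
   thus ?thesis using True by (simp add: ennreal_mult[symmetric] ennreal_leI)
  next
   case False
   thus ?thesis using z[of x] by (cases "x \<in> W") auto
  qed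
 qed
 also have "... = ennreal (M\<^sup>2) * (NB x. indicator U x * ennreal ((f x)\<^sup>2))" by (rule nn_integral_cmult) measurable
 also have "... < \<infinity>" using f by (auto simp: L2X_def ennreal_mult_less_top)
 finally show ?thesis by (simp add: L2X_def)
qed

text \<open>Square integrability is asked on W only: a local extension is controlled over its own
  chart, and nothing is known of it elsewhere.\<close>

definition wL :: "(real^3) set => (real^3 => real) => (real^3 => real^3) => bool" where
 "wL W f g \<longleftrightarrow> wd W f g & L2X W f & (\<forall>j. L2X W (%x. g x $ j))"

lemma bounded_emeasure: "bounded (W :: (real^3) set) ==> emeasure lborel W < \<infinity>"
 using emeasure_bounded_finite by simp

lemma wL_integrable:
 assumes "wL W f g" "open W" "bounded W"
 shows "intb (%x. indicator W x * f x)" "!!j. intb (%x. (indicator W x *R g x) $ j)"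
  "wd W (%x. indicator W x * f x) (%x. indicator W x *R g x)"
proof -
 have W: "W \<in> sets borel" "emeasure lborel W < \<infinity>" using assms bounded_emeasure by auto
 show "intb (%x. indicator W x * f x)" using assms(1) by (intro L2X_integrable(2)[OF _ W]) (simp add: wL_def)
 show "intb (%x. (indicator W x *R g x) $ j)" for j
  using L2X_integrable(2)[OF _ W, of "%x. g x $ j"] assms(1) by (simp add: wL_def)
 show "wd W (%x. indicator W x * f x) (%x. indicator W x *R g x)"
  by (rule wd_cong_on[of W f g]) (use assms in \<open>auto simp: wL_def\<close>)
qed

lemma wL_cong:
 assumes "wL W f g" "open W" and "!!x. x \<in> W ==> f2 x = f x" "!!x. x \<in> W ==> g2 x = g x"
  and m: "f2 \<in> bmb" "!!j. (%x. g2 x $ j) \<in> bmb"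
 shows "wL W f2 g2"
proof -
 have 1: "wd W f2 g2" using wd_cong_on[of W f g f2 g2] assms by (auto simp: wL_def)
 have c: "(NB x. indicator W x * ennreal ((a x)\<^sup>2)) = (NB x. indicator W x * ennreal ((b x)\<^sup>2))"
  if "!!x. x \<in> W ==> a x = b x" for a b :: "real^3 => real"
  by (rule nn_integral_cong) (auto simp: indicator_def that)
 have "L2X W f2" using assms(1) m(1) c[of f2 f, OF assms(3)] by (simp add: wL_def L2X_def)
 moreover have "L2X W (%x. g2 x $ j)" for j
  using assms(1) m(2)[of j] c[of "%x. g2 x $ j" "%x. g x $ j"] assms(4) by (simp add: wL_def L2X_def)
 ultimately show ?thesis using 1 by (simp add: wL_def)
qed

lemma wL_add:
 assumes a: "wL W f g" "wL W f2 g2" and W: "open W" "bounded W"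
 shows "wL W (%x. f x + f2 x) (%x. g x + g2 x)"
proof -
 have "wd W (%x. indicator W x * f x + indicator W x * f2 x) (%x. indicator W x *R g x + indicator W x *R g2 x)"
  by (intro wd_add wL_integrable[OF a(1) W] wL_integrable[OF a(2) W])
 hence "wd W (%x. f x + f2 x) (%x. g x + g2 x)" by (rule wd_cong_on) auto
 thus ?thesis using a W by (auto simp: wL_def intro!: L2X_add)
qed

lemma wL_zero: "wL W (%x. 0) (%x. 0)"
 by (simp add: wL_def wd_zero L2X_zero)

lemma wL_sum:
 assumes "finite S" "!!k. k \<in> S ==> wL W (f k) (g k)" "open W" "bounded W"
 shows "wL W (%x. \<Sum>k\<in>S. f k x) (%x. \<Sum>k\<in>S. g k x)"
 using assms(1,2)
proof (induction S)
 case empty thus ?case by (simp add: wL_zero)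
next
 case (insert k S)
 have "wL W (%x. f k x + (\<Sum>k\<in>S. f k x)) (%x. g k x + (\<Sum>k\<in>S. g k x))"
  by (rule wL_add) (use insert assms in auto)
 thus ?case using insert by simp
qed

text \<open>Spreads a function controlled on U to W by a cut-off carried by S. Multiplication by the
  indicator of U first makes it globally integrable, as the product rule for weak gradients
  requires, and the indicator is removed afterwards.\<close>

lemma wL_product:
 assumes w: "wL U f g" and et: "C1 et et'" and S: "closed S" "!!x. x ~: S ==> et x = 0" "W \<inter> S \<subseteq> U"
  and U: "open U" "bounded U" and W: "open W" "bounded W"
 shows "wL W (%x. et x * f x) (%x. et x *R g x + f x *R et' x)"
proof -
 have K: "compact (closure W)" using W(2) by simp
 obtain M1 where M1: "!!x. x \<in> closure W ==> \<bar>et x\<bar> <= M1"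
  using compact_imp_bounded[OF compact_continuous_image[OF continuous_on_subset[OF C1_cont[OF et] subset_UNIV] K]] by (auto simp: bounded_iff)
 obtain M2 where M2: "!!x. x \<in> closure W ==> norm (et' x) <= M2"
  using compact_imp_bounded[OF compact_continuous_image[OF continuous_on_subset[OF C1_cont'[OF et] subset_UNIV] K]] by (auto simp: bounded_iff)
 have z: "et' x = 0" if "x ~: S" for x by (rule C1_zero_outside[OF et S(1,2) that])
 have "wd W (%x. et x * (indicator U x * f x)) (%x. et x *R (indicator U x *R g x) + (indicator U x * f x) *R et' x)"
  by (rule wd_product[OF wL_integrable(3)[OF w U] wL_integrable(1,2)[OF w U] et S(1) _ S(3)]) (rule S(2))
 hence 1: "wd W (%x. et x * f x) (%x. et x *R g x + f x *R et' x)"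
 proof (rule wd_cong_on)
  fix x assume "x \<in> W"
  hence "x \<in> U \<or> x ~: S" using S(3) by blast
  thus "et x * f x = et x * (indicator U x * f x)"
   "et x *R g x + f x *R et' x = et x *R (indicator U x *R g x) + (indicator U x * f x) *R et' x"
   using S(2)[of x] z[of x] by auto
 qed
 note [measurable] = C1_borel[OF et]
 have bor: "U \<in> sets borel" "W \<in> sets borel" using U W by auto
 have M1W: "\<bar>et x\<bar> <= M1" if "x \<in> W" for x using M1 subsetD[OF closure_subset that] .
 have zU: "et x = 0" "et' x = 0" if "x \<in> W" "x ~: U" for x using that S z[of x] by auto
 have "L2X W (%x. et x * f x)"
  by (rule L2X_local[OF _ bor C1_borel(1)[OF et], where M = M1]) (use w M1W zU in \<open>auto simp: wL_def\<close>)
 moreover have "L2X W (%x. (et x *R g x + f x *R et' x) $ j)" for j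
 proof -
  have "L2X W (%x. et x * g x $ j)"
   by (rule L2X_local[OF _ bor C1_borel(1)[OF et], where M = M1]) (use w M1W zU in \<open>auto simp: wL_def\<close>)
  moreover have "L2X W (%x. et' x $ j * f x)"
  proof (rule L2X_local[OF _ bor, where M = M2])
   show "L2X U f" using w by (simp add: wL_def)
   show "\<bar>et' x $ j\<bar> <= M2" if "x \<in> W" for x using M2[of x] that closure_subset component_le_norm_cart[of "et' x" j] by force
   show "et' x $ j = 0" if "x \<in> W" "x ~: U" for x using zU[OF that] by simp
  qed measurable
  ultimately have "L2X W (%x. et x * g x $ j + et' x $ j * f x)" using bor by (intro L2X_add)
  thus ?thesis by (simp add: mult.commute)
 qed
 ultimately show ?thesis using 1 by (simp add: wL_def)
qed

lemma closed_hat_vimage: "closed S ==> closed (hat -` S)"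
 by (rule continuous_closed_vimage) (auto intro!: continuous_at_imp_continuous_on linear_continuous_at simp: linear_conv_bounded_linear[symmetric] hat_linear)

lemma norm_symm_measurable:
 assumes [measurable]: "!!i j. (%x. f x $ i $ j) \<in> bmb"
 shows "(%x. norm (symm (f x))) \<in> bmb"
proof -
 have e: "norm (symm M) = sqrt (\<Sum>i\<in>UNIV. \<Sum>j\<in>UNIV. ((M $ i $ j + M $ j $ i) / 2)\<^sup>2)" for M
  unfolding symm_nth[symmetric] norm_matrix_sq[symmetric] by simp
 show ?thesis unfolding e by measurable
qed

lemma L2X_of_integrable:
 assumes f: "f \<in> bmb" and i: "intb (%x. (f x)\<^sup>2)"
 shows "L2X W f"
proof -
 have "(NB x. indicator W x * ennreal ((f x)\<^sup>2)) <= (NB x. ennreal (norm ((f x)\<^sup>2)))"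
  by (rule nn_integral_mono) (auto simp: indicator_def)
 also have "... < \<infinity>" using i by (simp add: integrable_iff_bounded)
 finally show ?thesis using f by (simp add: L2X_def)
qed

lemma hatT_linear: "linear hatT"
 by (rule linearI) (auto simp: vec3_eq)

section \<open>Extension operator on one cell with bounds uniform in the height\<close>

context hole_cell
begin

text \<open>Fields whose L2 norm over the hole is controlled by the strain, uniformly in T and u.
  Closure under sums lets the entries of the symmetrised gradient be estimated summand by
  summand.\<close>

definition Bd :: "((real^3 => real^3) => (real^3 => real^3^3) => real^3 => real) => bool" where
 "Bd f \<longleftrightarrow> (\<exists>K\<ge>0. \<forall>T u g. c0 <= T --> adm (VT Y T) u g --> (\<forall>i. intb (%x. (u x $ i)\<^sup>2)) -->
  f u g \<in> bmb & (NB x. indicator (VT D T) x * ennreal ((f u g x)\<^sup>2)) <= ennreal K * JJ g)"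

lemma VTD_borel [measurable]: "VT D T \<in> sets borel"
 using D(1) by (intro VT_borel) auto

lemma Bd_zero: "Bd (%u g x. 0)"
 unfolding Bd_def by (intro exI[of _ 0]) auto

lemma Bd_add: assumes "Bd a" "Bd b" shows "Bd (%u g x. a u g x + b u g x)"
proof -
 obtain K1 where K1: "K1 >= 0" "!!T u g. c0 <= T ==> adm (VT Y T) u g ==> \<forall>i. intb (%x. (u x $ i)\<^sup>2) ==>
  a u g \<in> bmb & (NB x. indicator (VT D T) x * ennreal ((a u g x)\<^sup>2)) <= ennreal K1 * JJ g"
  using assms(1) unfolding Bd_def by blast
 obtain K2 where K2: "K2 >= 0" "!!T u g. c0 <= T ==> adm (VT Y T) u g ==> \<forall>i. intb (%x. (u x $ i)\<^sup>2) ==>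
  b u g \<in> bmb & (NB x. indicator (VT D T) x * ennreal ((b u g x)\<^sup>2)) <= ennreal K2 * JJ g"
  using assms(2) unfolding Bd_def by blast
 show ?thesis unfolding Bd_def
 proof (intro exI[of _ "2 * K1 + 2 * K2"] conjI allI impI)
  show "0 <= 2 * K1 + 2 * K2" using K1 K2 by simp
  fix T u g assume t: "c0 <= T" "adm (VT Y T) u g" "\<forall>i. intb (%x. (u x $ i)\<^sup>2)"
  note k1 = K1(2)[OF t] and k2 = K2(2)[OF t]
  have [measurable]: "a u g \<in> bmb" "b u g \<in> bmb" using k1 k2 by auto
  show "(%x. a u g x + b u g x) \<in> bmb" by measurable
  have "(NB x. indicator (VT D T) x * ennreal ((a u g x + b u g x)\<^sup>2))
   <= (NB x. ennreal 2 * (indicator (VT D T) x * ennreal ((a u g x)\<^sup>2)) + ennreal 2 * (indicator (VT D T) x * ennreal ((b u g x)\<^sup>2)))"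
  proof (rule nn_integral_mono)
   fix x
   have "(a u g x + b u g x)\<^sup>2 <= 2 * (a u g x)\<^sup>2 + 2 * (b u g x)\<^sup>2"
   using sum_squares_bound[of "a u g x" "b u g x"] by (simp add: power2_sum)
   hence "ennreal ((a u g x + b u g x)\<^sup>2) <= ennreal 2 * ennreal ((a u g x)\<^sup>2) + ennreal 2 * ennreal ((b u g x)\<^sup>2)"
   by (subst (1 2) ennreal_mult[symmetric]) (auto simp: ennreal_plus[symmetric] intro!: ennreal_leI simp del: ennreal_plus)
   thus "indicator (VT D T) x * ennreal ((a u g x + b u g x)\<^sup>2) <= ennreal 2 * (indicator (VT D T) x * ennreal ((a u g x)\<^sup>2)) + ennreal 2 * (indicator (VT D T) x * ennreal ((b u g x)\<^sup>2))"
   by (cases "x \<in> VT D T") (simp_all del: ennreal_numeral)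
  qed
  also have "... = ennreal 2 * (NB x. indicator (VT D T) x * ennreal ((a u g x)\<^sup>2)) + ennreal 2 * (NB x. indicator (VT D T) x * ennreal ((b u g x)\<^sup>2))"
  proof -
   have m: "(%x. indicator (VT D T) x * ennreal ((a u g x)\<^sup>2)) \<in> borel_measurable lborel" "(%x. indicator (VT D T) x * ennreal ((b u g x)\<^sup>2)) \<in> borel_measurable lborel"
   by measurable
   show ?thesis
   by (subst nn_integral_add[OF borel_measurable_times_ennreal[OF borel_measurable_const m(1)] borel_measurable_times_ennreal[OF borel_measurable_const m(2)]])
   (simp only: nn_integral_cmult[OF m(1)] nn_integral_cmult[OF m(2)])
  qed
  also have "... <= ennreal 2 * (ennreal K1 * JJ g) + ennreal 2 * (ennreal K2 * JJ g)"
   using k1 k2 by (intro add_mono mult_left_mono) auto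
  also have "... = ennreal (2 * K1 + 2 * K2) * JJ g"
   using K1(1) K2(1) by (simp add: ennreal_plus distrib_right ennreal_mult' mult.assoc)
  finally show "(NB x. indicator (VT D T) x * ennreal ((a u g x + b u g x)\<^sup>2)) <= ennreal (2 * K1 + 2 * K2) * JJ g" .
 qed
qed

lemma Bd_sum: "finite S ==> (!!k. k \<in> S ==> Bd (f k)) ==> Bd (%u g x. \<Sum>k\<in>S. f k u g x)"
 by (induction S rule: finite_induct) (auto intro: Bd_zero Bd_add)

text \<open>Intended for a factor \<open>c\<close> that is a cut-off or a derivative of one and
  lives on \<open>X T\<close>, where a norm \<open>n\<close> dominating \<open>f\<close> has a known
  bound.\<close>

lemma Bd_local:
 assumes X: "!!T. X T \<in> sets borel" and C: "C >= 0" and c: "c \<in> bmb" "!!x. hat x \<in> D ==> \<bar>c x\<bar> <= M"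
  and z: "!!x T. x \<in> VT D T ==> x ~: X T ==> c x = 0"
  and b: "!!T u g. c0 <= T ==> adm (VT Y T) u g ==> (\<forall>i. intb (%x. (u x $ i)\<^sup>2)) ==>
   f u g \<in> bmb & n u g \<in> bmb & (\<forall>x\<in>X T. \<bar>f u g x\<bar> <= n u g x)
   & (NB x. indicator (X T) x * ennreal ((n u g x)\<^sup>2)) <= ennreal C * JJ g"
 shows "Bd (%u g x. c x * f u g x)"
 unfolding Bd_def
proof (intro exI[of _ "M\<^sup>2 * C"] conjI allI impI)
 show "0 <= M\<^sup>2 * C" using C by simp
 fix T u g assume t: "c0 <= T" "adm (VT Y T) u g" "\<forall>i. intb (%x. (u x $ i)\<^sup>2)"
 note bb = b[OF t]
 have [measurable]: "f u g \<in> bmb" "n u g \<in> bmb" "c \<in> bmb" "X T \<in> sets borel" using bb c X by auto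
 show "(%x. c x * f u g x) \<in> bmb" by measurable
 have "(NB x. indicator (VT D T) x * ennreal ((c x * f u g x)\<^sup>2)) <= (NB x. ennreal (M\<^sup>2) * (indicator (X T) x * ennreal ((n u g x)\<^sup>2)))"
 proof (rule nn_integral_mono)
  fix x
  show "indicator (VT D T) x * ennreal ((c x * f u g x)\<^sup>2) <= ennreal (M\<^sup>2) * (indicator (X T) x * ennreal ((n u g x)\<^sup>2))"
  proof (cases "x \<in> VT D T & x \<in> X T")
   case True
   hence "\<bar>c x\<bar> <= M" "\<bar>f u g x\<bar> <= n u g x" using c(2)[of x] bb by (auto simp: VT_def)
   hence "(c x)\<^sup>2 <= M\<^sup>2" "(f u g x)\<^sup>2 <= (n u g x)\<^sup>2"
   using power_mono[of "\<bar>c x\<bar>" M 2] power_mono[of "\<bar>f u g x\<bar>" "n u g x" 2] by simp_all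
   hence "(c x * f u g x)\<^sup>2 <= M\<^sup>2 * (n u g x)\<^sup>2" by (simp add: power_mult_distrib mult_mono)
   thus ?thesis using True by (simp add: ennreal_mult[symmetric] ennreal_leI)
  next
   case False
   thus ?thesis using z[of x T] by (cases "x \<in> VT D T") auto
  qed
 qed
 also have "... = ennreal (M\<^sup>2) * (NB x. indicator (X T) x * ennreal ((n u g x)\<^sup>2))" by (rule nn_integral_cmult) measurable
 also have "... <= ennreal (M\<^sup>2) * (ennreal C * JJ g)" using bb by (intro mult_left_mono) auto
 also have "... = ennreal (M\<^sup>2 * C) * JJ g" using C by (simp add: ennreal_mult' mult.assoc)
 finally show "(NB x. indicator (VT D T) x * ennreal ((c x * f u g x)\<^sup>2)) <= ennreal (M\<^sup>2 * C) * JJ g" .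
qed

lemma L2X_vec_measurable:
 assumes "!!i. L2X X (%x. f x $ i)" shows "f \<in> bmb"
proof -
 have "(%x. f x $ i) \<in> bmb" for i using assms by (simp add: L2X_def)
 thus ?thesis by (subst borel_measurable_euclidean_space) (auto simp: Basis_vec_def inner_axis)
qed

lemma C1_bounded_on:
 fixes f :: "real^2 => real"
 assumes f: "C1 f f'" shows "\<exists>M. \<forall>y\<in>D. \<bar>f y\<bar> <= M & norm (f' y) <= M"
proof -
 have K: "compact (closure D)" using D(2) by simp
 obtain M1 where M1: "!!x. x \<in> closure D ==> \<bar>f x\<bar> <= M1"
  using compact_imp_bounded[OF compact_continuous_image[OF continuous_on_subset[OF C1_cont[OF f] subset_UNIV] K]] by (auto simp: bounded_iff)
 obtain M2 where M2: "!!x. x \<in> closure D ==> norm (f' x) <= M2"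
  using compact_imp_bounded[OF compact_continuous_image[OF continuous_on_subset[OF C1_cont'[OF f] subset_UNIV] K]] by (auto simp: bounded_iff)
 have "\<bar>f y\<bar> <= max M1 M2 & norm (f' y) <= max M1 M2" if "y \<in> D" for y
  using M1[of y] M2[of y] that closure_subset by force
 thus ?thesis by blast
qed

text \<open>The gradient map takes both u and g, because the product rule multiplies derivatives of
  cut-offs by values of the local extensions. The extension itself takes u alone.\<close>

lemma cell_extension:
 "\<exists>E GG C. C >= 0 &
  (\<forall>T u g. c0 <= T --> adm (VT Y T) u g --> (\<forall>i. intb (%x. (u x $ i)\<^sup>2)) -->
   (\<forall>i. wL (VT Z T) (%x. E u x $ i) (%x. GG u g x $ i)) &
   (NB x. indicator (VT D T) x * ennreal ((norm (symm (GG u g x)))\<^sup>2)) <= ennreal C * JJ g) &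
  (\<forall>u g x. hat x ~: D --> E u x = u x & GG u g x = g x) &
  (\<forall>u v w a c x. (\<forall>i. intb (%x. u x $ i)) --> (\<forall>i. intb (%x. w x $ i)) --> (\<forall>i. intb (%x. v x $ i)) -->
   (AE y in lborel. v y = a *R u y + c *R w y) --> hat x \<in> D --> E v x = a *R E u x + c *R E w x)"
proof -
 have "\<forall>b\<in>frontier D. \<exists>r q m F G C. r > 0 & 0 < m & m <= lam0 & cball q m \<subseteq> Y & C >= 0 & is_chart b r q m F G C"
  using ex_chart_map by blast
 then obtain r q m F G C where ch: "!!b. b \<in> frontier D ==> r b > 0 & 0 < m b & m b <= lam0 & cball (q b) (m b) \<subseteq> Y & C b >= 0 & is_chart b (r b) (q b) (m b) (F b) (G b) (C b)"
  by metis
 have cf: "compact (frontier D)" using D(2) by (rule compact_frontier_bounded)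
 \<comment> \<open>Half radii, so that every cut-off is carried by a closed ball strictly inside its
   chart.\<close>
 obtain S where S: "S \<subseteq> frontier D" "finite S" "frontier D \<subseteq> (\<Union>b\<in>S. ball b (r b / 2))"
 proof (rule compactE_image[OF cf, of "frontier D" "%b. ball b (r b / 2)"])
  show "frontier D \<subseteq> (\<Union>b\<in>frontier D. ball b (r b / 2))" using ch by force
 qed auto
 have "D ~= UNIV" using D(2) not_bounded_UNIV by auto
 hence "frontier D ~= {}" using D(3) by (simp add: frontier_eq_empty)
 then obtain b0 where b0: "b0 \<in> frontier D" by auto
 define q0 where "q0 = q b0"
 define m0 where "m0 = m b0"
 have m0: "0 < m0" "m0 <= lam0" "cball q0 m0 \<subseteq> Y" using ch[OF b0] by (auto simp: m0_def q0_def)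
 have rS: "r b > 0" if "b \<in> S" for b using ch S(1) that by blast
 obtain ck ck' U where ck: "!!b. b \<in> S ==> C1 (ck b) (ck' b)" "!!b x. b \<in> S ==> x ~: cball b (r b / 2) ==> ck b x = 0"
  and U: "open U" "frontier D \<subseteq> U" "!!x. x \<in> U ==> (\<Sum>b\<in>S. ck b x) = 1"
  using ex_partition[OF S(2), of "%b. r b / 2", OF _ cf S(3)] rS by fastforce
 have ckz': "ck' b x = 0" if "b \<in> S" "x ~: cball b (r b / 2)" for b x
  by (rule C1_zero_outside[OF ck(1)[OF that(1)] closed_cball ck(2)[OF that(1)] that(2)])
 define X where "X x = (\<Sum>b\<in>S. ck b x)" for x
 define X' where "X' x = (\<Sum>b\<in>S. ck' b x)" for x
 have CX: "C1 (%x. 1 - X x) (%x. 0 - X' x)"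
  unfolding X_def X'_def by (intro C1_diff C1_const C1_sum ck(1))
 have XU: "1 - X x = 0" "X' x = 0" if "x \<in> U" for x
 proof -
  show "1 - X x = 0" using U(3)[OF that] by (simp add: X_def)
  have "0 - X' x = 0" by (rule C1_zero_outside[OF CX, of "- U"]) (use U that in \<open>auto simp: X_def\<close>)
  thus "X' x = 0" by simp
 qed
 \<comment> \<open>The remainder 1 - X vanishes near the boundary of the hole, so its inner and
   outer parts are both C1: the inner one will carry the rigid motions over the fixed column, the
   outer one u itself.\<close>
 define al where "al x = (if x \<in> D then 1 - X x else 0)" for x
 define al' where "al' x = (if x \<in> D then 0 - X' x else 0)" for x
 define be where "be x = (if x \<in> D then 0 else 1 - X x)" for x
 define be' where "be' x = (if x \<in> D then 0 else 0 - X' x)" for x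
 have clD: "closure D \<subseteq> D \<union> U" using U(2) D(1) by (auto simp: frontier_def interior_open)
 have loc: "C1 h h'" if "!!x. x \<in> D ==> h x = f x & h' x = f' x" "C1 f f'" "!!x. x \<in> U ==> h x = 0 & h' x = 0"
  "!!x. x ~: closure D ==> h x = k x & h' x = k' x" "C1 k k'" for h h' f f' k k'
 proof (rule C1_local)
  fix x
  consider "x \<in> D" | "x \<in> U" | "x \<in> - closure D" using clD by blast
  thus "\<exists>U h2 h2'. open U & x \<in> U & C1 h2 h2' & (\<forall>y\<in>U. h y = h2 y & h' y = h2' y)"
  proof cases
   case 1 thus ?thesis using that(1,2) D(1) by blast
  next
   case 2 thus ?thesis using that(3) U(1) C1_const[of 0] by blast
  next
   case 3 thus ?thesis using that(4,5) by (intro exI[of _ "- closure D"] exI[of _ k] exI[of _ k']) auto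
  qed
 qed
 have Cal: "C1 al al'"
  by (rule loc[OF _ CX _ _ C1_const[of 0]]) (use XU closure_subset[of D] in \<open>auto simp: al_def al'_def\<close>)
 have Cbe: "C1 be be'"
  by (rule loc[OF _ C1_const[of 0] _ _ CX]) (use XU closure_subset[of D] in \<open>auto simp: be_def be'_def\<close>)
 define \<rho> where "\<rho> u x = Rg B u q0 m0 x" for u x
 define p' where "p' k x = (if k = 3 then axis 3 1 + m0 *R nu' B x 3 else 0)" for k :: 3 and x :: "real^3"
 have Cp: "C1 (%x. col B q0 m0 x $ k) (p' k)" for k
 proof -
  have "C1 (%x::real^3. x $ 3 + m0 * nu 0 B x $ 3) (%x. axis 3 1 + m0 *R nu' B x 3)"
   by (intro C1_add C1_coord C1_cmult C1_nu)
  hence 3: "C1 (%x. col B q0 m0 x $ 3) (p' 3)" by (simp add: p'_def[abs_def])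
  have "k = 1 \<or> k = 2 \<or> k = 3" by (rule exhaust_3)
  thus ?thesis using 3 C1_const[of "q0 $ 1"] C1_const[of "q0 $ 2"] by (auto simp: p'_def[abs_def])
 qed
 define dd where "dd x = (1 / m0) *R (x - col B q0 m0 x)" for x
 define \<Gamma> where "\<Gamma> g x = (\<chi> i. Gr g (dd x) (col B q0 m0 x) m0 (%k. p' k x) 0 i)" for g x
 have mcol [measurable]: "(%x. col B q0 m0 x) \<in> bmb" by (rule col_measurable) auto
 have mp' [measurable]: "(%x. p' k x) \<in> bmb" for k using C1_borel(2)[OF Cp] .
 have mdd [measurable]: "dd \<in> bmb" unfolding dd_def[abs_def] by measurable
 obtain R where R: "R > 0" "!!y. y \<in> Z ==> norm y <= R" using Z(2) by (auto simp: bounded_pos)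
 define K where "K = 2 * R / m0"
 have K: "K >= 0" using R m0 by (simp add: K_def)
 have q0Z: "q0 \<in> Z" using subsetD[OF m0(3), of q0] m0(1) by (simp add: Y_def)
 have hq: "norm (hat x - q0) <= K * m0" if "hat x \<in> Z" for x
  using R(2)[OF that] R(2)[OF q0Z] norm_triangle_ineq4[of "hat x" q0] m0 by (simp add: K_def)
 define M where "M = K + 2 * B + (1 + lam0 * B)"
 have ddb: "norm (dd x) <= M" if "hat x \<in> Z" for x
 proof -
  have "norm (x - col B q0 m0 x) <= (K + 2 * B) * m0"
   using norm_col[of B m0 x q0] hq[OF that] B0 m0 by (simp add: algebra_simps)
  hence "norm (dd x) <= K + 2 * B" using m0 by (simp add: dd_def pos_divide_le_eq)
  moreover have "0 <= 1 + lam0 * B" using lam0_pos B0 by simp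
  ultimately show ?thesis by (simp add: M_def)
 qed
 have p'b: "norm (p' k x) <= M" for k x
 proof -
  have "norm (m0 *R nu' B x 3) <= lam0 * B" unfolding norm_scaleR using m0 norm_nu'[of B x 3] B0 lam0_pos by (intro mult_mono) auto
  hence "norm (axis 3 1 + m0 *R nu' B x 3) <= 1 + lam0 * B" using norm_triangle_ineq[of "axis 3 1 :: real^3" "m0 *R nu' B x 3"] by (simp add: norm_axis_1)
  moreover have "0 <= 1 + lam0 * B" using lam0_pos B0 by simp
  ultimately show ?thesis using K B0 by (auto simp: p'_def M_def)
 qed
 have M0: "M >= 0" using order_trans[OF norm_ge_zero p'b] .
 have VZ: "VT Z T \<in> sets borel" for T using Z by (intro VT_borel) auto
 have sch: "schur (VT Z T) (%x. col B q0 m0 x) (%x. m0) (CK K)" for T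
  by (rule schur_const[OF VZ borel_measurable_const K m0(1)]) (rule hq, simp add: VT_def)
 have hT: "closed (hat -` cball b s)" for b :: "real^2" and s by (rule closed_hat_vimage) simp
 define E where "E u x = (\<Sum>b\<in>S. ck b (hat x) *R F b u x) + al (hat x) *R \<rho> u x + be (hat x) *R u x" for u x
 define GG where "GG u g x = (\<chi> i. (\<Sum>b\<in>S. ck b (hat x) *R G b g x $ i + F b u x $ i *R hatT (ck' b (hat x)))
  + (al (hat x) *R \<Gamma> g x $ i + \<rho> u x $ i *R hatT (al' (hat x))) + (be (hat x) *R g x $ i + u x $ i *R hatT (be' (hat x))))" for u g x
 have chart: "is_chart b (r b) (q b) (m b) (F b) (G b) (C b)" "C b >= 0" "0 < m b" "m b <= lam0" "cball (q b) (m b) \<subseteq> Y" if "b \<in> S" for b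
  using ch S(1) that by blast+
 have wLE: "wL (VT Z T) (%x. E u x $ i) (%x. GG u g x $ i)"
  if T: "c0 <= T" and ad: "adm (VT Y T) u g" and u2: "\<forall>i. intb (%x. (u x $ i)\<^sup>2)" for T u g i
 proof -
  have oZ: "open (VT Z T)" "bounded (VT Z T)" using Z VT_open VT_bounded by auto
  have oY: "open (VT Y T)" "bounded (VT Y T)" using Yopen Z(2) VT_open VT_bounded by (auto simp: Y_def bounded_diff)
  have 1: "wL (VT Z T) (%x. ck b (hat x) * F b u x $ i) (%x. ck b (hat x) *R G b g x $ i + F b u x $ i *R hatT (ck' b (hat x)))" if b: "b \<in> S" for b
  proof (rule wL_product[OF _ C1_hat[OF ck(1)[OF b]] hT[of b "r b / 2"] _ _ _ _ oZ])
   show "wL (VT (ball b (r b)) T) (%x. F b u x $ i) (%x. G b g x $ i)"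
   using chart(1)[OF b] T ad u2 unfolding is_chart_def wL_def by blast
   show "ck b (hat x) = 0" if "x ~: hat -` cball b (r b / 2)" for x using ck(2)[OF b] that by simp
   show "VT Z T \<inter> hat -` cball b (r b / 2) \<subseteq> VT (ball b (r b)) T" using rS[OF b] by (auto simp: VT_def)
   show "open (VT (ball b (r b)) T)" "bounded (VT (ball b (r b)) T)" using VT_open VT_bounded by auto
  qed
  have s: "wL (VT Z T) (%x. \<Sum>b\<in>S. ck b (hat x) * F b u x $ i) (%x. \<Sum>b\<in>S. ck b (hat x) *R G b g x $ i + F b u x $ i *R hatT (ck' b (hat x)))"
   by (rule wL_sum[OF S(2) 1 oZ])
  have "wL (VT Z T) (%x. \<rho> u x $ i) (%x. \<Gamma> g x $ i)"
   unfolding wL_def \<rho>_def Rg_def \<Gamma>_def vec_lambda_beta dd_def[symmetric]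
  proof (intro conjI allI)
   show "wd (VT Z T) (%x. Fr u (dd x) (col B q0 m0 x) m0 i) (%x. Gr g (dd x) (col B q0 m0 x) m0 (%k. p' k x) 0 i)"
   unfolding dd_def
   proof (rule Fr_wd(1)[OF ad Cp C1_const])
   show "0 < m0" by (rule m0)
   show "cball (col B q0 m0 x) m0 \<subseteq> VT Y T" if "x \<in> VT Z T" for x
   using that by (intro col_ball[OF T _ m0]) (simp add: VT_def)
   qed
   show "L2X (VT Z T) (%x. Fr u (dd x) (col B q0 m0 x) m0 i)"
   by (rule L2X_Fr_Gr(1)[OF ad u2[rule_format] sch VZ mcol _ mdd mp', where M = M and l' = "%x. 0"])
   (use ddb p'b M0 in \<open>auto simp: VT_def\<close>)
   show "L2X (VT Z T) (%x. Gr g (dd x) (col B q0 m0 x) m0 (%k. p' k x) 0 i $ j)" for j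
   by (rule L2X_Fr_Gr(2)[OF ad u2[rule_format] sch VZ mcol _ mdd mp', where M = M and l' = "%x. 0"])
   (use ddb p'b M0 in \<open>auto simp: VT_def\<close>)
  qed
  from wL_product[OF this C1_hat[OF Cal] closed_UNIV _ _ oZ oZ]
  have 2: "wL (VT Z T) (%x. al (hat x) * \<rho> u x $ i) (%x. al (hat x) *R \<Gamma> g x $ i + \<rho> u x $ i *R hatT (al' (hat x)))" by simp
  have "wL (VT Y T) (%x. u x $ i) (%x. g x $ i)"
   unfolding wL_def using admD[OF ad] u2 by (auto intro!: L2X_of_integrable)
  hence 3: "wL (VT Z T) (%x. be (hat x) * u x $ i) (%x. be (hat x) *R g x $ i + u x $ i *R hatT (be' (hat x)))"
  proof (rule wL_product[OF _ C1_hat[OF Cbe] _ _ _ oY oZ])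
   show "closed (hat -` (- (D \<union> U)))" using D(1) U(1) by (intro closed_hat_vimage) auto
   show "be (hat x) = 0" if "x ~: hat -` (- (D \<union> U))" for x using that XU by (auto simp: be_def)
   show "VT Z T \<inter> hat -` (- (D \<union> U)) \<subseteq> VT Y T" using clD by (auto simp: VT_def Y_def)
  qed
  show ?thesis using wL_add[OF wL_add[OF s 2 oZ] 3 oZ] by (simp add: E_def GG_def)
 qed
 define h where "h b i x = hatT (ck' b (hat x)) $ i" for b i x
 \<comment> \<open>In the hole the gradients of all cut-offs sum to 0, so they multiply differences
   of \<open>F b u\<close> and \<open>\<rho> u\<close> only. Each difference is split at the rigid
   motions over the column of the chart: the chart bounds the first part, \<open>Rel_all\<close> the
   second.\<close>
 define nice where "nice i j u g x = (\<Sum>b\<in>S. ck b (hat x) * symm (G b g x) $ i $ j) + al (hat x) * symm (\<Gamma> g x) $ i $ j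
  + (\<Sum>b\<in>S. (h b j x / 2) * (F b u x - Rg B u (q b) (m b) x) $ i + (h b j x / 2) * (Rg B u (q b) (m b) x - \<rho> u x) $ i
   + (h b i x / 2) * (F b u x - Rg B u (q b) (m b) x) $ j + (h b i x / 2) * (Rg B u (q b) (m b) x - \<rho> u x) $ j)" for i j u g x
 have nice: "symm (GG u g x) $ i $ j = nice i j u g x" if x: "hat x \<in> D" for i j u g x
 proof -
  have hal: "hatT (al' (hat x)) $ j = - (\<Sum>b\<in>S. h b j x)" for j
   using x by (simp add: al'_def X'_def linear_neg[OF hatT_linear] linear_sum[OF hatT_linear] h_def)
  have e: "GG u g x $ i $ j = (\<Sum>b\<in>S. ck b (hat x) * G b g x $ i $ j) + al (hat x) * \<Gamma> g x $ i $ j + (\<Sum>b\<in>S. h b j x * (F b u x - \<rho> u x) $ i)" for i j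
   using x by (simp add: GG_def hal be_def be'_def sum.distrib h_def[symmetric] linear_0[OF hatT_linear])
   (simp add: algebra_simps sum.distrib sum_subtractf sum_distrib_left)
  show ?thesis unfolding symm_nth e nice_def
   by (simp add: add_divide_distrib sum_divide_distrib sum.distrib[symmetric] algebra_simps diff_divide_distrib sum_subtractf)
 qed
 have mC: "(%x. c (hat x)) \<in> bmb" if "C1 c c'" for c :: "real^2 => real" and c' using C1_borel(1)[OF C1_hat[OF that]] .
 have mh: "h b j \<in> bmb" if "b \<in> S" for b j
 proof -
  note [measurable] = C1_borel(2)[OF C1_hat[OF ck(1)[OF that]]]
  show ?thesis unfolding h_def[abs_def] by measurable
 qed
 define N where "N b = (SOME M. \<forall>y\<in>D. \<bar>ck b y\<bar> <= M & norm (ck' b y) <= M)" for b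
 have N: "\<bar>ck b y\<bar> <= N b" "norm (ck' b y) <= N b" if "b \<in> S" "y \<in> D" for b y
  using someI_ex[OF C1_bounded_on[OF ck(1)[OF that(1)]]] that(2) unfolding N_def by blast+
 have hN: "\<bar>h b j x / 2\<bar> <= N b" if "b \<in> S" "hat x \<in> D" for b j x
  using N(2)[OF that] component_le_norm_cart[of "hatT (ck' b (hat x))" j] by (simp add: h_def)
 have off: "hat x ~: cball b (r b / 2)" if "b \<in> S" "x \<in> VT D T" "x ~: VT (ball b (r b) \<inter> D) T" for b x T
  using that rS[OF that(1)] by (auto simp: VT_def)
 have bX: "VT (ball b (r b) \<inter> D) T \<in> sets borel" for b T using D(1) by (intro VT_borel) auto
 have B1: "Bd (%u g x. ck b (hat x) * symm (G b g x) $ i $ j)" if b: "b \<in> S" for b i j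
 proof (rule Bd_local[where X = "%T. VT (ball b (r b) \<inter> D) T" and C = "C b" and M = "N b" and n = "%u g x. norm (symm (G b g x))"])
  fix T u g assume t: "c0 <= T" "adm (VT Y T) u g" "\<forall>i. intb (%x. (u x $ i)\<^sup>2)"
  have 1: "!!i j. L2X (VT (ball b (r b)) T) (%x. G b g x $ i $ j)"
   and 2: "(NB x. indicator (VT (ball b (r b) \<inter> D) T) x * ennreal ((norm (symm (G b g x)))\<^sup>2)) <= ennreal (C b) * JJ g"
   using chart(1)[OF b] t unfolding is_chart_def by blast+
  have [measurable]: "(%x. G b g x $ i $ j) \<in> bmb" for i j using 1 by (simp add: L2X_def)
  have 3: "(%x. symm (G b g x) $ i $ j) \<in> bmb" unfolding symm_nth by measurable
  show "(%x. symm (G b g x) $ i $ j) \<in> bmb & (%x. norm (symm (G b g x))) \<in> bmb &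
   (\<forall>x\<in>VT (ball b (r b) \<inter> D) T. \<bar>symm (G b g x) $ i $ j\<bar> <= norm (symm (G b g x))) &
   (NB x. indicator (VT (ball b (r b) \<inter> D) T) x * ennreal ((norm (symm (G b g x)))\<^sup>2)) <= ennreal (C b) * JJ g"
   using 2 3 matrix_entry_le by (auto intro!: norm_symm_measurable)
 qed (use bX chart(2)[OF b] mC[OF ck(1)[OF b]] N(1)[OF b] off[OF b] ck(2)[OF b] in auto)
 have B2: "Bd (%u g x. (h b j x / 2) * (F b u x - Rg B u (q b) (m b) x) $ i)" if b: "b \<in> S" for b i j
 proof (rule Bd_local[where X = "%T. VT (ball b (r b) \<inter> D) T" and C = "C b" and M = "N b" and n = "%u g x. norm (F b u x - Rg B u (q b) (m b) x)"])
  fix T u g assume t: "c0 <= T" "adm (VT Y T) u g" "\<forall>i. intb (%x. (u x $ i)\<^sup>2)"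
  have 1: "!!i. L2X (VT (ball b (r b)) T) (%x. F b u x $ i)"
   and 2: "(NB x. indicator (VT (ball b (r b) \<inter> D) T) x * ennreal ((norm (F b u x - Rg B u (q b) (m b) x))\<^sup>2)) <= ennreal (C b) * JJ g"
   using chart(1)[OF b] t unfolding is_chart_def by blast+
  have [measurable]: "F b u \<in> bmb" by (rule L2X_vec_measurable[OF 1])
  have [measurable]: "(%x. Rg B u (q b) (m b) x) \<in> bmb" by (rule Rg_measurable[OF t(2)]) auto
  have 3: "(%x. F b u x - Rg B u (q b) (m b) x) \<in> bmb" by measurable
  show "(%x. (F b u x - Rg B u (q b) (m b) x) $ i) \<in> bmb & (%x. norm (F b u x - Rg B u (q b) (m b) x)) \<in> bmb &
   (\<forall>x\<in>VT (ball b (r b) \<inter> D) T. \<bar>(F b u x - Rg B u (q b) (m b) x) $ i\<bar> <= norm (F b u x - Rg B u (q b) (m b) x)) &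
   (NB x. indicator (VT (ball b (r b) \<inter> D) T) x * ennreal ((norm (F b u x - Rg B u (q b) (m b) x))\<^sup>2)) <= ennreal (C b) * JJ g"
   using 2 borel_measurable_vec_component[OF 3] measurable_compose[OF 3 borel_measurable_norm] component_le_norm_cart by blast
 next
  show "h b j x / 2 = 0" if "x \<in> VT D T" "x ~: VT (ball b (r b) \<inter> D) T" for x T
   using ckz'[OF b off[OF b that]] by (simp add: h_def linear_0[OF hatT_linear])
 qed (use bX chart(2)[OF b] mh[OF b] hN[OF b] in auto)
 have B3: "Bd (%u g x. (h b j x / 2) * (Rg B u (q b) (m b) x - \<rho> u x) $ i)" if b: "b \<in> S" for b i j
 proof -
  have "Rel q0 m0 (q b) (m b)" by (rule Rel_all) (use m0 chart[OF b] in auto)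
  then obtain Cr where Cr: "Cr >= 0" "!!T u g. c0 <= T ==> adm (VT Y T) u g ==>
  (NB x. indicator (VT Z T) x * ennreal ((norm (Rg B u (q b) (m b) x - \<rho> u x))\<^sup>2)) <= ennreal Cr * JJ g"
   unfolding Rel_def \<rho>_def by blast
  show ?thesis
  proof (rule Bd_local[where X = "%T. VT Z T" and C = Cr and M = "N b" and n = "%u g x. norm (Rg B u (q b) (m b) x - \<rho> u x)"])
   fix T u g assume t: "c0 <= T" "adm (VT Y T) u g" "\<forall>i. intb (%x. (u x $ i)\<^sup>2)"
   have [measurable]: "(%x. Rg B u q m x) \<in> bmb" for q m by (rule Rg_measurable[OF t(2)]) auto
   have 3: "(%x. Rg B u (q b) (m b) x - \<rho> u x) \<in> bmb" unfolding \<rho>_def by measurable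
   show "(%x. (Rg B u (q b) (m b) x - \<rho> u x) $ i) \<in> bmb & (%x. norm (Rg B u (q b) (m b) x - \<rho> u x)) \<in> bmb &
   (\<forall>x\<in>VT Z T. \<bar>(Rg B u (q b) (m b) x - \<rho> u x) $ i\<bar> <= norm (Rg B u (q b) (m b) x - \<rho> u x)) &
   (NB x. indicator (VT Z T) x * ennreal ((norm (Rg B u (q b) (m b) x - \<rho> u x))\<^sup>2)) <= ennreal Cr * JJ g"
   using Cr(2)[OF t(1,2)] borel_measurable_vec_component[OF 3] measurable_compose[OF 3 borel_measurable_norm] component_le_norm_cart by blast
  next
   show "h b j x / 2 = 0" if "x \<in> VT D T" "x ~: VT Z T" for x T
   using that Z(3) closure_subset by (auto simp: VT_def)
  qed (use VZ Cr(1) mh[OF b] hN[OF b] in auto)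
 qed
 define kk where "kk = cS * (4 * M) * (1 + M)"
 have B4: "Bd (%u g x. al (hat x) * symm (\<Gamma> g x) $ i $ j)" for i j
 proof -
  obtain Na where Na: "!!y. y \<in> D ==> \<bar>al y\<bar> <= Na" using C1_bounded_on[OF Cal] by blast
  show ?thesis
  proof (rule Bd_local[where X = "%T. VT Z T" and C = "kk\<^sup>2 * CK K" and M = Na and n = "%u g x. kk * sqrt (Er g (col B q0 m0 x) m0)"])
   fix T u g assume t: "c0 <= T" "adm (VT Y T) u g" "\<forall>i. intb (%x. (u x $ i)\<^sup>2)"
   have 1: "L2X (VT Z T) (%x. Gr g (dd x) (col B q0 m0 x) m0 (%k. p' k x) 0 i $ j)" for i j
   by (rule L2X_Fr_Gr(2)[OF t(2) t(3)[rule_format] sch VZ mcol _ mdd mp', where M = M and l' = "%x. 0"])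
   (use ddb p'b M0 in \<open>auto simp: VT_def\<close>)
   have [measurable]: "(%x. \<Gamma> g x $ i $ j) \<in> bmb" for i j using 1 by (simp add: L2X_def \<Gamma>_def)
   have 3: "(%x. symm (\<Gamma> g x) $ i $ j) \<in> bmb" unfolding symm_nth by measurable
   have mEr [measurable]: "(%x. Er g (col B q0 m0 x) m0) \<in> bmb" by (rule Er_measurable[OF t(2) mcol]) simp
   have 4: "\<bar>symm (\<Gamma> g x) $ i $ j\<bar> <= kk * sqrt (Er g (col B q0 m0 x) m0)" if "x \<in> VT Z T" for x
   unfolding symm_nth \<Gamma>_def vec_lambda_beta kk_def
   by (rule Gr_symm_bound[OF t(2) m0(1) ddb p'b]) (use that M0 in \<open>auto simp: VT_def\<close>)
   have "(NB x. indicator (VT Z T) x * ennreal ((kk * sqrt (Er g (col B q0 m0 x) m0))\<^sup>2))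
   = (NB x. ennreal (kk\<^sup>2) * (indicator (VT Z T) x * ennreal (Er g (col B q0 m0 x) m0)))"
   using Er_nonneg by (intro nn_integral_cong) (auto simp: indicator_def power_mult_distrib ennreal_mult)
   also have "... = ennreal (kk\<^sup>2) * (NB x. indicator (VT Z T) x * ennreal (Er g (col B q0 m0 x) m0))"
   proof (rule nn_integral_cmult)
   have "(%x. ennreal (Er g (col B q0 m0 x) m0)) \<in> bmb" using mEr by simp
   moreover have "(%x. indicator (VT Z T) x :: ennreal) \<in> bmb" using VZ by simp
   ultimately show "(%x. indicator (VT Z T) x * ennreal (Er g (col B q0 m0 x) m0)) \<in> borel_measurable lborel"
   using borel_measurable_times_ennreal by simp
   qed
   also have "... <= ennreal (kk\<^sup>2) * (ennreal (CK K) * JJ g)"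
   unfolding JJ_def by (intro mult_left_mono schur_Er[OF t(2) sch] m0) auto
   also have "... = ennreal (kk\<^sup>2 * CK K) * JJ g" using CK_nonneg[OF K] by (simp add: ennreal_mult' mult.assoc)
   finally show "(%x. symm (\<Gamma> g x) $ i $ j) \<in> bmb & (%x. kk * sqrt (Er g (col B q0 m0 x) m0)) \<in> bmb &
   (\<forall>x\<in>VT Z T. \<bar>symm (\<Gamma> g x) $ i $ j\<bar> <= kk * sqrt (Er g (col B q0 m0 x) m0)) &
   (NB x. indicator (VT Z T) x * ennreal ((kk * sqrt (Er g (col B q0 m0 x) m0))\<^sup>2)) <= ennreal (kk\<^sup>2 * CK K) * JJ g"
   using 3 4 by auto
  next
   show "al (hat x) = 0" if "x \<in> VT D T" "x ~: VT Z T" for x T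
   using that Z(3) closure_subset by (auto simp: VT_def)
  qed (use VZ CK_nonneg[OF K] mC[OF Cal] Na in auto)
 qed
 have Bnice: "Bd (nice i j)" for i j
  unfolding nice_def by (intro Bd_add Bd_sum S(2) B1 B2 B3 B4)
 \<comment> \<open>Named so that the constants for all index pairs can be chosen at once.\<close>
 define PP where "PP i j K \<longleftrightarrow> 0 <= K & (\<forall>T u g. c0 <= T --> adm (VT Y T) u g --> (\<forall>i. intb (%x. (u x $ i)\<^sup>2)) -->
  nice i j u g \<in> bmb & (NB x. indicator (VT D T) x * ennreal ((nice i j u g x)\<^sup>2)) <= ennreal K * JJ g)" for i j K
 have "\<exists>K. PP i j K" for i j
  using Bnice[of i j] unfolding Bd_def PP_def by blast
 then obtain KK where PK: "!!i j. PP i j (KK i j)" by metis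
 have KK: "KK i j >= 0" for i j using PK[of i j] unfolding PP_def by blast
 have KK2: "nice i j u g \<in> bmb & (NB x. indicator (VT D T) x * ennreal ((nice i j u g x)\<^sup>2)) <= ennreal (KK i j) * JJ g"
  if "c0 <= T" "adm (VT Y T) u g" "\<forall>i. intb (%x. (u x $ i)\<^sup>2)" for i j T u g
  using PK[of i j] that unfolding PP_def by blast
 define CC where "CC = (\<Sum>i\<in>UNIV. \<Sum>j\<in>UNIV. KK i j)"
 have CC: "CC >= 0" unfolding CC_def by (intro sum_nonneg KK)
 have est: "(NB x. indicator (VT D T) x * ennreal ((norm (symm (GG u g x)))\<^sup>2)) <= ennreal CC * JJ g"
  if t: "c0 <= T" "adm (VT Y T) u g" "\<forall>i. intb (%x. (u x $ i)\<^sup>2)" for T u g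
 proof -
  have m [measurable]: "nice i j u g \<in> bmb" for i j using KK2[OF t] by blast
  have "(NB x. indicator (VT D T) x * ennreal ((norm (symm (GG u g x)))\<^sup>2))
   = (NB x. (\<Sum>i\<in>UNIV. \<Sum>j\<in>UNIV. indicator (VT D T) x * ennreal ((nice i j u g x)\<^sup>2)))"
  proof (rule nn_integral_cong)
   fix x
   show "indicator (VT D T) x * ennreal ((norm (symm (GG u g x)))\<^sup>2) = (\<Sum>i\<in>UNIV. \<Sum>j\<in>UNIV. indicator (VT D T) x * ennreal ((nice i j u g x)\<^sup>2))"
   proof (cases "x \<in> VT D T")
   case True
   hence "hat x \<in> D" by (simp add: VT_def)
   thus ?thesis using True by (simp add: norm_matrix_sq nice sum_ennreal sum_nonneg)
   qed simp
  qed
  also have "... = (\<Sum>i\<in>UNIV. \<Sum>j\<in>UNIV. (NB x. indicator (VT D T) x * ennreal ((nice i j u g x)\<^sup>2)))"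
   by (subst nn_integral_sum, measurable, intro sum.cong refl nn_integral_sum) measurable
  also have "... <= (\<Sum>i\<in>UNIV. \<Sum>j\<in>UNIV. ennreal (KK i j) * JJ g)"
   using KK2[OF t] by (intro sum_mono) blast
  also have "... = ennreal CC * JJ g"
   by (simp add: CC_def sum_distrib_right[symmetric] sum_ennreal KK sum_nonneg)
  finally show ?thesis .
 qed
 have offD: "E u x = u x & GG u g x = g x" if x: "hat x ~: D" for u g x
 proof -
  have FG: "F b u x = u x" "G b g x = g x" if "b \<in> S" for b using chart(1)[OF that] x unfolding is_chart_def by blast+
  have 1: "E u x = (\<Sum>b\<in>S. ck b (hat x)) *R u x + (1 - X (hat x)) *R u x"
   using x by (simp add: E_def FG al_def be_def scaleR_sum_left)
  have "GG u g x $ i = ((\<Sum>b\<in>S. ck b (hat x)) + (1 - X (hat x))) *R g x $ i + u x $ i *R (hatT (X' (hat x)) + hatT (- X' (hat x)))" for i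
   using x by (simp add: GG_def FG al_def al'_def be_def be'_def X'_def linear_sum[OF hatT_linear] linear_0[OF hatT_linear]
   sum.distrib scaleR_sum_left scaleR_sum_right scaleR_add_left scaleR_add_right)
  hence 2: "GG u g x = g x" by (simp add: vec_eq_iff X_def linear_neg[OF hatT_linear])
  have "E u x = ((\<Sum>b\<in>S. ck b (hat x)) + (1 - X (hat x))) *R u x" unfolding 1 by (simp only: scaleR_add_left)
  thus ?thesis using 2 by (simp add: X_def)
 qed
 have lin: "E v x = a *R E u x + c *R E w x"
  if i: "\<forall>i. intb (%x. u x $ i)" "\<forall>i. intb (%x. w x $ i)" "\<forall>i. intb (%x. v x $ i)"
   and ae: "AE y in lborel. v y = a *R u y + c *R w y" and x: "hat x \<in> D" for u v w a c x
 proof -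
  have f: "F b v x = a *R F b u x + c *R F b w x" if "b \<in> S" for b
   using chart(1)[OF that] i ae x unfolding is_chart_def by blast
  have r: "\<rho> v x = a *R \<rho> u x + c *R \<rho> w x"
   using Fr_lin[OF m0(1) i(1)[rule_format] i(2)[rule_format] i(3)[rule_format] ae, where d = "(1 / m0) *R (x - col B q0 m0 x)" and p = "col B q0 m0 x"]
   by (simp add: \<rho>_def Rg_def vec_eq_iff)
  show ?thesis using x by (simp add: E_def be_def f r scaleR_add_right scaleR_sum_right sum.distrib mult.commute)
 qed
 show ?thesis
  using CC wLE est offD lin by (intro exI[of _ E] exI[of _ GG] exI[of _ CC]) blast
qed

end

section \<open>Borel representatives and the Sobolev spaces of the statement\<close>

definition repr :: "(real^3) set => (real^3 => real) => (real^3 => real) => bool" where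
 "repr U f fb \<longleftrightarrow> fb \<in> bmb & (\<forall>x. x ~: U --> fb x = 0) & (AE x in lborel. x \<in> U --> fb x = f x)"

lemma repr_AE: "repr U f fb ==> AE x in lebesgue. fb x = indicator U x *R f x"
 unfolding repr_def by (subst AE_completion_iff) (auto elim!: eventually_mono simp: indicator_def)

text \<open>A function measurable for the completed measure agrees almost everywhere with a Borel
  one; extension by 0 then allows integrals over the whole space.\<close>

lemma ex_repr:
 assumes U: "open U" and f: "set_borel_measurable lebesgue U f"
 shows "\<exists>fb. repr U f fb"
proof -
 have "(%x. indicator U x *R f x) \<in> borel_measurable (completion lborel)" using f by (simp add: set_borel_measurable_def)
 then obtain g where g: "g \<in> borel_measurable lborel" "AE x in lborel. indicator U x *R f x = g x"
  using completion_ex_borel_measurable_real by blast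
 have [measurable]: "U \<in> sets borel" "g \<in> bmb" using U g by auto
 have "repr U f (%x. indicator U x * g x)"
  unfolding repr_def using g(2) by (auto elim!: eventually_mono)
 thus ?thesis by blast
qed

lemma repr_measurable:
 assumes "repr U f fb" shows "set_borel_measurable lebesgue U f"
proof -
 have "fb \<in> borel_measurable lebesgue" using assms by (simp add: repr_def measurable_completion)
 from borel_measurable_AE[OF this repr_AE[OF assms]] show ?thesis by (simp add: set_borel_measurable_def)
qed

lemma repr_L2:
 assumes r: "repr U f fb" shows "L2_on U f \<longleftrightarrow> intb (%x. (fb x)\<^sup>2)"
proof -
 have [measurable]: "fb \<in> bmb" using r by (simp add: repr_def)
 have m: "(%x. (fb x)\<^sup>2) \<in> borel_measurable lborel" by measurable
 have ae: "AE x in lebesgue. (fb x)\<^sup>2 = indicator U x *R (f x)\<^sup>2"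
  using repr_AE[OF r] by eventually_elim (auto simp: indicator_def)
 have "intb (%x. (fb x)\<^sup>2) \<longleftrightarrow> integrable lebesgue (%x. (fb x)\<^sup>2)" using integrable_completion[OF m] by simp
 also have "... \<longleftrightarrow> integrable lebesgue (%x. indicator U x *R (f x)\<^sup>2)"
  by (rule integrable_cong_AE[OF measurable_completion[OF m] borel_measurable_AE[OF measurable_completion[OF m] ae] ae])
 finally show ?thesis using repr_measurable[OF r] by (simp add: L2_on_def set_integrable_def)
qed

lemma repr_LINT:
 assumes r: "repr U f fb" and p [measurable]: "ps \<in> bmb"
 shows "(LINT x:U|lebesgue. f x * ps x) = (LB x. fb x * ps x)"
proof -
 have [measurable]: "fb \<in> bmb" using r by (simp add: repr_def)
 have m: "(%x. fb x * ps x) \<in> borel_measurable lborel" by measurable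
 have ae: "AE x in lebesgue. fb x * ps x = indicator U x *R (f x * ps x)"
  using repr_AE[OF r] by eventually_elim auto
 have "(LB x. fb x * ps x) = (\<integral>x. fb x * ps x \<partial>lebesgue)" using integral_completion[OF m] by simp
 also have "... = (\<integral>x. indicator U x *R (f x * ps x) \<partial>lebesgue)"
  by (rule integral_cong_AE[OF measurable_completion[OF m] borel_measurable_AE[OF measurable_completion[OF m] ae] ae])
 finally show ?thesis by (simp add: set_lebesgue_integral_def)
qed

lemma test_fun_borel:
 assumes "test_fun U ph" shows "ph \<in> bmb" "(%x. Dp ph i x) \<in> bmb"
proof -
 have c: "C1 ph (%x. \<chi> i. Dp ph i x)" using test_fun_ctest[OF assms] by (simp add: ctest_def)
 show "ph \<in> bmb" by (rule C1_borel(1)[OF c])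
 have "(%x. (\<chi> i. Dp ph i x) $ i) \<in> bmb" by (rule borel_measurable_vec_component[OF C1_borel(2)[OF c]])
 thus "(%x. Dp ph i x) \<in> bmb" by simp
qed

lemma repr_weak_partial:
 assumes "repr U f fb" "repr U g gb"
 shows "weak_partial U f i g \<longleftrightarrow> (\<forall>ph. test_fun U ph --> (LB x. fb x * Dp ph i x) = - (LB x. gb x * ph x))"
 unfolding weak_partial_def
 using repr_LINT[OF assms(1) test_fun_borel(2)] repr_LINT[OF assms(2) test_fun_borel(1)] by (intro all_cong1 imp_cong refl) simp

lemma integrable_of_square:
 fixes f :: "real^3 => real"
 assumes f: "f \<in> bmb" "!!x. x ~: U ==> f x = 0" "intb (%x. (f x)\<^sup>2)" and U: "open U" "bounded (U :: (real^3) set)"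
 shows "integrable lborel f"
proof -
 have "intb (%x. indicator U x * f x)"
  using U by (intro L2X_integrable(2)[OF L2X_of_integrable[OF f(1,3)]] bounded_emeasure) auto
 moreover have "(%x. indicator U x * f x) = f" using f(2) by (intro ext) (metis indicator_simps mult_1 mult_zero_left)
 ultimately show ?thesis by simp
qed

text \<open>Representatives of u and of its selected weak gradient \<open>wgrad\<close>, with the
  weak identity already upgraded to C1 tests.\<close>

definition rep :: "(real^3) set => (real^3 => real^3) => (real^3 => real^3) => (real^3 => real^3^3) => bool" where
 "rep U u ub gb \<longleftrightarrow> (\<forall>i. repr U (%x. u x $ i) (%x. ub x $ i)) & (\<forall>i j. repr U (%x. wgrad U u x $ i $ j) (%x. gb x $ i $ j))
  & (\<forall>i. intb (%x. ub x $ i) & intb (%x. (ub x $ i)\<^sup>2))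
  & (\<forall>i j. intb (%x. gb x $ i $ j) & intb (%x. (gb x $ i $ j)\<^sup>2))
  & (\<forall>i. wd U (%x. ub x $ i) (%x. gb x $ i))"

lemma wgrad_props:
 assumes "H1v U u"
 shows "L2_on U (%x. wgrad U u x $ i $ j) & weak_partial U (%x. u x $ i) j (%x. wgrad U u x $ i $ j)"
proof -
 have "\<exists>g. L2_on U g & weak_partial U (%y. u y $ i) j g" using assms unfolding H1v_def H1_def by blast
 from someI_ex[OF this] show ?thesis by (simp add: wgrad_def)
qed

lemma H1v_rep:
 assumes U: "open U" "bounded U" and u: "H1v U u" and ub: "!!i. repr U (%x. u x $ i) (%x. ub x $ i)"
 shows "\<exists>gb. rep U u ub gb"
proof -
 have "\<forall>i j. \<exists>g. repr U (%x. wgrad U u x $ i $ j) g"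
  using wgrad_props[OF u] ex_repr[OF U(1)] by (simp add: L2_on_def)
 then obtain g where g: "!!i j. repr U (%x. wgrad U u x $ i $ j) (g i j)" by metis
 define gb where "gb x = (\<chi> i j. g i j x)" for x
 have gb: "repr U (%x. wgrad U u x $ i $ j) (%x. gb x $ i $ j)" for i j using g by (simp add: gb_def)
 have u2: "intb (%x. (ub x $ i)\<^sup>2)" for i
  using repr_L2[OF ub] u by (simp add: H1v_def H1_def)
 have g2: "intb (%x. (gb x $ i $ j)\<^sup>2)" for i j
  using repr_L2[OF gb] wgrad_props[OF u] by simp
 have u1: "intb (%x. ub x $ i)" for i
  by (rule integrable_of_square[OF _ _ u2 U]) (use ub in \<open>auto simp: repr_def\<close>)
 have g1: "intb (%x. gb x $ i $ j)" for i j
  by (rule integrable_of_square[OF _ _ g2 U]) (use gb in \<open>auto simp: repr_def\<close>)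
 have "wd U (%x. ub x $ i) (%x. gb x $ i)" for i
 proof (rule wdI_test_fun[OF U(1) u1 g1])
  fix ph j assume "test_fun U ph"
  thus "(LB x. ub x $ i * Dp ph j x) = - (LB x. gb x $ i $ j * ph x)"
   using wgrad_props[OF u, of i j] repr_weak_partial[OF ub gb] by blast
 qed
 thus ?thesis unfolding rep_def using ub gb u1 u2 g1 g2 by blast
qed

text \<open>As \<open>wgrad\<close> is picked by a choice operator, a constructed gradient need not
  be the picked one. Uniqueness of weak derivatives identifies the two almost everywhere, which is
  what the norm in the statement needs.\<close>

lemma H1v_of_wL:
 assumes U: "open U" "bounded U" and w: "!!i. wL U (%x. u x $ i) (%x. g x $ i)"
 shows "H1v U u" and "rep U u (%x. indicator U x *R u x) (%x. indicator U x *R g x)"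
proof -
 have Ub: "U \<in> sets borel" "emeasure lborel U < \<infinity>" using U bounded_emeasure by auto
 note [measurable] = Ub(1)
 have mu [measurable]: "(%x. u x $ i) \<in> bmb" for i using w by (simp add: wL_def L2X_def)
 have mg [measurable]: "(%x. g x $ i $ j) \<in> bmb" for i j using w by (simp add: wL_def L2X_def)
 have ru: "repr U (%x. u x $ i) (%x. (indicator U x *R u x) $ i)" for i by (auto simp: repr_def)
 have rg: "repr U (%x. g x $ i $ j) (%x. (indicator U x *R g x) $ i $ j)" for i j by (auto simp: repr_def)
 have u2: "intb (%x. ((indicator U x *R u x) $ i)\<^sup>2)" for i
  using L2X_integrable(1)[OF _ Ub, of "%x. u x $ i"] w by (simp add: wL_def)
 have g2: "intb (%x. ((indicator U x *R g x) $ i $ j)\<^sup>2)" for i j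
  using L2X_integrable(1)[OF _ Ub, of "%x. g x $ i $ j"] w by (simp add: wL_def)
 have wdi: "wd U (%x. (indicator U x *R u x) $ i) (%x. (indicator U x *R g x) $ i)" for i
  using wL_integrable(3)[OF w U] by simp
 have L2g: "L2_on U (%x. g x $ i $ j)" for i j using repr_L2[OF rg] g2 by blast
 have wp: "weak_partial U (%x. u x $ i) j (%x. g x $ i $ j)" for i j
  unfolding repr_weak_partial[OF ru rg]
 proof (intro allI impI)
  fix ph assume "test_fun U ph"
  from wdi[unfolded wd_def, rule_format, OF test_fun_ctest[OF this], of i j]
  show "(LB x. (indicator U x *R u x) $ i * Dp ph j x) = - (LB x. (indicator U x *R g x) $ i $ j * ph x)"
   by (simp only: vec_lambda_beta)
 qed
 show H: "H1v U u" unfolding H1v_def H1_def using repr_L2[OF ru] u2 L2g wp by blast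
 obtain gb where gb: "rep U u (%x. indicator U x *R u x) gb" using H1v_rep[OF U H ru] by blast
 have u1: "intb (%x. (indicator U x *R u x) $ i)" for i using wL_integrable(1)[OF w U] by simp
 have g1: "intb (%x. (indicator U x *R g x) $ i $ j)" for i j using wL_integrable(2)[OF w U] by simp
 have "AE x in lborel. x \<in> U --> gb x $ i $ j = (indicator U x *R g x) $ i $ j" for i j
  by (rule wd_unique[OF U _ wdi]) (use gb g1 in \<open>auto simp: rep_def\<close>)
 moreover have "AE x in lborel. x \<in> U --> gb x $ i $ j = wgrad U u x $ i $ j" for i j using gb by (auto simp: rep_def repr_def)
 ultimately have ae: "AE x in lborel. x \<in> U --> (indicator U x *R g x) $ i $ j = wgrad U u x $ i $ j" for i j
 proof -
  assume a: "!!i j. AE x in lborel. x \<in> U --> gb x $ i $ j = (indicator U x *R g x) $ i $ j"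
   "!!i j. AE x in lborel. x \<in> U --> gb x $ i $ j = wgrad U u x $ i $ j"
  show ?thesis using a(1)[of i j] a(2)[of i j] by eventually_elim auto
 qed
 have "repr U (%x. wgrad U u x $ i $ j) (%x. (indicator U x *R g x) $ i $ j)" for i j
  using ae[of i j] rg[of i j] by (simp add: repr_def)
 thus "rep U u (%x. indicator U x *R u x) (%x. indicator U x *R g x)"
  unfolding rep_def using ru u1 u2 g1 g2 wdi by blast
qed

text \<open>The passage from the gradient to the scaled gradient, detached from \<open>wgrad\<close>
  so that it can act on any representative.\<close>

definition sc :: "real => real^3^3 => real^3^3" where
 "sc h M = (\<chi> k j. (if j = 3 then 1 / h else 1) * M $ k $ j)"

lemma sc_nth [simp]: "sc h M $ k $ j = (if j = 3 then 1 / h else 1) * M $ k $ j"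
 by (simp add: sc_def)

lemma grad_h_sc: "grad_h h U u x = sc h (wgrad U u x)"
 by (simp add: grad_h_def sc_def)

lemma L2norm_rep:
 assumes r: "rep U u ub gb"
 shows "L2norm U (%x. symm (grad_h h U u x)) = sqrt (enn2real (NB x. ennreal ((norm (symm (sc h (gb x))))\<^sup>2)))"
  and "(NB x. ennreal ((norm (symm (sc h (gb x))))\<^sup>2)) < \<infinity>"
proof -
 have rg: "repr U (%x. wgrad U u x $ i $ j) (%x. gb x $ i $ j)" for i j using r by (simp add: rep_def)
 have [measurable]: "(%x. gb x $ i $ j) \<in> bmb" for i j using rg by (simp add: repr_def)
 have m: "(%x. (norm (symm (sc h (gb x))))\<^sup>2) \<in> borel_measurable lborel"
  using norm_symm_measurable[of "%x. sc h (gb x)"] by simp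
 have "AE x in lebesgue. \<forall>i\<in>UNIV. \<forall>j\<in>UNIV. gb x $ i $ j = indicator U x *R (wgrad U u x $ i $ j)"
  using repr_AE[OF rg] by (intro AE_finite_allI finite) auto
 hence ae: "AE x in lebesgue. (norm (symm (sc h (gb x))))\<^sup>2 = indicator U x *R (norm (symm (grad_h h U u x)))\<^sup>2"
 proof eventually_elim
  case (elim x)
  hence "gb x = indicator U x *R wgrad U u x" by (simp add: vec_eq_iff)
  moreover have "symm (sc h 0) = 0" by (simp add: vec_eq_iff symm_nth)
  ultimately show ?case by (cases "x \<in> U") (simp_all add: grad_h_sc)
 qed
 have "(LINT x:U|lebesgue. (norm (symm (grad_h h U u x)))\<^sup>2) = (\<integral>x. (norm (symm (sc h (gb x))))\<^sup>2 \<partial>lebesgue)"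
  unfolding set_lebesgue_integral_def
  by (rule integral_cong_AE[OF measurable_completion[OF m] borel_measurable_AE[OF measurable_completion[OF m] ae] ae, symmetric])
 also have "... = (LB x. (norm (symm (sc h (gb x))))\<^sup>2)" using integral_completion[OF m] by simp
 also have "... = enn2real (NB x. ennreal ((norm (symm (sc h (gb x))))\<^sup>2))"
  by (rule integral_eq_nn_integral[OF m]) simp
 finally show "L2norm U (%x. symm (grad_h h U u x)) = sqrt (enn2real (NB x. ennreal ((norm (symm (sc h (gb x))))\<^sup>2)))"
  by (simp add: L2norm_def)
 have i: "intb (%x. (norm (symm (sc h (gb x))))\<^sup>2)"
 proof -
  \<comment> \<open>A bound for both factors 1 and 1/h, used for the finiteness of the norm.\<close>
  define k where "k = 1 + 1 / \<bar>h\<bar>"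
  have k1: "\<bar>if j = 3 then 1 / h else 1\<bar> <= k" for j :: 3 by (auto simp: k_def)
  have k0: "k >= 0" by (simp add: k_def)
  have e2: "(a + b)\<^sup>2 / 4 <= a\<^sup>2 + b\<^sup>2" for a b :: real using sum_squares_bound[of a b] by (simp add: power2_sum) (smt (verit) zero_le_power2)
  have "(norm (symm (sc h M)))\<^sup>2 <= (\<Sum>i\<in>UNIV. \<Sum>j\<in>UNIV. k\<^sup>2 * (M $ i $ j)\<^sup>2 + k\<^sup>2 * (M $ j $ i)\<^sup>2)" for M
   unfolding norm_matrix_sq symm_nth
  proof (intro sum_mono)
   fix i j :: 3
   have s: "(sc h M $ i $ j)\<^sup>2 <= k\<^sup>2 * (M $ i $ j)\<^sup>2" for i j
   proof -
   have "(if j = 3 then 1 / h else 1)\<^sup>2 <= k\<^sup>2" using power_mono[OF k1[of j] abs_ge_zero, of 2] by (simp only: power2_abs)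
   thus ?thesis unfolding sc_nth power_mult_distrib by (rule mult_right_mono) simp
   qed
   have "((sc h M $ i $ j + sc h M $ j $ i) / 2)\<^sup>2 = (sc h M $ i $ j + sc h M $ j $ i)\<^sup>2 / 4" by (simp add: power_divide)
   also have "... <= (sc h M $ i $ j)\<^sup>2 + (sc h M $ j $ i)\<^sup>2" by (rule e2)
   also have "... <= k\<^sup>2 * (M $ i $ j)\<^sup>2 + k\<^sup>2 * (M $ j $ i)\<^sup>2" by (intro add_mono s)
   finally show "((sc h M $ i $ j + sc h M $ j $ i) / 2)\<^sup>2 <= k\<^sup>2 * (M $ i $ j)\<^sup>2 + k\<^sup>2 * (M $ j $ i)\<^sup>2" .
  qed
  moreover have "intb (%x. \<Sum>i\<in>UNIV. \<Sum>j\<in>UNIV. k\<^sup>2 * (gb x $ i $ j)\<^sup>2 + k\<^sup>2 * (gb x $ j $ i)\<^sup>2)"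
   using r by (intro Bochner_Integration.integrable_sum Bochner_Integration.integrable_add integrable_mult_right) (auto simp: rep_def)
  ultimately show ?thesis
   by (intro Bochner_Integration.integrable_bound[OF _ m]) (auto intro!: AE_I2 order_trans[OF _ abs_ge_self])
 qed
 have "(NB x. ennreal (norm ((norm (symm (sc h (gb x))))\<^sup>2))) < \<infinity>"
  using i unfolding integrable_iff_bounded by blast
 thus "(NB x. ennreal ((norm (symm (sc h (gb x))))\<^sup>2)) < \<infinity>" by simp
qed

section \<open>Rescaling to cells and gluing over the perforated domain\<close>

lemma AE_daff:
 fixes f g :: "real^3 => real^3"
 assumes c: "!!k. c $ k ~= 0" and [measurable]: "f \<in> bmb" "g \<in> bmb"
  and e: "AE x in lborel. f x = g x"
 shows "AE y in lborel. f (daff b c y) = g (daff b c y)"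
proof -
 define d :: ennreal where "d = ennreal (\<Prod>k\<in>UNIV. \<bar>c $ k\<bar>)"
 have d: "d ~= 0" using c by (auto simp: d_def prod_pos less_eq_real_def intro!: less_imp_neq[symmetric] prod_pos)
 have m [measurable]: "(%x. ennreal (norm (f x - g x))) \<in> bmb" by measurable
 have "d * (NB y. ennreal (norm (f (daff b c y) - g (daff b c y)))) = (NB x. ennreal (norm (f x - g x)))"
  unfolding d_def by (rule nn_integral_daff[OF c m, symmetric])
 also have "... = (NB x::real^3. 0)" by (rule nn_integral_cong_AE, rule eventually_mono[OF e]) simp
 finally have "(NB y. ennreal (norm (f (daff b c y) - g (daff b c y)))) = 0" using d by simp
 hence "AE y in lborel. ennreal (norm (f (daff b c y) - g (daff b c y))) = 0"
  by (subst (asm) nn_integral_0_iff_AE) measurable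
 thus ?thesis by eventually_elim simp
qed

lemma wL_daff:
 assumes w: "wL U f g" and U: "open U" "bounded U" and c: "!!k. c $ k ~= 0"
 shows "wL (daff b c -` U) (%y. f (daff b c y)) (%y. \<chi> k. c $ k * g (daff b c y) $ k)"
proof -
 have "wd (daff b c -` U) (%y. indicator U (daff b c y) * f (daff b c y)) (%y. \<chi> k. c $ k * (indicator U (daff b c y) *R g (daff b c y)) $ k)"
  by (rule wd_daff[OF wL_integrable(3)[OF w U] c wL_integrable(1,2)[OF w U]])
 hence 1: "wd (daff b c -` U) (%y. f (daff b c y)) (%y. \<chi> k. c $ k * g (daff b c y) $ k)"
  by (rule wd_cong_on) auto
 have UB: "U \<in> sets borel" using U by simp
 have UB2: "daff b c -` U \<in> sets borel" using measurable_sets[OF daff_measurable UB, of b c] by simp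
 have L: "L2X (daff b c -` U) (%y. k (daff b c y))" if k: "L2X U k" for k
 proof -
  have [measurable]: "k \<in> bmb" "U \<in> sets borel" using k UB by (auto simp: L2X_def)
  define d where "d = (\<Prod>k\<in>UNIV. \<bar>c $ k\<bar>)"
  have d: "d > 0" using c by (auto simp: d_def intro!: prod_pos)
  have m: "(%x. indicator U x * ennreal ((k x)\<^sup>2)) \<in> bmb" by measurable
  have "(NB x. indicator U x * ennreal ((k x)\<^sup>2)) = ennreal d * (NB y. indicator U (daff b c y) * ennreal ((k (daff b c y))\<^sup>2))"
   unfolding d_def by (rule nn_integral_daff[OF c m])
  hence "ennreal d * (NB y. indicator U (daff b c y) * ennreal ((k (daff b c y))\<^sup>2)) < \<infinity>" using k by (simp add: L2X_def)
  hence "(NB y. indicator U (daff b c y) * ennreal ((k (daff b c y))\<^sup>2)) < \<infinity>" using d by (auto simp: ennreal_mult_less_top)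
  moreover have "(%y. k (daff b c y)) \<in> bmb" by measurable
  moreover have "indicator (daff b c -` U) y = (indicator U (daff b c y) :: ennreal)" for y by (simp add: indicator_def)
  ultimately show ?thesis by (simp add: L2X_def)
 qed
 have "L2X (daff b c -` U) (%x. c $ j * g (daff b c x) $ j)" for j
  by (rule L2X_cmult[OF L[of "%x. g x $ j"] UB2]) (use w in \<open>simp add: wL_def\<close>)
 thus ?thesis using 1 L[of f] w by (simp add: wL_def)
qed

text \<open>Cell extension and cut-off are parameters, obtained once for all indices; only
  \<epsilon> and h will vary, so that \<open>Cc\<close> is common to all of them.\<close>

locale perforated = hole_cell +
 fixes Ec :: "(real^3 => real^3) => real^3 => real^3" and Gc :: "(real^3 => real^3) => (real^3 => real^3^3) => real^3 => real^3^3"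
  and Cc :: real and ps :: "real^2 => real" and ps' :: "real^2 => real^2" and Ups K \<omega> :: "(real^2) set" and \<epsilon> h :: real
 assumes Cc: "Cc >= 0"
  and cell: "!!T u g. c0 <= T ==> adm (VT Y T) u g ==> (\<forall>i. intb (%x. (u x $ i)\<^sup>2)) ==>
   (\<forall>i. wL (VT Z T) (%x. Ec u x $ i) (%x. Gc u g x $ i)) &
   (NB x. indicator (VT D T) x * ennreal ((norm (symm (Gc u g x)))\<^sup>2)) <= ennreal Cc * JJ g"
  and cell_off: "!!u g x. hat x ~: D ==> Ec u x = u x & Gc u g x = g x"
  and cell_lin: "!!u v w a c x. (\<forall>i. intb (%x. u x $ i)) ==> (\<forall>i. intb (%x. w x $ i)) ==> (\<forall>i. intb (%x. v x $ i)) ==>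
   (AE y in lborel. v y = a *R u y + c *R w y) ==> hat x \<in> D ==> Ec v x = a *R Ec u x + c *R Ec w x"
  and psi: "C1 ps ps'" "compact K" "K \<subseteq> Z" "!!x. x ~: K ==> ps x = 0" "open Ups" "closure D \<subseteq> Ups" "Ups \<subseteq> Z" "!!x. x \<in> Ups ==> ps x = 1"
  and ZY: "Z \<subseteq> Ycell" and om: "open \<omega>" "bounded \<omega>" and eps: "\<epsilon> > 0" "h > 0" "c0 <= h / \<epsilon>"
begin

definition "II = {z::real^2. z $ 1 \<in> \<int> & z $ 2 \<in> \<int> & (%y. \<epsilon> *R (y + z)) ` Ycell \<subseteq> \<omega>}"
definition "sh z = daff (- z) (\<chi> k. 1 / \<epsilon>)" for z :: "real^2"
text \<open>Factors of the map \<open>Ph\<close> from the stretched cell; the vertical one,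
  \<epsilon>/h, takes the layer of height \<open>TT\<close> to height 1.\<close>

definition "cc = (vector [\<epsilon>, \<epsilon>, \<epsilon> / h] :: real^3)"
definition "Ph z = daff (hatT (\<epsilon> *R z)) cc"
definition "Ps z = daff (\<chi> k. - hatT (\<epsilon> *R z) $ k / cc $ k) (\<chi> k. 1 / cc $ k)"
definition "TT = h / \<epsilon>"
text \<open>Omitting open holes does not leave an open set in general, while weak derivatives are
  tested on an open one.\<close>

definition "VV = interior (Omega1 \<omega> D \<epsilon>)"

lemma sh_nth [simp]: "sh z y $ k = y $ k / \<epsilon> - z $ k" by (simp add: sh_def)

lemma cc_nth [simp]: "cc $ 1 = \<epsilon>" "cc $ 2 = \<epsilon>" "cc $ 3 = \<epsilon> / h" by (simp_all add: cc_def)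

lemma cc_nz: "cc $ k ~= 0"
 using eps exhaust_3[of k] by auto

lemma Ph_Ps [simp]: "Ph z (Ps z x) = x" "Ps z (Ph z y) = y"
 unfolding Ph_def Ps_def using daff_inverse[OF cc_nz] by auto

lemma sh_Ph [simp]: "sh z (hat (Ph z y)) = hat y"
 using eps by (simp add: vec2_eq Ph_def field_simps)

lemma hat_Ps [simp]: "hat (Ps z x) = sh z (hat x)"
 using eps by (simp add: vec2_eq Ps_def field_simps)

lemma Ps3 [simp]: "Ps z x $ 3 = (h / \<epsilon>) * x $ 3" and Ph3 [simp]: "Ph z y $ 3 = (\<epsilon> / h) * y $ 3"
 using eps by (simp_all add: Ps_def Ph_def)

lemma Ps_VT: "Ps z x \<in> VT S TT \<longleftrightarrow> sh z (hat x) \<in> S & x $ 3 \<in> Iint"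
proof -
 have "\<bar>(h / \<epsilon>) * x $ 3\<bar> = (h / \<epsilon>) * \<bar>x $ 3\<bar>" using eps by (simp add: abs_mult)
 moreover have "(h / \<epsilon>) * \<bar>x $ 3\<bar> < (h / \<epsilon>) * (1 / 2) \<longleftrightarrow> \<bar>x $ 3\<bar> < 1 / 2"
  using eps by (subst mult_less_cancel_left_pos) auto
 ultimately have "\<bar>Ps z x $ 3\<bar> < TT / 2 \<longleftrightarrow> \<bar>x $ 3\<bar> < 1 / 2" by (simp add: TT_def)
 thus ?thesis by (auto simp: VT_def Iint_def)
qed

lemma Ph_measurable [measurable]: "Ph z \<in> bmb" and Ps_measurable [measurable]: "Ps z \<in> bmb"
 by (simp_all add: Ph_def Ps_def)

lemma sh_eq: "hat x \<in> (%y. \<epsilon> *R (y + z)) ` S \<longleftrightarrow> sh z (hat x) \<in> S"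
proof -
 have 1: "y = \<epsilon> *R (sh z y + z)" for y using eps by (simp add: vec2_eq)
 have "sh z (\<epsilon> *R (y + z)) = y" for y using eps by (simp add: vec2_eq field_simps)
 thus ?thesis using 1[of "hat x"] by (auto intro: rev_image_eqI)
qed

lemma II_disj:
 assumes "z \<in> II" "z' \<in> II" "sh z y \<in> Ycell" "sh z' y \<in> Ycell" shows "z = z'"
proof -
 have "z $ i = z' $ i" for i
 proof -
  have "i = 1 \<or> i = 2" by (rule exhaust_2)
  then obtain a b :: int where ab: "z $ i = of_int a" "z' $ i = of_int b" using assms(1,2) by (auto simp: II_def elim!: Ints_cases)
  have "0 <= y $ i / \<epsilon> - a" "y $ i / \<epsilon> - a < 1" "0 <= y $ i / \<epsilon> - b" "y $ i / \<epsilon> - b < 1"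
   using assms(3,4) ab(1)[symmetric] ab(2)[symmetric] unfolding Ycell_def mem_Collect_eq sh_nth by metis+
  hence "a = b" by linarith
  thus ?thesis using ab by simp
 qed
 thus ?thesis by (simp add: vec_eq_iff)
qed

text \<open>Every admissible translate has its corner \<epsilon> z in the bounded set \<omega>, so
  all gluing sums are finite.\<close>

lemma II_finite: "finite II"
proof -
 obtain R where R: "!!y. y \<in> \<omega> ==> norm y <= R" using om(2) by (auto simp: bounded_iff)
 define N where "N = \<lceil>R / \<epsilon>\<rceil>"
 have "II \<subseteq> (%(a, b). vector [of_int a, of_int b]) ` ({-N..N} \<times> {-N..N})"
 proof
  fix z assume z: "z \<in> II"
  then obtain a b :: int where ab: "z $ 1 = of_int a" "z $ 2 = of_int b" by (auto simp: II_def elim!: Ints_cases)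
  have "\<epsilon> *R (0 + z) \<in> (%y. \<epsilon> *R (y + z)) ` Ycell" by (rule imageI) (simp add: Ycell_def)
  hence "\<epsilon> *R (0 + z) \<in> \<omega>" using z by (auto simp: II_def)
  hence "norm (\<epsilon> *R z) <= R" using R[of "\<epsilon> *R (0 + z)"] by simp
  hence nz: "norm z <= R / \<epsilon>" using eps by (simp add: field_simps)
  have "\<bar>z $ i\<bar> <= of_int N" for i using order_trans[OF component_le_norm_cart nz, of i] by (simp add: N_def) linarith
  from this[of 1] this[of 2] have "a \<in> {-N..N}" "b \<in> {-N..N}" unfolding ab by (auto simp: abs_le_iff)
  moreover have "z = vector [of_int a, of_int b]" using ab by (simp add: vec2_eq)
  ultimately show "z \<in> (%(a, b). vector [of_int a, of_int b]) ` ({-N..N} \<times> {-N..N})" by (intro image_eqI[of _ _ "(a, b)"]) auto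
 qed
 thus ?thesis by (rule finite_subset) simp
qed

lemma sh_closed: "closed S ==> closed (hat -` (sh z -` S))"
 unfolding sh_def by (rule closed_hat_vimage[OF closed_vimage[OF _ daff_continuous]])

lemma Om: "open (Omega \<omega>)" "bounded (Omega \<omega>)"
proof -
 have "Omega \<omega> = VT \<omega> 1" by (auto simp: Omega_def VT_def Iint_def abs_less_iff)
 thus "open (Omega \<omega>)" "bounded (Omega \<omega>)" using om VT_open VT_bounded by auto
qed

text \<open>Passing to the interior removes the closed holes: near a point of the closure of a hole
  there are points of the hole itself, and conversely the removal of finitely many closed sets
  leaves an open set.\<close>

lemma VV_eq: "VV = {x \<in> Omega \<omega>. \<forall>z\<in>II. sh z (hat x) ~: closure D}" (is "_ = ?R")
proof
 have o: "?R = Omega \<omega> - (\<Union>z\<in>II. hat -` (sh z -` closure D))" by auto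
 have "open ?R" unfolding o using Om(1) II_finite sh_closed by (intro open_Diff closed_UN) auto
 moreover have "?R \<subseteq> Omega1 \<omega> D \<epsilon>"
  using closure_subset[of D] by (fastforce simp: Omega1_def Omega0_def sh_eq II_def)
 ultimately show "?R \<subseteq> VV" unfolding VV_def by (rule interior_maximal[rotated])
next
 show "VV \<subseteq> ?R"
 proof
  fix x assume x: "x \<in> VV"
  hence "x \<in> Omega1 \<omega> D \<epsilon>" using interior_subset by (auto simp: VV_def)
  hence xO: "x \<in> Omega \<omega>" by (simp add: Omega1_def)
  have "False" if z: "z \<in> II" "sh z (hat x) \<in> closure D" for z
  proof -
   obtain e where e: "e > 0" "ball x e \<subseteq> VV" using x open_contains_ball[of VV] by (auto simp: VV_def)
   obtain w where w: "w \<in> D" "dist w (sh z (hat x)) < e / \<epsilon>" using z(2) e eps by (meson closure_approachable divide_pos_pos)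
   define t where "t = \<epsilon> *R (w - sh z (hat x))"
   define y where "y = x + hatT t"
   have "norm t = \<epsilon> * norm (w - sh z (hat x))" using eps by (simp only: t_def norm_scaleR abs_of_pos)
   hence "norm t < e" using w(2) eps by (simp add: dist_norm pos_less_divide_eq mult.commute)
   hence "y \<in> ball x e" by (simp add: y_def dist_norm)
   hence "y \<in> Omega1 \<omega> D \<epsilon>" using e interior_subset unfolding VV_def by blast
   moreover have "sh z (hat y) = w" using eps by (simp add: vec2_eq y_def t_def field_simps)
   hence "sh z (hat y) \<in> D" using w by simp
   moreover have "y $ 3 \<in> Iint" using xO by (simp add: y_def Omega_def)
   ultimately show False using z(1) by (auto simp: Omega1_def Omega0_def sh_eq II_def)
  qed
  thus "x \<in> ?R" using xO by blast
 qed
qed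

lemma VV: "open VV" "bounded VV" "VV \<subseteq> Omega \<omega>"
proof -
 show "open VV" by (simp add: VV_def)
 show "VV \<subseteq> Omega \<omega>" by (auto simp: VV_eq)
 thus "bounded VV" using Om bounded_subset by blast
qed

lemma II_om: "z \<in> II ==> sh z (hat x) \<in> Ycell ==> hat x \<in> \<omega>"
 using sh_eq[of x z Ycell] by (auto simp: II_def)

lemma Ph_V: assumes "z \<in> II" "y \<in> VT Y TT" shows "Ph z y \<in> VV"
proof -
 have y: "hat y \<in> Z" "hat y ~: closure D" using assms(2) by (auto simp: VT_def Y_def)
 have "Ps z (Ph z y) \<in> VT Y TT" using assms(2) by simp
 hence 3: "Ph z y $ 3 \<in> Iint" unfolding Ps_VT by simp
 have "hat (Ph z y) \<in> \<omega>" by (rule II_om[OF assms(1)]) (use y ZY in auto)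
 moreover have "sh z' (hat (Ph z y)) ~: closure D" if "z' \<in> II" for z'
 proof
  assume a: "sh z' (hat (Ph z y)) \<in> closure D"
  have "z = z'" by (rule II_disj[OF assms(1) that, of "hat (Ph z y)"]) (use a y Z(3) ZY in auto)
  thus False using a y by simp
 qed
 ultimately show ?thesis using 3 by (simp add: VV_eq Omega_def)
qed

text \<open>Chosen from u alone, so that \<open>EE\<close> is a function of u. The choice is not
  linear, hence linearity of the operator holds almost everywhere.\<close>

definition "ub u = (SOME f. \<forall>i. repr VV (%x. u x $ i) (%x. f x $ i :: real))" for u :: "real^3 => real^3"
definition "uh z u y = indicator (VT Y TT) y *R ub u (Ph z y)"
text \<open>Gradient of the rescaled displacement: the chain rule multiplies column k by
  \<open>cc $ k\<close>.\<close>

definition "gh z gb y = (indicator (VT Y TT) y :: real) *R (\<chi> i k. cc $ k * gb (Ph z y) $ i $ k)" for gb :: "real^3 => real^3^3"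
text \<open>The cut-offs equal 1 near the closed holes, and those of different cells have disjoint
  supports. Off the holes a cell extension gives back \<open>ub u\<close>, so the transition region
  of a cut-off contributes no error.\<close>

definition "EE u x = (\<Sum>z\<in>II. ps (sh z (hat x)) *R Ec (uh z u) (Ps z x)) + (1 - (\<Sum>z\<in>II. ps (sh z (hat x)))) *R ub u x"
definition "Gz z u gb x = (\<chi> i k. (1 / cc $ k) * Gc (uh z u) (gh z gb) (Ps z x) $ i $ k)"
definition "sp z y = (\<chi> k. (1 / \<epsilon>) * ps' (sh z y) $ k)"
definition "HH u gb x = (\<chi> i. (\<Sum>z\<in>II. ps (sh z (hat x)) *R Gz z u gb x $ i + Ec (uh z u) (Ps z x) $ i *R hatT (sp z (hat x)))
 + ((1 - (\<Sum>z\<in>II. ps (sh z (hat x)))) *R gb x $ i + ub u x $ i *R hatT (0 - (\<Sum>z\<in>II. sp z (hat x)))))"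

lemma C1_sp: "C1 (%y. ps (sh z y)) (sp z)"
 using C1_daff[OF psi(1), of "- z" "\<chi> k. 1 / \<epsilon>"] by (simp add: sh_def sp_def[abs_def])

lemma psi'_zero: "x ~: K ==> ps' x = 0" "x \<in> Ups ==> ps' x = 0"
proof -
 show "x ~: K ==> ps' x = 0" by (rule C1_zero_outside[OF psi(1) compact_imp_closed[OF psi(2)] psi(4)])
 assume x: "x \<in> Ups"
 have "0 - ps' x = 0" by (rule C1_zero_outside[OF C1_diff[OF C1_const[of 1] psi(1)], of "- Ups"]) (use psi(5,8) x in auto)
 thus "ps' x = 0" by simp
qed

lemma sp_zero: "sh z y ~: K ==> sp z y = 0" "sh z y \<in> Ups ==> sp z y = 0"
 using psi'_zero by (simp_all add: sp_def vec_eq_iff)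

lemma only_one:
 assumes z: "z \<in> II" "sh z y \<in> Ups" "z' \<in> II" "z' ~= z" shows "sh z' y ~: K"
proof
 assume "sh z' y \<in> K"
 hence "z' = z" by (intro II_disj[OF z(3,1), of y]) (use z psi(3,7) ZY in auto)
 thus False using z by simp
qed

lemma sum_only:
 fixes f :: "real^2 => 'v::comm_monoid_add"
 assumes z: "z \<in> II" "sh z y \<in> Ups" and f: "!!z'. sh z' y ~: K ==> f z' = 0"
 shows "(\<Sum>z'\<in>II. f z') = f z"
proof -
 have "(\<Sum>z'\<in>II - {z}. f z') = 0" by (rule sum.neutral) (use only_one[OF z] f in auto)
 thus ?thesis using sum.remove[OF II_finite z(1), of f] by simp
qed

lemma ub_repr:
 assumes "\<exists>f. \<forall>i. repr VV (%x. u x $ i) (%x. f x $ i)" shows "repr VV (%x. u x $ i) (%x. ub u x $ i)"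
 using someI_ex[OF assms] unfolding ub_def by blast

lemma H1v_ub:
 assumes "H1v VV u" shows "repr VV (%x. u x $ i) (%x. ub u x $ i)"
proof (rule ub_repr)
 have "\<forall>i. \<exists>f. repr VV (%x. u x $ i) f" using assms ex_repr[OF VV(1)] by (simp add: H1v_def H1_def L2_on_def)
 then obtain f where f: "!!i. repr VV (%x. u x $ i) (f i)" by metis
 thus "\<exists>f. \<forall>i. repr VV (%x. u x $ i) (%x. f x $ i)" by (intro exI[of _ "%x. \<chi> i. f i x"]) simp
qed

lemma uh_integrable:
 assumes "!!i. intb (%x. ub u x $ i)" shows "intb (%x. uh z u x $ i)"
proof -
 have "VT Y TT \<in> sets borel" using Yopen by (intro VT_borel) auto
 moreover have "intb (%y. ub u (Ph z y) $ i)" unfolding Ph_def by (rule integrable_daff[OF cc_nz assms])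
 ultimately show ?thesis using integrable_mult_indicator[of "VT Y TT" lborel "%y. ub u (Ph z y) $ i"] by (simp add: uh_def)
qed

lemma off_hole:
 assumes x: "x \<in> Omega \<omega>" "z \<in> II" "sh z (hat x) \<in> Z - D" and 0: "!!x. x ~: VV ==> ub u x = 0 & gb x = 0"
 shows "Ec (uh z u) (Ps z x) = ub u x" "Gz z u gb x = gb x"
proof -
 have i: "indicator (VT Y TT) (Ps z x) *R ub u x = ub u x" "indicator (VT Y TT) (Ps z x) *R gb x = gb x"
 proof -
  have "Ps z x \<in> VT Y TT" if "x \<in> VV"
   using that x unfolding Ps_VT by (auto simp: VV_eq Y_def Omega_def)
  thus "indicator (VT Y TT) (Ps z x) *R ub u x = ub u x" "indicator (VT Y TT) (Ps z x) *R gb x = gb x"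
   using 0[of x] by (auto simp: indicator_def)
 qed
 have E: "Ec (uh z u) (Ps z x) = uh z u (Ps z x)" "Gc (uh z u) (gh z gb) (Ps z x) = gh z gb (Ps z x)"
  using cell_off[of "Ps z x"] x by auto
 show "Ec (uh z u) (Ps z x) = ub u x" using i by (simp add: E uh_def)
 have "Gz z u gb x = indicator (VT Y TT) (Ps z x) *R gb x" using cc_nz by (simp add: Gz_def E gh_def vec_eq_iff)
 thus "Gz z u gb x = gb x" using i by simp
qed

text \<open>Where a cut-off is active outside the holes, the cell extension returns the given
  displacement and gradient, so the weights add up to 1 and their derivatives cancel.\<close>

lemma EE_off:
 assumes x: "x \<in> Omega \<omega>" "!!z. z \<in> II ==> sh z (hat x) ~: D" and 0: "!!x. x ~: VV ==> ub u x = 0 & gb x = 0"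
 shows "EE u x = ub u x" "HH u gb x = gb x"
proof -
 have a: "ps (sh z (hat x)) *R Ec (uh z u) (Ps z x) = ps (sh z (hat x)) *R ub u x"
  "ps (sh z (hat x)) *R Gz z u gb x $ i + Ec (uh z u) (Ps z x) $ i *R hatT (sp z (hat x)) = ps (sh z (hat x)) *R gb x $ i + ub u x $ i *R hatT (sp z (hat x))"
  if "z \<in> II" for z i
 proof -
  have "ps (sh z (hat x)) = 0 & sp z (hat x) = 0 \<or> sh z (hat x) \<in> Z - D" using psi(3,4) sp_zero(1) x(2)[OF that] by blast
  thus "ps (sh z (hat x)) *R Ec (uh z u) (Ps z x) = ps (sh z (hat x)) *R ub u x"
   "ps (sh z (hat x)) *R Gz z u gb x $ i + Ec (uh z u) (Ps z x) $ i *R hatT (sp z (hat x)) = ps (sh z (hat x)) *R gb x $ i + ub u x $ i *R hatT (sp z (hat x))"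
   using off_hole[OF x(1) that _ 0] linear_0[OF hatT_linear] by auto
 qed
 have "EE u x = (\<Sum>z\<in>II. ps (sh z (hat x))) *R ub u x + (1 - (\<Sum>z\<in>II. ps (sh z (hat x)))) *R ub u x"
  by (simp add: EE_def a scaleR_sum_left)
 thus "EE u x = ub u x" by (simp add: scaleR_add_left[symmetric])
 have "HH u gb x $ i = (\<Sum>z\<in>II. ps (sh z (hat x))) *R gb x $ i + ub u x $ i *R hatT (\<Sum>z\<in>II. sp z (hat x))
   + ((1 - (\<Sum>z\<in>II. ps (sh z (hat x)))) *R gb x $ i - ub u x $ i *R hatT (\<Sum>z\<in>II. sp z (hat x)))" for i
  by (simp add: HH_def a sum.distrib scaleR_sum_left scaleR_sum_right linear_neg[OF hatT_linear] linear_sum[OF hatT_linear])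
 thus "HH u gb x = gb x" by (simp add: vec_eq_iff[of "HH u gb x"] scaleR_add_left[symmetric] algebra_simps)
qed

lemma HH_hole:
 assumes x: "z \<in> II" "sh z (hat x) \<in> D" shows "HH u gb x = Gz z u gb x"
proof -
 have U: "sh z (hat x) \<in> Ups" using x psi(6) closure_subset by blast
 have s: "(\<Sum>z\<in>II. ps (sh z (hat x))) = 1" "(\<Sum>z\<in>II. sp z (hat x)) = 0"
  using sum_only[OF x(1) U, of "%z. ps (sh z (hat x))"] sum_only[OF x(1) U, of "%z. sp z (hat x)"] psi(4) psi(8)[OF U] sp_zero(1) sp_zero(2)[OF U] by auto
 have "(\<Sum>z\<in>II. ps (sh z (hat x)) *R Gz z u gb x $ i + Ec (uh z u) (Ps z x) $ i *R hatT (sp z (hat x))) = Gz z u gb x $ i" for i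
  using sum_only[OF x(1) U, of "%z. ps (sh z (hat x)) *R Gz z u gb x $ i + Ec (uh z u) (Ps z x) $ i *R hatT (sp z (hat x))"]
   psi(4) psi(8)[OF U] sp_zero(1) sp_zero(2)[OF U] by (simp add: linear_0[OF hatT_linear])
 thus ?thesis by (simp add: HH_def s vec_eq_iff linear_0[OF hatT_linear])
qed

lemma rep_adm:
 assumes r: "rep VV u (ub u) gb" and z: "z \<in> II"
 shows "adm (VT Y TT) (uh z u) (gh z gb)" "intb (%x. (uh z u x $ i)\<^sup>2)"
proof -
 have bor: "VT Y TT \<in> sets lborel" using Yopen VT_borel[of Y] by auto
 have sub: "VT Y TT \<subseteq> Ph z -` VV" using Ph_V[OF z] by auto
 have int: "intb (%y. f (Ph z y))" if "integrable lborel f" for f :: "real^3 => real"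
  unfolding Ph_def by (rule integrable_daff[OF cc_nz that])
 have wdu: "wd (VT Y TT) (%x. uh z u x $ i) (%x. gh z gb x $ i)" for i
 proof -
  have "wd (Ph z -` VV) (%y. ub u (Ph z y) $ i) (%y. \<chi> k. cc $ k * gb (Ph z y) $ i $ k)"
   unfolding Ph_def by (rule wd_daff[OF _ cc_nz]) (use r in \<open>auto simp: rep_def\<close>)
  from wd_mono[OF this sub] show ?thesis by (rule wd_cong_on) (auto simp: uh_def gh_def)
 qed
 have "intb (%x. ub u x $ i)" for i using r by (simp add: rep_def)
 note iu = uh_integrable[OF this]
 have ig: "intb (%x. gh z gb x $ i $ j)" "intb (%x. (gh z gb x $ i $ j)\<^sup>2)" for i j
 proof -
  have 1: "intb (%y. cc $ j * gb (Ph z y) $ i $ j)" using r by (intro integrable_mult_right int) (simp add: rep_def)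
  show "intb (%x. gh z gb x $ i $ j)" using integrable_mult_indicator[OF bor 1] by (simp add: gh_def)
  have 2: "intb (%y. (cc $ j)\<^sup>2 * (gb (Ph z y) $ i $ j)\<^sup>2)" using r by (intro integrable_mult_right int[of "%x. (gb x $ i $ j)\<^sup>2"]) (simp add: rep_def)
  have "(%x. (gh z gb x $ i $ j)\<^sup>2) = (%x. indicator (VT Y TT) x *R ((cc $ j)\<^sup>2 * (gb (Ph z x) $ i $ j)\<^sup>2))"
   by (auto simp: gh_def indicator_def power_mult_distrib)
  thus "intb (%x. (gh z gb x $ i $ j)\<^sup>2)" using integrable_mult_indicator[OF bor 2] by simp
 qed
 show "adm (VT Y TT) (uh z u) (gh z gb)" unfolding adm_def using wdu iu ig by blast
 have 2: "intb (%y. (ub u (Ph z y) $ i)\<^sup>2)" using r by (intro int[of "%x. (ub u x $ i)\<^sup>2"]) (simp add: rep_def)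
 have "(%x. (uh z u x $ i)\<^sup>2) = (%x. indicator (VT Y TT) x *R (ub u (Ph z x) $ i)\<^sup>2)" by (auto simp: uh_def indicator_def)
 thus "intb (%x. (uh z u x $ i)\<^sup>2)" using integrable_mult_indicator[OF bor 2] by simp
qed

lemma rep_zero:
 assumes "rep VV u (ub u) gb" shows "x ~: VV ==> ub u x = 0 & gb x = 0"
 using assms by (simp add: rep_def repr_def vec_eq_iff)

lemma TT_c0: "c0 <= TT" using eps by (simp add: TT_def)

lemma EE_wL:
 assumes r: "rep VV u (ub u) gb" shows "wL (Omega \<omega>) (%x. EE u x $ i) (%x. HH u gb x $ i)"
proof -
 have oZ: "open (VT Z TT)" "bounded (VT Z TT)" using Z VT_open VT_bounded by auto
 have 1: "wL (Omega \<omega>) (%x. ps (sh z (hat x)) * Ec (uh z u) (Ps z x) $ i) (%x. ps (sh z (hat x)) *R Gz z u gb x $ i + Ec (uh z u) (Ps z x) $ i *R hatT (sp z (hat x)))"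
  if z: "z \<in> II" for z
 proof (rule wL_product[OF _ C1_hat[OF C1_sp] sh_closed[OF compact_imp_closed[OF psi(2)]] _ _ _ _ Om])
  have w: "wL (VT Z TT) (%x. Ec (uh z u) x $ i) (%x. Gc (uh z u) (gh z gb) x $ i)"
   using cell[OF TT_c0 rep_adm(1)[OF r z]] rep_adm(2)[OF r z] by blast
  have "wL (Ps z -` VT Z TT) (%x. Ec (uh z u) (Ps z x) $ i) (%x. \<chi> k. (\<chi> k. 1 / cc $ k) $ k * Gc (uh z u) (gh z gb) (Ps z x) $ i $ k)"
   unfolding Ps_def by (rule wL_daff[OF w oZ]) (simp add: cc_nz)
  thus "wL (Ps z -` VT Z TT) (%x. Ec (uh z u) (Ps z x) $ i) (%x. Gz z u gb x $ i)" by (simp add: Gz_def)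
  show "ps (sh z (hat x)) = 0" if "x ~: hat -` (sh z -` K)" for x using that psi(4) by simp
  show "Omega \<omega> \<inter> hat -` (sh z -` K) \<subseteq> Ps z -` VT Z TT" using psi(3) by (auto simp: Ps_VT Omega_def)
  show "open (Ps z -` VT Z TT)" unfolding Ps_def
   by (rule open_vimage[OF oZ(1) daff_continuous])
  have "Ps z -` VT Z TT \<subseteq> Ph z ` closure (VT Z TT)" using closure_subset by (auto intro!: image_eqI[of _ _ "Ps z _"])
  moreover have "compact (Ph z ` closure (VT Z TT))" unfolding Ph_def
   by (rule compact_continuous_image[OF daff_continuous]) (use oZ in simp)
  ultimately show "bounded (Ps z -` VT Z TT)" using bounded_subset compact_imp_bounded by blast
 qed
 have s: "wL (Omega \<omega>) (%x. \<Sum>z\<in>II. ps (sh z (hat x)) * Ec (uh z u) (Ps z x) $ i) (%x. \<Sum>z\<in>II. ps (sh z (hat x)) *R Gz z u gb x $ i + Ec (uh z u) (Ps z x) $ i *R hatT (sp z (hat x)))"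
  by (rule wL_sum[OF II_finite 1 Om])
 have wV: "wL VV (%x. ub u x $ i) (%x. gb x $ i)"
  using r by (auto simp: rep_def repr_def wL_def intro!: L2X_of_integrable)
 have C: "C1 (%y. 1 - (\<Sum>z\<in>II. ps (sh z y))) (%y. 0 - (\<Sum>z\<in>II. sp z y))"
  by (intro C1_diff C1_const C1_sum C1_sp)
 have 2: "wL (Omega \<omega>) (%x. (1 - (\<Sum>z\<in>II. ps (sh z (hat x)))) * ub u x $ i)
  (%x. (1 - (\<Sum>z\<in>II. ps (sh z (hat x)))) *R gb x $ i + ub u x $ i *R hatT (0 - (\<Sum>z\<in>II. sp z (hat x))))"
 proof (rule wL_product[OF wV C1_hat[OF C] _ _ _ VV(1,2) Om])
  show "closed (\<Inter>z\<in>II. hat -` (sh z -` (- Ups)))" using psi(5) by (intro closed_INT ballI sh_closed) auto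
  fix x assume "x ~: (\<Inter>z\<in>II. hat -` (sh z -` (- Ups)))"
  then obtain z where z: "z \<in> II" "sh z (hat x) \<in> Ups" by auto
  show "1 - (\<Sum>z\<in>II. ps (sh z (hat x))) = 0"
   using sum_only[OF z, of "%z. ps (sh z (hat x))"] psi(4) psi(8)[OF z(2)] by simp
 next
  show "Omega \<omega> \<inter> (\<Inter>z\<in>II. hat -` (sh z -` (- Ups))) \<subseteq> VV" using psi(6) by (auto simp: VV_eq)
 qed
 show ?thesis using wL_add[OF s 2 Om] by (simp add: EE_def HH_def)
qed

lemma N_scale: "(norm (symm (a *R M)))\<^sup>2 = a\<^sup>2 * (norm (symm M))\<^sup>2"
proof -
 have "symm (a *R M) = a *R symm M" by (simp add: vec_eq_iff symm_nth algebra_simps add_divide_distrib)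
 thus ?thesis by (simp add: power_mult_distrib)
qed

text \<open>The reason for the stretched height: after the change of variables the scaled gradient
  is an isotropic multiple, 1/\<epsilon>, of the ordinary one, so that symmetrisation is compatible
  with the rescaling.\<close>

lemma cc_sc: "(if k = 3 then 1 / h else 1) / cc $ k = 1 / \<epsilon>" "cc $ k = \<epsilon> * (if k = 3 then 1 / h else 1)"
proof -
 have "k = 1 \<or> k = 2 \<or> k = 3" by (rule exhaust_3)
 thus "(if k = 3 then 1 / h else 1) / cc $ k = 1 / \<epsilon>" "cc $ k = \<epsilon> * (if k = 3 then 1 / h else 1)"
  using eps by auto
qed

text \<open>The Jacobian occurs on both sides and the factors 1/\<epsilon>^2 and \<epsilon>^2
  cancel, which leaves the constant of the cell unchanged.\<close>

lemma hole_estimate: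
 assumes r: "rep VV u (ub u) gb" and z: "z \<in> II"
 shows "(NB x. indicator (VT D TT) (Ps z x) * ennreal ((norm (symm (sc h (Gz z u gb x))))\<^sup>2))
  <= ennreal Cc * (NB x. indicator (VT Y TT) (Ps z x) * ennreal ((norm (symm (sc h (gb x))))\<^sup>2))"
proof -
 define d where "d = ennreal (\<Prod>k\<in>UNIV. \<bar>cc $ k\<bar>)"
 have [measurable]: "Y \<in> sets borel" using Yopen by simp
 note c = cell[OF TT_c0 rep_adm(1)[OF r z]]
 have c1: "!!i. wL (VT Z TT) (%x. Ec (uh z u) x $ i) (%x. Gc (uh z u) (gh z gb) x $ i)"
  and c2: "(NB x. indicator (VT D TT) x * ennreal ((norm (symm (Gc (uh z u) (gh z gb) x)))\<^sup>2)) <= ennreal Cc * JJ (gh z gb)"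
  using c rep_adm(2)[OF r z] by blast+
 have mc: "(%x. Gc (uh z u) (gh z gb) x $ i $ j) \<in> bmb" for i j using c1[of i] by (simp add: wL_def L2X_def)
 have [measurable]: "(%x. gb x $ i $ j) \<in> bmb" for i j using r by (simp add: rep_def repr_def)
 have mG [measurable]: "(%x. Gz z u gb x $ i $ j) \<in> bmb" for i j
  using measurable_compose[OF Ps_measurable mc[of i j], of z] by (simp add: Gz_def)
 have [measurable]: "VT D TT \<in> sets borel" "VT Y TT \<in> sets borel" using D Yopen by (auto intro!: VT_borel)
 have [measurable]: "(%x. norm (symm (sc h (Gz z u gb x)))) \<in> bmb" "(%x. norm (symm (sc h (gb x)))) \<in> bmb"
  "(%x. norm (symm (Gc (uh z u) (gh z gb) x))) \<in> bmb"
  using norm_symm_measurable[of "%x. sc h (Gz z u gb x)"] norm_symm_measurable[of "%x. sc h (gb x)"] norm_symm_measurable[of "%x. Gc (uh z u) (gh z gb) x", OF mc] by simp_all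
 have tr: "(NB x. F x) = d * (NB y. F (Ph z y))" if "F \<in> bmb" for F :: "real^3 => ennreal"
  unfolding d_def Ph_def by (rule nn_integral_daff[OF cc_nz that])
 have e1: "sc h (Gz z u gb (Ph z y)) = (1 / \<epsilon>) *R Gc (uh z u) (gh z gb) y" for y
 proof -
  have "sc h (Gz z u gb (Ph z y)) $ i $ k = ((if k = 3 then 1 / h else 1) / cc $ k) * Gc (uh z u) (gh z gb) y $ i $ k" for i k
   by (simp add: Gz_def)
  thus ?thesis unfolding cc_sc(1) by (simp add: vec_eq_iff)
 qed
 have e2: "gh z gb y = (indicator (VT Y TT) y * \<epsilon>) *R sc h (gb (Ph z y))" for y
  by (simp only: vec_eq_iff sc_nth gh_def vec_lambda_beta vector_scaleR_component real_scaleR_def cc_sc(2)) (simp add: mult.assoc)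
 have "(NB x. indicator (VT D TT) (Ps z x) * ennreal ((norm (symm (sc h (Gz z u gb x))))\<^sup>2))
  = d * (NB y. indicator (VT D TT) y * ennreal ((norm (symm ((1 / \<epsilon>) *R Gc (uh z u) (gh z gb) y)))\<^sup>2))"
  by (subst tr, measurable) (simp add: e1)
 also have "... = d * (NB y. ennreal ((1 / \<epsilon>)\<^sup>2) * (indicator (VT D TT) y * ennreal ((norm (symm (Gc (uh z u) (gh z gb) y)))\<^sup>2)))"
  unfolding N_scale by (subst ennreal_mult) (simp_all only: zero_le_power2 mult.left_commute)
 also have "... = d * (ennreal ((1 / \<epsilon>)\<^sup>2) * (NB y. indicator (VT D TT) y * ennreal ((norm (symm (Gc (uh z u) (gh z gb) y)))\<^sup>2)))"
  by (subst nn_integral_cmult, measurable)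
 also have "... <= d * (ennreal ((1 / \<epsilon>)\<^sup>2) * (ennreal Cc * JJ (gh z gb)))" by (intro mult_left_mono c2) auto
 also have "JJ (gh z gb) = (NB y. ennreal (\<epsilon>\<^sup>2) * (indicator (VT Y TT) y * ennreal ((norm (symm (sc h (gb (Ph z y)))))\<^sup>2)))"
  unfolding JJ_def e2 N_scale by (rule nn_integral_cong) (auto simp: indicator_def ennreal_mult)
 also have "... = ennreal (\<epsilon>\<^sup>2) * (NB y. indicator (VT Y TT) y * ennreal ((norm (symm (sc h (gb (Ph z y)))))\<^sup>2))"
  by (rule nn_integral_cmult) measurable
 also have "d * (ennreal ((1 / \<epsilon>)\<^sup>2) * (ennreal Cc * (ennreal (\<epsilon>\<^sup>2) * (NB y. indicator (VT Y TT) y * ennreal ((norm (symm (sc h (gb (Ph z y)))))\<^sup>2)))))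
  = (ennreal ((1 / \<epsilon>)\<^sup>2) * ennreal (\<epsilon>\<^sup>2)) * (ennreal Cc * (d * (NB y. indicator (VT Y TT) y * ennreal ((norm (symm (sc h (gb (Ph z y)))))\<^sup>2))))"
  by (simp only: mult.assoc mult.left_commute)
 also have "ennreal ((1 / \<epsilon>)\<^sup>2) * ennreal (\<epsilon>\<^sup>2) = 1" using eps by (subst ennreal_mult[symmetric]) (auto simp: power_mult_distrib[symmetric])
 also have "d * (NB y. indicator (VT Y TT) y * ennreal ((norm (symm (sc h (gb (Ph z y)))))\<^sup>2))
  = (NB x. indicator (VT Y TT) (Ps z x) * ennreal ((norm (symm (sc h (gb x))))\<^sup>2))"
 proof -
  have "(%x. indicator (VT Y TT) (Ps z x) * ennreal ((norm (symm (sc h (gb x))))\<^sup>2)) \<in> bmb" by measurable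
  from tr[OF this] show ?thesis by simp
 qed
 finally show ?thesis by simp
qed

text \<open>Pointwise the strain is the given one off the holes and that of the cell extension
  inside a hole. Distinct cells are disjoint, so the cell bounds add up to at most one copy of the
  total energy, whence 1 + \<open>Cc\<close>.\<close>

lemma EE_estimate:
 assumes r: "rep VV u (ub u) gb"
 shows "(NB x. ennreal ((norm (symm (sc h (indicator (Omega \<omega>) x *R HH u gb x))))\<^sup>2))
  <= ennreal (1 + Cc) * (NB x. ennreal ((norm (symm (sc h (gb x))))\<^sup>2))"
proof -
 let ?N = "%M. ennreal ((norm (symm (sc h M)))\<^sup>2)"
 have [measurable]: "(%x. gb x $ i $ j) \<in> bmb" for i j using r by (simp add: rep_def repr_def)
 have [measurable]: "VT D TT \<in> sets borel" "VT Y TT \<in> sets borel" using D Yopen by (auto intro!: VT_borel)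
 have mg [measurable]: "(%x. ?N (gb x)) \<in> bmb" using norm_symm_measurable[of "%x. sc h (gb x)"] by simp
 have mG [measurable]: "(%x. ?N (Gz z u gb x)) \<in> bmb" if z: "z \<in> II" for z
 proof -
  have "(%x. Gc (uh z u) (gh z gb) x $ i $ j) \<in> bmb" for i j
   using cell[OF TT_c0 rep_adm(1)[OF r z]] rep_adm(2)[OF r z] by (simp add: wL_def L2X_def)
  from measurable_compose[OF Ps_measurable this, of z] have [measurable]: "(%x. Gz z u gb x $ i $ j) \<in> bmb" for i j by (simp add: Gz_def)
  show ?thesis using norm_symm_measurable[of "%x. sc h (Gz z u gb x)"] by simp
 qed
 have mGi: "(%x. indicator (VT D TT) (Ps z x) * ?N (Gz z u gb x)) \<in> borel_measurable lborel" if "z \<in> II" for z using mG[OF that] by measurable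
 have mgi: "(%x. indicator (VT Y TT) (Ps z x) * ?N (gb x)) \<in> borel_measurable lborel" for z by measurable
 have "(NB x. ?N (indicator (Omega \<omega>) x *R HH u gb x)) <= (NB x. ?N (gb x) + (\<Sum>z\<in>II. indicator (VT D TT) (Ps z x) * ?N (Gz z u gb x)))"
 proof (rule nn_integral_mono)
  fix x
  have s0: "symm (sc h 0) = 0" by (simp add: vec_eq_iff symm_nth)
  consider "x ~: Omega \<omega>" | z where "x \<in> Omega \<omega>" "z \<in> II" "sh z (hat x) \<in> D" | "x \<in> Omega \<omega>" "!!z. z \<in> II ==> sh z (hat x) ~: D" by blast
  thus "?N (indicator (Omega \<omega>) x *R HH u gb x) <= ?N (gb x) + (\<Sum>z\<in>II. indicator (VT D TT) (Ps z x) * ?N (Gz z u gb x))"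
  proof cases
   case 1 thus ?thesis by (simp add: s0)
  next
   case 2
   have "Ps z x \<in> VT D TT" using 2 by (simp add: Ps_VT Omega_def)
   hence "?N (indicator (Omega \<omega>) x *R HH u gb x) = indicator (VT D TT) (Ps z x) * ?N (Gz z u gb x)" using 2 by (simp add: HH_hole)
   also have "... <= (\<Sum>z\<in>II. indicator (VT D TT) (Ps z x) * ?N (Gz z u gb x))" using 2(2) II_finite by (intro member_le_sum) auto
   finally show ?thesis by (simp add: add_increasing)
  next
   case 3 thus ?thesis using EE_off(2)[OF 3(1) 3(2) rep_zero[OF r]] by simp
  qed
 qed
 also have "... = (NB x. ?N (gb x)) + (NB x. (\<Sum>z\<in>II. indicator (VT D TT) (Ps z x) * ?N (Gz z u gb x)))"
  by (rule nn_integral_add) (use mGi mg in auto)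
 also have "(NB x. (\<Sum>z\<in>II. indicator (VT D TT) (Ps z x) * ?N (Gz z u gb x))) = (\<Sum>z\<in>II. (NB x. indicator (VT D TT) (Ps z x) * ?N (Gz z u gb x)))"
  by (rule nn_integral_sum) (rule mGi)
 also have "... <= (\<Sum>z\<in>II. ennreal Cc * (NB x. indicator (VT Y TT) (Ps z x) * ?N (gb x)))"
  by (intro sum_mono hole_estimate[OF r])
 also have "... = ennreal Cc * (NB x. (\<Sum>z\<in>II. indicator (VT Y TT) (Ps z x) * ?N (gb x)))"
  by (subst nn_integral_sum[OF mgi]) (rule sum_distrib_left[symmetric])
 also have "(NB x. (\<Sum>z\<in>II. indicator (VT Y TT) (Ps z x) * ?N (gb x))) <= (NB x. ?N (gb x))"
 proof (rule nn_integral_mono)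
  fix x
  show "(\<Sum>z\<in>II. indicator (VT Y TT) (Ps z x) * ?N (gb x)) <= ?N (gb x)"
  proof (cases "\<exists>z\<in>II. Ps z x \<in> VT Y TT")
   case False thus ?thesis by (simp add: sum.neutral)
  next
   case True
   then obtain z where z: "z \<in> II" "Ps z x \<in> VT Y TT" by auto
   have "Ps z' x ~: VT Y TT" if "z' \<in> II - {z}" for z'
   using II_disj[of z z' "hat x"] z that ZY by (auto simp: Ps_VT Y_def)
   hence "(\<Sum>z\<in>II - {z}. indicator (VT Y TT) (Ps z x) * ?N (gb x)) = 0" by (intro sum.neutral) auto
   thus ?thesis using sum.remove[OF II_finite z(1), of "%z. indicator (VT Y TT) (Ps z x) * ?N (gb x)"] z by simp
  qed
 qed
 finally have "(NB x. ?N (indicator (Omega \<omega>) x *R HH u gb x)) <= (NB x. ?N (gb x)) + ennreal Cc * (NB x. ?N (gb x))"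
  by (simp add: add_left_mono mult_left_mono)
 thus ?thesis using Cc by (simp add: ennreal_plus distrib_right)
qed

lemma EE_main:
 assumes u: "H1v VV u"
 shows "H1v (Omega \<omega>) (EE u)" "AE x in lebesgue. x \<in> VV --> EE u x = u x"
  "L2norm (Omega \<omega>) (%x. symm (grad_h h (Omega \<omega>) (EE u) x)) <= sqrt (1 + Cc) * L2norm VV (%x. symm (grad_h h VV u x))"
proof -
 obtain gb where r: "rep VV u (ub u) gb" using H1v_rep[OF VV(1,2) u H1v_ub[OF u]] by blast
 note w = EE_wL[OF r]
 show "H1v (Omega \<omega>) (EE u)" by (rule H1v_of_wL(1)[OF Om w])
 have "AE x in lborel. \<forall>i\<in>UNIV. x \<in> VV --> ub u x $ i = u x $ i"
  using r by (intro AE_finite_allI finite) (auto simp: rep_def repr_def)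
 hence "AE x in lborel. x \<in> VV --> EE u x = u x"
 proof eventually_elim
  case (elim x)
  show ?case
  proof
   assume x: "x \<in> VV"
   have "EE u x = ub u x" by (rule EE_off(1)[OF _ _ rep_zero[OF r]]) (use x closure_subset in \<open>auto simp: VV_eq\<close>)
   thus "EE u x = u x" using elim x by (simp add: vec_eq_iff)
  qed
 qed
 thus "AE x in lebesgue. x \<in> VV --> EE u x = u x" by (subst AE_completion_iff)
 note rE = H1v_of_wL(2)[OF Om w]
 let ?A = "(NB x. ennreal ((norm (symm (sc h (indicator (Omega \<omega>) x *R HH u gb x))))\<^sup>2))"
 let ?B = "(NB x. ennreal ((norm (symm (sc h (gb x))))\<^sup>2))"
 have "enn2real ?A <= enn2real (ennreal (1 + Cc) * ?B)"
  by (rule enn2real_mono[OF EE_estimate[OF r]]) (use L2norm_rep(2)[OF r, of h] in \<open>simp add: ennreal_mult_less_top\<close>)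
 also have "... = (1 + Cc) * enn2real ?B" using Cc by (simp add: enn2real_mult)
 finally have "sqrt (enn2real ?A) <= sqrt (1 + Cc) * sqrt (enn2real ?B)" by (simp add: real_sqrt_mult[symmetric])
 thus "L2norm (Omega \<omega>) (%x. symm (grad_h h (Omega \<omega>) (EE u) x)) <= sqrt (1 + Cc) * L2norm VV (%x. symm (grad_h h VV u x))"
  unfolding L2norm_rep(1)[OF r] L2norm_rep(1)[OF rE] .
qed

text \<open>The representative of a combination differs from the combination of representatives on a
  null set. Averages inside the holes do not see it; where the extension returns the value itself,
  the points of that set are discarded.\<close>

lemma EE_linear:
 assumes u: "H1v VV u" and v: "H1v VV v"
 shows "AE x in lebesgue. x \<in> Omega \<omega> --> EE (%y. a *R u y + b *R v y) x = a *R EE u x + b *R EE v x"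
proof -
 define w where "w y = a *R u y + b *R v y" for y
 note ru = H1v_ub[OF u] and rv = H1v_ub[OF v]
 have mi: "(%x. ub u x $ i) \<in> bmb" "(%x. ub v x $ i) \<in> bmb" for i using ru rv by (auto simp: repr_def)
 have "repr VV (%x. w x $ i) (%x. (a *R ub u x + b *R ub v x) $ i)" for i
  unfolding repr_def
 proof (intro conjI allI impI)
  note [measurable] = mi
  show "(%x. (a *R ub u x + b *R ub v x) $ i) \<in> bmb" by simp
  show "(a *R ub u x + b *R ub v x) $ i = 0" if "x ~: VV" for x using ru[of i] rv[of i] that by (simp add: repr_def)
  have "AE x in lborel. x \<in> VV --> ub u x $ i = u x $ i" "AE x in lborel. x \<in> VV --> ub v x $ i = v x $ i" using ru[of i] rv[of i] by (auto simp: repr_def)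
  thus "AE x in lborel. x \<in> VV --> (a *R ub u x + b *R ub v x) $ i = w x $ i" by eventually_elim (simp add: w_def)
 qed
 note rl = this
 have rw: "repr VV (%x. w x $ i) (%x. ub w x $ i)" for i
  by (rule ub_repr, rule exI[of _ "%x. a *R ub u x + b *R ub v x"]) (use rl in blast)
 have "AE x in lborel. ub w x $ i = (a *R ub u x + b *R ub v x) $ i" for i
 proof -
  have "AE x in lborel. x \<in> VV --> ub w x $ i = w x $ i" "AE x in lborel. x \<in> VV --> (a *R ub u x + b *R ub v x) $ i = w x $ i"
   using rw[of i] rl[of i] unfolding repr_def by blast+
  thus ?thesis
  proof eventually_elim
   case (elim x)
   have "ub w x $ i = (a *R ub u x + b *R ub v x) $ i" if "x ~: VV" using rw[of i] rl[of i] that by (simp add: repr_def)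
   thus ?case using elim by metis
  qed
 qed
 hence "AE x in lborel. \<forall>i\<in>UNIV. ub w x $ i = (a *R ub u x + b *R ub v x) $ i" by (intro AE_finite_allI finite) auto
 hence ae: "AE x in lborel. ub w x = a *R ub u x + b *R ub v x" by eventually_elim (simp add: vec_eq_iff)
 have iu: "intb (%x. ub u x $ i)" "intb (%x. ub v x $ i)" for i
  using H1v_rep[OF VV(1,2) u ru] H1v_rep[OF VV(1,2) v rv] by (auto simp: rep_def)
 have iw: "intb (%x. ub w x $ i)" for i
 proof -
  have "intb (%x. a * ub u x $ i + b * ub v x $ i)" using iu by simp
  moreover have "AE x in lborel. ub w x $ i = a * ub u x $ i + b * ub v x $ i" using ae by eventually_elim simp
  ultimately show ?thesis using rw[of i] by (subst integrable_cong_AE) (auto simp: repr_def intro: borel_measurable_integrable)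
 qed
 have mv: "f \<in> bmb" if "!!i. (%x. f x $ i) \<in> bmb" for f :: "real^3 => real^3"
  using that by (subst borel_measurable_euclidean_space) (auto simp: Basis_vec_def inner_axis)
 have [measurable]: "ub u \<in> bmb" "ub v \<in> bmb" "ub w \<in> bmb"
  using mi rw by (auto intro!: mv simp: repr_def)
 have aeh: "AE y in lborel. uh z w y = a *R uh z u y + b *R uh z v y" for z
 proof -
  have "AE y in lborel. ub w (Ph z y) = a *R ub u (Ph z y) + b *R ub v (Ph z y)"
   unfolding Ph_def by (rule AE_daff[OF cc_nz _ _ ae]) measurable
  thus ?thesis by eventually_elim (simp add: uh_def scaleR_add_right mult.commute)
 qed
 have "AE x in lborel. EE w x = a *R EE u x + b *R EE v x"
  using ae
 proof eventually_elim
  case (elim x)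
  have "Ec (uh z w) (Ps z x) = a *R Ec (uh z u) (Ps z x) + b *R Ec (uh z v) (Ps z x)" for z
  proof (cases "sh z (hat x) \<in> D")
   case True
   show ?thesis by (rule cell_lin[OF _ _ _ aeh]) (use True uh_integrable[OF iu(1)] uh_integrable[OF iu(2)] uh_integrable[OF iw] in auto)
  next
   case False
   hence "Ec f (Ps z x) = f (Ps z x)" for f using cell_off[of "Ps z x"] by simp
   thus ?thesis using elim by (simp add: uh_def scaleR_add_right mult.commute)
  qed
  thus ?case using elim by (simp add: EE_def scaleR_add_right scaleR_sum_right sum.distrib mult.commute)
 qed
 hence "AE x in lborel. x \<in> Omega \<omega> --> EE w x = a *R EE u x + b *R EE v x" by eventually_elim simp
 thus ?thesis unfolding w_def by (subst AE_completion_iff)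
qed

end

section \<open>Cut-off function and geometry of the unit cell\<close>

lemma ex_cutoff:
 fixes F Z :: "(real^2) set"
 assumes F: "compact F" and Z: "open Z" "F \<subseteq> Z"
 shows "\<exists>ps ps' K U. C1 ps ps' & compact K & K \<subseteq> Z & (\<forall>x. x ~: K --> ps x = 0) & open U & F \<subseteq> U & U \<subseteq> Z & (\<forall>x\<in>U. ps x = 1)"
proof -
 have "\<forall>b\<in>F. \<exists>r>0. cball b r \<subseteq> Z" using Z open_contains_cball by blast
 then obtain r where r: "!!b. b \<in> F ==> r b > 0 & cball b (r b) \<subseteq> Z" by metis
 obtain S where S: "S \<subseteq> F" "finite S" "F \<subseteq> (\<Union>b\<in>S. ball b (r b))"
 proof (rule compactE_image[OF F, of F "%b. ball b (r b)"])
  show "F \<subseteq> (\<Union>b\<in>F. ball b (r b))" using r by force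
 qed auto
 have "\<exists>ck ck' U. (\<forall>b\<in>S. C1 (ck b) (ck' b) & (\<forall>x. x ~: cball b (r b) --> ck b x = 0))
  & open U & F \<subseteq> U & (\<forall>x\<in>U. (\<Sum>b\<in>S. ck b x) = 1)"
  by (rule ex_partition[OF S(2) _ F S(3)]) (use r S(1) in blast)
 then obtain ck ck' U where ck': "\<forall>b\<in>S. C1 (ck b) (ck' b) & (\<forall>x. x ~: cball b (r b) --> ck b x = 0)"
  and U: "open U" "F \<subseteq> U" "\<forall>x\<in>U. (\<Sum>b\<in>S. ck b x) = 1" by (elim exE conjE)
 have ck: "C1 (ck b) (ck' b)" "x ~: cball b (r b) ==> ck b x = 0" if "b \<in> S" for b x using ck' that by blast+
 show ?thesis
 proof (intro exI conjI)
  show "C1 (%x. \<Sum>b\<in>S. ck b x) (%x. \<Sum>b\<in>S. ck' b x)" by (rule C1_sum[OF ck(1)])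
  show "compact (\<Union>b\<in>S. cball b (r b))" using S(2) by (intro compact_UN) auto
  show "(\<Union>b\<in>S. cball b (r b)) \<subseteq> Z" using r S(1) by blast
  show "\<forall>x. x ~: (\<Union>b\<in>S. cball b (r b)) --> (\<Sum>b\<in>S. ck b x) = 0" using ck(2) by (auto intro!: sum.neutral)
  show "open (U \<inter> Z)" using U(1) Z(1) by auto
 qed (use U Z in auto)
qed

lemma interior_Ycell: "interior Ycell = {y. \<forall>i. 0 < y $ i & y $ i < 1}"
proof
 have "{y :: real^2. \<forall>i. 0 < y $ i & y $ i < 1} = (\<Inter>i. {y. 0 < y $ i} \<inter> {y. y $ i < 1})" by auto
 moreover have "open (\<Inter>i::2. {y :: real^2. 0 < y $ i} \<inter> {y. y $ i < 1})"
  by (intro open_INT ballI open_Int open_Collect_less continuous_intros) auto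
 ultimately show "{y. \<forall>i. 0 < y $ i & y $ i < 1} \<subseteq> interior Ycell"
  by (intro interior_maximal) (auto simp: Ycell_def less_imp_le)
 show "interior Ycell \<subseteq> {y. \<forall>i. 0 < y $ i & y $ i < 1}"
 proof
  fix y assume y: "y \<in> interior Ycell"
  then obtain e where e: "e > 0" "ball y e \<subseteq> Ycell" by (auto simp: mem_interior)
  have "0 < y $ i" for i
  proof -
   have "y - (e / 2) *R axis i 1 \<in> ball y e" using e by (simp add: dist_norm norm_axis_1)
   hence "y - (e / 2) *R axis i 1 \<in> Ycell" using e by blast
   thus ?thesis using e by (auto simp: Ycell_def dest!: spec[of _ i])
  qed
  moreover have "y $ i < 1" for i using y interior_subset[of Ycell] by (auto simp: Ycell_def)
  ultimately show "y \<in> {y. \<forall>i. 0 < y $ i & y $ i < 1}" by simp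
 qed
qed

text \<open>The map truncating the coordinates from below at a small height retracts the half-open cell
 minus the hole onto a connected set that avoids the two closed edges.\<close>
lemma connected_interior_cell:
 assumes D: "closure D \<subseteq> interior Ycell" "bounded D" and c: "connected (Ycell - closure D)"
 shows "connected (interior Ycell - closure D)"
proof (subst connected_iff_connected_component, intro ballI)
 fix q q' assume q: "q \<in> interior Ycell - closure D" "q' \<in> interior Ycell - closure D"
 define F where "F = insert q (insert q' (closure D))"
 have F: "compact F" "F ~= {}" "F \<subseteq> interior Ycell" using D q by (auto simp: F_def)
 have "\<exists>m>0. \<forall>y\<in>F. m <= y $ i" for i
 proof -
  have "continuous_on F (%y. y $ i)" by (intro continuous_intros)
  then obtain y where "y \<in> F" "\<forall>x\<in>F. y $ i <= x $ i" using continuous_attains_inf[OF F(1,2)] by blast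
  thus ?thesis using F(3) by (auto simp: interior_Ycell intro!: exI[of _ "y $ i"])
 qed
 then obtain m where m: "!!i. m i > 0 & (\<forall>y\<in>F. m i <= y $ i)" by metis
 \<comment> \<open>Half of a positive lower bound for the coordinates on F, so that truncation at
   this height fixes F, in particular the two given points and the closed hole.\<close>
 define et where "et = min (m 1) (m 2) / 2"
 have et: "et > 0" "!!y i. y \<in> F ==> et < y $ i"
 proof -
  show "et > 0" using m by (simp add: et_def)
  fix y and i :: 2 assume "y \<in> F"
  moreover have "i = 1 \<or> i = 2" by (rule exhaust_2)
  ultimately have "min (m 1) (m 2) <= y $ i" using m by (auto simp: min.coboundedI1 min.coboundedI2)
  thus "et < y $ i" using m[of 1] m[of 2] by (auto simp: et_def)
 qed
 define P where "P y = (\<chi> i. max (y $ i) et)" for y :: "real^2"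
 have Pq: "P y = y" if "y \<in> F" for y
 proof -
  have "P y $ i = y $ i" for i using et(2)[OF that, of i] by (simp add: P_def)
  thus ?thesis by (simp add: vec_eq_iff)
 qed
 have et1: "et < 1" using et(2)[of q 1] q(1) by (auto simp: F_def interior_Ycell intro: less_trans)
 have "connected (P ` (Ycell - closure D))"
  unfolding P_def by (rule connected_continuous_image[OF _ c]) (intro continuous_on_vec_lambda continuous_intros)
 moreover have "P ` (Ycell - closure D) \<subseteq> interior Ycell - closure D"
 proof
  fix x assume "x \<in> P ` (Ycell - closure D)"
  then obtain y where y: "y \<in> Ycell" "y ~: closure D" "x = P y" by auto
  have "x \<in> interior Ycell" unfolding interior_Ycell using y et(1) et1 by (auto simp: P_def Ycell_def less_max_iff_disj)
  moreover have "x ~: closure D"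
  proof
   assume "x \<in> closure D"
   \<comment> \<open>A truncated coordinate would equal \<open>et\<close>; an image point in the
     closed hole was therefore not moved at all and already belonged to the hole.\<close>
   hence "et < x $ i" for i using et(2) by (simp add: F_def)
   hence "x $ i = y $ i" for i using y(3) by (simp add: P_def less_max_iff_disj)
   hence "x = y" by (simp add: vec_eq_iff)
   thus False using y \<open>x \<in> closure D\<close> by simp
  qed
  ultimately show "x \<in> interior Ycell - closure D" by simp
 qed
 moreover have "q \<in> P ` (Ycell - closure D)" "q' \<in> P ` (Ycell - closure D)"
  using q interior_subset[of Ycell] Pq[of q] Pq[of q'] imageI[of q _ P] imageI[of q' _ P] by (auto simp: F_def)
 ultimately show "connected_component (interior Ycell - closure D) q q'" unfolding connected_component_def by blast
qed

lemma bounded_Ycell: "bounded Ycell"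
proof -
 have "norm y <= 2" if "y \<in> Ycell" for y
  using norm_le_l1_cart[of y] that by (auto simp: Ycell_def sum_2 abs_if dest!: spec[of _ 1] spec[of _ 2]) (smt (verit) that Ycell_def mem_Collect_eq)
 thus ?thesis by (auto simp: bounded_iff)
qed

text \<open>Divergence settles all but finitely many indices, positivity the remaining ones.\<close>

lemma eventually_large_bounded_below:
 fixes a :: "nat => real"
 assumes "!!n. a n > 0" "filterlim a at_top sequentially"
 shows "\<exists>c>0. \<forall>n. c <= a n"
proof -
 obtain N where N: "!!n. n >= N ==> a n >= 1"
  using assms(2) by (auto simp: filterlim_at_top eventually_sequentially)
 define c where "c = Min (insert 1 (a ` {..<N}))"
 have "c > 0" using assms(1) by (auto simp: c_def)
 moreover have "c <= a n" for n
 proof (cases "n < N")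
  case True thus ?thesis by (auto simp: c_def intro!: Min_le)
 next
  case False
  hence "1 <= a n" using N by simp
  moreover have "c <= 1" by (auto simp: c_def intro!: Min_le)
  ultimately show ?thesis by simp
 qed
 ultimately show ?thesis by blast
qed

theorem theoremA6:
  fixes \<omega> Y0 :: "(real^2) set" and h eps :: "nat \<Rightarrow> real"
  assumes "lipschitz_domain \<omega>" and "bounded \<omega>"
    and "open Y0" and "Y0 \<subseteq> Ycell" and "lipschitz_boundary Y0"
    and "closure Y0 \<subseteq> interior Ycell"
    and "connected (Ycell - closure Y0)"
    and "\<forall>n. h n > 0" and "h \<longlonglongrightarrow> 0"
    and "\<forall>n. eps n > 0" and "eps \<longlonglongrightarrow> 0"
    and "filterlim (\<lambda>n. h n / eps n) at_top sequentially"
  shows "\<exists>C>0. \<forall>n. \<exists>E :: (real^3 \<Rightarrow> real^3) \<Rightarrow> (real^3 \<Rightarrow> real^3).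
     (\<forall>u v a b. H1v (interior (Omega1 \<omega> Y0 (eps n))) u \<longrightarrow>
                H1v (interior (Omega1 \<omega> Y0 (eps n))) v \<longrightarrow>
        (AE x in lebesgue. x \<in> Omega \<omega> \<longrightarrow>
           E (\<lambda>y. a *\<^sub>R u y + b *\<^sub>R v y) x = a *\<^sub>R E u x + b *\<^sub>R E v x)) \<and>
     (\<forall>u. H1v (interior (Omega1 \<omega> Y0 (eps n))) u \<longrightarrow>
        H1v (Omega \<omega>) (E u) \<and>
        (AE x in lebesgue. x \<in> interior (Omega1 \<omega> Y0 (eps n)) \<longrightarrow> E u x = u x) \<and>
        L2norm (Omega \<omega>) (\<lambda>x. symm (grad_h (h n) (Omega \<omega>) (E u) x))
          \<le> C * L2norm (interior (Omega1 \<omega> Y0 (eps n)))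
                 (\<lambda>x. symm (grad_h (h n) (interior (Omega1 \<omega> Y0 (eps n))) u x)))"
proof (cases "Y0 = {}")
 \<comment> \<open>Without holes the perforated domain is the whole plate and the identity extends
   with constant 1; the cell construction below works with a nonempty hole.\<close>
 case True
 have "Omega \<omega> = VT \<omega> 1" by (auto simp: Omega_def VT_def Iint_def abs_less_iff)
 hence "open (Omega \<omega>)" using assms(1) VT_open by (simp add: lipschitz_domain_def)
 hence e: "interior (Omega1 \<omega> Y0 (eps n)) = Omega \<omega>" for n
  using True by (simp add: Omega1_def Omega0_def interior_open)
 show ?thesis unfolding e by (intro exI[of _ "1::real"] conjI allI exI[of _ "%u::real^3 => real^3. u"] impI) auto
next
 case False
 have om: "open \<omega>" using assms(1) by (simp add: lipschitz_domain_def)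
 have bI: "bounded (interior Ycell)" by (rule bounded_subset[OF bounded_Ycell interior_subset])
 have bD: "bounded Y0" by (rule bounded_subset[OF bounded_Ycell assms(4)])
 \<comment> \<open>The bound holds at every index and not only eventually, as the statement asks for
   every h.\<close>
 obtain c0 where c0: "c0 > 0" "!!n. c0 <= h n / eps n"
  using eventually_large_bounded_below[of "%n. h n / eps n"] assms(8,10,12) by auto
 define B where "B = 1 / arctan (c0 / 4)"
 define lam0 where "lam0 = c0 / (4 * (2 * B + 1))"
 define Y where "Y = interior Ycell - closure Y0"
 \<comment> \<open>The cell is taken open, as weak derivatives require; connectedness, given for the
   half-open cell, has been transferred to it.\<close>
 interpret H: hole_cell Y0 "interior Ycell" Y c0 B lam0
  by unfold_locales (use assms False bD bI c0 connected_interior_cell[OF assms(6) bD assms(7)] in \<open>simp_all add: B_def lam0_def Y_def\<close>)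
 obtain Ec Gc Cc where Cc: "Cc >= 0"
  and cell: "\<forall>T u g. c0 <= T --> adm (VT Y T) u g --> (\<forall>i. intb (%x. (u x $ i)\<^sup>2)) -->
   (\<forall>i. wL (VT (interior Ycell) T) (%x. Ec u x $ i) (%x. Gc u g x $ i)) &
   (NB x. indicator (VT Y0 T) x * ennreal ((norm (symm (Gc u g x)))\<^sup>2)) <= ennreal Cc * JJ g"
  and off: "\<forall>u g x. hat x ~: Y0 --> Ec u x = u x & Gc u g x = g x"
  and lin: "\<forall>u v w a c x. (\<forall>i. intb (%x. u x $ i)) --> (\<forall>i. intb (%x. w x $ i)) --> (\<forall>i. intb (%x. v x $ i)) -->
   (AE y in lborel. v y = a *R u y + c *R w y) --> hat x \<in> Y0 --> Ec v x = a *R Ec u x + c *R Ec w x"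
  using H.cell_extension by blast
 obtain ps ps' K U where psi: "C1 ps ps'" "compact K" "K \<subseteq> interior Ycell" "\<forall>x. x ~: K --> ps x = 0"
   "open U" "closure Y0 \<subseteq> U" "U \<subseteq> interior Ycell" "\<forall>x\<in>U. ps x = 1"
  using ex_cutoff[OF _ open_interior assms(6)] bD by auto
 show ?thesis
 proof (intro exI[of _ "sqrt (1 + Cc)"] conjI allI)
  show "sqrt (1 + Cc) > 0" using Cc by simp
  fix n
  interpret P: perforated Y0 "interior Ycell" Y c0 B lam0 Ec Gc Cc ps ps' U K \<omega> "eps n" "h n"
  proof (unfold_locales, goal_cases)
   case 1 show ?case by (rule Cc)
  next
   case (2 T u g) thus ?case by (rule cell[THEN spec, THEN spec, THEN spec, THEN mp, THEN mp, THEN mp])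
  next
   case 3 thus ?case by (rule off[THEN spec, THEN spec, THEN spec, THEN mp])
  next
   case 4 thus ?case
   by (rule lin[THEN spec, THEN spec, THEN spec, THEN spec, THEN spec, THEN spec, THEN mp, THEN mp, THEN mp, THEN mp, THEN mp])
  qed (use psi om assms(2,8,10) c0(2) interior_subset[of Ycell] in simp_all)
  show "\<exists>E :: (real^3 => real^3) => (real^3 => real^3).
  (\<forall>u v a b. H1v (interior (Omega1 \<omega> Y0 (eps n))) u -->
   H1v (interior (Omega1 \<omega> Y0 (eps n))) v -->
   (AE x in lebesgue. x \<in> Omega \<omega> -->
   E (%y. a *R u y + b *R v y) x = a *R E u x + b *R E v x)) &
  (\<forall>u. H1v (interior (Omega1 \<omega> Y0 (eps n))) u -->
   H1v (Omega \<omega>) (E u) &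
   (AE x in lebesgue. x \<in> interior (Omega1 \<omega> Y0 (eps n)) --> E u x = u x) &
   L2norm (Omega \<omega>) (%x. symm (grad_h (h n) (Omega \<omega>) (E u) x))
   <= sqrt (1 + Cc) * L2norm (interior (Omega1 \<omega> Y0 (eps n)))
   (%x. symm (grad_h (h n) (interior (Omega1 \<omega> Y0 (eps n))) u x)))"
   unfolding P.VV_def[symmetric] by (intro exI[of _ P.EE] conjI allI impI P.EE_linear P.EE_main)
 qed
qed

end
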